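(* Let $(A,c_A)$ be a braided algebra over a field $K$, with multiplication $m_A$. Then $(A,c_A,b_A)$ is a braided Lie algebra, where $b_A:E(A,c_A)\to A$ is the $K$-linear map given by $b_A(z):=m_A^{t-1}(z)$ for every $z\in E_t(A,c_A)$, $t\ge 2$; here $m_A^{t-1}:A^{\otimes t}\to A$ is the iterated multiplication.
   Context: $K$ is a field, vector spaces are over $K$, $\otimes=\otimes_K$, and the name of an object also denotes its identity map. A braided vector space $(V,c)$ is a vector space $V$ with a $K$-linear map $c:V\otimes V\to V\otimes V$ such that $(c\otimes V)(V\otimes c)(c\otimes V)=(V\otimes c)(c\otimes V)(V\otimes c)$. A braided algebra $(A,m,u,c)$ is an associative unital algebra with a braided vector space $(A,c)$ such that $c(m\otimes A)=(A\otimes m)(c\otimes A)(A\otimes c)$, $c(A\otimes m)=(m\otimes A)(A\otimes c)(c\otimes A)$, $c(u\otimes A)=A\otimes u$, $c(A\otimes u)=u\otimes A$. A braided bialgebra is a braided algebra $(B,m,u,c)$ with a coalgebra structure $(\Delta,\varepsilon)$ commuting with $c$ (the dual conditions) such that $\Delta m=(m\otimes m)(B\otimes c\otimes B)(\Delta\otimes\Delta)$, with $\Delta,\varepsilon$ unital and $\varepsilon$ multiplicative. For a braided vector space $(V,c)$, $T=T(V,c)$ is the tensor algebra of $V$ with its unique braided bialgebra structure such that the braiding $c_T$ extends $c$ and $\Delta_T(v)=v\otimes1+1\otimes v$ for $v\in V$; it is graded by $T^n=V^{\otimes n}$, and $\Delta_T^{a,b}:V^{\otimes(a+b)}\to V^{\otimes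 a}\otimes V^{\otimes b}$ are the homogeneous components of $\Delta_T$. Put $E_n(V,c)=\bigcap_{a,b\ge1,\ a+b=n}\ker(\Delta_T^{a,b})\subseteq V^{\otimes n}$ for $n\ge2$ and $E(V,c)=\bigoplus_{n\ge2}E_n(V,c)$. The braiding $c_T$ restricts to maps $c_{E(V,c),V}:E(V,c)\otimes V\to V\otimes E(V,c)$ and $c_{V,E(V,c)}:V\otimes E(V,c)\to E(V,c)\otimes V$. A (braided) bracket on $(V,c)$ is a $K$-linear map $b:E(V,c)\to V$ with $c(b\otimes V)=(V\otimes b)c_{E(V,c),V}$ and $c(V\otimes b)=(b\otimes V)c_{V,E(V,c)}$. Its universal enveloping algebra is $U(V,c,b)=T(V,c)/\big((\mathrm{Id}-b)[E(V,c)]\big)$ (quotient by the generated two-sided ideal), with $i_U:V\to U(V,c,b)$ the restriction of the canonical projection. $(V,c,b)$ is a braided Lie algebra if $(V,c)$ is a braided vector space, $b$ is a bracket on $(V,c)$ and $i_U$ is injective. *)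

theory Defs
  imports "HOL-Algebra.QuotRing" "HOL-Algebra.Module"
begin

section \<open>Linear maps\<close>

text \<open>Subspaces are handled as modules \<open>M\<lparr>carrier := S\<rparr>\<close>.\<close>

definition lin_hom ::
  "('k, 'm) ring_scheme \<Rightarrow> ('k, 'a, 'n) module_scheme \<Rightarrow> ('k, 'b, 'p) module_scheme \<Rightarrow> ('a \<Rightarrow> 'b) set"
  where "lin_hom K M N =
    {f \<in> carrier M \<rightarrow> carrier N.
       (\<forall>x\<in>carrier M. \<forall>y\<in>carrier M. f (x \<oplus>\<^bsub>M\<^esub> y) = f x \<oplus>\<^bsub>N\<^esub> f y) \<and>
       (\<forall>a\<in>carrier K. \<forall>x\<in>carrier M. f (a \<odot>\<^bsub>M\<^esub> x) = a \<odot>\<^bsub>N\<^esub> f x)}"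

definition module_span :: "('k, 'm) ring_scheme \<Rightarrow> ('k, 'a, 'n) module_scheme \<Rightarrow> 'a set \<Rightarrow> 'a set"
  where "module_span K M S = \<Inter>{H. submodule H K M \<and> S \<subseteq> H}"


section \<open>Tensor algebra and tensor powers\<close>

text \<open>The free associative algebra on a set \<open>X\<close>: finitely supported functions on the words over
  \<open>X\<close>, with the convolution product.\<close>

definition free_algebra :: "('k, 'm) ring_scheme \<Rightarrow> 'x set \<Rightarrow> ('k, 'x list \<Rightarrow> 'k) module"
  where "free_algebra K X =
    \<lparr>carrier = {f. range f \<subseteq> carrier K \<and> finite {w. f w \<noteq> \<zero>\<^bsub>K\<^esub>} \<and> {w. f w \<noteq> \<zero>\<^bsub>K\<^esub>} \<subseteq> lists X},
     monoid.mult = (\<lambda>f g w. \<Oplus>\<^bsub>K\<^esub>i\<in>{..length w}. f (take i w) \<otimes>\<^bsub>K\<^esub> g (drop i w)),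
     one = (\<lambda>w. if w = [] then \<one>\<^bsub>K\<^esub> else \<zero>\<^bsub>K\<^esub>),
     zero = (\<lambda>w. \<zero>\<^bsub>K\<^esub>),
     add = (\<lambda>f g w. f w \<oplus>\<^bsub>K\<^esub> g w),
     smult = (\<lambda>a f w. a \<otimes>\<^bsub>K\<^esub> f w)\<rparr>"

definition free_word :: "('k, 'm) ring_scheme \<Rightarrow> 'x list \<Rightarrow> 'x list \<Rightarrow> 'k"
  where "free_word K w = (\<lambda>w'. if w' = w then \<one>\<^bsub>K\<^esub> else \<zero>\<^bsub>K\<^esub>)"

definition tensor_ideal ::
  "('k, 'm) ring_scheme \<Rightarrow> ('k, 'v, 'n) module_scheme \<Rightarrow> ('v list \<Rightarrow> 'k) set"
  where "tensor_ideal K V = (let F = free_algebra K (carrier V) in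
    Idl\<^bsub>F\<^esub> ({free_word K [x \<oplus>\<^bsub>V\<^esub> y] \<ominus>\<^bsub>F\<^esub> (free_word K [x] \<oplus>\<^bsub>F\<^esub> free_word K [y]) | x y.
               x \<in> carrier V \<and> y \<in> carrier V}
         \<union> {free_word K [a \<odot>\<^bsub>V\<^esub> x] \<ominus>\<^bsub>F\<^esub> (a \<odot>\<^bsub>F\<^esub> free_word K [x]) | a x.
               a \<in> carrier K \<and> x \<in> carrier V}))"

type_synonym ('k, 'v) tensor = "('v list \<Rightarrow> 'k) set"

text \<open>\<open>T(V)\<close> is the free algebra on the set \<open>V\<close> modulo the relations making \<open>V \<rightarrow> T(V)\<close> linear.
  The quotient ring of the library has no scalar multiplication; scalars act by multiplication with
  the class of \<open>a 1\<close>.\<close>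

definition tensor_algebra ::
  "('k, 'm) ring_scheme \<Rightarrow> ('k, 'v, 'n) module_scheme \<Rightarrow> ('k, ('k, 'v) tensor) module"
  where "tensor_algebra K V =
    (let F = free_algebra K (carrier V); I = tensor_ideal K V; Q = F Quot I in
     \<lparr>carrier = carrier Q, monoid.mult = monoid.mult Q, one = one Q, zero = zero Q, add = add Q,
      smult = (\<lambda>a C. (I +>\<^bsub>F\<^esub> (a \<odot>\<^bsub>F\<^esub> \<one>\<^bsub>F\<^esub>)) \<otimes>\<^bsub>Q\<^esub> C)\<rparr>)"

text \<open>\<open>pure K V [v\<^sub>1, \<dots>, v\<^sub>n]\<close> is \<open>v\<^sub>1 \<otimes> \<dots> \<otimes> v\<^sub>n\<close>.\<close>

definition pure ::
  "('k, 'm) ring_scheme \<Rightarrow> ('k, 'v, 'n) module_scheme \<Rightarrow> 'v list \<Rightarrow> ('k, 'v) tensor"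
  where "pure K V w = tensor_ideal K V +>\<^bsub>free_algebra K (carrier V)\<^esub> free_word K w"

text \<open>\<open>V\<^sup>\<otimes>\<^sup>n\<close>, realised as the component of degree \<open>n\<close> of \<open>T(V)\<close>. Thus \<open>K\<close> is \<open>V\<^sup>\<otimes>\<^sup>0\<close>,
  \<open>V \<otimes> V\<close> is \<open>V\<^sup>\<otimes>\<^sup>2\<close>, and \<open>V\<^sup>\<otimes>\<^sup>p \<otimes> V\<^sup>\<otimes>\<^sup>q\<close> and \<open>V\<^sup>\<otimes>\<^sup>(\<^sup>p\<^sup>+\<^sup>q\<^sup>)\<close> are literally identified through the product of
  \<open>T(V)\<close>, so no associativity or unit constraints occur below. This is used for arbitrary modules, in
  particular \<open>T(V) \<otimes> T(V)\<close> is \<open>tpow K (tensor_algebra K V) 2\<close>.\<close>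

definition tpow ::
  "('k, 'm) ring_scheme \<Rightarrow> ('k, 'v, 'n) module_scheme \<Rightarrow> nat \<Rightarrow> ('k, ('k, 'v) tensor) module"
  where "tpow K V n = (tensor_algebra K V)\<lparr>carrier :=
    {tensor_ideal K V +>\<^bsub>free_algebra K (carrier V)\<^esub> f | f.
       f \<in> carrier (free_algebra K (carrier V)) \<and> (\<forall>w. f w \<noteq> \<zero>\<^bsub>K\<^esub> \<longrightarrow> length w = n)}\<rparr>"

text \<open>The identification of \<open>V\<close> with \<open>V\<^sup>\<otimes>\<^sup>1\<close>, and its inverse.\<close>

definition incl ::
  "('k, 'm) ring_scheme \<Rightarrow> ('k, 'v, 'n) module_scheme \<Rightarrow> 'v \<Rightarrow> ('k, 'v) tensor"
  where "incl K V v = pure K V [v]"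

definition unincl ::
  "('k, 'm) ring_scheme \<Rightarrow> ('k, 'v, 'n) module_scheme \<Rightarrow> ('k, 'v) tensor \<Rightarrow> 'v"
  where "unincl K V = inv_into (carrier V) (incl K V)"

text \<open>\<open>f \<otimes> g\<close> on \<open>V\<^sup>\<otimes>\<^sup>p \<otimes> V\<^sup>\<otimes>\<^sup>q\<close>, where \<open>f\<close> and \<open>g\<close> take values in tensor powers of \<open>V\<close>.\<close>

definition tens ::
  "('k, 'm) ring_scheme \<Rightarrow> ('k, 'v, 'n) module_scheme \<Rightarrow>
   nat \<Rightarrow> (('k, 'v) tensor \<Rightarrow> ('k, 'v) tensor) \<Rightarrow>
   nat \<Rightarrow> (('k, 'v) tensor \<Rightarrow> ('k, 'v) tensor) \<Rightarrow> ('k, 'v) tensor \<Rightarrow> ('k, 'v) tensor"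
  where "tens K V p f q g =
    (THE h. h \<in> extensional (carrier (tpow K V (p + q))) \<and>
            h \<in> lin_hom K (tpow K V (p + q)) (tensor_algebra K V) \<and>
            (\<forall>x\<in>carrier (tpow K V p). \<forall>y\<in>carrier (tpow K V q).
               h (x \<otimes>\<^bsub>tensor_algebra K V\<^esub> y) = f x \<otimes>\<^bsub>tensor_algebra K V\<^esub> g y))"

text \<open>For subspaces \<open>S\<close>, \<open>S'\<close> of \<open>M\<close>, the space \<open>S \<otimes> S'\<close> as a subspace of \<open>M \<otimes> M\<close>, and for linear maps
  \<open>f: S \<rightarrow> N\<close> and \<open>g: S' \<rightarrow> N\<close> the map \<open>f \<otimes> g: S \<otimes> S' \<rightarrow> N \<otimes> N\<close>.\<close>

definition sub_tensor ::
  "('k, 'm) ring_scheme \<Rightarrow> ('k, 'v, 'n) module_scheme \<Rightarrow> 'v set \<Rightarrow> 'v set \<Rightarrow>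
   ('k, ('k, 'v) tensor) module"
  where "sub_tensor K M S S' = (tensor_algebra K M)\<lparr>carrier :=
    module_span K (tensor_algebra K M) {pure K M [x, y] | x y. x \<in> S \<and> y \<in> S'}\<rparr>"

definition sub_tensor_map ::
  "('k, 'm) ring_scheme \<Rightarrow> ('k, 'v, 'n) module_scheme \<Rightarrow> ('k, 'w, 'p) module_scheme \<Rightarrow>
   'v set \<Rightarrow> 'v set \<Rightarrow> ('v \<Rightarrow> 'w) \<Rightarrow> ('v \<Rightarrow> 'w) \<Rightarrow> ('k, 'v) tensor \<Rightarrow> ('k, 'w) tensor"
  where "sub_tensor_map K M N S S' f g =
    (THE h. h \<in> extensional (carrier (sub_tensor K M S S')) \<and>
            h \<in> lin_hom K (sub_tensor K M S S') (tpow K N 2) \<and>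
            (\<forall>x\<in>S. \<forall>y\<in>S'. h (pure K M [x, y]) = pure K N [f x, g y]))"


section \<open>Braided vector spaces, algebras and bialgebras\<close>

text \<open>All structure maps are maps between tensor powers; \<open>\<lambda>x. x\<close> on degree 1 plays the role of the
  identity map of the object.\<close>

locale braided_vector_space = field K + module K V
  for K (structure) and V (structure) +
  fixes c :: "('a, 'c) tensor \<Rightarrow> ('a, 'c) tensor"
  assumes c_linear: "c \<in> lin_hom K (tpow K V 2) (tpow K V 2)"
    and braid_equation:
      "x \<in> carrier (tpow K V 3) \<Longrightarrow>
         tens K V 2 c 1 (\<lambda>x. x) (tens K V 1 (\<lambda>x. x) 2 c (tens K V 2 c 1 (\<lambda>x. x) x)) =
         tens K V 1 (\<lambda>x. x) 2 c (tens K V 2 c 1 (\<lambda>x. x) (tens K V 1 (\<lambda>x. x) 2 c x))"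

text \<open>The locale \<open>algebra\<close> of the library covers commutative algebras only.\<close>

locale assoc_algebra = field K + module K A + ring A
  for K (structure) and A (structure) +
  assumes smult_mult_left:
      "\<lbrakk>a \<in> carrier K; x \<in> carrier A; y \<in> carrier A\<rbrakk> \<Longrightarrow>
         (a \<odot>\<^bsub>A\<^esub> x) \<otimes>\<^bsub>A\<^esub> y = a \<odot>\<^bsub>A\<^esub> (x \<otimes>\<^bsub>A\<^esub> y)"
    and smult_mult_right:
      "\<lbrakk>a \<in> carrier K; x \<in> carrier A; y \<in> carrier A\<rbrakk> \<Longrightarrow>
         x \<otimes>\<^bsub>A\<^esub> (a \<odot>\<^bsub>A\<^esub> y) = a \<odot>\<^bsub>A\<^esub> (x \<otimes>\<^bsub>A\<^esub> y)"

text \<open>The multiplication \<open>m: A \<otimes> A \<rightarrow> A\<close> and the unit \<open>u: K \<rightarrow> A\<close> as linear maps.\<close>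

definition mult_map ::
  "('k, 'm) ring_scheme \<Rightarrow> ('k, 'a, 'n) module_scheme \<Rightarrow> ('k, 'a) tensor \<Rightarrow> ('k, 'a) tensor"
  where "mult_map K A =
    (THE h. h \<in> extensional (carrier (tpow K A 2)) \<and> h \<in> lin_hom K (tpow K A 2) (tpow K A 1) \<and>
            (\<forall>x\<in>carrier A. \<forall>y\<in>carrier A. h (pure K A [x, y]) = incl K A (x \<otimes>\<^bsub>A\<^esub> y)))"

definition unit_map ::
  "('k, 'm) ring_scheme \<Rightarrow> ('k, 'a, 'n) module_scheme \<Rightarrow> ('k, 'a) tensor \<Rightarrow> ('k, 'a) tensor"
  where "unit_map K A =
    (THE h. h \<in> extensional (carrier (tpow K A 0)) \<and> h \<in> lin_hom K (tpow K A 0) (tpow K A 1) \<and>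
            h (pure K A []) = incl K A \<one>\<^bsub>A\<^esub>)"

locale braided_algebra = assoc_algebra K A + braided_vector_space K A c
  for K (structure) and A (structure) and c +
  assumes c_mult_left:
      "x \<in> carrier (tpow K A 3) \<Longrightarrow>
         c (tens K A 2 (mult_map K A) 1 (\<lambda>x. x) x) =
         tens K A 1 (\<lambda>x. x) 2 (mult_map K A) (tens K A 2 c 1 (\<lambda>x. x) (tens K A 1 (\<lambda>x. x) 2 c x))"
    and c_mult_right:
      "x \<in> carrier (tpow K A 3) \<Longrightarrow>
         c (tens K A 1 (\<lambda>x. x) 2 (mult_map K A) x) =
         tens K A 2 (mult_map K A) 1 (\<lambda>x. x) (tens K A 1 (\<lambda>x. x) 2 c (tens K A 2 c 1 (\<lambda>x. x) x))"
    and c_unit_left: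
      "x \<in> carrier (tpow K A 1) \<Longrightarrow>
         c (tens K A 0 (unit_map K A) 1 (\<lambda>x. x) x) = tens K A 1 (\<lambda>x. x) 0 (unit_map K A) x"
    and c_unit_right:
      "x \<in> carrier (tpow K A 1) \<Longrightarrow>
         c (tens K A 1 (\<lambda>x. x) 0 (unit_map K A) x) = tens K A 0 (unit_map K A) 1 (\<lambda>x. x) x"

locale coalgebra = field K + module K B
  for K (structure) and B (structure) +
  fixes D :: "('a, 'c) tensor \<Rightarrow> ('a, 'c) tensor"
    and e :: "('a, 'c) tensor \<Rightarrow> ('a, 'c) tensor"
  assumes comult_linear: "D \<in> lin_hom K (tpow K B 1) (tpow K B 2)"
    and counit_linear: "e \<in> lin_hom K (tpow K B 1) (tpow K B 0)"
    and coassoc: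
      "x \<in> carrier (tpow K B 1) \<Longrightarrow>
         tens K B 1 D 1 (\<lambda>x. x) (D x) = tens K B 1 (\<lambda>x. x) 1 D (D x)"
    and counit_left: "x \<in> carrier (tpow K B 1) \<Longrightarrow> tens K B 1 e 1 (\<lambda>x. x) (D x) = x"
    and counit_right: "x \<in> carrier (tpow K B 1) \<Longrightarrow> tens K B 1 (\<lambda>x. x) 1 e (D x) = x"

locale braided_bialgebra = braided_algebra K B c + coalgebra K B D e
  for K (structure) and B (structure) and c D e +
  assumes c_comult_left:
      "x \<in> carrier (tpow K B 2) \<Longrightarrow>
         tens K B 1 D 1 (\<lambda>x. x) (c x) =
         tens K B 1 (\<lambda>x. x) 2 c (tens K B 2 c 1 (\<lambda>x. x) (tens K B 1 (\<lambda>x. x) 1 D x))"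
    and c_comult_right:
      "x \<in> carrier (tpow K B 2) \<Longrightarrow>
         tens K B 1 (\<lambda>x. x) 1 D (c x) =
         tens K B 2 c 1 (\<lambda>x. x) (tens K B 1 (\<lambda>x. x) 2 c (tens K B 1 D 1 (\<lambda>x. x) x))"
    and c_counit_left:
      "x \<in> carrier (tpow K B 2) \<Longrightarrow> tens K B 1 e 1 (\<lambda>x. x) (c x) = tens K B 1 (\<lambda>x. x) 1 e x"
    and c_counit_right:
      "x \<in> carrier (tpow K B 2) \<Longrightarrow> tens K B 1 (\<lambda>x. x) 1 e (c x) = tens K B 1 e 1 (\<lambda>x. x) x"
    and comult_mult:
      "x \<in> carrier (tpow K B 2) \<Longrightarrow>
         D (mult_map K B x) =
         tens K B 2 (mult_map K B) 2 (mult_map K B)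
           (tens K B 1 (\<lambda>x. x) 3 (tens K B 2 c 1 (\<lambda>x. x)) (tens K B 1 D 1 D x))"
    and comult_unit:
      "x \<in> carrier (tpow K B 0) \<Longrightarrow>
         D (unit_map K B x) = tens K B 0 (unit_map K B) 0 (unit_map K B) x"
    and counit_mult: "x \<in> carrier (tpow K B 2) \<Longrightarrow> e (mult_map K B x) = tens K B 1 e 1 e x"
    and counit_unit: "x \<in> carrier (tpow K B 0) \<Longrightarrow> e (unit_map K B x) = x"


section \<open>The braided bialgebra \<open>T(V, c)\<close>\<close>

text \<open>In the second conjunct \<open>incl \<otimes> incl: V \<otimes> V \<rightarrow> T(V) \<otimes> T(V)\<close>.\<close>

definition tensor_bialgebra ::
  "('k, 'm) ring_scheme \<Rightarrow> ('k, 'v, 'n) module_scheme \<Rightarrow> (('k, 'v) tensor \<Rightarrow> ('k, 'v) tensor) \<Rightarrow>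
   (('k, ('k, 'v) tensor) tensor \<Rightarrow> ('k, ('k, 'v) tensor) tensor) \<Rightarrow>
   (('k, ('k, 'v) tensor) tensor \<Rightarrow> ('k, ('k, 'v) tensor) tensor) \<Rightarrow>
   (('k, ('k, 'v) tensor) tensor \<Rightarrow> ('k, ('k, 'v) tensor) tensor) \<Rightarrow> bool"
  where "tensor_bialgebra K V c cT D e \<longleftrightarrow> (let T = tensor_algebra K V in
    braided_bialgebra K T cT D e \<and>
    (\<forall>x\<in>carrier (tpow K V 2).
       cT (sub_tensor_map K V T (carrier V) (carrier V) (incl K V) (incl K V) x) =
       sub_tensor_map K V T (carrier V) (carrier V) (incl K V) (incl K V) (c x)) \<and>
    (\<forall>v\<in>carrier V.
       D (incl K T (incl K V v)) =
       pure K T [incl K V v, \<one>\<^bsub>T\<^esub>] \<oplus>\<^bsub>tensor_algebra K T\<^esub> pure K T [\<one>\<^bsub>T\<^esub>, incl K V v]))"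

text \<open>The structure is unique as far as the values on the respective carriers are concerned, so only
  the irrelevant values outside the carriers depend on the choice.\<close>

definition tensor_structure ::
  "('k, 'm) ring_scheme \<Rightarrow> ('k, 'v, 'n) module_scheme \<Rightarrow> (('k, 'v) tensor \<Rightarrow> ('k, 'v) tensor) \<Rightarrow>
   (('k, ('k, 'v) tensor) tensor \<Rightarrow> ('k, ('k, 'v) tensor) tensor) \<times>
   (('k, ('k, 'v) tensor) tensor \<Rightarrow> ('k, ('k, 'v) tensor) tensor) \<times>
   (('k, ('k, 'v) tensor) tensor \<Rightarrow> ('k, ('k, 'v) tensor) tensor)"
  where "tensor_structure K V c = (SOME (cT, D, e). tensor_bialgebra K V c cT D e)"

definition tensor_braiding ::
  "('k, 'm) ring_scheme \<Rightarrow> ('k, 'v, 'n) module_scheme \<Rightarrow> (('k, 'v) tensor \<Rightarrow> ('k, 'v) tensor) \<Rightarrow>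
   ('k, ('k, 'v) tensor) tensor \<Rightarrow> ('k, ('k, 'v) tensor) tensor"
  where "tensor_braiding K V c = fst (tensor_structure K V c)"

definition tensor_comult ::
  "('k, 'm) ring_scheme \<Rightarrow> ('k, 'v, 'n) module_scheme \<Rightarrow> (('k, 'v) tensor \<Rightarrow> ('k, 'v) tensor) \<Rightarrow>
   ('k, ('k, 'v) tensor) tensor \<Rightarrow> ('k, ('k, 'v) tensor) tensor"
  where "tensor_comult K V c = fst (snd (tensor_structure K V c))"

definition tensor_proj ::
  "('k, 'm) ring_scheme \<Rightarrow> ('k, 'v, 'n) module_scheme \<Rightarrow> nat \<Rightarrow> ('k, 'v) tensor \<Rightarrow> ('k, 'v) tensor"
  where "tensor_proj K V n =
    (THE h. h \<in> extensional (carrier (tensor_algebra K V)) \<and>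
            h \<in> lin_hom K (tensor_algebra K V) (tensor_algebra K V) \<and>
            (\<forall>x\<in>carrier (tpow K V n). h x = x) \<and>
            (\<forall>m. m \<noteq> n \<longrightarrow> (\<forall>x\<in>carrier (tpow K V m). h x = \<zero>\<^bsub>tensor_algebra K V\<^esub>)))"

text \<open>The component of the comultiplication of bidegree \<open>(a, b)\<close>, with values in the subspace
  \<open>V\<^sup>\<otimes>\<^sup>a \<otimes> V\<^sup>\<otimes>\<^sup>b\<close> of \<open>T(V) \<otimes> T(V)\<close>.\<close>

definition tensor_comult_comp ::
  "('k, 'm) ring_scheme \<Rightarrow> ('k, 'v, 'n) module_scheme \<Rightarrow> (('k, 'v) tensor \<Rightarrow> ('k, 'v) tensor) \<Rightarrow>
   nat \<Rightarrow> nat \<Rightarrow> ('k, 'v) tensor \<Rightarrow> ('k, ('k, 'v) tensor) tensor"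
  where "tensor_comult_comp K V c a b z = (let T = tensor_algebra K V in
    sub_tensor_map K T T (carrier T) (carrier T) (tensor_proj K V a) (tensor_proj K V b)
      (tensor_comult K V c (incl K T z)))"

definition E_comp ::
  "('k, 'm) ring_scheme \<Rightarrow> ('k, 'v, 'n) module_scheme \<Rightarrow> (('k, 'v) tensor \<Rightarrow> ('k, 'v) tensor) \<Rightarrow>
   nat \<Rightarrow> ('k, 'v) tensor set"
  where "E_comp K V c n = {z \<in> carrier (tpow K V n).
    \<forall>a b. a \<ge> 1 \<and> b \<ge> 1 \<and> a + b = n \<longrightarrow>
      tensor_comult_comp K V c a b z = \<zero>\<^bsub>tensor_algebra K (tensor_algebra K V)\<^esub>}"

definition E_space ::
  "('k, 'm) ring_scheme \<Rightarrow> ('k, 'v, 'n) module_scheme \<Rightarrow> (('k, 'v) tensor \<Rightarrow> ('k, 'v) tensor) \<Rightarrow>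
   ('k, ('k, 'v) tensor) module"
  where "E_space K V c = (tensor_algebra K V)\<lparr>carrier :=
    {z. \<exists>N f. (\<forall>n\<in>{2..N}. f n \<in> E_comp K V c n) \<and> z = finsum (tensor_algebra K V) f {2..N}}\<rparr>"


section \<open>Brackets and braided Lie algebras\<close>

text \<open>\<open>E \<otimes> V\<close> and \<open>V \<otimes> E\<close> are subspaces of \<open>T(V) \<otimes> T(V)\<close>, with \<open>V\<close> embedded in \<open>T(V)\<close> as
  \<open>V\<^sup>\<otimes>\<^sup>1\<close>; the maps between them induced by the braiding of \<open>T(V)\<close> are its restrictions.\<close>

definition braided_bracket ::
  "('k, 'm) ring_scheme \<Rightarrow> ('k, 'v, 'n) module_scheme \<Rightarrow> (('k, 'v) tensor \<Rightarrow> ('k, 'v) tensor) \<Rightarrow>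
   (('k, 'v) tensor \<Rightarrow> 'v) \<Rightarrow> bool"
  where "braided_bracket K V c b \<longleftrightarrow>
    (let T = tensor_algebra K V; E = carrier (E_space K V c); V1 = carrier (tpow K V 1);
         bV = sub_tensor_map K T V E V1 b (unincl K V);
         Vb = sub_tensor_map K T V V1 E (unincl K V) b
     in b \<in> lin_hom K (E_space K V c) V \<and>
        (\<forall>x\<in>carrier (sub_tensor K T E V1).
           tensor_braiding K V c x \<in> carrier (sub_tensor K T V1 E) \<and>
           c (bV x) = Vb (tensor_braiding K V c x)) \<and>
        (\<forall>x\<in>carrier (sub_tensor K T V1 E).
           tensor_braiding K V c x \<in> carrier (sub_tensor K T E V1) \<and>
           c (Vb x) = bV (tensor_braiding K V c x)))"

definition enveloping_ideal ::
  "('k, 'm) ring_scheme \<Rightarrow> ('k, 'v, 'n) module_scheme \<Rightarrow> (('k, 'v) tensor \<Rightarrow> ('k, 'v) tensor) \<Rightarrow>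
   (('k, 'v) tensor \<Rightarrow> 'v) \<Rightarrow> ('k, 'v) tensor set"
  where "enveloping_ideal K V c b = Idl\<^bsub>tensor_algebra K V\<^esub>
    {z \<ominus>\<^bsub>tensor_algebra K V\<^esub> incl K V (b z) | z. z \<in> carrier (E_space K V c)}"

definition enveloping_algebra ::
  "('k, 'm) ring_scheme \<Rightarrow> ('k, 'v, 'n) module_scheme \<Rightarrow> (('k, 'v) tensor \<Rightarrow> ('k, 'v) tensor) \<Rightarrow>
   (('k, 'v) tensor \<Rightarrow> 'v) \<Rightarrow> ('k, 'v) tensor set ring"
  where "enveloping_algebra K V c b = tensor_algebra K V Quot enveloping_ideal K V c b"

definition i_U ::
  "('k, 'm) ring_scheme \<Rightarrow> ('k, 'v, 'n) module_scheme \<Rightarrow> (('k, 'v) tensor \<Rightarrow> ('k, 'v) tensor) \<Rightarrow>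
   (('k, 'v) tensor \<Rightarrow> 'v) \<Rightarrow> 'v \<Rightarrow> ('k, 'v) tensor set"
  where "i_U K V c b v = enveloping_ideal K V c b +>\<^bsub>tensor_algebra K V\<^esub> incl K V v"

definition braided_lie_algebra ::
  "('k, 'm) ring_scheme \<Rightarrow> ('k, 'v, 'n) module_scheme \<Rightarrow> (('k, 'v) tensor \<Rightarrow> ('k, 'v) tensor) \<Rightarrow>
   (('k, 'v) tensor \<Rightarrow> 'v) \<Rightarrow> bool"
  where "braided_lie_algebra K V c b \<longleftrightarrow>
    braided_vector_space K V c \<and> braided_bracket K V c b \<and>
    i_U K V c b \<in> carrier V \<rightarrow> carrier (enveloping_algebra K V c b) \<and>
    inj_on (i_U K V c b) (carrier V)"


section \<open>The bracket of a braided algebra\<close>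

text \<open>\<open>iter_mult K A n: A\<^sup>\<otimes>\<^sup>(\<^sup>n\<^sup>+\<^sup>1\<^sup>) \<rightarrow> A\<close> is the iterated multiplication \<open>m\<^sup>n\<close>.\<close>

primrec iter_mult ::
  "('k, 'm) ring_scheme \<Rightarrow> ('k, 'a, 'n) module_scheme \<Rightarrow> nat \<Rightarrow> ('k, 'a) tensor \<Rightarrow> ('k, 'a) tensor"
  where
    "iter_mult K A 0 = (\<lambda>x. x)"
  | "iter_mult K A (Suc n) =
       (\<lambda>x. mult_map K A (tens K A (n + 1) (iter_mult K A n) 1 (\<lambda>x. x) x))"

definition algebra_bracket ::
  "('k, 'm) ring_scheme \<Rightarrow> ('k, 'a, 'n) module_scheme \<Rightarrow> (('k, 'a) tensor \<Rightarrow> ('k, 'a) tensor) \<Rightarrow>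
   ('k, 'a) tensor \<Rightarrow> 'a"
  where "algebra_bracket K A c =
    (THE b. b \<in> extensional (carrier (E_space K A c)) \<and> b \<in> lin_hom K (E_space K A c) A \<and>
            (\<forall>t\<ge>2. \<forall>z\<in>E_comp K A c t. b z = unincl K A (iter_mult K A (t - 1) z)))"

end

theory Submission
  imports Defs
begin

text \<open>Let \<open>A\<close> be a braided algebra. The universal property of the tensor algebra extends the identity of
  \<open>A\<close> to an algebra map \<open>mu: T(A) \<rightarrow> A\<close>, which on \<open>A\<^sup>\<otimes>\<^sup>n\<close> is the iterated multiplication. The bracket is
  therefore the restriction of \<open>mu\<close> to \<open>E(A, c)\<close> (\<open>bracket_restrict\<close>), and the theorem comes down to three
  facts.

  Injectivity of \<open>i_U\<close>: since \<open>mu\<close> agrees with the bracket on \<open>E(A, c)\<close> and is the identity on \<open>A\<close>, it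
  kills the generators \<open>z - b(z)\<close> of the enveloping ideal. It factors through the enveloping algebra
  and provides a left inverse of \<open>i_U\<close> (\<open>env_ideal_kernel\<close>, \<open>i_U_inj\<close>).

  Compatibility of the bracket with the braiding: by induction on the number of letters the axioms of a
  braided algebra give \<open>c (mu \<otimes> mu) = (mu \<otimes> mu) c\<^sub>T\<close> on \<open>A\<^sup>\<otimes>\<^sup>m \<otimes> A\<close> and on \<open>A \<otimes> A\<^sup>\<otimes>\<^sup>n\<close> (\<open>c_N_right\<close>,
  \<open>c_N_left\<close>).

  The braiding of \<open>T(V, c)\<close> maps \<open>E \<otimes> V\<close> into \<open>V \<otimes> E\<close> and \<open>V \<otimes> E\<close> into \<open>E \<otimes> V\<close>: let \<open>S i\<close> be the braiding \<open>c\<close>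
  applied to the letters \<open>i\<close> and \<open>i + 1\<close> of a tensor. On \<open>V\<^sup>\<otimes>\<^sup>m \<otimes> V\<^sup>\<otimes>\<^sup>n\<close> the braiding of \<open>T(V, c)\<close> is the
  crossing \<open>C\<close> of two bundles of strands, and the components of the comultiplication are the quantum
  shuffles \<open>sh\<close>; both are built from the \<open>S i\<close>. By the braid relations every operator built from
  the \<open>S i\<close> inside one bundle slides through a crossing (\<open>fam_C_left\<close>, \<open>fam_C_right\<close>). So the crossing
  carries the common kernel of the shuffles of the first \<open>n\<close> letters of \<open>V\<^sup>\<otimes>\<^sup>(\<^sup>n\<^sup>+\<^sup>1\<^sup>)\<close> to that of the shuffles of
  the last \<open>n\<close> letters, and since tensoring with a vector space is exact these kernels are
  \<open>E\<^sub>n \<otimes> V\<close> and \<open>V \<otimes> E\<^sub>n\<close> (\<open>E_kernel_left\<close>, \<open>E_kernel_right\<close>).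

  The last point rests on the description of \<open>T(V, c)\<close> by crossings and shuffles. As the structure of
  \<open>T(V, c)\<close> is chosen among all braided bialgebra structures that extend \<open>c\<close> and make the elements of \<open>V\<close>
  primitive, this takes existence and uniqueness. For existence, the operator \<open>sp\<close> cuts a
  tensor into blocks and turns each axiom into an identity of operators on a single tensor power of
  \<open>V\<close>: coassociativity becomes \<open>sh_coassoc\<close>, multiplicativity of the comultiplication the Vandermonde
  identity \<open>sh_vandermonde\<close>, and the axioms for the braiding become sliding rules
  (\<open>tensor_bialgebra_exists\<close>). For uniqueness, the axioms determine the structure maps degree by degree
  (\<open>c'_cT\<close>, \<open>D'_DT\<close>).\<close>

section \<open>Linear maps between modules\<close>

lemma lin_homI:
  assumes "\<And>x. x \<in> carrier M \<Longrightarrow> f x \<in> carrier N"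
    and "\<And>x y. x \<in> carrier M \<Longrightarrow> y \<in> carrier M \<Longrightarrow> f (x \<oplus>\<^bsub>M\<^esub> y) = f x \<oplus>\<^bsub>N\<^esub> f y"
    and "\<And>a x. a \<in> carrier K \<Longrightarrow> x \<in> carrier M \<Longrightarrow> f (a \<odot>\<^bsub>M\<^esub> x) = a \<odot>\<^bsub>N\<^esub> f x"
  shows "f \<in> lin_hom K M N"
  using assms by (auto simp: lin_hom_def)

lemma lin_hom_closed: "f \<in> lin_hom K M N \<Longrightarrow> x \<in> carrier M \<Longrightarrow> f x \<in> carrier N"
  by (auto simp: lin_hom_def)

lemma lin_hom_add:
  "f \<in> lin_hom K M N \<Longrightarrow> x \<in> carrier M \<Longrightarrow> y \<in> carrier M \<Longrightarrow> f (x \<oplus>\<^bsub>M\<^esub> y) = f x \<oplus>\<^bsub>N\<^esub> f y"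
  by (auto simp: lin_hom_def)

lemma lin_hom_smult:
  "f \<in> lin_hom K M N \<Longrightarrow> a \<in> carrier K \<Longrightarrow> x \<in> carrier M \<Longrightarrow> f (a \<odot>\<^bsub>M\<^esub> x) = a \<odot>\<^bsub>N\<^esub> f x"
  by (auto simp: lin_hom_def)

lemma lin_hom_zero:
  assumes "f \<in> lin_hom K M N" "module K M" "module K N"
  shows "f \<zero>\<^bsub>M\<^esub> = \<zero>\<^bsub>N\<^esub>"
proof -
  interpret M: module K M by fact
  interpret N: module K N by fact
  have "f \<zero>\<^bsub>M\<^esub> = f (\<zero>\<^bsub>K\<^esub> \<odot>\<^bsub>M\<^esub> \<zero>\<^bsub>M\<^esub>)" by simp
  also have "\<dots> = \<zero>\<^bsub>K\<^esub> \<odot>\<^bsub>N\<^esub> f \<zero>\<^bsub>M\<^esub>" using assms by (intro lin_hom_smult) auto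
  also have "\<dots> = \<zero>\<^bsub>N\<^esub>" using lin_hom_closed[OF assms(1)] by simp
  finally show ?thesis .
qed

lemma lin_hom_minus:
  assumes "f \<in> lin_hom K M N" "module K M" "module K N" "x \<in> carrier M" "y \<in> carrier M"
  shows "f (x \<ominus>\<^bsub>M\<^esub> y) = f x \<ominus>\<^bsub>N\<^esub> f y"
proof -
  interpret M: module K M by fact
  interpret N: module K N by fact
  have c: "f x \<in> carrier N" "f y \<in> carrier N" "f (x \<ominus>\<^bsub>M\<^esub> y) \<in> carrier N"
    using lin_hom_closed[OF assms(1)] assms by auto
  have e: "(x \<ominus>\<^bsub>M\<^esub> y) \<oplus>\<^bsub>M\<^esub> y = x"
    using assms by (simp add: M.minus_eq M.a_assoc M.l_neg)
  have "f x = f ((x \<ominus>\<^bsub>M\<^esub> y) \<oplus>\<^bsub>M\<^esub> y)" by (simp add: e)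
  also have "\<dots> = f (x \<ominus>\<^bsub>M\<^esub> y) \<oplus>\<^bsub>N\<^esub> f y" using assms by (intro lin_hom_add) auto
  finally show ?thesis using c by (simp add: N.minus_eq N.a_assoc N.r_neg)
qed

lemma lin_hom_finsum:
  assumes f: "f \<in> lin_hom K M N" "module K M" "module K N" and g: "g \<in> I \<rightarrow> carrier M"
  shows "f (finsum M g I) = finsum N (\<lambda>i. f (g i)) I"
proof -
  interpret M: module K M by fact
  interpret N: module K N by fact
  from g show ?thesis
  proof (induction I rule: infinite_finite_induct)
    case (infinite A)
    then show ?case using lin_hom_zero[OF f] by (simp add: M.finsum_infinite N.finsum_infinite)
  next
    case empty
    then show ?case using lin_hom_zero[OF f] by simp
  next
    case (insert i I)
    then have "(\<lambda>i. f (g i)) \<in> insert i I \<rightarrow> carrier N"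
      using lin_hom_closed[OF f(1)] by auto
    then show ?case using insert by (simp add: lin_hom_add[OF f(1)] Pi_def)
  qed
qed

lemma lin_hom_comp:
  "f \<in> lin_hom K M N \<Longrightarrow> g \<in> lin_hom K N P \<Longrightarrow> (\<lambda>x. g (f x)) \<in> lin_hom K M P"
  by (auto simp: lin_hom_def Pi_def)

lemma lin_hom_cong:
  assumes "f \<in> lin_hom K M N" "\<And>x. x \<in> carrier M \<Longrightarrow> f x = g x" "module K M"
  shows "g \<in> lin_hom K M N"
proof -
  interpret M: module K M by fact
  show ?thesis
    using assms(1) by (intro lin_homI) (auto simp: lin_hom_def assms(2)[symmetric] Pi_def)
qed

lemma lin_hom_restrict:
  "f \<in> lin_hom K M N \<Longrightarrow> module K M \<Longrightarrow> restrict f (carrier M) \<in> lin_hom K M N"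
  by (rule lin_hom_cong) auto

lemma lin_hom_sum:
  assumes "f \<in> lin_hom K M N" "g \<in> lin_hom K M N" "module K N"
  shows "(\<lambda>x. f x \<oplus>\<^bsub>N\<^esub> g x) \<in> lin_hom K M N"
proof -
  interpret N: module K N by fact
  show ?thesis using assms
    by (intro lin_homI)
       (simp_all add: lin_hom_closed lin_hom_add lin_hom_smult N.smult_r_distr N.a_ac)
qed

lemma lin_hom_smult_map:
  assumes "f \<in> lin_hom K M N" "a \<in> carrier K" "module K N"
  shows "(\<lambda>x. a \<odot>\<^bsub>N\<^esub> f x) \<in> lin_hom K M N"
proof -
  interpret N: module K N by fact
  show ?thesis using assms
    by (intro lin_homI)
       (simp_all add: lin_hom_closed lin_hom_add lin_hom_smult N.smult_r_distr
          N.smult_assoc1[symmetric] N.m_comm)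
qed

lemma lin_hom_zero_map: "module K N \<Longrightarrow> (\<lambda>x. \<zero>\<^bsub>N\<^esub>) \<in> lin_hom K M N"
proof -
  assume "module K N"
  then interpret N: module K N .
  show ?thesis by (intro lin_homI) auto
qed

lemma lin_hom_finsum_map:
  assumes "\<And>i. i \<in> I \<Longrightarrow> f i \<in> lin_hom K M N" "module K M" "module K N"
  shows "(\<lambda>x. finsum N (\<lambda>i. f i x) I) \<in> lin_hom K M N"
proof -
  interpret N: module K N by fact
  show ?thesis using assms(1)
  proof (induction I rule: infinite_finite_induct)
    case (infinite A)
    then show ?case using lin_hom_zero_map[OF assms(3)] by (simp add: N.finsum_infinite)
  next
    case empty
    then show ?case using lin_hom_zero_map[OF assms(3)] by simp
  next
    case (insert i I)
    have "(\<lambda>x. f i x \<oplus>\<^bsub>N\<^esub> finsum N (\<lambda>i. f i x) I) \<in> lin_hom K M N" (is "?g \<in> _")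
      using insert by (intro lin_hom_sum assms(3)) auto
    moreover have "?g x = finsum N (\<lambda>i. f i x) (insert i I)" if "x \<in> carrier M" for x
      using insert.prems that
      by (intro N.finsum_insert[symmetric] insert.hyps) (auto intro: lin_hom_closed)
    ultimately show ?case by (rule lin_hom_cong[OF _ _ assms(2)])
  qed
qed

lemma lin_hom_domain:
  assumes "f \<in> lin_hom K M N" "S \<subseteq> carrier M"
  shows "f \<in> lin_hom K (M\<lparr>carrier := S\<rparr>) N"
  using assms(2) by (intro lin_homI) (auto simp: lin_hom_closed[OF assms(1)] lin_hom_add[OF assms(1)]
    lin_hom_smult[OF assms(1)] subset_iff)

lemma assoc_algebra_module: "assoc_algebra K A \<Longrightarrow> module K A"
  by (simp add: assoc_algebra_def)

lemma assoc_algebra_ring: "assoc_algebra K A \<Longrightarrow> ring A"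
  by (simp add: assoc_algebra_def)

text \<open>Both sides sum over \<open>j \<le> i \<le> n\<close>. Indexing the inner sum by the difference \<open>i - j\<close> is the form in
  which convolution products and iterated comultiplications produce such sums.\<close>

lemma (in abelian_monoid) finsum_triangle_swap:
  assumes "\<And>i j. H j i \<in> carrier G"
  shows "(\<Oplus>i\<in>{..n::nat}. \<Oplus>j\<in>{..i}. H j i) = (\<Oplus>j\<in>{..n}. \<Oplus>i\<in>{..n-j}. H j (i+j))"
proof (induction n)
  case 0
  then show ?case by (simp add: assms)
next
  case (Suc n)
  have "(\<Oplus>j\<in>{..Suc n}. \<Oplus>i\<in>{..Suc n-j}. H j (i+j)) =
        H (Suc n) (Suc n) \<oplus> (\<Oplus>j\<in>{..n}. \<Oplus>i\<in>{..Suc n-j}. H j (i+j))"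
    by (simp add: assms)
  also have "(\<Oplus>j\<in>{..n}. \<Oplus>i\<in>{..Suc n-j}. H j (i+j)) =
             (\<Oplus>j\<in>{..n}. H j (Suc n) \<oplus> (\<Oplus>i\<in>{..n-j}. H j (i+j)))"
    by (rule finsum_cong') (auto simp: Suc_diff_le assms)
  also have "\<dots> = (\<Oplus>j\<in>{..n}. H j (Suc n)) \<oplus> (\<Oplus>j\<in>{..n}. \<Oplus>i\<in>{..n-j}. H j (i+j))"
    by (rule finsum_addf) (auto simp: assms)
  finally show ?case using Suc by (simp add: assms a_assoc)
qed

section \<open>The free associative algebra\<close>

locale free_alg = field K for K (structure) +
  fixes X :: "'x set"
begin

abbreviation "F \<equiv> free_algebra K X"

lemma F_memI:
  "(\<And>w. f w \<in> carrier K) \<Longrightarrow> finite {w. f w \<noteq> \<zero>} \<Longrightarrow> {w. f w \<noteq> \<zero>} \<subseteq> lists X \<Longrightarrow> f \<in> carrier F"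
  by (auto simp: free_algebra_def)

lemma F_mem: "f \<in> carrier F \<Longrightarrow> f w \<in> carrier K"
  "f \<in> carrier F \<Longrightarrow> finite {w. f w \<noteq> \<zero>}"
  "f \<in> carrier F \<Longrightarrow> f w \<noteq> \<zero> \<Longrightarrow> w \<in> lists X"
  by (auto simp: free_algebra_def)

lemma F_simps:
  "f \<otimes>\<^bsub>F\<^esub> g = (\<lambda>w. \<Oplus>i\<in>{..length w}. f (take i w) \<otimes> g (drop i w))"
  "\<one>\<^bsub>F\<^esub> = (\<lambda>w. if w = [] then \<one> else \<zero>)"
  "\<zero>\<^bsub>F\<^esub> = (\<lambda>w. \<zero>)"
  "f \<oplus>\<^bsub>F\<^esub> g = (\<lambda>w. f w \<oplus> g w)"
  "a \<odot>\<^bsub>F\<^esub> f = (\<lambda>w. a \<otimes> f w)"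
  by (simp_all add: free_algebra_def)

lemma F_one_closed: "\<one>\<^bsub>F\<^esub> \<in> carrier F"
  by (rule F_memI) (auto simp: F_simps)

lemma F_zero_closed: "\<zero>\<^bsub>F\<^esub> \<in> carrier F"
  by (rule F_memI) (auto simp: F_simps)

lemma F_add_closed: "f \<in> carrier F \<Longrightarrow> g \<in> carrier F \<Longrightarrow> f \<oplus>\<^bsub>F\<^esub> g \<in> carrier F"
proof (rule F_memI)
  assume f: "f \<in> carrier F" and g: "g \<in> carrier F"
  have s: "{w. (f \<oplus>\<^bsub>F\<^esub> g) w \<noteq> \<zero>} \<subseteq> {w. f w \<noteq> \<zero>} \<union> {w. g w \<noteq> \<zero>}"
    using F_mem[OF f] F_mem[OF g] by (auto simp: F_simps)
  then show "finite {w. (f \<oplus>\<^bsub>F\<^esub> g) w \<noteq> \<zero>}"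
    using F_mem(2)[OF f] F_mem(2)[OF g] finite_subset by blast
  show "{w. (f \<oplus>\<^bsub>F\<^esub> g) w \<noteq> \<zero>} \<subseteq> lists X"
    using s F_mem(3)[OF f] F_mem(3)[OF g] by blast
qed (auto simp: F_simps F_mem)

lemma F_smult_closed: "a \<in> carrier K \<Longrightarrow> f \<in> carrier F \<Longrightarrow> a \<odot>\<^bsub>F\<^esub> f \<in> carrier F"
proof (rule F_memI)
  assume a: "a \<in> carrier K" and f: "f \<in> carrier F"
  have s: "{w. (a \<odot>\<^bsub>F\<^esub> f) w \<noteq> \<zero>} \<subseteq> {w. f w \<noteq> \<zero>}"
    using a by (auto simp: F_simps)
  then show "finite {w. (a \<odot>\<^bsub>F\<^esub> f) w \<noteq> \<zero>}"
    using F_mem(2)[OF f] finite_subset by blast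
  show "{w. (a \<odot>\<^bsub>F\<^esub> f) w \<noteq> \<zero>} \<subseteq> lists X"
    using s F_mem(3)[OF f] by blast
qed (auto simp: F_simps F_mem)

lemma F_mult_closed:
  assumes f: "f \<in> carrier F" and g: "g \<in> carrier F" shows "f \<otimes>\<^bsub>F\<^esub> g \<in> carrier F"
proof (rule F_memI)
  have s: "{w. (f \<otimes>\<^bsub>F\<^esub> g) w \<noteq> \<zero>} \<subseteq> (\<lambda>(u, v). u @ v) ` ({w. f w \<noteq> \<zero>} \<times> {w. g w \<noteq> \<zero>})"
  proof
    fix w assume "w \<in> {w. (f \<otimes>\<^bsub>F\<^esub> g) w \<noteq> \<zero>}"
    then have *: "(\<Oplus>i\<in>{..length w}. f (take i w) \<otimes> g (drop i w)) \<noteq> \<zero>" by (simp add: F_simps)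
    have "\<exists>i. f (take i w) \<otimes> g (drop i w) \<noteq> \<zero>"
    proof (rule ccontr)
      assume "\<nexists>i. f (take i w) \<otimes> g (drop i w) \<noteq> \<zero>"
      then have "(\<Oplus>i\<in>{..length w}. f (take i w) \<otimes> g (drop i w)) = \<zero>"
        by (intro add.finprod_one_eqI) auto
      with * show False by simp
    qed
    then obtain i where "f (take i w) \<otimes> g (drop i w) \<noteq> \<zero>" by blast
    then have "f (take i w) \<noteq> \<zero>" "g (drop i w) \<noteq> \<zero>"
      using F_mem(1)[OF f] F_mem(1)[OF g] by auto
    then show "w \<in> (\<lambda>(u, v). u @ v) ` ({w. f w \<noteq> \<zero>} \<times> {w. g w \<noteq> \<zero>})"
      by (intro image_eqI[where x = "(take i w, drop i w)"]) simp_all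
  qed
  then show "finite {w. (f \<otimes>\<^bsub>F\<^esub> g) w \<noteq> \<zero>}"
    by (rule finite_subset) (intro finite_imageI finite_cartesian_product F_mem f g)
  show "{w. (f \<otimes>\<^bsub>F\<^esub> g) w \<noteq> \<zero>} \<subseteq> lists X"
    using s F_mem(3)[OF f] F_mem(3)[OF g] by fastforce
qed (auto simp: F_simps F_mem f g intro!: finsum_closed)

text \<open>Either way of bracketing sums over the cuts of a word into three pieces.\<close>

lemma F_mult_assoc:
  assumes f: "f \<in> carrier F" and g: "g \<in> carrier F" and h: "h \<in> carrier F"
  shows "(f \<otimes>\<^bsub>F\<^esub> g) \<otimes>\<^bsub>F\<^esub> h = f \<otimes>\<^bsub>F\<^esub> (g \<otimes>\<^bsub>F\<^esub> h)"
proof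
  fix w
  note [simp] = F_mem(1)[OF f] F_mem(1)[OF g] F_mem(1)[OF h]
  let ?G = "\<lambda>j i. f (take j w) \<otimes> (g (take (i - j) (drop j w)) \<otimes> h (drop i w))"
  have "((f \<otimes>\<^bsub>F\<^esub> g) \<otimes>\<^bsub>F\<^esub> h) w =
      (\<Oplus>i\<in>{..length w}. (\<Oplus>j\<in>{..i}. f (take j w) \<otimes> g (take (i-j) (drop j w))) \<otimes> h (drop i w))"
    by (auto simp: F_simps min_absorb1 take_drop min_def intro!: finsum_cong' finsum_closed
        arg_cong2[where f = "(\<otimes>)"])
  also have "\<dots> = (\<Oplus>i\<in>{..length w}. \<Oplus>j\<in>{..i}. ?G j i)"
    by (auto simp: finsum_ldistr m_assoc intro!: finsum_cong' finsum_closed)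
  also have "\<dots> = (\<Oplus>j\<in>{..length w}. \<Oplus>i\<in>{..length w - j}. ?G j (i + j))"
    by (rule finsum_triangle_swap) simp
  also have "\<dots> = (\<Oplus>j\<in>{..length w}. f (take j w) \<otimes>
                    (\<Oplus>i\<in>{..length w - j}. g (take i (drop j w)) \<otimes> h (drop (i + j) w)))"
    by (auto simp: finsum_rdistr intro!: finsum_cong' finsum_closed)
  also have "\<dots> = (f \<otimes>\<^bsub>F\<^esub> (g \<otimes>\<^bsub>F\<^esub> h)) w"
    by (auto simp: F_simps intro!: finsum_cong' finsum_closed)
  finally show "((f \<otimes>\<^bsub>F\<^esub> g) \<otimes>\<^bsub>F\<^esub> h) w = (f \<otimes>\<^bsub>F\<^esub> (g \<otimes>\<^bsub>F\<^esub> h)) w" .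
qed

lemma word_mult:
  "free_word K u \<otimes>\<^bsub>F\<^esub> free_word K v = free_word K (u @ v)"
proof
  fix w
  show "(free_word K u \<otimes>\<^bsub>F\<^esub> free_word K v) w = free_word K (u @ v) w"
  proof (cases "w = u @ v")
    case True
    have "(free_word K u \<otimes>\<^bsub>F\<^esub> free_word K v) w =
          (\<Oplus>i\<in>{..length w}. if i = length u then \<one> else \<zero>)"
      unfolding F_simps
    proof (rule finsum_cong')
      fix i assume "i \<in> {..length w}"
      then have "take i w = u \<and> drop i w = v \<longleftrightarrow> i = length u"
        using True by (metis append_eq_conv_conj atMost_iff length_take min_absorb2)
      then show "free_word K u (take i w) \<otimes> free_word K v (drop i w) = (if i = length u then \<one> else \<zero>)"
        by (auto simp: free_word_def)
    qed auto
    also have "\<dots> = \<one>" using True by (subst add.finprod_singleton_swap) auto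
    finally show ?thesis using True by (simp add: free_word_def)
  next
    case False
    have "(free_word K u \<otimes>\<^bsub>F\<^esub> free_word K v) w = \<zero>"
      using False unfolding F_simps
      by (intro add.finprod_one_eqI) (auto simp: free_word_def)
    then show ?thesis using False by (simp add: free_word_def)
  qed
qed

lemma one_word: "\<one>\<^bsub>F\<^esub> = free_word K []"
  by (simp add: F_simps free_word_def)

lemma word_closed: "w \<in> lists X \<Longrightarrow> free_word K w \<in> carrier F"
  by (rule F_memI) (auto simp: free_word_def)

lemma F_one_mult: "f \<in> carrier F \<Longrightarrow> \<one>\<^bsub>F\<^esub> \<otimes>\<^bsub>F\<^esub> f = f"
proof
  fix w assume f: "f \<in> carrier F"
  have "(\<one>\<^bsub>F\<^esub> \<otimes>\<^bsub>F\<^esub> f) w = (\<Oplus>i\<in>{..length w}. if i = 0 then f (drop i w) else \<zero>)"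
    using F_mem(1)[OF f] by (auto simp: F_simps intro!: finsum_cong')
  also have "\<dots> = f w" using F_mem(1)[OF f] by (subst add.finprod_singleton_swap) auto
  finally show "(\<one>\<^bsub>F\<^esub> \<otimes>\<^bsub>F\<^esub> f) w = f w" .
qed

lemma F_mult_one: "f \<in> carrier F \<Longrightarrow> f \<otimes>\<^bsub>F\<^esub> \<one>\<^bsub>F\<^esub> = f"
proof
  fix w assume f: "f \<in> carrier F"
  have "(f \<otimes>\<^bsub>F\<^esub> \<one>\<^bsub>F\<^esub>) w = (\<Oplus>i\<in>{..length w}. if i = length w then f (take i w) else \<zero>)"
    using F_mem(1)[OF f] by (auto simp: F_simps intro!: finsum_cong')
  also have "\<dots> = f w" using F_mem(1)[OF f] by (subst add.finprod_singleton_swap) auto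
  finally show "(f \<otimes>\<^bsub>F\<^esub> \<one>\<^bsub>F\<^esub>) w = f w" .
qed

lemma F_abelian_group: "abelian_group F"
proof (rule abelian_groupI)
  fix f assume f: "f \<in> carrier F"
  have "(\<ominus> \<one>) \<odot>\<^bsub>F\<^esub> f \<in> carrier F" using f by (intro F_smult_closed) auto
  moreover have "((\<ominus> \<one>) \<odot>\<^bsub>F\<^esub> f) \<oplus>\<^bsub>F\<^esub> f = \<zero>\<^bsub>F\<^esub>"
    using F_mem(1)[OF f] by (simp add: F_simps l_minus l_neg)
  ultimately show "\<exists>g\<in>carrier F. g \<oplus>\<^bsub>F\<^esub> f = \<zero>\<^bsub>F\<^esub>" by blast
qed (auto simp: F_zero_closed F_add_closed, auto simp: F_simps F_mem a_ac)

lemma F_ring: "ring F"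
proof (rule ringI)
  show "abelian_group F" by (rule F_abelian_group)
  show "monoid F"
    by (rule monoidI) (auto simp: F_one_closed F_mult_closed F_mult_assoc F_one_mult F_mult_one)
  fix f g h assume f: "f \<in> carrier F" and g: "g \<in> carrier F" and h: "h \<in> carrier F"
  note [simp] = F_mem(1)[OF f] F_mem(1)[OF g] F_mem(1)[OF h]
  show "(f \<oplus>\<^bsub>F\<^esub> g) \<otimes>\<^bsub>F\<^esub> h = f \<otimes>\<^bsub>F\<^esub> h \<oplus>\<^bsub>F\<^esub> g \<otimes>\<^bsub>F\<^esub> h"
    by (simp add: F_simps l_distr finsum_addf Pi_def)
  show "h \<otimes>\<^bsub>F\<^esub> (f \<oplus>\<^bsub>F\<^esub> g) = h \<otimes>\<^bsub>F\<^esub> f \<oplus>\<^bsub>F\<^esub> h \<otimes>\<^bsub>F\<^esub> g"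
    by (simp add: F_simps r_distr finsum_addf Pi_def)
qed

lemma F_module: "module K F"
  by (rule moduleI[OF cring_axioms F_abelian_group F_smult_closed])
     (auto simp: F_simps F_mem l_distr r_distr m_assoc)

lemma F_algebra: "assoc_algebra K F"
proof -
  interpret F: module K F by (rule F_module)
  interpret Fr: ring F by (rule F_ring)
  show ?thesis
  proof (unfold_locales)
    fix a f g assume a: "a \<in> carrier K" and f: "f \<in> carrier F" and g: "g \<in> carrier F"
    note [simp] = F_mem(1)[OF f] F_mem(1)[OF g] a
    show "a \<odot>\<^bsub>F\<^esub> f \<otimes>\<^bsub>F\<^esub> g = a \<odot>\<^bsub>F\<^esub> (f \<otimes>\<^bsub>F\<^esub> g)"
      by (simp add: F_simps finsum_rdistr Pi_def m_assoc)
    show "f \<otimes>\<^bsub>F\<^esub> (a \<odot>\<^bsub>F\<^esub> g) = a \<odot>\<^bsub>F\<^esub> (f \<otimes>\<^bsub>F\<^esub> g)"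
      by (simp add: F_simps finsum_rdistr Pi_def m_lcomm)
  qed
qed

text \<open>An element of the free algebra is a linear combination of the words in its support; \<open>P\<close> records
  a condition on the support, such as a fixed length of the words.\<close>

lemma F_induct_on:
  assumes f: "f \<in> carrier F" "\<And>w. f w \<noteq> \<zero> \<Longrightarrow> P w"
    and zero: "Q \<zero>\<^bsub>F\<^esub>"
    and step: "\<And>a w g. a \<in> carrier K \<Longrightarrow> w \<in> lists X \<Longrightarrow> P w \<Longrightarrow> g \<in> carrier F \<Longrightarrow>
      (\<And>w. g w \<noteq> \<zero> \<Longrightarrow> P w) \<Longrightarrow> Q g \<Longrightarrow> Q ((a \<odot>\<^bsub>F\<^esub> free_word K w) \<oplus>\<^bsub>F\<^esub> g)"
  shows "Q f"
proof -
  have "\<forall>f. f \<in> carrier F \<longrightarrow> {w. f w \<noteq> \<zero>} = W \<longrightarrow> (\<forall>w\<in>W. P w) \<longrightarrow> Q f" if "finite W" for W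
    using that
  proof (induction W)
    case empty
    have "f = \<zero>\<^bsub>F\<^esub>" if "{w. f w \<noteq> \<zero>} = {}" for f
      using that by (auto simp: F_simps)
    then show ?case using zero by auto
  next
    case (insert w W)
    show ?case
    proof (intro allI impI)
      fix f assume f: "f \<in> carrier F" "{w. f w \<noteq> \<zero>} = insert w W" "\<forall>w\<in>insert w W. P w"
      define g where "g = (\<lambda>v. if v = w then \<zero> else f v)"
      have gs: "{v. g v \<noteq> \<zero>} = W" using f(2) insert(2) by (auto simp: g_def)
      have g: "g \<in> carrier F"
      proof (rule F_memI)
        show "finite {v. g v \<noteq> \<zero>}" using gs insert(1) by simp
        show "{v. g v \<noteq> \<zero>} \<subseteq> lists X" using gs f(2) F_mem(3)[OF f(1)] by blast
      qed (auto simp: g_def F_mem f)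
      have "w \<in> lists X" using f F_mem(3)[OF f(1)] by blast
      then have "Q ((f w \<odot>\<^bsub>F\<^esub> free_word K w) \<oplus>\<^bsub>F\<^esub> g)"
        using insert.IH g gs f by (intro step) (auto simp: F_mem)
      also have "(f w \<odot>\<^bsub>F\<^esub> free_word K w) \<oplus>\<^bsub>F\<^esub> g = f"
        using F_mem(1)[OF f(1)] by (auto simp: F_simps free_word_def g_def)
      finally show "Q f" .
    qed
  qed
  from this[OF F_mem(2)[OF f(1)]] show ?thesis using f by blast
qed

end


section \<open>The tensor algebra and its universal property\<close>

lemma (in module) submoduleI':
  assumes "H \<subseteq> carrier M" "\<zero>\<^bsub>M\<^esub> \<in> H"
    and "\<And>a b. a \<in> H \<Longrightarrow> b \<in> H \<Longrightarrow> a \<oplus>\<^bsub>M\<^esub> b \<in> H"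
    and sm: "\<And>a x. a \<in> carrier R \<Longrightarrow> x \<in> H \<Longrightarrow> a \<odot>\<^bsub>M\<^esub> x \<in> H"
  shows "submodule H R M"
proof (rule submoduleI)
  fix x assume x: "x \<in> H"
  have "(\<ominus> \<one>) \<odot>\<^bsub>M\<^esub> x = \<ominus>\<^bsub>M\<^esub> x" using assms(1) x by (subst smult_l_minus) auto
  then show "\<ominus>\<^bsub>M\<^esub> x \<in> H" using sm[OF _ x, of "\<ominus> \<one>"] by simp
qed (use assms in auto)

lemma (in abelian_group) minus_add_cancel: "x \<in> carrier G \<Longrightarrow> y \<in> carrier G \<Longrightarrow> (x \<ominus> y) \<oplus> y = x"
  by (simp add: minus_eq a_assoc l_neg)

lemma (in abelian_group) minus_zero_eq:
  assumes "x \<ominus> y = \<zero>" "x \<in> carrier G" "y \<in> carrier G" shows "x = y"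
  using minus_add_cancel[OF assms(2,3)] assms by simp

lemma module_submodule:
  assumes "module K M" "submodule H K M" shows "module K (M\<lparr>carrier := H\<rparr>)"
  using submodule.submodule_is_module assms by blast

text \<open>Functions of words that are linear in each letter; these are the linear maps out of the
  tensor algebra.\<close>

definition multilinear ::
  "('k, 'm) ring_scheme \<Rightarrow> ('k, 'v, 'n) module_scheme \<Rightarrow> ('k, 'w, 'p) module_scheme \<Rightarrow> ('v list \<Rightarrow> 'w) \<Rightarrow> bool"
  where "multilinear K V N \<phi> \<longleftrightarrow>
    (\<forall>w\<in>lists (carrier V). \<phi> w \<in> carrier N) \<and>
    (\<forall>u\<in>lists (carrier V). \<forall>w\<in>lists (carrier V). \<forall>x\<in>carrier V. \<forall>y\<in>carrier V.
       \<phi> (u @ (x \<oplus>\<^bsub>V\<^esub> y) # w) = \<phi> (u @ x # w) \<oplus>\<^bsub>N\<^esub> \<phi> (u @ y # w)) \<and>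
    (\<forall>u\<in>lists (carrier V). \<forall>w\<in>lists (carrier V). \<forall>a\<in>carrier K. \<forall>x\<in>carrier V.
       \<phi> (u @ (a \<odot>\<^bsub>V\<^esub> x) # w) = a \<odot>\<^bsub>N\<^esub> \<phi> (u @ x # w))"

lemma multilinearI:
  assumes "\<And>w. w \<in> lists (carrier V) \<Longrightarrow> \<phi> w \<in> carrier N"
    and "\<And>u w x y. u \<in> lists (carrier V) \<Longrightarrow> w \<in> lists (carrier V) \<Longrightarrow> x \<in> carrier V \<Longrightarrow> y \<in> carrier V \<Longrightarrow>
       \<phi> (u @ (x \<oplus>\<^bsub>V\<^esub> y) # w) = \<phi> (u @ x # w) \<oplus>\<^bsub>N\<^esub> \<phi> (u @ y # w)"
    and "\<And>u w a x. u \<in> lists (carrier V) \<Longrightarrow> w \<in> lists (carrier V) \<Longrightarrow> a \<in> carrier K \<Longrightarrow> x \<in> carrier V \<Longrightarrow>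
       \<phi> (u @ (a \<odot>\<^bsub>V\<^esub> x) # w) = a \<odot>\<^bsub>N\<^esub> \<phi> (u @ x # w)"
  shows "multilinear K V N \<phi>"
  using assms by (auto simp: multilinear_def)

lemma multilinearD:
  assumes "multilinear K V N \<phi>"
  shows "w \<in> lists (carrier V) \<Longrightarrow> \<phi> w \<in> carrier N"
    and "u \<in> lists (carrier V) \<Longrightarrow> w \<in> lists (carrier V) \<Longrightarrow> x \<in> carrier V \<Longrightarrow> y \<in> carrier V \<Longrightarrow>
       \<phi> (u @ (x \<oplus>\<^bsub>V\<^esub> y) # w) = \<phi> (u @ x # w) \<oplus>\<^bsub>N\<^esub> \<phi> (u @ y # w)"
    and "u \<in> lists (carrier V) \<Longrightarrow> w \<in> lists (carrier V) \<Longrightarrow> a \<in> carrier K \<Longrightarrow> x \<in> carrier V \<Longrightarrow>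
       \<phi> (u @ (a \<odot>\<^bsub>V\<^esub> x) # w) = a \<odot>\<^bsub>N\<^esub> \<phi> (u @ x # w)"
  using assms by (auto simp: multilinear_def)

locale vec = field K + module K V for K (structure) and V (structure)

sublocale vec \<subseteq> free_alg K "carrier V" ..

context vec
begin

abbreviation "L \<equiv> lists (carrier V)"
abbreviation "T \<equiv> tensor_algebra K V"
abbreviation "P \<equiv> pure K V"
abbreviation "TP n \<equiv> carrier (tpow K V n)"

interpretation F: ring F by (rule F_ring)
interpretation FA: assoc_algebra K F by (rule F_algebra)

definition rels :: "('c list \<Rightarrow> 'a) set" where
  "rels = {free_word K [x \<oplus>\<^bsub>V\<^esub> y] \<ominus>\<^bsub>F\<^esub> (free_word K [x] \<oplus>\<^bsub>F\<^esub> free_word K [y]) | x y.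
               x \<in> carrier V \<and> y \<in> carrier V}
         \<union> {free_word K [a \<odot>\<^bsub>V\<^esub> x] \<ominus>\<^bsub>F\<^esub> (a \<odot>\<^bsub>F\<^esub> free_word K [x]) | a x.
               a \<in> carrier K \<and> x \<in> carrier V}"

abbreviation "I \<equiv> tensor_ideal K V"

lemma I_def: "I = Idl\<^bsub>F\<^esub> rels"
  by (simp add: tensor_ideal_def rels_def Let_def)

lemma rels_sub: "rels \<subseteq> carrier F"
  by (auto simp: rels_def word_closed intro!: F.minus_closed F.a_closed FA.smult_closed)

lemma I_ideal: "ideal I F"
  unfolding I_def by (rule F.genideal_ideal[OF rels_sub])

interpretation I: ideal I F by (rule I_ideal)

definition cls :: "('c list \<Rightarrow> 'a) \<Rightarrow> ('c list \<Rightarrow> 'a) set" where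
  "cls f = I +>\<^bsub>F\<^esub> f"

lemma T_simps:
  "carrier T = cls ` carrier F"
  "\<one>\<^bsub>T\<^esub> = cls \<one>\<^bsub>F\<^esub>"
  "\<zero>\<^bsub>T\<^esub> = cls \<zero>\<^bsub>F\<^esub>"
  "f \<in> carrier F \<Longrightarrow> g \<in> carrier F \<Longrightarrow> cls f \<otimes>\<^bsub>T\<^esub> cls g = cls (f \<otimes>\<^bsub>F\<^esub> g)"
  "f \<in> carrier F \<Longrightarrow> g \<in> carrier F \<Longrightarrow> cls f \<oplus>\<^bsub>T\<^esub> cls g = cls (f \<oplus>\<^bsub>F\<^esub> g)"
  "a \<in> carrier K \<Longrightarrow> f \<in> carrier F \<Longrightarrow> a \<odot>\<^bsub>T\<^esub> cls f = cls (a \<odot>\<^bsub>F\<^esub> f)"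
proof -
  interpret h: ring_hom_ring F "F Quot I" cls
    using I.rcos_ring_hom_ring unfolding cls_def[abs_def] .
  show "carrier T = cls ` carrier F"
    by (auto simp: tensor_algebra_def Let_def FactRing_def A_RCOSETS_def' cls_def)
  show "\<one>\<^bsub>T\<^esub> = cls \<one>\<^bsub>F\<^esub>" by (simp add: tensor_algebra_def Let_def)
  show "\<zero>\<^bsub>T\<^esub> = cls \<zero>\<^bsub>F\<^esub>" by (simp add: tensor_algebra_def Let_def)
  show m: "cls f \<otimes>\<^bsub>T\<^esub> cls g = cls (f \<otimes>\<^bsub>F\<^esub> g)" if "f \<in> carrier F" "g \<in> carrier F" for f g
    using that by (simp add: tensor_algebra_def Let_def)
  show "cls f \<oplus>\<^bsub>T\<^esub> cls g = cls (f \<oplus>\<^bsub>F\<^esub> g)" if "f \<in> carrier F" "g \<in> carrier F"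
    using that by (simp add: tensor_algebra_def Let_def)
  show "a \<odot>\<^bsub>T\<^esub> cls f = cls (a \<odot>\<^bsub>F\<^esub> f)" if a: "a \<in> carrier K" and f: "f \<in> carrier F"
  proof -
    have "a \<odot>\<^bsub>T\<^esub> cls f = cls (a \<odot>\<^bsub>F\<^esub> \<one>\<^bsub>F\<^esub>) \<otimes>\<^bsub>F Quot I\<^esub> cls f"
      by (simp add: tensor_algebra_def Let_def cls_def)
    also have "\<dots> = cls ((a \<odot>\<^bsub>F\<^esub> \<one>\<^bsub>F\<^esub>) \<otimes>\<^bsub>F\<^esub> f)"
      using a f by (subst h.hom_mult) (auto intro!: FA.smult_closed)
    also have "(a \<odot>\<^bsub>F\<^esub> \<one>\<^bsub>F\<^esub>) \<otimes>\<^bsub>F\<^esub> f = a \<odot>\<^bsub>F\<^esub> f"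
      using a f by (simp add: FA.smult_mult_left)
    finally show ?thesis .
  qed
qed

lemma T_cases: "x \<in> carrier T \<Longrightarrow> (\<And>f. f \<in> carrier F \<Longrightarrow> x = cls f \<Longrightarrow> thesis) \<Longrightarrow> thesis"
  by (auto simp: T_simps)

lemma cls_closed: "f \<in> carrier F \<Longrightarrow> cls f \<in> carrier T"
  by (auto simp: T_simps)

lemma T_ring: "ring T"
proof -
  interpret Q: ring "F Quot I" by (rule I.quotient_is_ring)
  have g: "abelian_group T"
  proof (rule abelian_groupI)
    fix x assume "x \<in> carrier T"
    then have "x \<in> carrier (F Quot I)" by (simp add: tensor_algebra_def Let_def)
    then have "\<exists>y\<in>carrier (F Quot I). y \<oplus>\<^bsub>F Quot I\<^esub> x = \<zero>\<^bsub>F Quot I\<^esub>"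
      using Q.l_neg by blast
    then show "\<exists>y\<in>carrier T. y \<oplus>\<^bsub>T\<^esub> x = \<zero>\<^bsub>T\<^esub>" by (simp add: tensor_algebra_def Let_def)
  qed (simp_all add: tensor_algebra_def Let_def Q.a_ac)
  have m: "monoid T"
    by (rule monoidI) (simp_all add: tensor_algebra_def Let_def Q.m_assoc)
  show ?thesis
    by (rule ringI[OF g m]) (simp_all add: tensor_algebra_def Let_def Q.l_distr Q.r_distr)
qed

interpretation T: ring T by (rule T_ring)

lemma T_module: "module K T"
proof (rule moduleI)
  show "cring K" by (rule cring_axioms)
  show "abelian_group T" by (rule T.is_abelian_group)
qed (auto elim!: T_cases simp: T_simps(4-) cls_closed FA.smult_l_distr FA.smult_r_distr FA.smult_assoc1)

lemma T_algebra: "assoc_algebra K T"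
proof -
  interpret TM: module K T by (rule T_module)
  show ?thesis
    by unfold_locales (auto elim!: T_cases simp: T_simps(4-) FA.smult_mult_left FA.smult_mult_right)
qed

interpretation TA: assoc_algebra K T by (rule T_algebra)

lemma pure_cls: "P w = cls (free_word K w)"
  by (simp add: pure_def cls_def)

lemma pure_closed [simp]: "w \<in> L \<Longrightarrow> P w \<in> carrier T"
  by (simp add: pure_cls cls_closed word_closed)

lemma pure_Nil: "P [] = \<one>\<^bsub>T\<^esub>"
  by (simp add: pure_cls T_simps one_word)

lemma pure_append: "u \<in> L \<Longrightarrow> w \<in> L \<Longrightarrow> P (u @ w) = P u \<otimes>\<^bsub>T\<^esub> P w"
  by (simp add: pure_cls T_simps word_closed word_mult)

lemma cls_eqI: "f \<in> carrier F \<Longrightarrow> g \<in> carrier F \<Longrightarrow> f \<ominus>\<^bsub>F\<^esub> g \<in> I \<Longrightarrow> cls f = cls g"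
  unfolding cls_def using F.quotient_eq_iff_same_a_r_cos[OF I_ideal] by blast

lemma pure_single_add:
  assumes "x \<in> carrier V" "y \<in> carrier V"
  shows "P [x \<oplus>\<^bsub>V\<^esub> y] = P [x] \<oplus>\<^bsub>T\<^esub> P [y]"
proof -
  have "free_word K [x \<oplus>\<^bsub>V\<^esub> y] \<ominus>\<^bsub>F\<^esub> (free_word K [x] \<oplus>\<^bsub>F\<^esub> free_word K [y]) \<in> I"
    using assms F.genideal_self[OF rels_sub] unfolding I_def rels_def by blast
  then show ?thesis
    using assms by (simp add: pure_cls T_simps word_closed) (intro cls_eqI F.a_closed word_closed, auto)
qed

lemma pure_single_smult:
  assumes "a \<in> carrier K" "x \<in> carrier V"
  shows "P [a \<odot>\<^bsub>V\<^esub> x] = a \<odot>\<^bsub>T\<^esub> P [x]"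
proof -
  have "free_word K [a \<odot>\<^bsub>V\<^esub> x] \<ominus>\<^bsub>F\<^esub> (a \<odot>\<^bsub>F\<^esub> free_word K [x]) \<in> I"
    using assms F.genideal_self[OF rels_sub] unfolding I_def rels_def by blast
  then show ?thesis
    using assms by (simp add: pure_cls T_simps word_closed) (intro cls_eqI FA.smult_closed word_closed, auto)
qed

lemma pure_Cons: "x \<in> carrier V \<Longrightarrow> w \<in> L \<Longrightarrow> P (x # w) = P [x] \<otimes>\<^bsub>T\<^esub> P w"
  using pure_append[of "[x]" w] by simp

lemma pure_multilinear: "multilinear K V T P"
proof (rule multilinearI)
  fix u w x y assume *: "u \<in> L" "w \<in> L" "x \<in> carrier V" "y \<in> carrier V"
  then show "P (u @ (x \<oplus>\<^bsub>V\<^esub> y) # w) = P (u @ x # w) \<oplus>\<^bsub>T\<^esub> P (u @ y # w)"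
    by (simp add: pure_append pure_Cons[of _ w] pure_single_add T.r_distr T.l_distr)
next
  fix u w a x assume *: "u \<in> L" "w \<in> L" "a \<in> carrier K" "x \<in> carrier V"
  then show "P (u @ (a \<odot>\<^bsub>V\<^esub> x) # w) = a \<odot>\<^bsub>T\<^esub> P (u @ x # w)"
    by (simp add: pure_append pure_Cons[of _ w] pure_single_smult TA.smult_mult_left TA.smult_mult_right)
qed simp

subsection \<open>Induction over tensors\<close>

lemma tpow_simps [simp]:
  "\<one>\<^bsub>tpow K V n\<^esub> = \<one>\<^bsub>T\<^esub>" "\<zero>\<^bsub>tpow K V n\<^esub> = \<zero>\<^bsub>T\<^esub>" "add (tpow K V n) = add T"
  "monoid.mult (tpow K V n) = monoid.mult T" "smult (tpow K V n) = smult T"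
  by (simp_all add: tpow_def)

lemma tpow_carrier: "TP n = {cls f | f. f \<in> carrier F \<and> (\<forall>w. f w \<noteq> \<zero> \<longrightarrow> length w = n)}"
  by (simp add: tpow_def cls_def)

lemma tpow_eq: "tpow K V n = T\<lparr>carrier := TP n\<rparr>"
  by (simp add: tpow_def)

lemma tpow_T: "x \<in> TP n \<Longrightarrow> x \<in> carrier T"
  by (auto simp: tpow_carrier cls_closed)

lemma pure_tpow: "w \<in> L \<Longrightarrow> length w = n \<Longrightarrow> P w \<in> TP n"
  unfolding tpow_carrier pure_cls
  by (rule CollectI, rule exI[of _ "free_word K w"]) (simp add: word_closed, simp add: free_word_def)

lemma tpow_add: "x \<in> TP n \<Longrightarrow> y \<in> TP n \<Longrightarrow> x \<oplus>\<^bsub>T\<^esub> y \<in> TP n"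
proof -
  assume "x \<in> TP n" "y \<in> TP n"
  then obtain f g where f: "x = cls f" "f \<in> carrier F" "\<And>w. f w \<noteq> \<zero> \<Longrightarrow> length w = n"
    and g: "y = cls g" "g \<in> carrier F" "\<And>w. g w \<noteq> \<zero> \<Longrightarrow> length w = n"
    unfolding tpow_carrier by blast
  have "length w = n" if "(f \<oplus>\<^bsub>F\<^esub> g) w \<noteq> \<zero>" for w
  proof (cases "f w = \<zero>")
    case True
    then have "g w \<noteq> \<zero>" using that by (auto simp: F_simps)
    then show ?thesis by (rule g)
  qed (rule f)
  then show ?thesis using f g unfolding tpow_carrier by (auto simp: T_simps intro!: exI[of _ "f \<oplus>\<^bsub>F\<^esub> g"])
qed

lemma tpow_smult: "a \<in> carrier K \<Longrightarrow> x \<in> TP n \<Longrightarrow> a \<odot>\<^bsub>T\<^esub> x \<in> TP n"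
proof -
  assume a: "a \<in> carrier K" and "x \<in> TP n"
  then obtain f where f: "x = cls f" "f \<in> carrier F" "\<And>w. f w \<noteq> \<zero> \<Longrightarrow> length w = n"
    unfolding tpow_carrier by blast
  have "length w = n" if "(a \<odot>\<^bsub>F\<^esub> f) w \<noteq> \<zero>" for w
    using that a f(3)[of w] by (cases "f w = \<zero>") (auto simp: F_simps)
  then show ?thesis using f a unfolding tpow_carrier
    by (auto simp: T_simps intro!: exI[of _ "a \<odot>\<^bsub>F\<^esub> f"])
qed

lemma tpow_zero: "\<zero>\<^bsub>T\<^esub> \<in> TP n"
  unfolding tpow_carrier T_simps by (auto simp: F_simps intro!: exI[of _ "\<lambda>w. \<zero>"] F_memI)

lemma tpow_submodule: "submodule (TP n) K T"
  by (rule TA.submoduleI') (auto simp: tpow_T tpow_zero tpow_add tpow_smult)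

lemma tpow_module: "module K (tpow K V n)"
proof -
  have "module K (T\<lparr>carrier := TP n\<rparr>)"
    by (rule module_submodule[OF T_module tpow_submodule])
  then show ?thesis by (simp add: tpow_def)
qed

text \<open>The common source of the induction rules for the tensor algebra and for its homogeneous
  components: \<open>S\<close> is the set of elements in question, and \<open>B\<close> the condition that singles out its
  words.\<close>

lemma tensor_induct_aux:
  assumes f: "f \<in> carrier F" "\<And>w. f w \<noteq> \<zero> \<Longrightarrow> B w"
    and zero: "Q \<zero>\<^bsub>T\<^esub>"
    and pure: "\<And>w. w \<in> L \<Longrightarrow> B w \<Longrightarrow> Q (P w)"
    and add: "\<And>x y. x \<in> S \<Longrightarrow> y \<in> S \<Longrightarrow> Q x \<Longrightarrow> Q y \<Longrightarrow> Q (x \<oplus>\<^bsub>T\<^esub> y)"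
    and smult: "\<And>a x. a \<in> carrier K \<Longrightarrow> x \<in> S \<Longrightarrow> Q x \<Longrightarrow> Q (a \<odot>\<^bsub>T\<^esub> x)"
    and S: "\<And>f. f \<in> carrier F \<Longrightarrow> (\<And>w. f w \<noteq> \<zero> \<Longrightarrow> B w) \<Longrightarrow> cls f \<in> S"
  shows "Q (cls f)"
proof (rule F_induct_on[where P = B and Q = "\<lambda>f. Q (cls f)", OF f])
  show "Q (cls \<zero>\<^bsub>F\<^esub>)" using zero by (simp add: T_simps)
  fix a w g assume a: "a \<in> carrier K" "w \<in> L" "B w" and g: "g \<in> carrier F" "\<And>w. g w \<noteq> \<zero> \<Longrightarrow> B w" "Q (cls g)"
  have "cls (free_word K w) \<in> S"
    using a by (intro S word_closed) (auto simp: free_word_def split: if_splits)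
  moreover have "cls (a \<odot>\<^bsub>F\<^esub> free_word K w) \<in> S"
    using a by (intro S FA.smult_closed word_closed) (auto simp: free_word_def F_simps split: if_splits)
  ultimately have "Q ((a \<odot>\<^bsub>T\<^esub> cls (free_word K w)) \<oplus>\<^bsub>T\<^esub> cls g)"
    using a g pure[of w] S[of g] by (intro add smult) (auto simp: T_simps word_closed pure_cls)
  then show "Q (cls ((a \<odot>\<^bsub>F\<^esub> free_word K w) \<oplus>\<^bsub>F\<^esub> g))"
    using a g by (simp add: T_simps word_closed)
qed auto

lemma T_induct [consumes 1, case_names pure add smult]:
  assumes x: "x \<in> carrier T"
    and pure: "\<And>w. w \<in> L \<Longrightarrow> Q (P w)"
    and add: "\<And>x y. x \<in> carrier T \<Longrightarrow> y \<in> carrier T \<Longrightarrow> Q x \<Longrightarrow> Q y \<Longrightarrow> Q (x \<oplus>\<^bsub>T\<^esub> y)"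
    and smult: "\<And>a x. a \<in> carrier K \<Longrightarrow> x \<in> carrier T \<Longrightarrow> Q x \<Longrightarrow> Q (a \<odot>\<^bsub>T\<^esub> x)"
  shows "Q x"
proof -
  obtain f where f: "f \<in> carrier F" "x = cls f" using x by (rule T_cases)
  have "Q (\<zero> \<odot>\<^bsub>T\<^esub> P [])" by (intro smult pure) auto
  then have "Q \<zero>\<^bsub>T\<^esub>" by simp
  then have "Q (cls f)"
    by (intro tensor_induct_aux[where B = "\<lambda>_. True" and S = "carrier T" and Q = Q])
       (use f pure add smult cls_closed in auto)
  then show ?thesis using f by simp
qed

lemma tpow_induct [consumes 1, case_names pure add smult]:
  assumes x: "x \<in> TP n"
    and pure: "\<And>w. w \<in> L \<Longrightarrow> length w = n \<Longrightarrow> Q (P w)"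
    and add: "\<And>x y. x \<in> TP n \<Longrightarrow> y \<in> TP n \<Longrightarrow> Q x \<Longrightarrow> Q y \<Longrightarrow> Q (x \<oplus>\<^bsub>T\<^esub> y)"
    and smult: "\<And>a x. a \<in> carrier K \<Longrightarrow> x \<in> TP n \<Longrightarrow> Q x \<Longrightarrow> Q (a \<odot>\<^bsub>T\<^esub> x)"
  shows "Q x"
proof -
  obtain f where f: "f \<in> carrier F" "x = cls f" "\<And>w. f w \<noteq> \<zero> \<Longrightarrow> length w = n"
    using x unfolding tpow_carrier by blast
  have w: "replicate n \<zero>\<^bsub>V\<^esub> \<in> L" by (induction n) auto
  have "Q (\<zero> \<odot>\<^bsub>T\<^esub> P (replicate n \<zero>\<^bsub>V\<^esub>))" using w by (intro smult pure pure_tpow) auto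
  then have "Q \<zero>\<^bsub>T\<^esub>" using w by simp
  then have "Q (cls f)"
    by (intro tensor_induct_aux[where B = "\<lambda>w. length w = n" and S = "TP n" and Q = Q])
       (use f pure add smult in \<open>auto simp: tpow_carrier\<close>)
  then show ?thesis using f by simp
qed

lemma tpow_mult: "x \<in> TP m \<Longrightarrow> y \<in> TP n \<Longrightarrow> x \<otimes>\<^bsub>T\<^esub> y \<in> TP (m + n)"
proof (induction x rule: tpow_induct)
  case (pure u)
  from pure(3) show ?case
  proof (induction y rule: tpow_induct)
    case (pure w)
    then show ?case using \<open>u \<in> L\<close> \<open>length u = m\<close> by (auto simp flip: pure_append intro!: pure_tpow)
  next
    case (add x y)
    then show ?case using \<open>u \<in> L\<close> by (simp add: T.r_distr tpow_T tpow_add)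
  next
    case (smult a x)
    then show ?case using \<open>u \<in> L\<close> by (simp add: TA.smult_mult_right tpow_T tpow_smult)
  qed
qed (simp_all add: T.l_distr TA.smult_mult_left tpow_T tpow_add tpow_smult)

lemma T_eqI:
  assumes "f \<in> lin_hom K T N" "g \<in> lin_hom K T N" "\<And>w. w \<in> L \<Longrightarrow> f (P w) = g (P w)" "x \<in> carrier T"
  shows "f x = g x"
  using assms(4) by (induction x rule: T_induct)
    (simp_all add: assms(3) lin_hom_add[OF assms(1)] lin_hom_add[OF assms(2)]
      lin_hom_smult[OF assms(1)] lin_hom_smult[OF assms(2)])

lemma tpow_eqI:
  assumes f: "f \<in> lin_hom K (tpow K V n) N" and g: "g \<in> lin_hom K (tpow K V n) N"
    and eq: "\<And>w. w \<in> L \<Longrightarrow> length w = n \<Longrightarrow> f (P w) = g (P w)" and x: "x \<in> TP n"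
  shows "f x = g x"
  using x
proof (induction x rule: tpow_induct)
  case (add x y)
  then show ?case using lin_hom_add[OF f, of x y] lin_hom_add[OF g, of x y] by simp
next
  case (smult a x)
  then show ?case using lin_hom_smult[OF f, of a x] lin_hom_smult[OF g, of a x] by simp
qed (simp add: eq)

lemma tpow_eqI_mult:
  assumes f: "f \<in> lin_hom K (tpow K V (p + q)) N" and g: "g \<in> lin_hom K (tpow K V (p + q)) N"
    and eq: "\<And>x y. x \<in> TP p \<Longrightarrow> y \<in> TP q \<Longrightarrow> f (x \<otimes>\<^bsub>T\<^esub> y) = g (x \<otimes>\<^bsub>T\<^esub> y)" and z: "z \<in> TP (p + q)"
  shows "f z = g z"
proof (rule tpow_eqI[OF f g _ z])
  fix w assume w: "w \<in> L" "length w = p + q"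
  have tk: "take p w \<in> L" "drop p w \<in> L"
    using w by (auto dest: in_set_takeD in_set_dropD)
  have "P w = P (take p w) \<otimes>\<^bsub>T\<^esub> P (drop p w)" using tk by (simp flip: pure_append)
  then show "f (P w) = g (P w)" using w tk by (simp add: eq pure_tpow)
qed

lemma lin_hom_T_tpow: "f \<in> lin_hom K T N \<Longrightarrow> f \<in> lin_hom K (tpow K V n) N"
  by (subst tpow_eq) (auto intro!: lin_hom_domain simp: tpow_T)

lemma lin_hom_tpow_T: "f \<in> lin_hom K M (tpow K V n) \<Longrightarrow> f \<in> lin_hom K M T"
  by (auto simp: lin_hom_def Pi_def tpow_T)

lemma lin_hom_into_tpow:
  "f \<in> lin_hom K M T \<Longrightarrow> (\<And>x. x \<in> carrier M \<Longrightarrow> f x \<in> TP n) \<Longrightarrow> f \<in> lin_hom K M (tpow K V n)"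
  by (auto simp: lin_hom_def)

subsection \<open>The universal property\<close>

definition flift :: "('a, 'w, 'p) module_scheme \<Rightarrow> ('c list \<Rightarrow> 'w) \<Rightarrow> ('c list \<Rightarrow> 'a) \<Rightarrow> 'w" where
  "flift N \<phi> f = finsum N (\<lambda>w. f w \<odot>\<^bsub>N\<^esub> \<phi> w) {w. f w \<noteq> \<zero>}"

context
  fixes N :: "('a, 'w, 'p) module_scheme" and \<phi>
  assumes N: "module K N" and \<phi>: "multilinear K V N \<phi>"
begin

interpretation N: module K N by (rule N)

lemma \<phi>_closed [simp]: "w \<in> L \<Longrightarrow> \<phi> w \<in> carrier N"
  by (rule multilinearD(1)[OF \<phi>])

lemma flift_superset:
  assumes f: "f \<in> carrier F" and W: "finite W" "W \<subseteq> L" "{w. f w \<noteq> \<zero>} \<subseteq> W"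
  shows "flift N \<phi> f = finsum N (\<lambda>w. f w \<odot>\<^bsub>N\<^esub> \<phi> w) W"
  unfolding flift_def
  by (rule N.add.finprod_mono_neutral_cong_left) (use W F_mem[OF f] in \<open>auto simp: subset_iff\<close>)

lemma flift_lin: "flift N \<phi> \<in> lin_hom K F N"
proof (rule lin_homI)
  fix f assume f: "f \<in> carrier F"
  show "flift N \<phi> f \<in> carrier N"
    unfolding flift_def using F_mem(1,3)[OF f] by (intro N.finsum_closed) (auto simp: Pi_def)
  fix g assume g: "g \<in> carrier F"
  let ?W = "{w. f w \<noteq> \<zero>} \<union> {w. g w \<noteq> \<zero>}"
  have W: "finite ?W" "?W \<subseteq> L" using F_mem[OF f] F_mem[OF g] by blast+
  have [simp]: "f w \<noteq> \<zero> \<Longrightarrow> \<phi> w \<in> carrier N" "g w \<noteq> \<zero> \<Longrightarrow> \<phi> w \<in> carrier N" for w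
    using F_mem(3)[OF f] F_mem(3)[OF g] \<phi>_closed by blast+
  have "flift N \<phi> (f \<oplus>\<^bsub>F\<^esub> g) = finsum N (\<lambda>w. (f \<oplus>\<^bsub>F\<^esub> g) w \<odot>\<^bsub>N\<^esub> \<phi> w) ?W"
    using f g W by (intro flift_superset F.a_closed) (auto simp: F_simps F_mem)
  also have "\<dots> = finsum N (\<lambda>w. f w \<odot>\<^bsub>N\<^esub> \<phi> w \<oplus>\<^bsub>N\<^esub> g w \<odot>\<^bsub>N\<^esub> \<phi> w) ?W"
    using W F_mem(1)[OF f] F_mem(1)[OF g]
    by (intro N.finsum_cong') (auto simp: F_simps N.smult_l_distr)
  also have "\<dots> = finsum N (\<lambda>w. f w \<odot>\<^bsub>N\<^esub> \<phi> w) ?W \<oplus>\<^bsub>N\<^esub> finsum N (\<lambda>w. g w \<odot>\<^bsub>N\<^esub> \<phi> w) ?W"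
    using W F_mem(1)[OF f] F_mem(1)[OF g] by (intro N.finsum_addf) auto
  also have "\<dots> = flift N \<phi> f \<oplus>\<^bsub>N\<^esub> flift N \<phi> g"
    using flift_superset[OF f W] flift_superset[OF g W] by simp
  finally show "flift N \<phi> (f \<oplus>\<^bsub>F\<^esub> g) = flift N \<phi> f \<oplus>\<^bsub>N\<^esub> flift N \<phi> g" .
next
  fix a f assume a: "a \<in> carrier K" and f: "f \<in> carrier F"
  let ?W = "{w. f w \<noteq> \<zero>}"
  have W: "finite ?W" "?W \<subseteq> L" using F_mem[OF f] by auto
  have [simp]: "f w \<noteq> \<zero> \<Longrightarrow> \<phi> w \<in> carrier N" for w
    using F_mem(3)[OF f] \<phi>_closed by blast
  have "flift N \<phi> (a \<odot>\<^bsub>F\<^esub> f) = finsum N (\<lambda>w. (a \<odot>\<^bsub>F\<^esub> f) w \<odot>\<^bsub>N\<^esub> \<phi> w) ?W"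
    using f a W by (intro flift_superset FA.smult_closed) (auto simp: F_simps)
  also have "\<dots> = finsum N (\<lambda>w. a \<odot>\<^bsub>N\<^esub> (f w \<odot>\<^bsub>N\<^esub> \<phi> w)) ?W"
    using W F_mem(1)[OF f] a
    by (intro N.finsum_cong') (auto simp: F_simps N.smult_assoc1)
  also have "\<dots> = a \<odot>\<^bsub>N\<^esub> flift N \<phi> f"
    unfolding flift_def using W F_mem(1)[OF f] a by (intro N.finsum_smult_ldistr[symmetric]) auto
  finally show "flift N \<phi> (a \<odot>\<^bsub>F\<^esub> f) = a \<odot>\<^bsub>N\<^esub> flift N \<phi> f" .
qed

lemma flift_word: "w \<in> L \<Longrightarrow> flift N \<phi> (free_word K w) = \<phi> w"
proof -
  assume w: "w \<in> L"
  have "{v. free_word K w v \<noteq> \<zero>} = {w}" by (auto simp: free_word_def)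
  then show ?thesis using w by (simp add: flift_def) (simp add: free_word_def)
qed

text \<open>The elements of the free algebra all of whose two-sided multiples are killed by the lift form an
  ideal, and multilinearity says that it contains the defining relations.\<close>

lemma flift_ideal:
  assumes "r \<in> I" shows "flift N \<phi> r = \<zero>\<^bsub>N\<^esub>"
proof -
  note lin = flift_lin
  note lz = lin_hom_zero[OF lin F_module N]
  define J where "J = {r \<in> carrier F. \<forall>g\<in>carrier F. \<forall>h\<in>carrier F. flift N \<phi> (g \<otimes>\<^bsub>F\<^esub> r \<otimes>\<^bsub>F\<^esub> h) = \<zero>\<^bsub>N\<^esub>}"
  have sub: "submodule J K F"
  proof (rule FA.submoduleI')
    show "J \<subseteq> carrier F" "\<zero>\<^bsub>F\<^esub> \<in> J" by (auto simp: J_def lz)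
    show "x \<oplus>\<^bsub>F\<^esub> y \<in> J" if "x \<in> J" "y \<in> J" for x y
      using that by (auto simp: J_def F.r_distr F.l_distr lin_hom_add[OF lin])
    show "a \<odot>\<^bsub>F\<^esub> y \<in> J" if "a \<in> carrier K" "y \<in> J" for a y
      using that by (auto simp: J_def FA.smult_mult_right FA.smult_mult_left lin_hom_smult[OF lin])
  qed
  have "ideal J F"
  proof (rule idealI[OF F_ring])
    show "subgroup J (add_monoid F)" using sub by (rule submodule.axioms)
    show "x \<otimes>\<^bsub>F\<^esub> a \<in> J" if "a \<in> J" "x \<in> carrier F" for a x
      using that by (auto simp: J_def simp flip: F.m_assoc)
    show "a \<otimes>\<^bsub>F\<^esub> x \<in> J" if "a \<in> J" "x \<in> carrier F" for a x
    proof -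
      have "g \<otimes>\<^bsub>F\<^esub> (a \<otimes>\<^bsub>F\<^esub> x) \<otimes>\<^bsub>F\<^esub> h = g \<otimes>\<^bsub>F\<^esub> a \<otimes>\<^bsub>F\<^esub> (x \<otimes>\<^bsub>F\<^esub> h)"
        if "g \<in> carrier F" "h \<in> carrier F" for g h
        using that \<open>a \<in> J\<close> \<open>x \<in> carrier F\<close> by (simp add: J_def F.m_assoc)
      then show ?thesis using that by (auto simp: J_def)
    qed
  qed
  moreover have "rels \<subseteq> J"
  proof
    fix r assume r: "r \<in> rels"
    then have rF: "r \<in> carrier F" using rels_sub by blast
    \<comment> \<open>By linearity it suffices to multiply a relation by words on both sides.\<close>
    have ww: "flift N \<phi> (free_word K u \<otimes>\<^bsub>F\<^esub> r \<otimes>\<^bsub>F\<^esub> free_word K v) = \<zero>\<^bsub>N\<^esub>" if uv: "u \<in> L" "v \<in> L" for u v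
    proof -
      note lm = lin_hom_minus[OF lin F_module N]
      consider x y where "x \<in> carrier V" "y \<in> carrier V"
        "r = free_word K [x \<oplus>\<^bsub>V\<^esub> y] \<ominus>\<^bsub>F\<^esub> (free_word K [x] \<oplus>\<^bsub>F\<^esub> free_word K [y])"
        | a x where "a \<in> carrier K" "x \<in> carrier V" "r = free_word K [a \<odot>\<^bsub>V\<^esub> x] \<ominus>\<^bsub>F\<^esub> (a \<odot>\<^bsub>F\<^esub> free_word K [x])"
        using r unfolding rels_def by blast
      then show ?thesis
      proof cases
        case 1
        have "free_word K u \<otimes>\<^bsub>F\<^esub> r \<otimes>\<^bsub>F\<^esub> free_word K v =
          free_word K (u @ (x \<oplus>\<^bsub>V\<^esub> y) # v) \<ominus>\<^bsub>F\<^esub> (free_word K (u @ x # v) \<oplus>\<^bsub>F\<^esub> free_word K (u @ y # v))"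
          using 1 uv by (simp add: F.minus_eq F.r_distr F.l_distr word_closed F.r_minus F.l_minus word_mult)
        then show ?thesis using 1 uv
          by (simp add: lm lin_hom_add[OF lin] word_closed flift_word multilinearD(2)[OF \<phi>] N.minus_eq N.r_neg)
      next
        case 2
        have "free_word K u \<otimes>\<^bsub>F\<^esub> r \<otimes>\<^bsub>F\<^esub> free_word K v =
          free_word K (u @ (a \<odot>\<^bsub>V\<^esub> x) # v) \<ominus>\<^bsub>F\<^esub> (a \<odot>\<^bsub>F\<^esub> free_word K (u @ x # v))"
          using 2 uv by (simp add: F.minus_eq F.r_distr F.l_distr word_closed F.r_minus F.l_minus word_mult
              FA.smult_mult_left FA.smult_mult_right)
        then show ?thesis using 2 uv
          by (simp add: lm lin_hom_smult[OF lin] word_closed flift_word multilinearD(3)[OF \<phi>] N.minus_eq N.r_neg)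
      qed
    qed
    have wh: "flift N \<phi> (free_word K u \<otimes>\<^bsub>F\<^esub> r \<otimes>\<^bsub>F\<^esub> h) = \<zero>\<^bsub>N\<^esub>" if u: "u \<in> L" and h: "h \<in> carrier F" for u h
      using h TrueI
    proof (rule F_induct_on[where P = "\<lambda>_. True"])
      fix a w g assume *: "a \<in> carrier K" "w \<in> L" "g \<in> carrier F" "flift N \<phi> (free_word K u \<otimes>\<^bsub>F\<^esub> r \<otimes>\<^bsub>F\<^esub> g) = \<zero>\<^bsub>N\<^esub>"
      then show "flift N \<phi> (free_word K u \<otimes>\<^bsub>F\<^esub> r \<otimes>\<^bsub>F\<^esub> ((a \<odot>\<^bsub>F\<^esub> free_word K w) \<oplus>\<^bsub>F\<^esub> g)) = \<zero>\<^bsub>N\<^esub>"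
        using u rF by (simp add: F.r_distr FA.smult_mult_right word_closed lin_hom_add[OF lin] lin_hom_smult[OF lin] ww)
    qed (use u rF in \<open>simp add: lz word_closed\<close>)
    have "flift N \<phi> (g \<otimes>\<^bsub>F\<^esub> r \<otimes>\<^bsub>F\<^esub> h) = \<zero>\<^bsub>N\<^esub>" if g: "g \<in> carrier F" and h: "h \<in> carrier F" for g h
      using g TrueI
    proof (rule F_induct_on[where P = "\<lambda>_. True"])
      fix a w g assume *: "a \<in> carrier K" "w \<in> L" "g \<in> carrier F" "flift N \<phi> (g \<otimes>\<^bsub>F\<^esub> r \<otimes>\<^bsub>F\<^esub> h) = \<zero>\<^bsub>N\<^esub>"
      then show "flift N \<phi> (((a \<odot>\<^bsub>F\<^esub> free_word K w) \<oplus>\<^bsub>F\<^esub> g) \<otimes>\<^bsub>F\<^esub> r \<otimes>\<^bsub>F\<^esub> h) = \<zero>\<^bsub>N\<^esub>"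
        using h rF by (simp add: F.l_distr FA.smult_mult_left word_closed lin_hom_add[OF lin] lin_hom_smult[OF lin] wh)
    qed (use h rF in \<open>simp add: lz word_closed\<close>)
    then show "r \<in> J" using rF by (auto simp: J_def)
  qed
  ultimately have "I \<subseteq> J" unfolding I_def by (rule F.genideal_minimal)
  then have "flift N \<phi> (\<one>\<^bsub>F\<^esub> \<otimes>\<^bsub>F\<^esub> r \<otimes>\<^bsub>F\<^esub> \<one>\<^bsub>F\<^esub>) = \<zero>\<^bsub>N\<^esub>"
    using assms unfolding J_def by blast
  moreover have "r \<in> carrier F" using \<open>I \<subseteq> J\<close> assms by (auto simp: J_def)
  ultimately show ?thesis by simp
qed

text \<open>The lift to the free algebra is constant on the cosets of the relation ideal, so it may be
  evaluated on any representative.\<close>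

theorem tensor_lift: "\<exists>h\<in>lin_hom K T N. \<forall>w\<in>L. h (P w) = \<phi> w"
proof -
  define h where "h x = flift N \<phi> (SOME f. f \<in> carrier F \<and> cls f = x)" for x
  have h: "h (cls f) = flift N \<phi> f" if f: "f \<in> carrier F" for f
  proof -
    let ?g = "SOME g. g \<in> carrier F \<and> cls g = cls f"
    have g: "?g \<in> carrier F \<and> cls ?g = cls f"
      by (rule someI[of "\<lambda>g. g \<in> carrier F \<and> cls g = cls f" f]) (simp add: f)
    then have "?g \<ominus>\<^bsub>F\<^esub> f \<in> I"
      using F.quotient_eq_iff_same_a_r_cos[OF I_ideal] f unfolding cls_def by blast
    then have "flift N \<phi> (?g \<ominus>\<^bsub>F\<^esub> f) = \<zero>\<^bsub>N\<^esub>" by (rule flift_ideal)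
    then have "flift N \<phi> ?g \<ominus>\<^bsub>N\<^esub> flift N \<phi> f = \<zero>\<^bsub>N\<^esub>"
      using g f by (simp add: lin_hom_minus[OF flift_lin F_module N])
    moreover have "flift N \<phi> ?g \<in> carrier N" "flift N \<phi> f \<in> carrier N"
      using g f lin_hom_closed[OF flift_lin] by blast+
    ultimately show ?thesis unfolding h_def by (rule N.minus_zero_eq)
  qed
  have "h \<in> lin_hom K T N"
    by (rule lin_homI)
       (auto elim!: T_cases simp: h T_simps(4-) lin_hom_closed[OF flift_lin]
          lin_hom_add[OF flift_lin] lin_hom_smult[OF flift_lin])
  moreover have "\<forall>w\<in>L. h (P w) = \<phi> w" by (simp add: pure_cls h word_closed flift_word)
  ultimately show ?thesis by blast
qed

end

definition tlift :: "('a, 'w, 'p) module_scheme \<Rightarrow> ('c list \<Rightarrow> 'w) \<Rightarrow> ('a, 'c) tensor \<Rightarrow> 'w" where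
  "tlift N \<phi> = (SOME h. h \<in> lin_hom K T N \<and> (\<forall>w\<in>L. h (P w) = \<phi> w))"

lemma tlift:
  assumes "module K N" "multilinear K V N \<phi>"
  shows "tlift N \<phi> \<in> lin_hom K T N" "w \<in> L \<Longrightarrow> tlift N \<phi> (P w) = \<phi> w"
proof -
  have "\<exists>h. h \<in> lin_hom K T N \<and> (\<forall>w\<in>L. h (P w) = \<phi> w)"
    using tensor_lift[OF assms] by blast
  from someI_ex[OF this] show "tlift N \<phi> \<in> lin_hom K T N" "w \<in> L \<Longrightarrow> tlift N \<phi> (P w) = \<phi> w"
    unfolding tlift_def by blast+
qed

end

sublocale assoc_algebra \<subseteq> vec K A ..


section \<open>Maps out of tensor powers\<close>

text \<open>All maps introduced by a definite description are of this form: linear, normalised outside the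
  carrier, and pinned down by a property \<open>R\<close>. To identify such a map it suffices to exhibit one
  linear map with the property and to see that every other one agrees with it on the carrier.\<close>

lemma the_lin_hom:
  assumes h0: "h0 \<in> lin_hom K M N" "module K M" and R: "R (restrict h0 (carrier M))"
    and u: "\<And>h x. h \<in> lin_hom K M N \<Longrightarrow> R h \<Longrightarrow> x \<in> carrier M \<Longrightarrow> h x = h0 x"
  shows "(THE h. h \<in> extensional (carrier M) \<and> h \<in> lin_hom K M N \<and> R h) = restrict h0 (carrier M)"
proof (rule the_equality)
  show "restrict h0 (carrier M) \<in> extensional (carrier M) \<and> restrict h0 (carrier M) \<in> lin_hom K M N \<and>
    R (restrict h0 (carrier M))"
    using R lin_hom_restrict[OF h0] by simp
  show "h = restrict h0 (carrier M)" if "h \<in> extensional (carrier M) \<and> h \<in> lin_hom K M N \<and> R h" for h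
    using that u by (auto intro!: extensionalityI[of _ "carrier M"])
qed

lemma module_span_submodule:
  assumes "module K M" "S \<subseteq> carrier M" shows "submodule (module_span K M S) K M"
proof -
  interpret M: module K M by fact
  have c: "submodule (carrier M) K M" by (rule M.carrier_is_submodule)
  show ?thesis unfolding module_span_def
  proof (rule M.submoduleI')
    show "\<Inter> {H. submodule H K M \<and> S \<subseteq> H} \<subseteq> carrier M" using c assms by blast
    show "\<zero>\<^bsub>M\<^esub> \<in> \<Inter> {H. submodule H K M \<and> S \<subseteq> H}"
      by (auto simp: submodule_def dest!: subgroup.one_closed)
    show "a \<oplus>\<^bsub>M\<^esub> b \<in> \<Inter> {H. submodule H K M \<and> S \<subseteq> H}"
      if "a \<in> \<Inter> {H. submodule H K M \<and> S \<subseteq> H}" "b \<in> \<Inter> {H. submodule H K M \<and> S \<subseteq> H}" for a b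
      using that M.submoduleE(5) by blast
    show "a \<odot>\<^bsub>M\<^esub> b \<in> \<Inter> {H. submodule H K M \<and> S \<subseteq> H}"
      if "a \<in> carrier K" "b \<in> \<Inter> {H. submodule H K M \<and> S \<subseteq> H}" for a b
      using that M.submoduleE(4) by blast
  qed
qed

lemma module_span_subset: "S \<subseteq> module_span K M S"
  by (auto simp: module_span_def)

lemma module_span_minimal: "submodule H K M \<Longrightarrow> S \<subseteq> H \<Longrightarrow> module_span K M S \<subseteq> H"
  by (auto simp: module_span_def)

lemma module_span_induct [consumes 3, case_names base zero add smult]:
  assumes x: "x \<in> module_span K M S" and M: "module K M" "S \<subseteq> carrier M"
    and base: "\<And>x. x \<in> S \<Longrightarrow> Q x" and zero: "Q \<zero>\<^bsub>M\<^esub>"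
    and add: "\<And>x y. x \<in> module_span K M S \<Longrightarrow> y \<in> module_span K M S \<Longrightarrow> Q x \<Longrightarrow> Q y \<Longrightarrow> Q (x \<oplus>\<^bsub>M\<^esub> y)"
    and smult: "\<And>a x. a \<in> carrier K \<Longrightarrow> x \<in> module_span K M S \<Longrightarrow> Q x \<Longrightarrow> Q (a \<odot>\<^bsub>M\<^esub> x)"
  shows "Q x"
proof -
  interpret M: module K M by fact
  let ?S = "module_span K M S"
  note sm = M.submoduleE[OF module_span_submodule[OF M]]
  have "submodule {x \<in> ?S. Q x} K M"
  proof (rule M.submoduleI')
    show "\<zero>\<^bsub>M\<^esub> \<in> {x \<in> ?S. Q x}"
      using zero submodule.axioms(1)[OF module_span_submodule[OF M]] by (auto dest: subgroup.one_closed)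
  qed (use sm add smult in auto)
  moreover have "S \<subseteq> {x \<in> ?S. Q x}" using base module_span_subset[of S K M] by auto
  ultimately have "?S \<subseteq> {x \<in> ?S. Q x}" by (rule module_span_minimal)
  then show ?thesis using x by blast
qed

context vec
begin

interpretation T: assoc_algebra K T by (rule T_algebra)

lemma take_L: "w \<in> L \<Longrightarrow> take n w \<in> L" and drop_L: "w \<in> L \<Longrightarrow> drop n w \<in> L"
  by (auto dest: in_set_takeD in_set_dropD)

lemma multilinear_graded:
  assumes "\<And>n. f n \<in> lin_hom K (tpow K V n) N"
  shows "multilinear K V N (\<lambda>w. f (length w) (P w))"
proof (rule multilinearI)
  show "f (length w) (P w) \<in> carrier N" if "w \<in> L" for w
    using lin_hom_closed[OF assms pure_tpow[OF that refl]] .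
next
  fix u w x y assume *: "u \<in> L" "w \<in> L" "x \<in> carrier V" "y \<in> carrier V"
  show "f (length (u @ (x \<oplus>\<^bsub>V\<^esub> y) # w)) (P (u @ (x \<oplus>\<^bsub>V\<^esub> y) # w)) =
    f (length (u @ x # w)) (P (u @ x # w)) \<oplus>\<^bsub>N\<^esub> f (length (u @ y # w)) (P (u @ y # w))"
    using lin_hom_add[OF assms, of "P (u @ x # w)" "length (u @ x # w)" "P (u @ y # w)"] *
    by (simp add: multilinearD(2)[OF pure_multilinear] pure_tpow)
next
  fix u w a x assume *: "u \<in> L" "w \<in> L" "a \<in> carrier K" "x \<in> carrier V"
  show "f (length (u @ (a \<odot>\<^bsub>V\<^esub> x) # w)) (P (u @ (a \<odot>\<^bsub>V\<^esub> x) # w)) =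
    a \<odot>\<^bsub>N\<^esub> f (length (u @ x # w)) (P (u @ x # w))"
    using lin_hom_smult[OF assms, of a "P (u @ x # w)" "length (u @ x # w)"] *
    by (simp add: multilinearD(3)[OF pure_multilinear] pure_tpow)
qed

text \<open>Multilinearity only compares words of equal length, so linear maps given separately in each
  degree glue.\<close>

lemma graded_lift:
  assumes N: "module K N" and f: "\<And>n. f n \<in> lin_hom K (tpow K V n) N"
  shows "\<exists>h\<in>lin_hom K T N. \<forall>n. \<forall>x\<in>TP n. h x = f n x"
proof -
  obtain h where h: "h \<in> lin_hom K T N" "\<forall>w\<in>L. h (P w) = f (length w) (P w)"
    using tensor_lift[OF N multilinear_graded[OF f]] by blast
  have "h x = f n x" if "x \<in> TP n" for n x
    by (rule tpow_eqI[OF lin_hom_T_tpow[OF h(1)] f _ that]) (use h in auto)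
  then show ?thesis using h by blast
qed

text \<open>Extending a bilinear map by zero to words of length other than two keeps it multilinear.\<close>

lemma bilinear_lift:
  assumes N: "module K N"
    and cl: "\<And>x y. x \<in> carrier V \<Longrightarrow> y \<in> carrier V \<Longrightarrow> \<beta> x y \<in> carrier N"
    and add: "\<And>x y z. x \<in> carrier V \<Longrightarrow> y \<in> carrier V \<Longrightarrow> z \<in> carrier V \<Longrightarrow> \<beta> (x \<oplus>\<^bsub>V\<^esub> y) z = \<beta> x z \<oplus>\<^bsub>N\<^esub> \<beta> y z"
      "\<And>x y z. x \<in> carrier V \<Longrightarrow> y \<in> carrier V \<Longrightarrow> z \<in> carrier V \<Longrightarrow> \<beta> z (x \<oplus>\<^bsub>V\<^esub> y) = \<beta> z x \<oplus>\<^bsub>N\<^esub> \<beta> z y"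
    and sm: "\<And>a x z. a \<in> carrier K \<Longrightarrow> x \<in> carrier V \<Longrightarrow> z \<in> carrier V \<Longrightarrow> \<beta> (a \<odot>\<^bsub>V\<^esub> x) z = a \<odot>\<^bsub>N\<^esub> \<beta> x z"
      "\<And>a x z. a \<in> carrier K \<Longrightarrow> x \<in> carrier V \<Longrightarrow> z \<in> carrier V \<Longrightarrow> \<beta> z (a \<odot>\<^bsub>V\<^esub> x) = a \<odot>\<^bsub>N\<^esub> \<beta> z x"
  shows "\<exists>h\<in>lin_hom K T N. \<forall>x\<in>carrier V. \<forall>y\<in>carrier V. h (P [x, y]) = \<beta> x y"
proof -
  interpret N: module K N by fact
  let ?\<phi> = "\<lambda>w. if length w = 2 then \<beta> (w ! 0) (w ! 1) else \<zero>\<^bsub>N\<^esub>"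
  have two: "(u = [] \<and> (\<exists>z. w = [z])) \<or> (w = [] \<and> (\<exists>z. u = [z]))" if "length (u @ x # w) = 2" for u w :: "'c list" and x
    using that by (cases u; cases w) auto
  have "multilinear K V N ?\<phi>"
  proof (rule multilinearI)
    fix w assume "w \<in> L"
    moreover have "w ! i \<in> carrier V" if "i < length w" for i using that \<open>w \<in> L\<close> by (auto simp: in_lists_conv_set)
    ultimately show "?\<phi> w \<in> carrier N" by (auto intro!: cl)
  next
    fix u w x y assume *: "u \<in> L" "w \<in> L" "x \<in> carrier V" "y \<in> carrier V"
    show "?\<phi> (u @ (x \<oplus>\<^bsub>V\<^esub> y) # w) = ?\<phi> (u @ x # w) \<oplus>\<^bsub>N\<^esub> ?\<phi> (u @ y # w)"
    proof (cases "length (u @ x # w) = 2")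
      case True
      then show ?thesis using two[OF True] * by (auto simp: add)
    qed simp
  next
    fix u w a x assume *: "u \<in> L" "w \<in> L" "a \<in> carrier K" "x \<in> carrier V"
    show "?\<phi> (u @ (a \<odot>\<^bsub>V\<^esub> x) # w) = a \<odot>\<^bsub>N\<^esub> ?\<phi> (u @ x # w)"
    proof (cases "length (u @ x # w) = 2")
      case True
      then show ?thesis using two[OF True] * by (auto simp: sm)
    qed (use * in simp)
  qed
  from tensor_lift[OF N this] obtain h where h: "h \<in> lin_hom K T N" "\<forall>w\<in>L. h (P w) = ?\<phi> w" by blast
  then have "h (P [x, y]) = \<beta> x y" if "x \<in> carrier V" "y \<in> carrier V" for x y
    using that by simp
  then show ?thesis using h by blast
qed

text \<open>Cutting a word after \<open>p\<close> letters, applying \<open>f\<close> and \<open>g\<close> to the two pieces and multiplying the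
  results is multilinear. For \<open>B = T(V)\<close> this gives the maps \<open>f \<otimes> g\<close> between tensor powers.\<close>

lemma product_lift:
  assumes B: "assoc_algebra K B"
    and f: "f \<in> lin_hom K (tpow K V p) B" and g: "g \<in> lin_hom K (tpow K V q) B"
  shows "\<exists>h\<in>lin_hom K T B. \<forall>x\<in>TP p. \<forall>y\<in>TP q. h (x \<otimes>\<^bsub>T\<^esub> y) = f x \<otimes>\<^bsub>B\<^esub> g y"
proof -
  interpret B: assoc_algebra K B by fact
  let ?\<phi> = "\<lambda>w. if length w = p + q then f (P (take p w)) \<otimes>\<^bsub>B\<^esub> g (P (drop p w)) else \<zero>\<^bsub>B\<^esub>"
  have fc: "f (P w) \<in> carrier B" if "w \<in> L" "length w = p" for w
    using lin_hom_closed[OF f pure_tpow[OF that]] .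
  have gc: "g (P w) \<in> carrier B" if "w \<in> L" "length w = q" for w
    using lin_hom_closed[OF g pure_tpow[OF that]] .
  have fa: "f (P (u @ (x \<oplus>\<^bsub>V\<^esub> y) # w)) = f (P (u @ x # w)) \<oplus>\<^bsub>B\<^esub> f (P (u @ y # w))"
    if "u \<in> L" "w \<in> L" "x \<in> carrier V" "y \<in> carrier V" "Suc (length u + length w) = p" for u w x y
    using lin_hom_add[OF f, of "P (u @ x # w)" "P (u @ y # w)"] that
    by (simp add: multilinearD(2)[OF pure_multilinear] pure_tpow)
  have ga: "g (P (u @ (x \<oplus>\<^bsub>V\<^esub> y) # w)) = g (P (u @ x # w)) \<oplus>\<^bsub>B\<^esub> g (P (u @ y # w))"
    if "u \<in> L" "w \<in> L" "x \<in> carrier V" "y \<in> carrier V" "Suc (length u + length w) = q" for u w x y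
    using lin_hom_add[OF g, of "P (u @ x # w)" "P (u @ y # w)"] that
    by (simp add: multilinearD(2)[OF pure_multilinear] pure_tpow)
  have fs: "f (P (u @ (a \<odot>\<^bsub>V\<^esub> x) # w)) = a \<odot>\<^bsub>B\<^esub> f (P (u @ x # w))"
    if "u \<in> L" "w \<in> L" "x \<in> carrier V" "a \<in> carrier K" "Suc (length u + length w) = p" for u w x a
    using lin_hom_smult[OF f, of a "P (u @ x # w)"] that
    by (simp add: multilinearD(3)[OF pure_multilinear] pure_tpow)
  have gs: "g (P (u @ (a \<odot>\<^bsub>V\<^esub> x) # w)) = a \<odot>\<^bsub>B\<^esub> g (P (u @ x # w))"
    if "u \<in> L" "w \<in> L" "x \<in> carrier V" "a \<in> carrier K" "Suc (length u + length w) = q" for u w x a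
    using lin_hom_smult[OF g, of a "P (u @ x # w)"] that
    by (simp add: multilinearD(3)[OF pure_multilinear] pure_tpow)
  have m: "multilinear K V B ?\<phi>"
  proof (rule multilinearI)
    show "?\<phi> w \<in> carrier B" if "w \<in> L" for w
      using that by (auto intro!: fc gc take_L drop_L)
  next
    fix u w x y assume *: "u \<in> L" "w \<in> L" "x \<in> carrier V" "y \<in> carrier V"
    show "?\<phi> (u @ (x \<oplus>\<^bsub>V\<^esub> y) # w) = ?\<phi> (u @ x # w) \<oplus>\<^bsub>B\<^esub> ?\<phi> (u @ y # w)"
    proof (cases "length (u @ x # w) = p + q")
      case True
      show ?thesis
      proof (cases "length u < p")
        case lt: True
        then obtain k where k: "p = Suc (length u + k)" using less_imp_Suc_add by blast
        have [simp]: "take k w \<in> L" "drop k w \<in> L" using * take_L drop_L by blast+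
        show ?thesis using True * k by (simp add: fa fc gc B.l_distr)
      next
        case False
        then have [simp]: "take p u \<in> L" "drop p u \<in> L" "length (take p u) = p" using * take_L drop_L by auto
        show ?thesis using True * False by (simp add: ga fc gc B.r_distr)
      qed
    qed simp
  next
    fix u w a x assume *: "u \<in> L" "w \<in> L" "a \<in> carrier K" "x \<in> carrier V"
    show "?\<phi> (u @ (a \<odot>\<^bsub>V\<^esub> x) # w) = a \<odot>\<^bsub>B\<^esub> ?\<phi> (u @ x # w)"
    proof (cases "length (u @ x # w) = p + q")
      case True
      show ?thesis
      proof (cases "length u < p")
        case lt: True
        then obtain k where k: "p = Suc (length u + k)" using less_imp_Suc_add by blast
        have [simp]: "take k w \<in> L" "drop k w \<in> L" using * take_L drop_L by blast+
        show ?thesis using True * k by (simp add: fs fc gc B.smult_mult_left)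
      next
        case False
        then have [simp]: "take p u \<in> L" "drop p u \<in> L" "length (take p u) = p" using * take_L drop_L by auto
        show ?thesis using True * False by (simp add: gs fc gc B.smult_mult_right)
      qed
    qed (use * in simp)
  qed
  obtain h where h: "h \<in> lin_hom K T B" "\<forall>w\<in>L. h (P w) = ?\<phi> w"
    using tensor_lift[OF B.module_axioms m] by blast
  have "h (x \<otimes>\<^bsub>T\<^esub> y) = f x \<otimes>\<^bsub>B\<^esub> g y" if x: "x \<in> TP p" and y: "y \<in> TP q" for x y
    using x
  proof (induction x rule: tpow_induct)
    case (pure u)
    from y show ?case
    proof (induction y rule: tpow_induct)
      case (pure w)
      then show ?case using \<open>u \<in> L\<close> \<open>length u = p\<close> h by (simp flip: pure_append)
    next
      case (add y z)
      then show ?case using pure lin_hom_add[OF g, of y z] lin_hom_closed[OF g]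
        by (simp add: T.r_distr B.r_distr tpow_T lin_hom_add[OF h(1)] fc)
    next
      case (smult a y)
      then show ?case using pure lin_hom_smult[OF g, of a y] lin_hom_closed[OF g]
        by (simp add: T.smult_mult_right B.smult_mult_right tpow_T lin_hom_smult[OF h(1)] fc)
    qed
  next
    case (add x z)
    then show ?case using y lin_hom_add[OF f, of x z] lin_hom_closed[OF f] lin_hom_closed[OF g]
      by (simp add: T.l_distr B.l_distr tpow_T lin_hom_add[OF h(1)])
  next
    case (smult a x)
    then show ?case using y lin_hom_smult[OF f, of a x] lin_hom_closed[OF f] lin_hom_closed[OF g]
      by (simp add: T.smult_mult_left B.smult_mult_left tpow_T lin_hom_smult[OF h(1)])
  qed
  then show ?thesis using h(1) by blast
qed

lemma id_lin: "(\<lambda>x. x) \<in> lin_hom K (tpow K V n) T"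
  by (rule lin_homI) (auto simp: tpow_T)

lemma id_lin_T: "(\<lambda>x. x) \<in> lin_hom K T T"
  by (rule lin_homI) auto

lemma tens:
  assumes f: "f \<in> lin_hom K (tpow K V p) T" and g: "g \<in> lin_hom K (tpow K V q) T"
  shows tens_lin: "tens K V p f q g \<in> lin_hom K (tpow K V (p + q)) T"
    and tens_mult: "\<And>x y. x \<in> TP p \<Longrightarrow> y \<in> TP q \<Longrightarrow> tens K V p f q g (x \<otimes>\<^bsub>T\<^esub> y) = f x \<otimes>\<^bsub>T\<^esub> g y"
    and tens_unique: "\<And>h z. h \<in> lin_hom K (tpow K V (p + q)) T \<Longrightarrow>
      (\<And>x y. x \<in> TP p \<Longrightarrow> y \<in> TP q \<Longrightarrow> h (x \<otimes>\<^bsub>T\<^esub> y) = f x \<otimes>\<^bsub>T\<^esub> g y) \<Longrightarrow>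
      z \<in> TP (p + q) \<Longrightarrow> tens K V p f q g z = h z"
proof -
  obtain h where h: "h \<in> lin_hom K T T" "\<forall>x\<in>TP p. \<forall>y\<in>TP q. h (x \<otimes>\<^bsub>T\<^esub> y) = f x \<otimes>\<^bsub>T\<^esub> g y"
    using product_lift[OF T_algebra f g] by blast
  note hl = lin_hom_T_tpow[OF h(1), of "p + q"]
  have eq: "tens K V p f q g = restrict h (TP (p + q))"
    unfolding tens_def
  proof (rule the_lin_hom[OF hl tpow_module])
    show "\<forall>x\<in>TP p. \<forall>y\<in>TP q. restrict h (TP (p + q)) (x \<otimes>\<^bsub>T\<^esub> y) = f x \<otimes>\<^bsub>T\<^esub> g y"
      using h(2) by (auto simp: tpow_mult)
    show "h' x = h x" if "h' \<in> lin_hom K (tpow K V (p + q)) T"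
      "\<forall>x\<in>TP p. \<forall>y\<in>TP q. h' (x \<otimes>\<^bsub>T\<^esub> y) = f x \<otimes>\<^bsub>T\<^esub> g y" "x \<in> TP (p + q)" for h' x
      by (rule tpow_eqI_mult[OF that(1) hl _ that(3)]) (use that h in auto)
  qed
  show "tens K V p f q g \<in> lin_hom K (tpow K V (p + q)) T"
    unfolding eq by (rule lin_hom_restrict[OF hl tpow_module])
  show "\<And>x y. x \<in> TP p \<Longrightarrow> y \<in> TP q \<Longrightarrow> tens K V p f q g (x \<otimes>\<^bsub>T\<^esub> y) = f x \<otimes>\<^bsub>T\<^esub> g y"
    using h(2) by (simp add: eq tpow_mult)
  fix h' z assume h': "h' \<in> lin_hom K (tpow K V (p + q)) T"
    "\<And>x y. x \<in> TP p \<Longrightarrow> y \<in> TP q \<Longrightarrow> h' (x \<otimes>\<^bsub>T\<^esub> y) = f x \<otimes>\<^bsub>T\<^esub> g y" "z \<in> TP (p + q)"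
  have "h z = h' z"
    by (rule tpow_eqI_mult[OF hl h'(1) _ h'(3)]) (simp add: h'(2) h(2))
  then show "tens K V p f q g z = h' z" using h'(3) by (simp add: eq)
qed

lemma tens_tpow:
  assumes f: "f \<in> lin_hom K (tpow K V p) (tpow K V p')" and g: "g \<in> lin_hom K (tpow K V q) (tpow K V q')"
  shows "tens K V p f q g \<in> lin_hom K (tpow K V (p + q)) (tpow K V (p' + q'))"
proof (rule lin_hom_into_tpow)
  note l = lin_hom_tpow_T[OF f] lin_hom_tpow_T[OF g]
  show lin: "tens K V p f q g \<in> lin_hom K (tpow K V (p + q)) T" by (rule tens_lin[OF l])
  fix z assume "z \<in> TP (p + q)"
  then show "tens K V p f q g z \<in> TP (p' + q')"
  proof (induction z rule: tpow_induct)
    case (pure w)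
    have w: "take p w \<in> L" "drop p w \<in> L" using take_L[OF pure(1)] drop_L[OF pure(1)] by blast+
    have "P w = P (take p w) \<otimes>\<^bsub>T\<^esub> P (drop p w)" using w by (simp flip: pure_append)
    then show ?case using w pure lin_hom_closed[OF f] lin_hom_closed[OF g]
      by (simp add: tens_mult[OF l] pure_tpow tpow_mult)
  next
    case (add x y)
    then show ?case using lin_hom_add[OF lin, of x y] by (simp add: tpow_add)
  next
    case (smult a x)
    then show ?case using lin_hom_smult[OF lin, of a x] by (simp add: tpow_smult)
  qed
qed

subsection \<open>Degree one\<close>

abbreviation "inc \<equiv> incl K V"

lemma incl_tpow: "x \<in> carrier V \<Longrightarrow> inc x \<in> TP 1"
  by (simp add: incl_def pure_tpow)

lemma incl_lin1: "inc \<in> lin_hom K V (tpow K V 1)"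
  by (rule lin_homI) (auto simp: incl_def pure_tpow pure_single_add pure_single_smult)

lemma incl_lin: "inc \<in> lin_hom K V T"
  by (rule lin_hom_tpow_T[OF incl_lin1])

lemma incl_closed [simp]: "x \<in> carrier V \<Longrightarrow> inc x \<in> carrier T"
  by (simp add: incl_def)

lemma pure_Cons_incl: "x \<in> carrier V \<Longrightarrow> w \<in> L \<Longrightarrow> P (x # w) = inc x \<otimes>\<^bsub>T\<^esub> P w"
  unfolding incl_def by (rule pure_Cons)

lemma pure_two: "x \<in> carrier V \<Longrightarrow> y \<in> carrier V \<Longrightarrow> P [x, y] = inc x \<otimes>\<^bsub>T\<^esub> inc y"
  unfolding incl_def by (rule pure_Cons) auto

text \<open>A linear retraction of \<open>T(V)\<close> onto its degree one part; it shows that \<open>V\<close> embeds in \<open>T(V)\<close>.\<close>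

definition pr1 :: "('a, 'c) tensor \<Rightarrow> 'c" where
  "pr1 = tlift V (\<lambda>w. if length w = 1 then hd w else \<zero>\<^bsub>V\<^esub>)"

lemma pr1: "pr1 \<in> lin_hom K T V" "x \<in> carrier V \<Longrightarrow> pr1 (inc x) = x"
proof -
  have m: "multilinear K V V (\<lambda>w. if length w = 1 then hd w else \<zero>\<^bsub>V\<^esub>)"
  proof (rule multilinearI)
    fix w assume "w \<in> L" then show "(if length w = 1 then hd w else \<zero>\<^bsub>V\<^esub>) \<in> carrier V"
      by (cases w) auto
  qed auto
  note t = tlift[OF module_axioms m, folded pr1_def]
  show "pr1 \<in> lin_hom K T V" by (rule t)
  show "x \<in> carrier V \<Longrightarrow> pr1 (inc x) = x" using t(2)[of "[x]"] by (simp add: incl_def)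
qed

lemma incl_inj: "inj_on inc (carrier V)"
  by (rule inj_on_inverseI[of _ pr1]) (rule pr1)

lemma incl_pr1: "x \<in> TP 1 \<Longrightarrow> inc (pr1 x) = x"
proof (induction x rule: tpow_induct)
  case (pure w)
  then obtain v where "w = [v]" "v \<in> carrier V" by (cases w) auto
  then show ?case using pr1(2)[of v] by (simp add: incl_def)
next
  case (add x y)
  then show ?case using lin_hom_closed[OF pr1(1)]
    by (simp add: lin_hom_add[OF pr1(1)] lin_hom_add[OF incl_lin] tpow_T)
next
  case (smult a x)
  then show ?case using lin_hom_closed[OF pr1(1)]
    by (simp add: lin_hom_smult[OF pr1(1)] lin_hom_smult[OF incl_lin] tpow_T)
qed

lemma pr1_closed [simp]: "x \<in> carrier T \<Longrightarrow> pr1 x \<in> carrier V"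
  by (rule lin_hom_closed[OF pr1(1)])

lemma tpow1_cases: "x \<in> TP 1 \<Longrightarrow> (\<And>v. v \<in> carrier V \<Longrightarrow> x = inc v \<Longrightarrow> thesis) \<Longrightarrow> thesis"
  using incl_pr1[of x] by (metis pr1_closed tpow_T)

subsection \<open>The maps of degree two\<close>

text \<open>\<open>f \<otimes> g: V \<otimes> V \<rightarrow> N \<otimes> N\<close>. Only the values in degree two are specified; a domain that is all of
  \<open>T(V)\<close> lets the same map serve for every subspace \<open>S \<otimes> S'\<close> and makes it easy to compose.\<close>

definition tensor_map2 :: "('a, 'w, 'p) module_scheme \<Rightarrow> ('c \<Rightarrow> 'w) \<Rightarrow> ('c \<Rightarrow> 'w) \<Rightarrow> ('a, 'c) tensor \<Rightarrow> ('a, 'w) tensor"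
  where "tensor_map2 N f g = (SOME h. h \<in> lin_hom K T (tensor_algebra K N) \<and>
    (\<forall>x\<in>carrier V. \<forall>y\<in>carrier V. h (P [x, y]) = pure K N [f x, g y]))"

lemma tensor_map2:
  assumes N: "module K N" and f: "f \<in> lin_hom K V N" and g: "g \<in> lin_hom K V N"
  shows "tensor_map2 N f g \<in> lin_hom K T (tensor_algebra K N)"
    and "x \<in> carrier V \<Longrightarrow> y \<in> carrier V \<Longrightarrow> tensor_map2 N f g (P [x, y]) = pure K N [f x, g y]"
proof -
  interpret N: vec K N using N field_axioms by (simp add: vec_def)
  note c = lin_hom_closed[OF f] lin_hom_closed[OF g]
  have "\<exists>h\<in>lin_hom K T (tensor_algebra K N). \<forall>x\<in>carrier V. \<forall>y\<in>carrier V. h (P [x, y]) = pure K N [f x, g y]"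
    using multilinearD(2,3)[OF N.pure_multilinear, of "[]" "[g z]" for z]
      multilinearD(2,3)[OF N.pure_multilinear, of "[f z]" "[]" for z]
    by (intro bilinear_lift N.T_module)
      (simp_all add: c lin_hom_add[OF f] lin_hom_add[OF g] lin_hom_smult[OF f] lin_hom_smult[OF g])
  then have "\<exists>h. h \<in> lin_hom K T (tensor_algebra K N) \<and>
    (\<forall>x\<in>carrier V. \<forall>y\<in>carrier V. h (P [x, y]) = pure K N [f x, g y])" by blast
  from someI_ex[OF this, folded tensor_map2_def]
  show "tensor_map2 N f g \<in> lin_hom K T (tensor_algebra K N)"
    "x \<in> carrier V \<Longrightarrow> y \<in> carrier V \<Longrightarrow> tensor_map2 N f g (P [x, y]) = pure K N [f x, g y]" by blast+
qed

lemma tensor_map2_tpow: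
  assumes N: "module K N" and f: "f \<in> lin_hom K V N" and g: "g \<in> lin_hom K V N"
  shows "tensor_map2 N f g \<in> lin_hom K (tpow K V 2) (tpow K N 2)"
proof -
  interpret N: vec K N using N field_axioms by (simp add: vec_def)
  note t = tensor_map2[OF assms]
  show ?thesis
  proof (rule N.lin_hom_into_tpow[OF lin_hom_T_tpow[OF t(1)]])
    fix x assume "x \<in> TP 2"
    then show "tensor_map2 N f g x \<in> carrier (tpow K N 2)"
    proof (induction x rule: tpow_induct)
      case (pure w)
      then obtain x y where "w = [x, y]" "x \<in> carrier V" "y \<in> carrier V"
        by (auto simp: numeral_2_eq_2 length_Suc_conv)
      then show ?case using lin_hom_closed[OF f] lin_hom_closed[OF g]
        by (simp add: t(2)) (rule N.pure_tpow, auto)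
    qed (simp_all add: lin_hom_add[OF t(1)] lin_hom_smult[OF t(1)] tpow_T N.tpow_add N.tpow_smult)
  qed
qed

lemma sub_tensor:
  assumes "S \<subseteq> carrier V" "S' \<subseteq> carrier V"
  shows sub_tensor_submodule: "submodule (carrier (sub_tensor K V S S')) K T"
    and sub_tensor_module: "module K (sub_tensor K V S S')"
    and sub_tensor_tpow: "carrier (sub_tensor K V S S') \<subseteq> TP 2"
    and sub_tensor_pure: "x \<in> S \<Longrightarrow> y \<in> S' \<Longrightarrow> P [x, y] \<in> carrier (sub_tensor K V S S')"
proof -
  let ?G = "{P [x, y] | x y. x \<in> S \<and> y \<in> S'}"
  have G: "?G \<subseteq> TP 2" using assms by (auto intro!: pure_tpow)
  then have GT: "?G \<subseteq> carrier T" by (auto intro: tpow_T)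
  show s: "submodule (carrier (sub_tensor K V S S')) K T"
    unfolding sub_tensor_def using module_span_submodule[OF T_module GT] by simp
  then show "module K (sub_tensor K V S S')"
    using module_submodule[OF T_module s] by (simp add: sub_tensor_def)
  show "carrier (sub_tensor K V S S') \<subseteq> TP 2"
    unfolding sub_tensor_def using module_span_minimal[OF tpow_submodule G] by simp
  show "x \<in> S \<Longrightarrow> y \<in> S' \<Longrightarrow> P [x, y] \<in> carrier (sub_tensor K V S S')"
    unfolding sub_tensor_def using module_span_subset[of ?G K T] by auto
qed

lemma sub_tensor_induct [consumes 3, case_names pure zero add smult]:
  assumes x: "x \<in> carrier (sub_tensor K V S S')" and S: "S \<subseteq> carrier V" "S' \<subseteq> carrier V"
    and pure: "\<And>x y. x \<in> S \<Longrightarrow> y \<in> S' \<Longrightarrow> Q (P [x, y])" and zero: "Q \<zero>\<^bsub>T\<^esub>"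
    and add: "\<And>x y. x \<in> carrier (sub_tensor K V S S') \<Longrightarrow> y \<in> carrier (sub_tensor K V S S') \<Longrightarrow>
      Q x \<Longrightarrow> Q y \<Longrightarrow> Q (x \<oplus>\<^bsub>T\<^esub> y)"
    and smult: "\<And>a x. a \<in> carrier K \<Longrightarrow> x \<in> carrier (sub_tensor K V S S') \<Longrightarrow> Q x \<Longrightarrow> Q (a \<odot>\<^bsub>T\<^esub> x)"
  shows "Q x"
proof -
  let ?G = "{P [x, y] | x y. x \<in> S \<and> y \<in> S'}"
  have "?G \<subseteq> TP 2" using S by (auto intro!: pure_tpow)
  then have GT: "?G \<subseteq> carrier T" by (auto intro: tpow_T)
  have c: "carrier (sub_tensor K V S S') = module_span K T ?G" by (simp add: sub_tensor_def)
  show ?thesis using x unfolding c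
    by (rule module_span_induct[OF _ T_module GT]) (use pure zero add smult c in auto)
qed

lemma sub_tensor_full: "carrier (sub_tensor K V (carrier V) (carrier V)) = TP 2"
proof
  note s = sub_tensor[of "carrier V" "carrier V", OF subset_refl subset_refl]
  show "carrier (sub_tensor K V (carrier V) (carrier V)) \<subseteq> TP 2" by (rule s)
  note m = T.submoduleE[OF s(1)]
  show "TP 2 \<subseteq> carrier (sub_tensor K V (carrier V) (carrier V))"
  proof
    fix x assume "x \<in> TP 2"
    then show "x \<in> carrier (sub_tensor K V (carrier V) (carrier V))"
    proof (induction x rule: tpow_induct)
      case (pure w)
      then obtain x y where "w = [x, y]" "x \<in> carrier V" "y \<in> carrier V"
        by (auto simp: numeral_2_eq_2 length_Suc_conv)
      then show ?case by (simp add: s(4))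
    qed (auto intro: m)
  qed
qed

text \<open>If \<open>f'\<close> and \<open>g'\<close> are restrictions of linear maps on the whole space, then the restriction of
  \<open>f \<otimes> g\<close> has the property that defines \<open>f' \<otimes> g'\<close>, and the pure tensors leave no other choice.\<close>

lemma sub_tensor_map:
  assumes N: "module K N" and f: "f \<in> lin_hom K V N" and g: "g \<in> lin_hom K V N"
    and S: "S \<subseteq> carrier V" "S' \<subseteq> carrier V"
    and eq: "\<And>x. x \<in> S \<Longrightarrow> f' x = f x" "\<And>x. x \<in> S' \<Longrightarrow> g' x = g x"
    and x: "x \<in> carrier (sub_tensor K V S S')"
  shows "sub_tensor_map K V N S S' f' g' x = tensor_map2 N f g x"
proof -
  interpret N: vec K N using N field_axioms by (simp add: vec_def)
  let ?M = "sub_tensor K V S S'"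
  note t = tensor_map2[OF N f g]
  note s = sub_tensor[OF S]
  have M: "?M = T\<lparr>carrier := carrier ?M\<rparr>" by (simp add: sub_tensor_def)
  have ops [simp]: "add ?M = add T" "smult ?M = smult T" "zero ?M = zero T" by (simp_all add: sub_tensor_def)
  have h: "tensor_map2 N f g \<in> lin_hom K ?M (tpow K N 2)"
    using tensor_map2_tpow[OF N f g] s(3) by (auto simp: lin_hom_def subset_iff)
  have "sub_tensor_map K V N S S' f' g' = restrict (tensor_map2 N f g) (carrier ?M)"
    unfolding sub_tensor_map_def
  proof (rule the_lin_hom[OF h s(2)])
    show "\<forall>x\<in>S. \<forall>y\<in>S'. restrict (tensor_map2 N f g) (carrier ?M) (P [x, y]) = pure K N [f' x, g' y]"
      using S by (auto simp: s(4) eq t(2) subset_iff)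
    fix h' x assume h': "h' \<in> lin_hom K ?M (tpow K N 2)"
      "\<forall>x\<in>S. \<forall>y\<in>S'. h' (P [x, y]) = pure K N [f' x, g' y]" and x: "x \<in> carrier ?M"
    from x S show "h' x = tensor_map2 N f g x"
    proof (induction x rule: sub_tensor_induct)
      case (pure x y)
      then show ?case using h'(2) S by (auto simp: eq t(2) subset_iff)
    next
      case zero
      show ?case using lin_hom_zero[OF h'(1) s(2) N.tpow_module] lin_hom_zero[OF h s(2) N.tpow_module] by simp
    next
      case (add x y)
      then show ?case using lin_hom_add[OF h'(1), of x y] lin_hom_add[OF h, of x y] by simp
    next
      case (smult a x)
      then show ?case using lin_hom_smult[OF h'(1), of a x] lin_hom_smult[OF h, of a x] by simp
    qed
  qed
  then show ?thesis using x by simp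
qed

lemma tensor_proj:
  shows tensor_proj_lin: "tensor_proj K V n \<in> lin_hom K T T"
    and tensor_proj_same: "x \<in> TP n \<Longrightarrow> tensor_proj K V n x = x"
    and tensor_proj_other: "x \<in> TP m \<Longrightarrow> m \<noteq> n \<Longrightarrow> tensor_proj K V n x = \<zero>\<^bsub>T\<^esub>"
proof -
  have "\<exists>h\<in>lin_hom K T T. \<forall>m. \<forall>x\<in>TP m. h x = (if m = n then x else \<zero>\<^bsub>T\<^esub>)"
  proof (rule graded_lift[OF T_module])
    show "(\<lambda>x. if m = n then x else \<zero>\<^bsub>T\<^esub>) \<in> lin_hom K (tpow K V m) T" for m
      using id_lin lin_hom_zero_map[OF T_module] by (cases "m = n") auto
  qed
  then obtain h where h: "h \<in> lin_hom K T T" "\<And>m x. x \<in> TP m \<Longrightarrow> h x = (if m = n then x else \<zero>\<^bsub>T\<^esub>)"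
    by blast
  have eq: "tensor_proj K V n = restrict h (carrier T)"
    unfolding tensor_proj_def
  proof (rule the_lin_hom[OF h(1) T_module])
    show "(\<forall>x\<in>TP n. restrict h (carrier T) x = x) \<and>
      (\<forall>m. m \<noteq> n \<longrightarrow> (\<forall>x\<in>TP m. restrict h (carrier T) x = \<zero>\<^bsub>T\<^esub>))"
      by (auto simp: h tpow_T)
    show "h' x = h x" if "h' \<in> lin_hom K T T"
      "(\<forall>x\<in>TP n. h' x = x) \<and> (\<forall>m. m \<noteq> n \<longrightarrow> (\<forall>x\<in>TP m. h' x = \<zero>\<^bsub>T\<^esub>))" "x \<in> carrier T" for h' x
    proof (rule T_eqI[OF that(1) h(1) _ that(3)])
      fix w assume "w \<in> L"
      then show "h' (P w) = h (P w)"
        using that(2) h(2)[of "P w" "length w"] pure_tpow[of w "length w"] by (cases "length w = n") auto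
    qed
  qed
  show "tensor_proj K V n \<in> lin_hom K T T"
    unfolding eq by (rule lin_hom_restrict[OF h(1) T_module])
  show "x \<in> TP n \<Longrightarrow> tensor_proj K V n x = x" by (simp add: eq h tpow_T)
  show "x \<in> TP m \<Longrightarrow> m \<noteq> n \<Longrightarrow> tensor_proj K V n x = \<zero>\<^bsub>T\<^esub>" by (simp add: eq h tpow_T)
qed

subsection \<open>Multiplication in an algebra as a map out of its tensor algebra\<close>

definition aprod :: "'c list \<Rightarrow> 'c" where
  "aprod w = foldr (\<otimes>\<^bsub>V\<^esub>) w \<one>\<^bsub>V\<^esub>"

text \<open>For an algebra \<open>V\<close>, the algebra map \<open>T(V) \<rightarrow> V\<close> that extends the identity of \<open>V\<close>: it multiplies out
  every tensor.\<close>

definition mu :: "('a, 'c) tensor \<Rightarrow> 'c" where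
  "mu = tlift V aprod"

context
  assumes alg: "assoc_algebra K V"
begin

interpretation A: assoc_algebra K V by (rule alg)
interpretation A: ring V by (rule assoc_algebra_ring[OF alg])

lemma aprod_simps: "aprod [] = \<one>\<^bsub>V\<^esub>" "aprod (x # w) = x \<otimes>\<^bsub>V\<^esub> aprod w"
  by (simp_all add: aprod_def)

lemma aprod_closed: "w \<in> L \<Longrightarrow> aprod w \<in> carrier V"
  by (induction w) (auto simp: aprod_simps)

lemma aprod_append: "u \<in> L \<Longrightarrow> w \<in> L \<Longrightarrow> aprod (u @ w) = aprod u \<otimes>\<^bsub>V\<^esub> aprod w"
  by (induction u) (auto simp: aprod_simps aprod_closed A.m_assoc)

lemma aprod_multilinear: "multilinear K V V aprod"
  by (rule multilinearI)
    (simp_all add: aprod_closed aprod_append aprod_simps A.l_distr A.r_distr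
      A.smult_mult_left A.smult_mult_right)

lemma mu_lin: "mu \<in> lin_hom K T V"
  and mu_pure: "w \<in> L \<Longrightarrow> mu (P w) = aprod w"
  unfolding mu_def by (rule tlift[OF module_axioms aprod_multilinear], assumption?)+

lemma mu_closed [simp]: "x \<in> carrier T \<Longrightarrow> mu x \<in> carrier V"
  by (rule lin_hom_closed[OF mu_lin])

lemma mu_incl: "x \<in> carrier V \<Longrightarrow> mu (inc x) = x"
  by (simp add: incl_def mu_pure aprod_simps)

lemma mu_one: "mu \<one>\<^bsub>T\<^esub> = \<one>\<^bsub>V\<^esub>"
  using mu_pure[of "[]"] by (simp add: pure_Nil aprod_simps)

lemma mu_mult: "x \<in> carrier T \<Longrightarrow> y \<in> carrier T \<Longrightarrow> mu (x \<otimes>\<^bsub>T\<^esub> y) = mu x \<otimes>\<^bsub>V\<^esub> mu y"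
proof (induction x rule: T_induct)
  case (pure u)
  from pure(2) show ?case
  proof (induction y rule: T_induct)
    case (pure w)
    then show ?case using \<open>u \<in> L\<close> by (simp add: mu_pure aprod_append flip: pure_append)
  qed (use pure(1) in \<open>simp_all add: T.r_distr A.r_distr T.smult_mult_right A.smult_mult_right
        lin_hom_add[OF mu_lin] lin_hom_smult[OF mu_lin]\<close>)
qed (simp_all add: T.l_distr A.l_distr T.smult_mult_left A.smult_mult_left
        lin_hom_add[OF mu_lin] lin_hom_smult[OF mu_lin])

lemma incl_mu_lin: "(\<lambda>x. inc (mu x)) \<in> lin_hom K (tpow K V n) (tpow K V 1)"
  by (rule lin_hom_comp[OF lin_hom_T_tpow[OF mu_lin] incl_lin1])

lemma mult_map: "x \<in> TP 2 \<Longrightarrow> mult_map K V x = inc (mu x)"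
proof -
  assume x: "x \<in> TP 2"
  have "mult_map K V = restrict (\<lambda>x. inc (mu x)) (TP 2)"
    unfolding mult_map_def
  proof (rule the_lin_hom[OF incl_mu_lin tpow_module])
    show "\<forall>x\<in>carrier V. \<forall>y\<in>carrier V. restrict (\<lambda>x. inc (mu x)) (TP 2) (P [x, y]) = inc (x \<otimes>\<^bsub>V\<^esub> y)"
      by (auto simp: pure_tpow mu_pure aprod_simps)
    show "h x = inc (mu x)" if "h \<in> lin_hom K (tpow K V 2) (tpow K V 1)"
      "\<forall>x\<in>carrier V. \<forall>y\<in>carrier V. h (P [x, y]) = inc (x \<otimes>\<^bsub>V\<^esub> y)" "x \<in> TP 2" for h x
    proof (rule tpow_eqI[OF that(1) incl_mu_lin _ that(3)])
      fix w assume "w \<in> L" "length w = 2"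
      then obtain x y where "w = [x, y]" "x \<in> carrier V" "y \<in> carrier V"
        by (auto simp: numeral_2_eq_2 length_Suc_conv)
      then show "h (P w) = inc (mu (P w))" using that(2) by (simp add: mu_pure aprod_simps)
    qed
  qed
  then show ?thesis using x by simp
qed

lemma mult_map_lin: "mult_map K V \<in> lin_hom K (tpow K V 2) (tpow K V 1)"
  by (rule lin_hom_cong[OF incl_mu_lin mult_map[symmetric] tpow_module])

lemma unit_map: "x \<in> TP 0 \<Longrightarrow> unit_map K V x = inc (mu x)"
proof -
  assume x: "x \<in> TP 0"
  have "unit_map K V = restrict (\<lambda>x. inc (mu x)) (TP 0)"
    unfolding unit_map_def
  proof (rule the_lin_hom[OF incl_mu_lin tpow_module])
    show "restrict (\<lambda>x. inc (mu x)) (TP 0) (P []) = inc \<one>\<^bsub>V\<^esub>"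
      by (auto simp: pure_tpow mu_pure aprod_simps)
    show "h x = inc (mu x)" if "h \<in> lin_hom K (tpow K V 0) (tpow K V 1)"
      "h (P []) = inc \<one>\<^bsub>V\<^esub>" "x \<in> TP 0" for h x
      by (rule tpow_eqI[OF that(1) incl_mu_lin _ that(3)]) (use that(2) in \<open>auto simp: mu_pure aprod_simps\<close>)
  qed
  then show ?thesis using x by simp
qed

lemma unit_map_lin: "unit_map K V \<in> lin_hom K (tpow K V 0) (tpow K V 1)"
  by (rule lin_hom_cong[OF incl_mu_lin unit_map[symmetric] tpow_module])

end

end


section \<open>Crossings in a representation of the braid monoid\<close>

text \<open>The rules for sliding an operator through a crossing follow from the braid relations alone; they
  are derived here for an arbitrary action of the braid monoid on infinitely many strands.\<close>

locale braid_action =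
  fixes S :: "nat \<Rightarrow> 'x \<Rightarrow> 'x"
  assumes braid: "S i (S (Suc i) (S i z)) = S (Suc i) (S i (S (Suc i) z))"
    and far: "Suc i < k \<Longrightarrow> S i (S k z) = S k (S i z)"
begin

text \<open>The strand at position \<open>k\<close> crosses the \<open>n\<close> strands to its right.\<close>

primrec cr :: "nat \<Rightarrow> nat \<Rightarrow> 'x \<Rightarrow> 'x" where
  "cr k 0 z = z"
| "cr k (Suc n) z = S (k + n) (cr k n z)"

text \<open>The bundle of \<open>m\<close> strands starting at position \<open>k\<close> crosses the \<open>n\<close> strands to its right, the last
  strand of the bundle going first.\<close>

primrec C :: "nat \<Rightarrow> nat \<Rightarrow> nat \<Rightarrow> 'x \<Rightarrow> 'x" where
  "C k 0 n z = z"
| "C k (Suc m) n z = cr k n (C (Suc k) m n z)"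

lemma cr_add: "cr i (m + n) z = cr (i + m) n (cr i m z)"
  by (induction n) (auto simp: add.assoc)

lemma S_cr_low: "Suc k < i \<Longrightarrow> S k (cr i n z) = cr i n (S k z)"
proof (induction n)
  case (Suc n)
  then show ?case using far[of k "i + n" "cr i n z"] by simp
qed simp

lemma S_cr_high: "i + n < k \<Longrightarrow> S k (cr i n z) = cr i n (S k z)"
proof (induction n)
  case (Suc n)
  then show ?case using far[of "i + n" k "cr i n z"] by simp
qed simp

text \<open>Only two factors of the crossing meet the generator, and the braid relation applies to them.\<close>

lemma S_cr: "Suc j < n \<Longrightarrow> S (i + j) (cr i n z) = cr i n (S (Suc (i + j)) z)"
proof -
  assume "Suc j < n"
  from less_imp_Suc_add[OF this] obtain m where n: "n = Suc (Suc j) + m" by auto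
  have e: "i + Suc (Suc j) = Suc (Suc (i + j))" by simp
  have "S (i + j) (cr i n z) = cr (Suc (Suc (i + j))) m (S (i + j) (cr i (Suc (Suc j)) z))"
    unfolding n cr_add e by (rule S_cr_low) simp
  also have "S (i + j) (cr i (Suc (Suc j)) z) = S (Suc (i + j)) (S (i + j) (S (Suc (i + j)) (cr i j z)))"
    by (simp only: cr.simps add_Suc_right braid)
  also have "S (Suc (i + j)) (cr i j z) = cr i j (S (Suc (i + j)) z)"
    by (rule S_cr_high) simp
  also have "S (Suc (i + j)) (S (i + j) (cr i j (S (Suc (i + j)) z))) = cr i (Suc (Suc j)) (S (Suc (i + j)) z)"
    by simp
  finally show ?thesis unfolding n cr_add e .
qed

lemma C_zero_right [simp]: "C i m 0 z = z"
  by (induction m arbitrary: i) auto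

lemma C_one_right: "C i (Suc l) (Suc 0) z = S i (C (Suc i) l (Suc 0) z)"
  by simp

lemma C_add_left: "C i (l + m) n z = C i l n (C (i + l) m n z)"
  by (induction l arbitrary: i) auto

lemma S_C_low: "Suc k < i \<Longrightarrow> S k (C i m n z) = C i m n (S k z)"
  by (induction m arbitrary: i) (auto simp: S_cr_low)

lemma cr_C_commute: "i + m < p \<Longrightarrow> cr i m (C p l n z) = C p l n (cr i m z)"
  by (induction m) (auto simp: S_C_low)

text \<open>The strands of the bundle may cross \<open>m + n\<close> strands in two rounds, because the generators that
  have to be exchanged for this are far apart.\<close>

lemma C_add_right: "C i l (m + n) z = C (i + m) l n (C i l m z)"
proof (induction l arbitrary: i)
  case (Suc l)
  then show ?case by (simp add: cr_add cr_C_commute)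
qed simp

text \<open>A generator that acts inside one of the two bundles may be applied before or after the crossing.
  For the bundle on the right this is \<open>S_cr\<close>, one crossing strand at a time. For the bundle on the left
  the case of a single strand on the right comes from the braid relations, and further strands are
  added by \<open>C_add_right\<close>.\<close>

lemma S_C_left: "Suc j < n \<Longrightarrow> S (i + j) (C i l n z) = C i l n (S (i + l + j) z)"
proof (induction l arbitrary: i)
  case (Suc l)
  then show ?case using Suc.IH[of "Suc i"] by (simp add: S_cr)
qed simp

lemma S_C_right_one: "Suc j < l \<Longrightarrow> S (Suc (i + j)) (C i l (Suc 0) z) = C i l (Suc 0) (S (i + j) z)"
proof (induction j arbitrary: i l)
  case 0
  from less_imp_Suc_add[OF this] obtain m where l: "l = Suc (Suc m)" by auto
  show ?case unfolding l C_one_right by (simp add: braid[symmetric] S_C_low)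
next
  case (Suc j)
  then obtain m where l: "l = Suc m" "Suc j < m" by (cases l) auto
  have "S (Suc (i + Suc j)) (S i (C (Suc i) m (Suc 0) z)) = S i (S (Suc (Suc i + j)) (C (Suc i) m (Suc 0) z))"
    using far[of i "Suc (i + Suc j)" "C (Suc i) m (Suc 0) z"] by simp
  also have "\<dots> = S i (C (Suc i) m (Suc 0) (S (Suc i + j) z))" by (simp only: Suc.IH[OF l(2)])
  finally show ?case unfolding l C_one_right by simp
qed

lemma S_C_right: "Suc j < l \<Longrightarrow> S (i + n + j) (C i l n z) = C i l n (S (i + j) z)"
proof (induction n)
  case (Suc n)
  have e: "C i l (Suc n) z = C (i + n) l (Suc 0) (C i l n z)" for z
    using C_add_right[of i l n "Suc 0"] by simp
  have "S (i + Suc n + j) (C i l (Suc n) z) = S (Suc ((i + n) + j)) (C (i + n) l (Suc 0) (C i l n z))"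
    unfolding e by simp
  also have "\<dots> = C (i + n) l (Suc 0) (S (i + n + j) (C i l n z))" by (rule S_C_right_one[OF Suc.prems])
  also have "\<dots> = C i l (Suc n) (S (i + j) z)" using Suc e by simp
  finally show ?case .
qed simp

end

section \<open>The braid monoid acting on the tensor algebra\<close>

sublocale braided_vector_space \<subseteq> vec K V ..

context vec
begin

interpretation T: assoc_algebra K T by (rule T_algebra)

lemma tpow_induct_mult [consumes 1, case_names mult add smult]:
  assumes z: "z \<in> TP (p + q)"
    and mult: "\<And>x y. x \<in> TP p \<Longrightarrow> y \<in> TP q \<Longrightarrow> Q (x \<otimes>\<^bsub>T\<^esub> y)"
    and add: "\<And>x y. x \<in> TP (p + q) \<Longrightarrow> y \<in> TP (p + q) \<Longrightarrow> Q x \<Longrightarrow> Q y \<Longrightarrow> Q (x \<oplus>\<^bsub>T\<^esub> y)"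
    and smult: "\<And>a x. a \<in> carrier K \<Longrightarrow> x \<in> TP (p + q) \<Longrightarrow> Q x \<Longrightarrow> Q (a \<odot>\<^bsub>T\<^esub> x)"
  shows "Q z"
  using z
proof (induction z rule: tpow_induct)
  case (pure w)
  have tk: "take p w \<in> L" "drop p w \<in> L"
    using take_L[OF pure(1)] drop_L[OF pure(1)] by blast+
  have "Q (P (take p w) \<otimes>\<^bsub>T\<^esub> P (drop p w))" using pure tk by (intro mult pure_tpow) auto
  also have "P (take p w) \<otimes>\<^bsub>T\<^esub> P (drop p w) = P w" using tk by (simp flip: pure_append)
  finally show ?case .
qed (rule add smult; assumption)+

lemma T_induct_tpow [consumes 1, case_names tpow add]:
  assumes z: "z \<in> carrier T"
    and tpow: "\<And>n x. x \<in> TP n \<Longrightarrow> Q x"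
    and add: "\<And>x y. x \<in> carrier T \<Longrightarrow> y \<in> carrier T \<Longrightarrow> Q x \<Longrightarrow> Q y \<Longrightarrow> Q (x \<oplus>\<^bsub>T\<^esub> y)"
  shows "Q z"
proof -
  have "z \<in> carrier T \<and> (\<forall>a\<in>carrier K. Q (a \<odot>\<^bsub>T\<^esub> z))"
    using z
  proof (induction z rule: T_induct)
    case (pure w)
    then show ?case using tpow[OF tpow_smult[OF _ pure_tpow[OF pure refl]]] by simp
  next
    case (add x y)
    then show ?case using assms(3) by (auto simp: T.smult_r_distr)
  next
    case (smult a x)
    then show ?case by (auto simp flip: T.smult_assoc1)
  qed
  then show ?thesis by (metis one_closed T.smult_one)
qed

lemma one_tpow: "\<one>\<^bsub>T\<^esub> \<in> TP 0"
  using pure_tpow[of "[]" 0] by (simp add: pure_Nil)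

end

context braided_vector_space
begin

interpretation T: assoc_algebra K T by (rule T_algebra)

lemma c_lin: "c \<in> lin_hom K (tpow K V 2) T"
  by (rule lin_hom_tpow_T[OF c_linear])

lemma c_tpow: "t \<in> TP 2 \<Longrightarrow> c t \<in> TP 2"
  by (rule lin_hom_closed[OF c_linear])

lemma c_add: "s \<in> TP 2 \<Longrightarrow> t \<in> TP 2 \<Longrightarrow> c (s \<oplus>\<^bsub>T\<^esub> t) = c s \<oplus>\<^bsub>T\<^esub> c t"
  using lin_hom_add[OF c_linear, of s t] by simp

lemma c_smult: "a \<in> carrier K \<Longrightarrow> t \<in> TP 2 \<Longrightarrow> c (a \<odot>\<^bsub>T\<^esub> t) = a \<odot>\<^bsub>T\<^esub> c t"
  using lin_hom_smult[OF c_linear, of a t] by simp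

text \<open>The braiding of the letters at positions \<open>i\<close> and \<open>i + 1\<close>; shorter tensors are sent to zero
  and everything outside the carrier is fixed, so that the braid relations hold without
  any condition.\<close>

definition S :: "nat \<Rightarrow> ('a, 'c) tensor \<Rightarrow> ('a, 'c) tensor" where
  "S i z = (if z \<in> carrier T then
     (SOME h. h \<in> lin_hom K T T \<and>
        (\<forall>n. \<forall>x\<in>TP n. h x = (if i + 2 \<le> n
           then tens K V i (\<lambda>x. x) (n - i) (tens K V 2 c (n - i - 2) (\<lambda>x. x)) x
           else \<zero>\<^bsub>T\<^esub>))) z else z)"

lemma S_spec:
  shows S_lin: "S i \<in> lin_hom K T T"
    and S_graded: "x \<in> TP n \<Longrightarrow> S i x = (if i + 2 \<le> n
       then tens K V i (\<lambda>x. x) (n - i) (tens K V 2 c (n - i - 2) (\<lambda>x. x)) x else \<zero>\<^bsub>T\<^esub>)"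
proof -
  let ?f = "\<lambda>n x. if i + 2 \<le> n
       then tens K V i (\<lambda>x. x) (n - i) (tens K V 2 c (n - i - 2) (\<lambda>x. x)) x else \<zero>\<^bsub>T\<^esub>"
  have "\<exists>h\<in>lin_hom K T T. \<forall>n. \<forall>x\<in>TP n. h x = ?f n x"
  proof (rule graded_lift[OF T_module])
    fix n
    show "?f n \<in> lin_hom K (tpow K V n) T"
    proof (cases "i + 2 \<le> n")
      case True
      then obtain m where n: "n = i + (2 + m)" by (metis add.assoc le_Suc_ex)
      have "tens K V i (\<lambda>x. x) (2 + m) (tens K V 2 c m (\<lambda>x. x)) \<in> lin_hom K (tpow K V (i + (2 + m))) T"
        by (intro tens_lin id_lin c_lin)
      then show ?thesis by (simp add: n)
    next
      case False
      then show ?thesis using lin_hom_zero_map[OF T_module] by simp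
    qed
  qed
  then have ex: "\<exists>h. h \<in> lin_hom K T T \<and> (\<forall>n. \<forall>x\<in>TP n. h x = ?f n x)" by blast
  let ?h = "SOME h. h \<in> lin_hom K T T \<and> (\<forall>n. \<forall>x\<in>TP n. h x = ?f n x)"
  have h: "?h \<in> lin_hom K T T \<and> (\<forall>n. \<forall>x\<in>TP n. ?h x = ?f n x)" by (rule someI_ex[OF ex])
  have eq: "S i z = ?h z" if "z \<in> carrier T" for z using that by (simp add: S_def)
  show "S i \<in> lin_hom K T T"
    by (rule lin_hom_cong[OF _ _ T_module, of ?h]) (use h eq in auto)
  show "S i x = ?f n x" if "x \<in> TP n"
    using h eq[OF tpow_T[OF that]] that by blast
qed

lemma S_out: "z \<notin> carrier T \<Longrightarrow> S i z = z"
  by (simp add: S_def)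

lemma S_closed [simp]: "z \<in> carrier T \<Longrightarrow> S i z \<in> carrier T"
  by (rule lin_hom_closed[OF S_lin])

lemma S_add: "x \<in> carrier T \<Longrightarrow> y \<in> carrier T \<Longrightarrow> S i (x \<oplus>\<^bsub>T\<^esub> y) = S i x \<oplus>\<^bsub>T\<^esub> S i y"
  by (rule lin_hom_add[OF S_lin])

lemma S_smult: "a \<in> carrier K \<Longrightarrow> x \<in> carrier T \<Longrightarrow> S i (a \<odot>\<^bsub>T\<^esub> x) = a \<odot>\<^bsub>T\<^esub> S i x"
  by (rule lin_hom_smult[OF S_lin])

lemma S_zero: "S i \<zero>\<^bsub>T\<^esub> = \<zero>\<^bsub>T\<^esub>"
  by (rule lin_hom_zero[OF S_lin T_module T_module])

lemma S_short: "x \<in> TP n \<Longrightarrow> n < i + 2 \<Longrightarrow> S i x = \<zero>\<^bsub>T\<^esub>"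
  by (simp add: S_graded)

lemma S_tpow: "x \<in> TP n \<Longrightarrow> S i x \<in> TP n"
proof (cases "i + 2 \<le> n")
  case True
  assume x: "x \<in> TP n"
  obtain m where n: "n = i + (2 + m)" using True by (metis add.assoc le_Suc_ex)
  have l: "(\<lambda>x. x) \<in> lin_hom K (tpow K V k) (tpow K V k)" for k by (rule lin_homI) auto
  have "tens K V i (\<lambda>x. x) (2 + m) (tens K V 2 c m (\<lambda>x. x)) \<in> lin_hom K (tpow K V (i + (2 + m))) (tpow K V (i + (2 + m)))"
    by (intro tens_tpow l c_linear)
  from lin_hom_closed[OF this, of x] show ?thesis using x by (simp add: S_graded n)
qed (simp add: S_graded tpow_zero)

lemma S_at: "x \<in> TP i \<Longrightarrow> t \<in> TP 2 \<Longrightarrow> y \<in> carrier T \<Longrightarrow>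
    S i (x \<otimes>\<^bsub>T\<^esub> (t \<otimes>\<^bsub>T\<^esub> y)) = x \<otimes>\<^bsub>T\<^esub> (c t \<otimes>\<^bsub>T\<^esub> y)"
proof -
  assume x: "x \<in> TP i" and t: "t \<in> TP 2" and "y \<in> carrier T"
  from this(3) show ?thesis
  proof (induction y rule: T_induct_tpow)
    case (tpow m y)
    have xty: "x \<otimes>\<^bsub>T\<^esub> (t \<otimes>\<^bsub>T\<^esub> y) \<in> TP (i + (2 + m))"
      by (intro tpow_mult x t tpow)
    have e: "i + 2 \<le> i + (2 + m)" "i + (2 + m) - i = 2 + m" "2 + m - 2 = m" by simp_all
    show ?case
      by (simp only: S_graded[OF xty] e if_True tens_mult[OF id_lin tens_lin[OF c_lin id_lin] x tpow_mult[OF t tpow]]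
          tens_mult[OF c_lin id_lin t tpow])
  next
    case (add y z)
    then show ?case using x t c_tpow[OF t]
      by (simp add: T.r_distr tpow_T S_add)
  qed
qed

lemma S_left: "x \<in> TP l \<Longrightarrow> y \<in> carrier T \<Longrightarrow> S (i + l) (x \<otimes>\<^bsub>T\<^esub> y) = x \<otimes>\<^bsub>T\<^esub> S i y"
proof -
  assume x: "x \<in> TP l" and "y \<in> carrier T"
  from this(2) show ?thesis
  proof (induction y rule: T_induct_tpow)
    case (tpow n y)
    show ?case
    proof (cases "i + 2 \<le> n")
      case True
      obtain m where n: "n = i + (2 + m)" using True by (metis add.assoc le_Suc_ex)
      from tpow show ?thesis unfolding n
      proof (induction y rule: tpow_induct_mult)
        case (mult a y)
        from mult(2) show ?case
        proof (induction y rule: tpow_induct_mult)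
          case (mult t y)
          have "x \<otimes>\<^bsub>T\<^esub> a \<in> TP (i + l)" using tpow_mult[OF x \<open>a \<in> TP i\<close>] by (simp add: add.commute)
          from S_at[OF this mult(1) tpow_T[OF mult(2)]] S_at[OF \<open>a \<in> TP i\<close> mult(1) tpow_T[OF mult(2)]]
          show ?case using x \<open>a \<in> TP i\<close> mult c_tpow[OF mult(1)]
            by (simp add: T.m_assoc tpow_T)
        qed (use x \<open>a \<in> TP i\<close> in \<open>simp_all add: T.r_distr T.smult_mult_right tpow_T S_add S_smult\<close>)
      qed (use x in \<open>simp_all add: T.r_distr T.smult_mult_right tpow_T S_add S_smult\<close>)
    next
      case False
      then show ?thesis using S_short[OF tpow] S_short[OF tpow_mult[OF x tpow]] x by (simp add: tpow_T)
    qed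
  next
    case (add y z)
    then show ?case using x by (simp add: T.r_distr tpow_T S_add)
  qed
qed

lemma S_right: "x \<in> TP n \<Longrightarrow> i + 2 \<le> n \<Longrightarrow> y \<in> carrier T \<Longrightarrow> S i (x \<otimes>\<^bsub>T\<^esub> y) = S i x \<otimes>\<^bsub>T\<^esub> y"
proof -
  assume x: "x \<in> TP n" and "i + 2 \<le> n" and y: "y \<in> carrier T"
  then obtain m where n: "n = i + (2 + m)" by (metis add.assoc le_Suc_ex)
  from x show ?thesis unfolding n
  proof (induction x rule: tpow_induct_mult)
    case (mult a x)
    from mult(2) show ?case
    proof (induction x rule: tpow_induct_mult)
      case (mult t b)
      then show ?case using S_at[OF \<open>a \<in> TP i\<close> mult(1), of b] S_at[OF \<open>a \<in> TP i\<close> mult(1), of "b \<otimes>\<^bsub>T\<^esub> y"]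
        y \<open>a \<in> TP i\<close> c_tpow[OF mult(1)]
        by (simp add: T.m_assoc tpow_T)
    qed (use y \<open>a \<in> TP i\<close> in \<open>simp_all add: T.r_distr T.l_distr T.smult_mult_right T.smult_mult_left tpow_T S_add S_smult\<close>)
  qed (use y in \<open>simp_all add: T.l_distr T.smult_mult_left tpow_T S_add S_smult\<close>)
qed

lemma S0_tens: "z \<in> TP (2 + m) \<Longrightarrow> S 0 z = tens K V 2 c m (\<lambda>x. x) z"
proof (rule tens_unique[OF c_lin id_lin lin_hom_T_tpow[OF S_lin], symmetric])
  fix x y assume "x \<in> TP 2" "y \<in> TP m"
  then show "S 0 (x \<otimes>\<^bsub>T\<^esub> y) = c x \<otimes>\<^bsub>T\<^esub> y"
    using S_at[OF one_tpow, of x y] c_tpow[of x] by (simp add: tpow_T)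
qed

lemma S0_c: "t \<in> TP 2 \<Longrightarrow> S 0 t = c t"
  using S_at[OF one_tpow, of t "\<one>\<^bsub>T\<^esub>"] c_tpow[of t] by (simp add: tpow_T)

lemma S1_tens: "z \<in> TP (n + 2) \<Longrightarrow> S n z = tens K V n (\<lambda>x. x) 2 c z"
proof (rule tens_unique[OF id_lin c_lin lin_hom_T_tpow[OF S_lin], symmetric])
  fix x y assume "x \<in> TP n" "y \<in> TP 2"
  then show "S n (x \<otimes>\<^bsub>T\<^esub> y) = x \<otimes>\<^bsub>T\<^esub> c y"
    using S_left[of x n y 0] by (simp add: S0_c tpow_T)
qed

lemma S_braid0: "z \<in> TP 3 \<Longrightarrow> S 0 (S 1 (S 0 z)) = S 1 (S 0 (S 1 z))"
proof -
  assume z: "z \<in> TP 3"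
  have t: "tens K V 2 c 1 (\<lambda>x. x) y = S 0 y" "tens K V 1 (\<lambda>x. x) 2 c y = S 1 y" if "y \<in> TP 3" for y
    using S0_tens[of y 1] S1_tens[of y 1] that by (simp_all add: numeral_3_eq_3)
  show ?thesis using braid_equation[OF z] z by (simp only: t S_tpow)
qed

text \<open>A tensor of degree at least \<open>i + 3\<close> is a sum of products of a left factor of degree \<open>i\<close>, a factor
  of degree three and a right factor; the generators act on the middle factor, where the relation is
  the braid equation of \<open>c\<close>. On shorter tensors both sides vanish.\<close>

lemma S_braid_T:
  assumes "z \<in> carrier T" shows "S i (S (Suc i) (S i z)) = S (Suc i) (S i (S (Suc i) z))"
  using assms
proof (induction z rule: T_induct_tpow)
  case (tpow n z)
  show ?case
  proof (cases "i + 3 \<le> n")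
    case True
    then obtain m where n: "n = i + (3 + m)" by (metis add.assoc le_Suc_ex)
    from tpow show ?thesis unfolding n
    proof (induction z rule: tpow_induct_mult)
      case (mult a z)
      from mult(2) show ?case
      proof (induction z rule: tpow_induct_mult)
        case (mult t b)
        have 1: "S i (a \<otimes>\<^bsub>T\<^esub> (t \<otimes>\<^bsub>T\<^esub> b)) = a \<otimes>\<^bsub>T\<^esub> (S 0 t \<otimes>\<^bsub>T\<^esub> b)" if "t \<in> TP 3" for t
          using S_left[OF \<open>a \<in> TP i\<close>, of "t \<otimes>\<^bsub>T\<^esub> b" 0] S_right[OF that, of 0 b] that mult
          by (simp add: tpow_T)
        have 2: "S (Suc i) (a \<otimes>\<^bsub>T\<^esub> (t \<otimes>\<^bsub>T\<^esub> b)) = a \<otimes>\<^bsub>T\<^esub> (S 1 t \<otimes>\<^bsub>T\<^esub> b)" if "t \<in> TP 3" for t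
          using S_left[OF \<open>a \<in> TP i\<close>, of "t \<otimes>\<^bsub>T\<^esub> b" 1] S_right[OF that, of 1 b] that mult
          by (simp add: tpow_T)
        show ?case using mult(1) S_braid0[OF mult(1)] by (simp add: 1 2 S_tpow)
      qed (use \<open>a \<in> TP i\<close> in \<open>simp_all add: T.r_distr T.smult_mult_right tpow_T S_add S_smult\<close>)
    qed (simp_all add: tpow_T S_add S_smult)
  next
    case False
    then show ?thesis using S_short[of _ n "Suc i"] S_tpow[OF tpow] tpow by (simp add: S_zero)
  qed
qed (simp add: S_add)

text \<open>Cutting at position \<open>k\<close> lets the two generators act on different factors.\<close>

lemma S_far_T:
  assumes "z \<in> carrier T" "Suc i < k" shows "S i (S k z) = S k (S i z)"
  using assms(1)
proof (induction z rule: T_induct_tpow)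
  case (tpow n z)
  show ?case
  proof (cases "k \<le> n")
    case True
    then obtain m where n: "n = k + m" by (metis le_Suc_ex)
    from tpow show ?thesis unfolding n
    proof (induction z rule: tpow_induct_mult)
      case (mult x y)
      have l: "S k (x \<otimes>\<^bsub>T\<^esub> y) = x \<otimes>\<^bsub>T\<^esub> S 0 y" if "x \<in> TP k" for x
        using S_left[OF that, of y 0] mult by (simp add: tpow_T)
      have r: "S i (x \<otimes>\<^bsub>T\<^esub> y) = S i x \<otimes>\<^bsub>T\<^esub> y" if "y \<in> TP m" for y
        using S_right[OF mult(1), of i y] assms(2) that by (simp add: tpow_T)
      show ?case using mult by (simp add: l r S_tpow)
    qed (simp_all add: tpow_T S_add S_smult)
  next
    case False
    then show ?thesis using S_short[of _ n k] S_tpow[OF tpow] tpow by (simp add: S_zero)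
  qed
qed (simp add: S_add)

end

sublocale braided_vector_space \<subseteq> braid_action S
proof
  show "S i (S (Suc i) (S i z)) = S (Suc i) (S i (S (Suc i) z))" for i z
    by (cases "z \<in> carrier (tensor_algebra K V)") (simp_all add: S_braid_T S_out)
  show "S i (S k z) = S k (S i z)" if "Suc i < k" for i k z
    by (cases "z \<in> carrier (tensor_algebra K V)") (simp_all add: S_far_T[OF _ that] S_out)
qed

context braided_vector_space
begin

interpretation T: assoc_algebra K T by (rule T_algebra)

text \<open>Families of operators made of the generators on \<open>n\<close> consecutive strands; the argument of the
  family is the position of the first strand. Such an operator acts on one block of letters of a
  product and passes through crossings.\<close>

inductive fam :: "nat \<Rightarrow> (nat \<Rightarrow> ('a, 'c) tensor \<Rightarrow> ('a, 'c) tensor) \<Rightarrow> bool" where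
  id: "fam n (\<lambda>k z. z)"
| zero: "fam n (\<lambda>k z. \<zero>\<^bsub>T\<^esub>)"
| gen: "Suc j < n \<Longrightarrow> fam n (\<lambda>k. S (k + j))"
| comp: "fam n X \<Longrightarrow> fam n Y \<Longrightarrow> fam n (\<lambda>k z. X k (Y k z))"
| add: "fam n X \<Longrightarrow> fam n Y \<Longrightarrow> fam n (\<lambda>k z. X k z \<oplus>\<^bsub>T\<^esub> Y k z)"

lemma fam_shift: "fam n X \<Longrightarrow> n + l \<le> m \<Longrightarrow> fam m (\<lambda>k. X (k + l))"
proof (induction rule: fam.induct)
  case (gen j n)
  then show ?case using fam.gen[of "l + j" m] by (simp add: add.assoc)
qed (auto intro: fam.intros)

lemma fam_lin: "fam n X \<Longrightarrow> X k \<in> lin_hom K T T"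
proof (induction rule: fam.induct)
  case (id n) show ?case by (rule id_lin_T)
next
  case (zero n) show ?case by (rule lin_hom_zero_map[OF T_module])
next
  case (gen j n) show ?case by (rule S_lin)
next
  case (comp n X Y) then show ?case by (metis lin_hom_comp)
next
  case (add n X Y) then show ?case by (intro lin_hom_sum T_module)
qed

lemma fam_closed: "fam n X \<Longrightarrow> z \<in> carrier T \<Longrightarrow> X k z \<in> carrier T"
  using lin_hom_closed[OF fam_lin] .

lemma fam_add: "fam n X \<Longrightarrow> x \<in> carrier T \<Longrightarrow> y \<in> carrier T \<Longrightarrow> X k (x \<oplus>\<^bsub>T\<^esub> y) = X k x \<oplus>\<^bsub>T\<^esub> X k y"
  using lin_hom_add[OF fam_lin] .

lemma fam_zero: "fam n X \<Longrightarrow> X k \<zero>\<^bsub>T\<^esub> = \<zero>\<^bsub>T\<^esub>"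
  using lin_hom_zero[OF fam_lin T_module T_module] .

lemma fam_tpow: "fam n X \<Longrightarrow> z \<in> TP m \<Longrightarrow> X k z \<in> TP m"
  by (induction arbitrary: z rule: fam.induct) (auto simp: tpow_zero S_tpow tpow_add)

lemma fam_left: "fam n X \<Longrightarrow> x \<in> TP l \<Longrightarrow> y \<in> carrier T \<Longrightarrow> X (k + l) (x \<otimes>\<^bsub>T\<^esub> y) = x \<otimes>\<^bsub>T\<^esub> X k y"
proof (induction arbitrary: y rule: fam.induct)
  case (gen j n)
  then show ?case using S_left[of x l y "k + j"] by (simp add: ac_simps)
next
  case (add n X Y)
  then show ?case by (simp add: T.r_distr tpow_T fam_closed)
qed (simp_all add: tpow_T fam_closed)

lemma fam_right: "fam n X \<Longrightarrow> x \<in> TP m \<Longrightarrow> k + n \<le> m \<Longrightarrow> y \<in> carrier T \<Longrightarrow> X k (x \<otimes>\<^bsub>T\<^esub> y) = X k x \<otimes>\<^bsub>T\<^esub> y"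
proof (induction arbitrary: x rule: fam.induct)
  case (gen j n)
  then show ?case using S_right[of x m "k + j" y] by simp
next
  case (comp n X Y)
  then show ?case using fam_tpow[OF comp(2)] by simp
next
  case (add n X Y)
  then show ?case by (simp add: T.l_distr tpow_T fam_closed)
qed (simp_all add: tpow_T)

lemma S_fam_commute:
  "fam n X \<Longrightarrow> z \<in> carrier T \<Longrightarrow> Suc j < k \<or> k + n \<le> j \<Longrightarrow> S j (X k z) = X k (S j z)"
proof (induction arbitrary: z rule: fam.induct)
  case (gen i n)
  then show ?case using far[of j "k + i" z] far[of "k + i" j z] by auto
next
  case (comp n X Y)
  then show ?case by (simp add: fam_closed)
next
  case (add n X Y)
  then show ?case by (simp add: fam_closed S_add)
qed (simp_all add: S_zero)

lemma fam_commute: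
  assumes X: "fam n X"
  shows "fam m Y \<Longrightarrow> z \<in> carrier T \<Longrightarrow> k + n \<le> l \<Longrightarrow> X k (Y l z) = Y l (X k z)"
proof (induction arbitrary: z rule: fam.induct)
  case (gen j m)
  then show ?case using S_fam_commute[OF X, of z "l + j" k] by simp
next
  case (comp n' X' Y')
  then show ?case by (simp add: fam_closed[OF comp(2)])
next
  case (add n' X' Y')
  then show ?case by (simp add: fam_closed fam_closed[OF X] fam_add[OF X])
qed (simp_all add: fam_zero[OF X])

lemma fam_cr: "Suc n \<le> m \<Longrightarrow> fam m (\<lambda>k. cr k n)"
proof (induction n)
  case 0
  show ?case using fam.id[of m] by simp
next
  case (Suc n)
  have "fam m (\<lambda>k z. S (k + n) (cr k n z))"
    by (rule fam.comp[OF fam.gen Suc.IH]) (use Suc.prems in auto)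
  then show ?case by simp
qed

lemma fam_C: "m + n \<le> p \<Longrightarrow> fam p (\<lambda>k. C k m n)"
proof (induction m arbitrary: p)
  case 0
  show ?case using fam.id[of p] by simp
next
  case (Suc m)
  have "fam p (\<lambda>k z. cr k n (C (k + 1) m n z))"
    by (rule fam.comp[OF fam_cr fam_shift[OF Suc.IH]]) (use Suc.prems in auto)
  then show ?case by simp
qed

lemmas C_closed = fam_closed[OF fam_C[OF order_refl]]
  and C_add = fam_add[OF fam_C[OF order_refl]]
  and C_zero = fam_zero[OF fam_C[OF order_refl]]
  and C_tpow = fam_tpow[OF fam_C[OF order_refl]]
  and cr_closed = fam_closed[OF fam_cr[OF order_refl]]
  and cr_zero = fam_zero[OF fam_cr[OF order_refl]]

text \<open>Naturality of the crossings: what holds for the generators passes to sums and composites.\<close>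

lemma fam_C_left:
  "fam n X \<Longrightarrow> z \<in> carrier T \<Longrightarrow> X i (C i l n z) = C i l n (X (i + l) z)"
proof (induction arbitrary: z rule: fam.induct)
  case (gen j n)
  then show ?case using S_C_left[of j n i l z] by (simp add: ac_simps)
next
  case (comp n X Y)
  then show ?case by (simp add: fam_closed)
next
  case (add n X Y)
  then show ?case by (simp add: fam_closed C_add)
qed (simp_all add: C_zero)

lemma fam_C_right:
  "fam l X \<Longrightarrow> z \<in> carrier T \<Longrightarrow> X (i + n) (C i l n z) = C i l n (X i z)"
proof (induction arbitrary: z rule: fam.induct)
  case (gen j l)
  then show ?case using S_C_right[of j l i n z] by (simp add: ac_simps)
next
  case (comp n X Y)
  then show ?case by (simp add: fam_closed)
next
  case (add n X Y)
  then show ?case by (simp add: fam_closed C_add)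
qed (simp_all add: C_zero)

lemma fam_cr_left: "fam n X \<Longrightarrow> z \<in> carrier T \<Longrightarrow> X i (cr i n z) = cr i n (X (Suc i) z)"
  using fam_C_left[of n X z i "Suc 0"] by simp

section \<open>Quantum shuffles\<close>

text \<open>The component of bidegree \<open>(a, n - a)\<close> of the comultiplication, as an operator on \<open>n\<close> strands
  from position \<open>k\<close> on. The comultiplication of a product \<open>v w\<close> with \<open>v\<close> in \<open>V\<close> has to be
  \<open>(v \<otimes> 1 + 1 \<otimes> v) \<Delta>(w)\<close>; accordingly the first strand either stays in the left factor or crosses the
  \<open>a\<close> strands that are moved to the left factor.\<close>

primrec sh :: "nat \<Rightarrow> nat \<Rightarrow> nat \<Rightarrow> ('a, 'c) tensor \<Rightarrow> ('a, 'c) tensor" where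
  "sh k 0 a z = (if a = 0 then z else \<zero>\<^bsub>T\<^esub>)"
| "sh k (Suc n) a z = (case a of 0 \<Rightarrow> sh (Suc k) n 0 z
     | Suc b \<Rightarrow> sh (Suc k) n b z \<oplus>\<^bsub>T\<^esub> cr k a (sh (Suc k) n a z))"

lemma sh_0 [simp]: "sh k n 0 z = z"
  by (induction n arbitrary: k) auto

lemma sh_Suc [simp]: "sh k (Suc n) (Suc b) z = sh (Suc k) n b z \<oplus>\<^bsub>T\<^esub> cr k (Suc b) (sh (Suc k) n (Suc b) z)"
  by simp

declare sh.simps(2) [simp del]

lemma sh_out: "n < a \<Longrightarrow> sh k n a z = \<zero>\<^bsub>T\<^esub>"
proof (induction n arbitrary: k a)
  case (Suc n)
  then obtain b where "a = Suc b" "n < b" by (cases a) auto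
  then show ?case using Suc.IH by (simp add: cr_zero S_zero)
qed simp

lemma fam_zero_fam: "(\<And>k z. X k z = \<zero>\<^bsub>T\<^esub>) \<Longrightarrow> fam m X"
  using fam.zero[of m] by (metis ext)

lemma fam_sh: "n \<le> m \<Longrightarrow> fam m (\<lambda>k. sh k n a)"
proof (induction n arbitrary: m a)
  case 0
  show ?case using fam.id[of m] fam.zero[of m] by (cases "a = 0") auto
next
  case (Suc n)
  show ?case
  proof (cases a)
    case 0
    then show ?thesis using fam.id[of m] by simp
  next
    case a: (Suc b)
    show ?thesis
    proof (cases "a \<le> Suc n")
      case False
      then show ?thesis using sh_out[of "Suc n" a] by (intro fam_zero_fam) simp
    next
      case True
      have f: "fam m (\<lambda>k. sh (k + 1) n b)" for b
        by (rule fam_shift[OF Suc.IH[OF order_refl]]) (use Suc.prems in simp)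
      show ?thesis
      proof (cases "a = Suc n")
        case True
        have "(\<lambda>k. sh k (Suc n) a) = (\<lambda>k z. sh (k + 1) n b z \<oplus>\<^bsub>T\<^esub> \<zero>\<^bsub>T\<^esub>)"
          using True a by (simp add: fun_eq_iff sh_out cr_zero S_zero)
        then show ?thesis using fam.add[OF f fam.zero] by simp
      next
        case False
        have "fam m (\<lambda>k z. sh (k + 1) n b z \<oplus>\<^bsub>T\<^esub> cr k a (sh (k + 1) n a z))"
          by (intro fam.add[OF f] fam.comp[OF fam_cr f]) (use True False Suc.prems in auto)
        then show ?thesis using a by simp
      qed
    qed
  qed
qed

lemmas sh_closed [simp] = fam_closed[OF fam_sh[OF order_refl]]
  and sh_add = fam_add[OF fam_sh[OF order_refl]]
  and sh_zero [simp] = fam_zero[OF fam_sh[OF order_refl]]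
  and sh_tpow = fam_tpow[OF fam_sh[OF order_refl]]

lemma sh_full [simp]: "z \<in> carrier T \<Longrightarrow> sh k n n z = z"
  by (induction n arbitrary: k) (auto simp: sh_out cr_zero S_zero)

text \<open>Both sides are the component of tridegree \<open>(a, b, n - a - b)\<close> of the iterated comultiplication. The
  first strand goes to one of the three factors, and the resulting three terms agree by induction.\<close>

lemma sh_coassoc:
  "z \<in> carrier T \<Longrightarrow> sh k (a + b) a (sh k n (a + b) z) = sh (k + a) (n - a) b (sh k n a z)"
proof (induction n arbitrary: k a b)
  case 0
  then show ?case by auto
next
  case (Suc n)
  note z = \<open>z \<in> carrier T\<close>
  note IH = Suc.IH[OF z]
  show ?case
  proof (cases "a = 0 \<or> b = 0")
    case True
    then show ?thesis using z by (elim disjE) simp_all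
  next
    case False
    then obtain a' b' where ab: "a = Suc a'" "b = Suc b'" by (metis not0_implies_Suc)
    have cc: "sh l m i z \<in> carrier T" for l m i using z by simp
    let ?X1 = "sh (Suc k) n (a' + b) z" and ?X2 = "sh (Suc k) n (a + b) z" and ?W = "sh (Suc k) n a z"
    have "sh k (a + b) a (sh k (Suc n) (a + b) z) = sh k (a + b) a (?X1 \<oplus>\<^bsub>T\<^esub> cr k (a + b) ?X2)"
      using ab by simp
    also have "\<dots> = sh k (a + b) a ?X1 \<oplus>\<^bsub>T\<^esub> sh k (a + b) a (cr k (a + b) ?X2)"
      using cc by (simp add: sh_add cr_closed)
    also have "sh k (a + b) a (cr k (a + b) ?X2) = cr k (a + b) (sh (Suc k) (a + b) a ?X2)"
      using fam_cr_left[OF fam_sh[OF order_refl] cc] .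
    also have "sh (Suc k) (a + b) a ?X2 = sh (Suc k + a) (n - a) b ?W" by (rule IH)
    also have "sh k (a + b) a ?X1 = sh (Suc k) (a' + b) a' ?X1 \<oplus>\<^bsub>T\<^esub> cr k a (sh (Suc k) (a + b') a ?X1)"
      using ab by simp
    also have "sh (Suc k) (a' + b) a' ?X1 = sh (Suc k + a') (n - a') b (sh (Suc k) n a' z)" by (rule IH)
    also have "?X1 = sh (Suc k) n (a + b') z" using ab by simp
    also have "sh (Suc k) (a + b') a (sh (Suc k) n (a + b') z) = sh (Suc k + a) (n - a) b' ?W" by (rule IH)
    finally have lhs: "sh k (a + b) a (sh k (Suc n) (a + b) z) =
      (sh (Suc k + a') (n - a') b (sh (Suc k) n a' z) \<oplus>\<^bsub>T\<^esub> cr k a (sh (Suc k + a) (n - a) b' ?W))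
        \<oplus>\<^bsub>T\<^esub> cr k (a + b) (sh (Suc k + a) (n - a) b ?W)" .
    have rhs: "sh (k + a) (Suc n - a) b (sh k (Suc n) a z) =
      sh (Suc k + a') (n - a') b (sh (Suc k) n a' z) \<oplus>\<^bsub>T\<^esub> sh (k + a) (Suc n - a) b (cr k a ?W)"
      using ab cc by (simp add: sh_add cr_closed)
    have "sh (k + a) (Suc n - a) b (cr k a ?W) =
      cr k a (sh (Suc k + a) (n - a) b' ?W) \<oplus>\<^bsub>T\<^esub> cr k (a + b) (sh (Suc k + a) (n - a) b ?W)"
    proof (cases "a \<le> n")
      case True
      have com: "sh (Suc k + a) (n - a) i (cr k a ?W) = cr k a (sh (Suc k + a) (n - a) i ?W)" for i
        using fam_commute[OF fam_cr[OF order_refl, of a] fam_sh[OF order_refl, of "n - a" i] cc, of k "Suc k + a"]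
        by simp
      have "sh (k + a) (Suc n - a) b (cr k a ?W) =
        sh (Suc k + a) (n - a) b' (cr k a ?W) \<oplus>\<^bsub>T\<^esub> cr (k + a) b (sh (Suc k + a) (n - a) b (cr k a ?W))"
        by (simp only: Suc_diff_le[OF True] sh_Suc ab(2) add_Suc)
      then show ?thesis by (simp only: com cr_add)
    next
      case False
      then show ?thesis by (simp add: sh_out cr_zero)
    qed
    then show ?thesis unfolding lhs rhs using cc by (simp add: T.a_assoc cr_closed)
  qed
qed

lemma C_lin: "C k m n \<in> lin_hom K T T"
  using fam_lin[OF fam_C[OF order_refl]] .

lemma cr_lin: "cr k n \<in> lin_hom K T T"
  using fam_lin[OF fam_cr[OF order_refl]] .

lemma sh_lin: "sh k n a \<in> lin_hom K T T"
  using fam_lin[OF fam_sh[OF order_refl]] .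

text \<open>A quantum Vandermonde identity, which expresses that the comultiplication is multiplicative: of the
  \<open>a\<close> strands that go to the left factor, \<open>i\<close> come from the first \<open>m\<close> strands and \<open>a - i\<close> from the last
  \<open>n\<close>, and the latter have to cross the \<open>m - i\<close> strands that stay on the right. The induction follows
  the first strand.\<close>

lemma sh_vandermonde:
  "z \<in> carrier T \<Longrightarrow> sh k (m + n) a z =
    (\<Oplus>\<^bsub>T\<^esub>i\<in>{..a}. C (k + i) (m - i) (a - i) (sh k m i (sh (k + m) n (a - i) z)))"
proof (induction m arbitrary: k a)
  case 0
  have "(\<Oplus>\<^bsub>T\<^esub>i\<in>{..a}. C (k + i) (0 - i) (a - i) (sh k 0 i (sh (k + 0) n (a - i) z))) =
        (\<Oplus>\<^bsub>T\<^esub>i\<in>{..a}. if i = 0 then sh k n (a - i) z else \<zero>\<^bsub>T\<^esub>)"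
    using 0 by (intro T.finsum_cong') auto
  also have "\<dots> = sh k n a z" using 0 by (subst T.add.finprod_singleton_swap) auto
  finally show ?case by simp
next
  case (Suc m)
  note z = \<open>z \<in> carrier T\<close>
  note IH = Suc.IH[OF z]
  let ?Y = "\<lambda>i b. sh (Suc k) m i (sh (Suc k + m) n b z)"
  have Y: "?Y i b \<in> carrier T" for i b using z by simp
  show ?case
  proof (cases a)
    case 0
    then show ?thesis using z by simp
  next
    case a: (Suc b)
    let ?G = "\<lambda>i. if i \<le> m then cr k a (C (Suc k + i) (m - i) (a - i) (?Y i (a - i))) else \<zero>\<^bsub>T\<^esub>"
    have G: "?G i \<in> carrier T" for i using Y by (auto simp: cr_closed C_closed)
    let ?H = "\<lambda>i. C (Suc k + i) (m - i) (b - i) (?Y i (b - i))"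
    have H: "?H i \<in> carrier T" for i using Y by (auto simp: C_closed)
    have "cr k a (sh (Suc k) (m + n) a z) = (\<Oplus>\<^bsub>T\<^esub>i\<in>{..a}. ?G i)"
    proof -
      have "cr k a (sh (Suc k) (m + n) a z) =
        (\<Oplus>\<^bsub>T\<^esub>i\<in>{..a}. cr k a (C (Suc k + i) (m - i) (a - i) (?Y i (a - i))))"
        unfolding IH by (rule lin_hom_finsum[OF cr_lin T_module T_module]) (use Y in \<open>auto simp: C_closed\<close>)
      also have "\<dots> = (\<Oplus>\<^bsub>T\<^esub>i\<in>{..a}. ?G i)"
        using Y by (intro T.finsum_cong') (auto simp: cr_closed C_closed sh_out C_zero cr_zero)
      finally show ?thesis .
    qed
    moreover have "sh (Suc k) (m + n) b z = (\<Oplus>\<^bsub>T\<^esub>i\<in>{..b}. ?H i)" by (rule IH)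
    ultimately have lhs: "sh k (Suc m + n) a z = (\<Oplus>\<^bsub>T\<^esub>i\<in>{..b}. ?H i) \<oplus>\<^bsub>T\<^esub> (\<Oplus>\<^bsub>T\<^esub>i\<in>{..a}. ?G i)"
      using a by simp
    let ?R = "\<lambda>i. C (k + i) (Suc m - i) (a - i) (sh k (Suc m) i (sh (k + Suc m) n (a - i) z))"
    have cr_C: "C (k + i) (Suc m - i) (a - i) (cr k i (?Y i (a - i))) = ?G i" if "i \<le> a" for i
    proof (cases "i \<le> m")
      case True
      have "C (k + i) (Suc (m - i)) (a - i) (cr k i (?Y i (a - i))) =
        cr (k + i) (a - i) (cr k i (C (Suc k + i) (m - i) (a - i) (?Y i (a - i))))"
        by (simp add: cr_C_commute)
      also have "\<dots> = ?G i" using cr_add[of k i "a - i"] that True by simp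
      finally show ?thesis using True by (simp add: Suc_diff_le)
    qed (simp add: sh_out cr_zero C_zero)
    have R0: "?R 0 = ?G 0"
      using cr_C[of 0] by simp
    have RS: "?R (Suc i) = ?H i \<oplus>\<^bsub>T\<^esub> ?G (Suc i)" if "i \<le> b" for i
    proof -
      have "sh k (Suc m) (Suc i) (sh (k + Suc m) n (a - Suc i) z) =
        ?Y i (a - Suc i) \<oplus>\<^bsub>T\<^esub> cr k (Suc i) (?Y (Suc i) (a - Suc i))" by simp
      then have "?R (Suc i) = C (k + Suc i) (m - i) (a - Suc i) (?Y i (a - Suc i)) \<oplus>\<^bsub>T\<^esub>
        C (k + Suc i) (Suc m - Suc i) (a - Suc i) (cr k (Suc i) (?Y (Suc i) (a - Suc i)))"
        using Y by (simp only: C_add cr_closed diff_Suc_Suc)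
      also have "C (k + Suc i) (Suc m - Suc i) (a - Suc i) (cr k (Suc i) (?Y (Suc i) (a - Suc i))) = ?G (Suc i)"
        by (rule cr_C) (use that a in simp)
      finally show ?thesis using a by simp
    qed
    have Rc: "?R i \<in> carrier T" for i using z by (simp add: C_closed)
    have "(\<Oplus>\<^bsub>T\<^esub>i\<in>{..a}. ?R i) = (\<Oplus>\<^bsub>T\<^esub>i\<in>{..b}. ?R (Suc i)) \<oplus>\<^bsub>T\<^esub> ?R 0"
      unfolding a by (rule T.finsum_Suc2) (use Rc[unfolded a] in blast)
    also have "(\<Oplus>\<^bsub>T\<^esub>i\<in>{..b}. ?R (Suc i)) = (\<Oplus>\<^bsub>T\<^esub>i\<in>{..b}. ?H i \<oplus>\<^bsub>T\<^esub> ?G (Suc i))"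
      by (rule T.finsum_cong') (use RS H G in auto)
    also have "\<dots> = (\<Oplus>\<^bsub>T\<^esub>i\<in>{..b}. ?H i) \<oplus>\<^bsub>T\<^esub> (\<Oplus>\<^bsub>T\<^esub>i\<in>{..b}. ?G (Suc i))"
      by (rule T.finsum_addf) (use H G in auto)
    also have "\<dots> \<oplus>\<^bsub>T\<^esub> ?R 0 = (\<Oplus>\<^bsub>T\<^esub>i\<in>{..b}. ?H i) \<oplus>\<^bsub>T\<^esub> ((\<Oplus>\<^bsub>T\<^esub>i\<in>{..b}. ?G (Suc i)) \<oplus>\<^bsub>T\<^esub> ?G 0)"
      unfolding R0 by (intro T.a_assoc T.finsum_closed funcsetI H G)
    also have "(\<Oplus>\<^bsub>T\<^esub>i\<in>{..b}. ?G (Suc i)) \<oplus>\<^bsub>T\<^esub> ?G 0 = (\<Oplus>\<^bsub>T\<^esub>i\<in>{..a}. ?G i)"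
      unfolding a by (rule T.finsum_Suc2[symmetric]) (use G[unfolded a] in blast)
    finally show ?thesis unfolding lhs by simp
  qed
qed

end


section \<open>Splitting tensors\<close>

context vec
begin

interpretation T: assoc_algebra K T by (rule T_algebra)

text \<open>A map out of \<open>T(V) \<otimes> T(V)\<close> is glued from its bihomogeneous parts by using the grading twice: for
  fixed homogeneous \<open>x\<close> the parts glue to a map \<open>B m x\<close> of the second variable, and for fixed \<open>y\<close> the
  values \<open>B m x y\<close> glue to a map \<open>G y\<close> of the first.\<close>

lemma bigraded_lift:
  assumes N: "module K N" and f: "\<And>m n. f m n \<in> lin_hom K (tpow K V (m + n)) N"
  shows "\<exists>h\<in>lin_hom K T.T N. \<forall>m n. \<forall>x\<in>TP m. \<forall>y\<in>TP n. h (T.P [x, y]) = f m n (x \<otimes>\<^bsub>T\<^esub> y)"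
proof -
  interpret N: module K N by fact
  have fa: "f m n (x \<oplus>\<^bsub>T\<^esub> y) = f m n x \<oplus>\<^bsub>N\<^esub> f m n y" if "x \<in> TP (m + n)" "y \<in> TP (m + n)" for m n x y
    using lin_hom_add[OF f, of x m n y] that by simp
  have fs: "f m n (a \<odot>\<^bsub>T\<^esub> x) = a \<odot>\<^bsub>N\<^esub> f m n x" if "a \<in> carrier K" "x \<in> TP (m + n)" for m n x a
    using lin_hom_smult[OF f, of a x m n] that by simp
  have fc: "f m n x \<in> carrier N" if "x \<in> TP (m + n)" for m n x
    using lin_hom_closed[OF f that] .
  define B where "B m x = (SOME h. h \<in> lin_hom K T N \<and> (\<forall>n. \<forall>y\<in>TP n. h y = f m n (x \<otimes>\<^bsub>T\<^esub> y)))" for m x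
  have B: "B m x \<in> lin_hom K T N \<and> (\<forall>n. \<forall>y\<in>TP n. B m x y = f m n (x \<otimes>\<^bsub>T\<^esub> y))" if x: "x \<in> TP m" for m x
  proof -
    have "(\<lambda>y. f m n (x \<otimes>\<^bsub>T\<^esub> y)) \<in> lin_hom K (tpow K V n) N" for n
      by (rule lin_homI) (use x in \<open>simp_all add: fc fa fs tpow_mult T.r_distr T.smult_mult_right tpow_T\<close>)
    from graded_lift[OF N this]
    have "\<exists>h. h \<in> lin_hom K T N \<and> (\<forall>n. \<forall>y\<in>TP n. h y = f m n (x \<otimes>\<^bsub>T\<^esub> y))" by blast
    from someI_ex[OF this, folded B_def] show ?thesis .
  qed
  have Bc: "B m x y \<in> carrier N" if "x \<in> TP m" "y \<in> carrier T" for m x y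
    using lin_hom_closed[of "B m x" K T N y] B[OF that(1)] that(2) by blast
  have Ba: "B m x (y \<oplus>\<^bsub>T\<^esub> y') = B m x y \<oplus>\<^bsub>N\<^esub> B m x y'" if "x \<in> TP m" "y \<in> carrier T" "y' \<in> carrier T" for m x y y'
    using lin_hom_add[of "B m x" K T N y y'] B[OF that(1)] that(2,3) by blast
  have Bs: "B m x (a \<odot>\<^bsub>T\<^esub> y) = a \<odot>\<^bsub>N\<^esub> B m x y" if "x \<in> TP m" "y \<in> carrier T" "a \<in> carrier K" for m x y a
    using lin_hom_smult[of "B m x" K T N a y] B[OF that(1)] that(2,3) by blast
  have Bl: "(\<lambda>x. B m x y) \<in> lin_hom K (tpow K V m) N" if "y \<in> carrier T" for m y
    using that
  proof (induction y rule: T_induct_tpow)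
    case (tpow n y)
    show ?case
      by (rule lin_homI)
        (use tpow in \<open>simp_all add: B tpow_add tpow_smult fc fa fs tpow_mult T.l_distr T.smult_mult_left tpow_T\<close>)
  next
    case (add y z)
    have "(\<lambda>x. B m x y \<oplus>\<^bsub>N\<^esub> B m x z) \<in> lin_hom K (tpow K V m) N"
      by (rule lin_hom_sum[OF add(3,4) N])
    then show ?case by (rule lin_hom_cong[OF _ _ tpow_module]) (use add in \<open>simp add: Ba\<close>)
  qed
  define G where "G y = (SOME h. h \<in> lin_hom K T N \<and> (\<forall>m. \<forall>x\<in>TP m. h x = B m x y))" for y
  have G: "G y \<in> lin_hom K T N \<and> (\<forall>m. \<forall>x\<in>TP m. G y x = B m x y)" if "y \<in> carrier T" for y
  proof -
    have "\<exists>h. h \<in> lin_hom K T N \<and> (\<forall>m. \<forall>x\<in>TP m. h x = B m x y)"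
      using graded_lift[OF N Bl[OF that]] by blast
    from someI_ex[OF this, folded G_def] show ?thesis .
  qed
  have Gc: "G y x \<in> carrier N" if "x \<in> carrier T" "y \<in> carrier T" for x y
    using lin_hom_closed[of "G y" K T N x] G[OF that(2)] that(1) by blast
  have Ga: "G y (x \<oplus>\<^bsub>T\<^esub> x') = G y x \<oplus>\<^bsub>N\<^esub> G y x'" if "x \<in> carrier T" "x' \<in> carrier T" "y \<in> carrier T" for x x' y
    using lin_hom_add[of "G y" K T N x x'] G[OF that(3)] that(1,2) by blast
  have Gs: "G y (a \<odot>\<^bsub>T\<^esub> x) = a \<odot>\<^bsub>N\<^esub> G y x" if "x \<in> carrier T" "a \<in> carrier K" "y \<in> carrier T" for x a y
    using lin_hom_smult[of "G y" K T N a x] G[OF that(3)] that(1,2) by blast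
  have Ga': "G (y \<oplus>\<^bsub>T\<^esub> y') x = G y x \<oplus>\<^bsub>N\<^esub> G y' x" if "x \<in> carrier T" "y \<in> carrier T" "y' \<in> carrier T" for x y y'
    using that(1)
  proof (induction x rule: T_induct_tpow)
    case (tpow n x)
    then show ?case using that by (simp add: G Ba)
  next
    case (add x z)
    then show ?case using that by (simp add: Ga Gc N.a_ac)
  qed
  have Gs': "G (a \<odot>\<^bsub>T\<^esub> y) x = a \<odot>\<^bsub>N\<^esub> G y x" if "x \<in> carrier T" "y \<in> carrier T" "a \<in> carrier K" for x y a
    using that(1)
  proof (induction x rule: T_induct_tpow)
    case (tpow n x)
    then show ?case using that by (simp add: G Bs)
  next
    case (add x z)
    then show ?case using that by (simp add: Ga Gc N.smult_r_distr)
  qed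
  have "\<exists>h\<in>lin_hom K T.T N. \<forall>x\<in>carrier T. \<forall>y\<in>carrier T. h (T.P [x, y]) = G y x"
    by (rule T.bilinear_lift[OF N]) (simp_all add: Gc Ga Ga' Gs Gs')
  then obtain h where h: "h \<in> lin_hom K T.T N" "\<forall>x\<in>carrier T. \<forall>y\<in>carrier T. h (T.P [x, y]) = G y x" by blast
  have "h (T.P [x, y]) = f m n (x \<otimes>\<^bsub>T\<^esub> y)" if "x \<in> TP m" "y \<in> TP n" for m n x y
    using h(2) G[of y] B[of x m] that by (simp add: tpow_T)
  then show ?thesis using h(1) by blast
qed

text \<open>\<open>sp [n\<^sub>1, \<dots>, n\<^sub>k]\<close> cuts a tensor of degree \<open>n\<^sub>1 + \<dots> + n\<^sub>k\<close> into blocks; it identifies that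
  tensor power of \<open>V\<close> with a subspace of the \<open>k\<close>-th tensor power of the tensor algebra, and the
  product of the tensor algebra is its inverse.\<close>

primrec sp :: "nat list \<Rightarrow> ('a, 'c) tensor \<Rightarrow> ('a, ('a, 'c) tensor) tensor" where
  "sp [] = tlift T.T (\<lambda>w. if w = [] then \<one>\<^bsub>T.T\<^esub> else \<zero>\<^bsub>T.T\<^esub>)"
| "sp (n # ns) = (SOME h. h \<in> lin_hom K T T.T \<and>
     (\<forall>x\<in>TP n. \<forall>y\<in>TP (sum_list ns). h (x \<otimes>\<^bsub>T\<^esub> y) = T.inc x \<otimes>\<^bsub>T.T\<^esub> sp ns y))"

lemma sp_Nil: "sp [] \<in> lin_hom K T T.T" "sp [] \<one>\<^bsub>T\<^esub> = \<one>\<^bsub>T.T\<^esub>"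
proof -
  interpret TT: assoc_algebra K T.T by (rule T.T_algebra)
  have m: "multilinear K V T.T (\<lambda>w. if w = [] then \<one>\<^bsub>T.T\<^esub> else \<zero>\<^bsub>T.T\<^esub>)"
    by (rule multilinearI) auto
  note t = tlift[OF T.T_module m, folded sp.simps(1)]
  show "sp [] \<in> lin_hom K T T.T" by (rule t(1))
  show "sp [] \<one>\<^bsub>T\<^esub> = \<one>\<^bsub>T.T\<^esub>" using t(2)[of "[]"] by (simp add: pure_Nil)
qed

lemma sp_Cons_aux:
  assumes "sp ns \<in> lin_hom K T T.T"
  shows "sp (n # ns) \<in> lin_hom K T T.T \<and>
    (\<forall>x\<in>TP n. \<forall>y\<in>TP (sum_list ns). sp (n # ns) (x \<otimes>\<^bsub>T\<^esub> y) = T.inc x \<otimes>\<^bsub>T.T\<^esub> sp ns y)"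
proof -
  have "\<exists>h\<in>lin_hom K T T.T. \<forall>x\<in>TP n. \<forall>y\<in>TP (sum_list ns). h (x \<otimes>\<^bsub>T\<^esub> y) = T.inc x \<otimes>\<^bsub>T.T\<^esub> sp ns y"
    by (rule product_lift[OF T.T_algebra lin_hom_T_tpow[OF T.incl_lin] lin_hom_T_tpow[OF assms]])
  then have "\<exists>h. h \<in> lin_hom K T T.T \<and> (\<forall>x\<in>TP n. \<forall>y\<in>TP (sum_list ns). h (x \<otimes>\<^bsub>T\<^esub> y) = T.inc x \<otimes>\<^bsub>T.T\<^esub> sp ns y)"
    by blast
  from someI_ex[OF this] show ?thesis by simp
qed

lemma sp_lin: "sp ns \<in> lin_hom K T T.T"
proof (induction ns)
  case Nil show ?case by (rule sp_Nil)
next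
  case (Cons n ns) then show ?case using sp_Cons_aux by blast
qed

lemma sp_Cons: "x \<in> TP n \<Longrightarrow> y \<in> TP (sum_list ns) \<Longrightarrow> sp (n # ns) (x \<otimes>\<^bsub>T\<^esub> y) = T.inc x \<otimes>\<^bsub>T.T\<^esub> sp ns y"
  using sp_Cons_aux[OF sp_lin] by blast

declare sp.simps [simp del]

interpretation TT: assoc_algebra K T.T by (rule T.T_algebra)

lemma sp_closed [simp]: "z \<in> carrier T \<Longrightarrow> sp ns z \<in> carrier T.T"
  by (rule lin_hom_closed[OF sp_lin])

lemma sp_add: "x \<in> carrier T \<Longrightarrow> y \<in> carrier T \<Longrightarrow> sp ns (x \<oplus>\<^bsub>T\<^esub> y) = sp ns x \<oplus>\<^bsub>T.T\<^esub> sp ns y"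
  by (rule lin_hom_add[OF sp_lin])

lemma sp_smult: "a \<in> carrier K \<Longrightarrow> x \<in> carrier T \<Longrightarrow> sp ns (a \<odot>\<^bsub>T\<^esub> x) = a \<odot>\<^bsub>T.T\<^esub> sp ns x"
  by (rule lin_hom_smult[OF sp_lin])

lemma sp_zero [simp]: "sp ns \<zero>\<^bsub>T\<^esub> = \<zero>\<^bsub>T.T\<^esub>"
  by (rule lin_hom_zero[OF sp_lin T_module T.T_module])

lemma sp_append:
  "x \<in> TP (sum_list ns) \<Longrightarrow> y \<in> TP (sum_list ms) \<Longrightarrow> sp (ns @ ms) (x \<otimes>\<^bsub>T\<^esub> y) = sp ns x \<otimes>\<^bsub>T.T\<^esub> sp ms y"
proof (induction ns arbitrary: x)
  case Nil
  have "x \<in> TP 0" using Nil by simp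
  then show ?case
  proof (induction x rule: tpow_induct)
    case (pure w)
    then show ?case using Nil(2) by (simp add: pure_Nil sp_Nil tpow_T)
  qed (use Nil(2) in \<open>simp_all add: T.l_distr TT.l_distr sp_add tpow_T T.smult_mult_left TT.smult_mult_left sp_smult\<close>)
next
  case (Cons n ns)
  have "x \<in> TP (n + sum_list ns)" using Cons by simp
  then show ?case
  proof (induction x rule: tpow_induct_mult)
    case (mult a b)
    have "sp ((n # ns) @ ms) (a \<otimes>\<^bsub>T\<^esub> b \<otimes>\<^bsub>T\<^esub> y) = sp (n # (ns @ ms)) (a \<otimes>\<^bsub>T\<^esub> (b \<otimes>\<^bsub>T\<^esub> y))"
      using mult Cons by (simp add: T.m_assoc tpow_T)
    also have "\<dots> = T.inc a \<otimes>\<^bsub>T.T\<^esub> sp (ns @ ms) (b \<otimes>\<^bsub>T\<^esub> y)"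
      using mult Cons by (intro sp_Cons) (auto intro: tpow_mult)
    also have "\<dots> = T.inc a \<otimes>\<^bsub>T.T\<^esub> (sp ns b \<otimes>\<^bsub>T.T\<^esub> sp ms y)" using mult Cons by simp
    also have "\<dots> = sp (n # ns) (a \<otimes>\<^bsub>T\<^esub> b) \<otimes>\<^bsub>T.T\<^esub> sp ms y"
      using mult Cons by (simp add: sp_Cons TT.m_assoc tpow_T)
    finally show ?case .
  qed (use Cons.prems(2) in \<open>simp_all add: T.l_distr TT.l_distr sp_add tpow_T T.smult_mult_left TT.smult_mult_left sp_smult\<close>)
qed

lemma sp_one: "z \<in> TP n \<Longrightarrow> sp [n] z = T.inc z"
  using sp_Cons[of z n "\<one>\<^bsub>T\<^esub>" "[]"] one_tpow by (simp add: sp_Nil tpow_T)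

lemma sp_two: "x \<in> TP m \<Longrightarrow> y \<in> TP n \<Longrightarrow> sp [m, n] (x \<otimes>\<^bsub>T\<^esub> y) = T.P [x, y]"
  by (simp add: sp_Cons sp_one T.pure_two tpow_T)

lemma sp_tpow: "z \<in> TP (sum_list ns) \<Longrightarrow> sp ns z \<in> T.TP (length ns)"
proof (induction ns arbitrary: z)
  case Nil
  have "z \<in> TP 0" using Nil by simp
  then show ?case
  proof (induction z rule: tpow_induct)
    case (pure w)
    then show ?case using T.one_tpow by (simp add: pure_Nil sp_Nil)
  qed (simp_all add: sp_add sp_smult T.tpow_add T.tpow_smult tpow_T)
next
  case (Cons n ns)
  have "z \<in> TP (n + sum_list ns)" using Cons by simp
  then show ?case
  proof (induction z rule: tpow_induct_mult)
    case (mult a b)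
    then show ?case using Cons.IH[of b] T.tpow_mult[OF T.incl_tpow, of a "sp ns b" "length ns"]
      by (simp add: sp_Cons tpow_T)
  qed (simp_all add: sp_add sp_smult T.tpow_add T.tpow_smult tpow_T)
qed

lemma mu_sp: "z \<in> TP (sum_list ns) \<Longrightarrow> T.mu (sp ns z) = z"
proof (induction ns arbitrary: z)
  case Nil
  have "z \<in> TP 0" using Nil by simp
  then show ?case
  proof (induction z rule: tpow_induct)
    case (pure w)
    then show ?case by (simp add: pure_Nil sp_Nil T.mu_one[OF T_algebra])
  qed (simp_all add: sp_add sp_smult tpow_T lin_hom_add[OF T.mu_lin[OF T_algebra]] lin_hom_smult[OF T.mu_lin[OF T_algebra]])
next
  case (Cons n ns)
  have "z \<in> TP (n + sum_list ns)" using Cons by simp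
  then show ?case
  proof (induction z rule: tpow_induct_mult)
    case (mult a b)
    then show ?case using Cons.IH[of b]
      by (simp add: sp_Cons tpow_T T.mu_mult[OF T_algebra] T.mu_incl[OF T_algebra])
  qed (simp_all add: sp_add sp_smult tpow_T lin_hom_add[OF T.mu_lin[OF T_algebra]] lin_hom_smult[OF T.mu_lin[OF T_algebra]])
qed

text \<open>Each factor of a pure tensor over \<open>T(V)\<close> is a sum of homogeneous tensors, so split tensors span.
  This reduces identities between maps on tensor powers of \<open>T(V)\<close> to identities between operators on
  tensor powers of \<open>V\<close>.\<close>

lemma TT_induct [consumes 1, case_names sp add smult]:
  assumes Z: "Z \<in> T.TP p"
    and sp: "\<And>ns z. length ns = p \<Longrightarrow> z \<in> TP (sum_list ns) \<Longrightarrow> Q (sp ns z)"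
    and add: "\<And>x y. x \<in> T.TP p \<Longrightarrow> y \<in> T.TP p \<Longrightarrow> Q x \<Longrightarrow> Q y \<Longrightarrow> Q (x \<oplus>\<^bsub>T.T\<^esub> y)"
    and smult: "\<And>a x. a \<in> carrier K \<Longrightarrow> x \<in> T.TP p \<Longrightarrow> Q x \<Longrightarrow> Q (a \<odot>\<^bsub>T.T\<^esub> x)"
  shows "Q Z"
  using Z
proof (induction Z rule: T.tpow_induct)
  case (pure xs)
  have *: "Q (sp ms z \<otimes>\<^bsub>T.T\<^esub> T.P xs)"
    if "xs \<in> T.L" "length ms + length xs = p" "z \<in> TP (sum_list ms)" for xs ms z
    using that
  proof (induction xs arbitrary: ms z rule: list.induct)
    case Nil
    then show ?case using sp[of ms z] by (simp add: T.pure_Nil tpow_T)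
  next
    case (Cons x xs)
    have x: "x \<in> carrier T" and xs: "xs \<in> T.L" using Cons.prems(1) by simp_all
    have mem: "sp ms z \<otimes>\<^bsub>T.T\<^esub> (T.inc y \<otimes>\<^bsub>T.T\<^esub> T.P xs) \<in> T.TP p" if "y \<in> carrier T" for y
    proof -
      have "sp ms z \<otimes>\<^bsub>T.T\<^esub> (T.inc y \<otimes>\<^bsub>T.T\<^esub> T.P xs) \<in> T.TP (length ms + (1 + length xs))"
        using Cons.prems xs that by (intro T.tpow_mult sp_tpow T.incl_tpow T.pure_tpow) auto
      then show ?thesis using Cons.prems by simp
    qed
    from x have "Q (sp ms z \<otimes>\<^bsub>T.T\<^esub> (T.inc x \<otimes>\<^bsub>T.T\<^esub> T.P xs))"
    proof (induction x rule: T_induct_tpow)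
      case (tpow n x)
      have "Q (sp (ms @ [n]) (z \<otimes>\<^bsub>T\<^esub> x) \<otimes>\<^bsub>T.T\<^esub> T.P xs)"
        using Cons.prems tpow xs tpow_mult[OF Cons.prems(3) tpow] by (intro Cons.IH) auto
      then show ?case using Cons.prems tpow xs
        by (simp add: sp_append sp_one tpow_T TT.m_assoc)
    next
      case (add x y)
      then show ?case using mem xs Cons.prems
        by (simp add: lin_hom_add[OF T.incl_lin] TT.l_distr TT.r_distr tpow_T assms(3))
    qed
    then show ?case using x xs by (simp add: T.pure_Cons_incl)
  qed
  show ?case using *[of xs "[]" "\<one>\<^bsub>T\<^esub>"] pure one_tpow by (simp add: sp_Nil)
qed (rule add smult; assumption)+

lemma TT_eqI:
  assumes f: "f \<in> lin_hom K (tpow K T p) N" and g: "g \<in> lin_hom K (tpow K T p) N"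
    and eq: "\<And>ns z. length ns = p \<Longrightarrow> z \<in> TP (sum_list ns) \<Longrightarrow> f (sp ns z) = g (sp ns z)"
    and Z: "Z \<in> T.TP p"
  shows "f Z = g Z"
  using Z
proof (induction Z rule: TT_induct)
  case (add x y)
  then show ?case using lin_hom_add[OF f, of x y] lin_hom_add[OF g, of x y] by simp
next
  case (smult a x)
  then show ?case using lin_hom_smult[OF f, of a x] lin_hom_smult[OF g, of a x] by simp
qed (simp add: eq)

lemma TT_eqI1:
  assumes "f \<in> lin_hom K (tpow K T 1) N" and "g \<in> lin_hom K (tpow K T 1) N"
    and eq: "\<And>n z. z \<in> TP n \<Longrightarrow> f (sp [n] z) = g (sp [n] z)"
    and Z: "Z \<in> T.TP 1"
  shows "f Z = g Z"
proof (rule TT_eqI[OF assms(1,2) _ Z])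
  fix ns z assume ns: "length ns = 1" and z: "z \<in> TP (sum_list ns)"
  from ns obtain n where "ns = [n]" by (auto simp: length_Suc_conv)
  then show "f (sp ns z) = g (sp ns z)" using eq z by simp
qed

lemma TT_eqI2:
  assumes "f \<in> lin_hom K (tpow K T 2) N" and "g \<in> lin_hom K (tpow K T 2) N"
    and eq: "\<And>m n z. z \<in> TP (m + n) \<Longrightarrow> f (sp [m, n] z) = g (sp [m, n] z)"
    and Z: "Z \<in> T.TP 2"
  shows "f Z = g Z"
proof (rule TT_eqI[OF assms(1,2) _ Z])
  fix ns z assume ns: "length ns = 2" and z: "z \<in> TP (sum_list ns)"
  from ns obtain m n where "ns = [m, n]" by (auto simp: length_Suc_conv numeral_2_eq_2)
  then show "f (sp ns z) = g (sp ns z)" using eq z by simp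
qed

lemma TT_eqI3:
  assumes "f \<in> lin_hom K (tpow K T 3) N" and "g \<in> lin_hom K (tpow K T 3) N"
    and eq: "\<And>l m n z. z \<in> TP (l + (m + n)) \<Longrightarrow> f (sp [l, m, n] z) = g (sp [l, m, n] z)"
    and Z: "Z \<in> T.TP 3"
  shows "f Z = g Z"
proof (rule TT_eqI[OF assms(1,2) _ Z])
  fix ns z assume ns: "length ns = 3" and z: "z \<in> TP (sum_list ns)"
  from ns obtain l m n where "ns = [l, m, n]" by (auto simp: length_Suc_conv numeral_3_eq_3)
  then show "f (sp ns z) = g (sp ns z)" using eq z by simp
qed

lemma bigraded_lift_sp:
  assumes N: "module K N" and f: "\<And>m n. f m n \<in> lin_hom K (tpow K V (m + n)) N"
  shows "\<exists>h\<in>lin_hom K T.T N. \<forall>m n. \<forall>z\<in>TP (m + n). h (sp [m, n] z) = f m n z"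
proof -
  obtain h where h: "h \<in> lin_hom K T.T N" "\<And>m n x y. x \<in> TP m \<Longrightarrow> y \<in> TP n \<Longrightarrow> h (T.P [x, y]) = f m n (x \<otimes>\<^bsub>T\<^esub> y)"
    using bigraded_lift[OF N f] by blast
  have "h (sp [m, n] z) = f m n z" if "z \<in> TP (m + n)" for m n z
    by (rule tpow_eqI_mult[OF lin_hom_T_tpow[OF lin_hom_comp[OF sp_lin h(1)]] f _ that])
      (simp add: sp_two h(2))
  then show ?thesis using h(1) by blast
qed

lemma graded_lift_sp:
  assumes N: "module K N" and f: "\<And>n. f n \<in> lin_hom K (tpow K V n) N"
  shows "\<exists>h\<in>lin_hom K T.T N. \<forall>n. \<forall>z\<in>TP n. h (sp [n] z) = f n z"
proof -
  obtain h where h: "h \<in> lin_hom K T N" "\<And>n x. x \<in> TP n \<Longrightarrow> h x = f n x"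
    using graded_lift[OF N f] by blast
  have "h (T.pr1 (sp [n] z)) = f n z" if "z \<in> TP n" for n z
    using that by (simp add: sp_one T.pr1(2) h(2) tpow_T)
  then show ?thesis
    by (intro bexI[OF _ lin_hom_comp[OF T.pr1(1) h(1)]] allI ballI)
qed

end


section \<open>The braided bialgebra structure of the tensor algebra\<close>

context vec
begin

interpretation T: assoc_algebra K T by (rule T_algebra)

lemma tpow_finsum: "(\<And>i. i \<in> I' \<Longrightarrow> f i \<in> TP n) \<Longrightarrow> finsum T f I' \<in> TP n"
proof (induction I' rule: infinite_finite_induct)
  case (insert i I')
  have t: "f k \<in> carrier T" if "k \<in> insert i I'" for k using insert.prems tpow_T that by blast
  have "finsum T f (insert i I') = f i \<oplus>\<^bsub>T\<^esub> finsum T f I'"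
    using insert.hyps t by (intro T.finsum_insert) auto
  then show ?case using insert by (simp add: tpow_add)
qed (simp_all add: tpow_zero T.finsum_infinite)

lemma lin_tpow_finsum:
  assumes N: "module K N" and h: "h \<in> lin_hom K (tpow K V n) N" and "\<And>i. i \<in> I' \<Longrightarrow> f i \<in> TP n"
  shows "h (finsum T f I') = finsum N (\<lambda>i. h (f i)) I'"
proof -
  interpret N: module K N by fact
  have z: "h \<zero>\<^bsub>T\<^esub> = \<zero>\<^bsub>N\<^esub>" using lin_hom_zero[OF h tpow_module N] by simp
  from assms(3) show ?thesis
  proof (induction I' rule: infinite_finite_induct)
    case (insert i I')
    have c: "h (f k) \<in> carrier N" if "k \<in> insert i I'" for k using insert.prems lin_hom_closed[OF h] that by blast
    have t: "f k \<in> carrier T" if "k \<in> insert i I'" for k using insert.prems tpow_T that by blast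
    have "h (finsum T f (insert i I')) = h (f i \<oplus>\<^bsub>T\<^esub> finsum T f I')"
      using insert.hyps t by (subst T.finsum_insert) auto
    also have "\<dots> = h (f i) \<oplus>\<^bsub>N\<^esub> h (finsum T f I')"
      using lin_hom_add[OF h, of "f i" "finsum T f I'"] insert.prems tpow_finsum[of I' f n] by simp
    also have "\<dots> = finsum N (\<lambda>i. h (f i)) (insert i I')"
      using insert c by (subst N.finsum_insert) auto
    finally show ?case .
  qed (simp_all add: z T.finsum_infinite N.finsum_infinite)
qed

end

context braided_vector_space
begin

interpretation T: assoc_algebra K T by (rule T_algebra)
interpretation TT: assoc_algebra K T.T by (rule T.T_algebra)

text \<open>If \<open>f\<close> and \<open>g\<close> act on split tensors through families of operators on consecutive strands, then so
  does \<open>f \<otimes> g\<close>: the operators of \<open>f\<close> act on the first block of strands, those of \<open>g\<close> on the block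
  after it. This computes every map in the axioms of a braided bialgebra.\<close>

lemma tens_sp:
  assumes f: "f \<in> lin_hom K (tpow K T p) T.T" and g: "g \<in> lin_hom K (tpow K T q) T.T"
    and len: "length ns = p" "length ms = q" and fin: "finite A" "finite B"
    and fs: "\<And>x. x \<in> TP (sum_list ns) \<Longrightarrow> f (sp ns x) = (\<Oplus>\<^bsub>T.T\<^esub>i\<in>A. sp (ns' i) (X i 0 x))"
    and gs: "\<And>y. y \<in> TP (sum_list ms) \<Longrightarrow> g (sp ms y) = (\<Oplus>\<^bsub>T.T\<^esub>k\<in>B. sp (ms' k) (Y k 0 y))"
    and X: "\<And>i. i \<in> A \<Longrightarrow> fam (sum_list ns) (X i)" "\<And>i. i \<in> A \<Longrightarrow> sum_list (ns' i) = sum_list ns"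
    and Y: "\<And>k. k \<in> B \<Longrightarrow> fam (sum_list ms) (Y k)" "\<And>k. k \<in> B \<Longrightarrow> sum_list (ms' k) = sum_list ms"
    and z: "z \<in> TP (sum_list ns + sum_list ms)"
  shows "tens K T p f q g (sp (ns @ ms) z) =
    (\<Oplus>\<^bsub>T.T\<^esub>i\<in>A. \<Oplus>\<^bsub>T.T\<^esub>k\<in>B. sp (ns' i @ ms' k) (X i 0 (Y k (sum_list ns) z)))"
proof (rule tpow_eqI_mult[OF _ _ _ z])
  have cl: "X i 0 (Y k l z) \<in> carrier T" if "i \<in> A" "k \<in> B" "z \<in> carrier T" for i k l z
    using that by (simp add: fam_closed[OF X(1)] fam_closed[OF Y(1)])
  have spm: "sp (ns @ ms) z \<in> T.TP (p + q)" if "z \<in> TP (sum_list ns + sum_list ms)" for z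
    using sp_tpow[of z "ns @ ms"] that len by simp
  have "(\<lambda>z. sp (ns @ ms) z) \<in> lin_hom K (tpow K V (sum_list ns + sum_list ms)) (tpow K T (p + q))"
    by (rule T.lin_hom_into_tpow[OF lin_hom_T_tpow[OF sp_lin] spm])
  from lin_hom_comp[OF this T.tens_lin[OF f g]]
  show "(\<lambda>z. tens K T p f q g (sp (ns @ ms) z)) \<in> lin_hom K (tpow K V (sum_list ns + sum_list ms)) T.T" .
  show "(\<lambda>z. \<Oplus>\<^bsub>T.T\<^esub>i\<in>A. \<Oplus>\<^bsub>T.T\<^esub>k\<in>B. sp (ns' i @ ms' k) (X i 0 (Y k (sum_list ns) z)))
    \<in> lin_hom K (tpow K V (sum_list ns + sum_list ms)) T.T"
    by (intro lin_hom_finsum_map tpow_module T.T_module lin_hom_T_tpow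
        lin_hom_comp[OF lin_hom_comp[OF fam_lin[OF Y(1)] fam_lin[OF X(1)]] sp_lin])
  fix x y assume x: "x \<in> TP (sum_list ns)" and y: "y \<in> TP (sum_list ms)"
  have sx: "sp ns x \<in> T.TP p" using sp_tpow[OF x] len by simp
  have sy: "sp ms y \<in> T.TP q" using sp_tpow[OF y] len by simp
  have Xc: "X i 0 x \<in> TP (sum_list (ns' i))" if "i \<in> A" for i
    using fam_tpow[OF X(1)[OF that] x] X(2)[OF that] by simp
  have Yc: "Y k 0 y \<in> TP (sum_list (ms' k))" if "k \<in> B" for k
    using fam_tpow[OF Y(1)[OF that] y] Y(2)[OF that] by simp
  have op: "sp (ns' i @ ms' k) (X i 0 (Y k (sum_list ns) (x \<otimes>\<^bsub>T\<^esub> y))) =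
    sp (ns' i) (X i 0 x) \<otimes>\<^bsub>T.T\<^esub> sp (ms' k) (Y k 0 y)" if i: "i \<in> A" and k: "k \<in> B" for i k
  proof -
    have "Y k (sum_list ns) (x \<otimes>\<^bsub>T\<^esub> y) = x \<otimes>\<^bsub>T\<^esub> Y k 0 y"
      using fam_left[OF Y(1)[OF k] x tpow_T[OF y], of 0] by simp
    moreover have "X i 0 (x \<otimes>\<^bsub>T\<^esub> Y k 0 y) = X i 0 x \<otimes>\<^bsub>T\<^esub> Y k 0 y"
      using fam_right[OF X(1)[OF i] x, of 0] tpow_T[OF Yc[OF k]] by simp
    ultimately show ?thesis by (simp add: sp_append[OF Xc[OF i] Yc[OF k]])
  qed
  have "tens K T p f q g (sp (ns @ ms) (x \<otimes>\<^bsub>T\<^esub> y)) = f (sp ns x) \<otimes>\<^bsub>T.T\<^esub> g (sp ms y)"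
    by (simp add: sp_append[OF x y] T.tens_mult[OF f g sx sy])
  also have "\<dots> = (\<Oplus>\<^bsub>T.T\<^esub>i\<in>A. \<Oplus>\<^bsub>T.T\<^esub>k\<in>B. sp (ns' i) (X i 0 x) \<otimes>\<^bsub>T.T\<^esub> sp (ms' k) (Y k 0 y))"
  proof -
    have 1: "(\<lambda>i. sp (ns' i) (X i 0 x)) \<in> A \<rightarrow> carrier T.T" by (intro funcsetI sp_closed tpow_T[OF Xc])
    have 2: "(\<lambda>k. sp (ms' k) (Y k 0 y)) \<in> B \<rightarrow> carrier T.T" by (intro funcsetI sp_closed tpow_T[OF Yc])
    have "f (sp ns x) \<otimes>\<^bsub>T.T\<^esub> g (sp ms y) =
      (\<Oplus>\<^bsub>T.T\<^esub>i\<in>A. sp (ns' i) (X i 0 x) \<otimes>\<^bsub>T.T\<^esub> (\<Oplus>\<^bsub>T.T\<^esub>k\<in>B. sp (ms' k) (Y k 0 y)))"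
      unfolding fs[OF x] gs[OF y] by (rule TT.finsum_ldistr[OF fin(1) TT.finsum_closed[OF 2] 1])
    also have "\<dots> = (\<Oplus>\<^bsub>T.T\<^esub>i\<in>A. \<Oplus>\<^bsub>T.T\<^esub>k\<in>B. sp (ns' i) (X i 0 x) \<otimes>\<^bsub>T.T\<^esub> sp (ms' k) (Y k 0 y))"
    proof (rule TT.finsum_cong'[OF refl])
      show "(\<lambda>i. \<Oplus>\<^bsub>T.T\<^esub>k\<in>B. sp (ns' i) (X i 0 x) \<otimes>\<^bsub>T.T\<^esub> sp (ms' k) (Y k 0 y)) \<in> A \<rightarrow> carrier T.T"
        using 1 2 by (intro funcsetI TT.finsum_closed TT.m_closed) (auto dest: funcset_mem)
      show "sp (ns' i) (X i 0 x) \<otimes>\<^bsub>T.T\<^esub> (\<Oplus>\<^bsub>T.T\<^esub>k\<in>B. sp (ms' k) (Y k 0 y)) =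
        (\<Oplus>\<^bsub>T.T\<^esub>k\<in>B. sp (ns' i) (X i 0 x) \<otimes>\<^bsub>T.T\<^esub> sp (ms' k) (Y k 0 y))" if "i \<in> A" for i
        by (rule TT.finsum_rdistr[OF fin(2) _ 2]) (use 1 that in auto)
    qed
    finally show ?thesis .
  qed
  also have "\<dots> = (\<Oplus>\<^bsub>T.T\<^esub>i\<in>A. \<Oplus>\<^bsub>T.T\<^esub>k\<in>B. sp (ns' i @ ms' k) (X i 0 (Y k (sum_list ns) (x \<otimes>\<^bsub>T\<^esub> y))))"
    using x y by (intro TT.finsum_cong' refl funcsetI TT.finsum_closed sp_closed cl op[symmetric]) (auto simp: tpow_T)
  finally show "tens K T p f q g (sp (ns @ ms) (x \<otimes>\<^bsub>T\<^esub> y)) =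
    (\<Oplus>\<^bsub>T.T\<^esub>i\<in>A. \<Oplus>\<^bsub>T.T\<^esub>k\<in>B. sp (ns' i @ ms' k) (X i 0 (Y k (sum_list ns) (x \<otimes>\<^bsub>T\<^esub> y))))" .
qed

lemma tens_sp_left:
  assumes f: "f \<in> lin_hom K (tpow K T p) T.T"
    and len: "length ns = p" "length ms = q" and fin: "finite A"
    and fs: "\<And>x. x \<in> TP (sum_list ns) \<Longrightarrow> f (sp ns x) = (\<Oplus>\<^bsub>T.T\<^esub>i\<in>A. sp (ns' i) (X i 0 x))"
    and X: "\<And>i. i \<in> A \<Longrightarrow> fam (sum_list ns) (X i)" "\<And>i. i \<in> A \<Longrightarrow> sum_list (ns' i) = sum_list ns"
    and z: "z \<in> TP (sum_list ns + sum_list ms)"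
  shows "tens K T p f q (\<lambda>x. x) (sp (ns @ ms) z) = (\<Oplus>\<^bsub>T.T\<^esub>i\<in>A. sp (ns' i @ ms) (X i 0 z))"
proof -
  have "tens K T p f q (\<lambda>x. x) (sp (ns @ ms) z) =
    (\<Oplus>\<^bsub>T.T\<^esub>i\<in>A. \<Oplus>\<^bsub>T.T\<^esub>k\<in>{()}. sp (ns' i @ ms) (X i 0 z))"
    using tens_sp[OF f T.id_lin len fin _ fs _ X, of "{()}" "\<lambda>_. ms" "\<lambda>_ k z. z" z] z fam.id[of "sum_list ms"]
    by (simp add: tpow_T)
  also have "\<dots> = (\<Oplus>\<^bsub>T.T\<^esub>i\<in>A. sp (ns' i @ ms) (X i 0 z))"
    using z by (intro TT.finsum_cong') (auto simp: tpow_T fam_closed[OF X(1)])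
  finally show ?thesis .
qed

lemma tens_sp_right:
  assumes f: "f \<in> lin_hom K (tpow K T p) T.T"
    and len: "length ms = q" "length ns = p" and fin: "finite A"
    and fs: "\<And>x. x \<in> TP (sum_list ns) \<Longrightarrow> f (sp ns x) = (\<Oplus>\<^bsub>T.T\<^esub>i\<in>A. sp (ns' i) (X i 0 x))"
    and X: "\<And>i. i \<in> A \<Longrightarrow> fam (sum_list ns) (X i)" "\<And>i. i \<in> A \<Longrightarrow> sum_list (ns' i) = sum_list ns"
    and z: "z \<in> TP (sum_list ms + sum_list ns)"
  shows "tens K T q (\<lambda>x. x) p f (sp (ms @ ns) z) = (\<Oplus>\<^bsub>T.T\<^esub>i\<in>A. sp (ms @ ns' i) (X i (sum_list ms) z))"
proof -
  have c: "(\<Oplus>\<^bsub>T.T\<^esub>i\<in>A. sp (ms @ ns' i) (X i (sum_list ms) z)) \<in> carrier T.T"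
    using z by (intro TT.finsum_closed funcsetI sp_closed fam_closed[OF X(1)] tpow_T) auto
  have "tens K T q (\<lambda>x. x) p f (sp (ms @ ns) z) =
    (\<Oplus>\<^bsub>T.T\<^esub>k\<in>{()}. \<Oplus>\<^bsub>T.T\<^esub>i\<in>A. sp (ms @ ns' i) (X i (sum_list ms) z))"
    using tens_sp[OF T.id_lin f len _ fin _ fs _ _ X, of "{()}" "\<lambda>_. ms" "\<lambda>_ k z. z" z] z fam.id[of "sum_list ms"]
    by (simp add: tpow_T)
  then show ?thesis using c by simp
qed

lemma tens_sp_left1:
  assumes f: "f \<in> lin_hom K (tpow K T p) T.T" and len: "length ns = p" "length ms = q"
    and fs: "\<And>x. x \<in> TP (sum_list ns) \<Longrightarrow> f (sp ns x) = sp ns' (X 0 x)"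
    and X: "fam (sum_list ns) X" "sum_list ns' = sum_list ns" and z: "z \<in> TP (sum_list ns + sum_list ms)"
  shows "tens K T p f q (\<lambda>x. x) (sp (ns @ ms) z) = sp (ns' @ ms) (X 0 z)"
  using tens_sp_left[OF f len, of "{()}" "\<lambda>_. ns'" "\<lambda>_. X" z] fs X z
  by (simp add: tpow_T fam_closed[OF X(1)])

lemma tens_sp_right1:
  assumes f: "f \<in> lin_hom K (tpow K T p) T.T" and len: "length ms = q" "length ns = p"
    and fs: "\<And>x. x \<in> TP (sum_list ns) \<Longrightarrow> f (sp ns x) = sp ns' (X 0 x)"
    and X: "fam (sum_list ns) X" "sum_list ns' = sum_list ns" and z: "z \<in> TP (sum_list ms + sum_list ns)"
  shows "tens K T q (\<lambda>x. x) p f (sp (ms @ ns) z) = sp (ms @ ns') (X (sum_list ms) z)"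
  using tens_sp_right[OF f len, of "{()}" "\<lambda>_. ns'" "\<lambda>_. X" z] fs X z
  by (simp add: tpow_T fam_closed[OF X(1)])

lemma lin_hom_sp_tpow:
  assumes h: "h \<in> lin_hom K T.T T.T" and "\<And>ns z. length ns = p \<Longrightarrow> z \<in> TP (sum_list ns) \<Longrightarrow> h (sp ns z) \<in> T.TP q"
  shows "h \<in> lin_hom K (tpow K T p) (tpow K T q)"
proof (rule T.lin_hom_into_tpow[OF T.lin_hom_T_tpow[OF h]])
  fix x assume "x \<in> T.TP p"
  then show "h x \<in> T.TP q"
    by (induction x rule: TT_induct)
      (simp_all add: assms(2) lin_hom_add[OF h] lin_hom_smult[OF h] T.tpow_T T.tpow_add T.tpow_smult)
qed

subsection \<open>The structure maps\<close>

text \<open>In the braiding two blocks of letters cross as wholes, the components of the comultiplication are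
  the quantum shuffles, and the counit is the projection to degree zero.\<close>

definition cT :: "('a, ('a, 'c) tensor) tensor \<Rightarrow> ('a, ('a, 'c) tensor) tensor" where
  "cT = (SOME h. h \<in> lin_hom K T.T T.T \<and> (\<forall>m n. \<forall>z\<in>TP (m + n). h (sp [m, n] z) = sp [n, m] (C 0 m n z)))"

definition DT :: "('a, ('a, 'c) tensor) tensor \<Rightarrow> ('a, ('a, 'c) tensor) tensor" where
  "DT = (SOME h. h \<in> lin_hom K T.T T.T \<and>
     (\<forall>n. \<forall>z\<in>TP n. h (sp [n] z) = (\<Oplus>\<^bsub>T.T\<^esub>a\<in>{..n}. sp [a, n - a] (sh 0 n a z))))"

definition eT :: "('a, ('a, 'c) tensor) tensor \<Rightarrow> ('a, ('a, 'c) tensor) tensor" where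
  "eT = (SOME h. h \<in> lin_hom K T.T T.T \<and>
     (\<forall>n. \<forall>z\<in>TP n. h (sp [n] z) = (if n = 0 then sp [] z else \<zero>\<^bsub>T.T\<^esub>)))"

lemma cT: "cT \<in> lin_hom K T.T T.T" "z \<in> TP (m + n) \<Longrightarrow> cT (sp [m, n] z) = sp [n, m] (C 0 m n z)"
proof -
  have "\<exists>h\<in>lin_hom K T.T T.T. \<forall>m n. \<forall>z\<in>TP (m + n). h (sp [m, n] z) = sp [n, m] (C 0 m n z)"
    by (rule bigraded_lift_sp[OF T.T_module]) (intro lin_hom_T_tpow lin_hom_comp[OF C_lin sp_lin])
  then have "\<exists>h. h \<in> lin_hom K T.T T.T \<and> (\<forall>m n. \<forall>z\<in>TP (m + n). h (sp [m, n] z) = sp [n, m] (C 0 m n z))"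
    by blast
  from someI_ex[OF this, folded cT_def]
  show "cT \<in> lin_hom K T.T T.T" "z \<in> TP (m + n) \<Longrightarrow> cT (sp [m, n] z) = sp [n, m] (C 0 m n z)" by blast+
qed

lemma DT: "DT \<in> lin_hom K T.T T.T" "z \<in> TP n \<Longrightarrow> DT (sp [n] z) = (\<Oplus>\<^bsub>T.T\<^esub>a\<in>{..n}. sp [a, n - a] (sh 0 n a z))"
proof -
  have "\<exists>h\<in>lin_hom K T.T T.T. \<forall>n. \<forall>z\<in>TP n. h (sp [n] z) = (\<Oplus>\<^bsub>T.T\<^esub>a\<in>{..n}. sp [a, n - a] (sh 0 n a z))"
    by (rule graded_lift_sp[OF T.T_module])
      (intro lin_hom_T_tpow lin_hom_finsum_map T_module T.T_module lin_hom_comp[OF sh_lin sp_lin])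
  then have "\<exists>h. h \<in> lin_hom K T.T T.T \<and>
     (\<forall>n. \<forall>z\<in>TP n. h (sp [n] z) = (\<Oplus>\<^bsub>T.T\<^esub>a\<in>{..n}. sp [a, n - a] (sh 0 n a z)))"
    by blast
  from someI_ex[OF this, folded DT_def]
  show "DT \<in> lin_hom K T.T T.T" "z \<in> TP n \<Longrightarrow> DT (sp [n] z) = (\<Oplus>\<^bsub>T.T\<^esub>a\<in>{..n}. sp [a, n - a] (sh 0 n a z))"
    by blast+
qed

lemma eT: "eT \<in> lin_hom K T.T T.T" "z \<in> TP n \<Longrightarrow> eT (sp [n] z) = (if n = 0 then sp [] z else \<zero>\<^bsub>T.T\<^esub>)"
proof -
  have l: "(\<lambda>z. if n = 0 then sp [] z else \<zero>\<^bsub>T.T\<^esub>) \<in> lin_hom K T T.T" for n :: nat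
    using sp_lin lin_hom_zero_map[OF T.T_module] by (cases "n = 0") auto
  have "\<exists>h\<in>lin_hom K T.T T.T. \<forall>n. \<forall>z\<in>TP n. h (sp [n] z) = (if n = 0 then sp [] z else \<zero>\<^bsub>T.T\<^esub>)"
    by (rule graded_lift_sp[OF T.T_module lin_hom_T_tpow[OF l]])
  then have "\<exists>h. h \<in> lin_hom K T.T T.T \<and>
     (\<forall>n. \<forall>z\<in>TP n. h (sp [n] z) = (if n = 0 then sp [] z else \<zero>\<^bsub>T.T\<^esub>))"
    by blast
  from someI_ex[OF this, folded eT_def]
  show "eT \<in> lin_hom K T.T T.T" "z \<in> TP n \<Longrightarrow> eT (sp [n] z) = (if n = 0 then sp [] z else \<zero>\<^bsub>T.T\<^esub>)"
    by blast+
qed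

lemma cT_lin: "cT \<in> lin_hom K (tpow K T 2) (tpow K T 2)"
proof (rule lin_hom_sp_tpow[OF cT(1)])
  fix ns :: "nat list" and z assume ns: "length ns = 2" and z: "z \<in> TP (sum_list ns)"
  from ns obtain m n where "ns = [m, n]" by (auto simp: length_Suc_conv numeral_2_eq_2)
  then show "cT (sp ns z) \<in> T.TP 2"
    using z sp_tpow[of "C 0 m n z" "[n, m]"] C_tpow[of z "m + n" 0 m n]
    by (simp add: cT(2) add.commute numeral_2_eq_2)
qed

lemma sp_sh_tpow: "z \<in> TP n \<Longrightarrow> a \<le> n \<Longrightarrow> sp [a, n - a] (sh k n a z) \<in> T.TP 2"
  using sp_tpow[of "sh k n a z" "[a, n - a]"] sh_tpow[of z n k n a] by (simp add: numeral_2_eq_2)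

lemma DT_lin: "DT \<in> lin_hom K (tpow K T 1) (tpow K T 2)"
proof (rule lin_hom_sp_tpow[OF DT(1)])
  fix ns :: "nat list" and z assume ns: "length ns = 1" and z: "z \<in> TP (sum_list ns)"
  from ns obtain n where "ns = [n]" by (auto simp: length_Suc_conv)
  then show "DT (sp ns z) \<in> T.TP 2"
    using z sp_sh_tpow[of z n _ 0] by (auto simp: DT(2) intro!: T.tpow_finsum)
qed

lemma eT_lin: "eT \<in> lin_hom K (tpow K T 1) (tpow K T 0)"
proof (rule lin_hom_sp_tpow[OF eT(1)])
  fix ns :: "nat list" and z assume ns: "length ns = 1" and z: "z \<in> TP (sum_list ns)"
  from ns obtain n where "ns = [n]" by (auto simp: length_Suc_conv)
  then show "eT (sp ns z) \<in> T.TP 0"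
    using z sp_tpow[of z "[]"] by (auto simp: eT(2) T.tpow_zero)
qed

abbreviation "mT \<equiv> mult_map K T"
abbreviation "uT \<equiv> unit_map K T"
abbreviation "idm \<equiv> \<lambda>x. x"

lemmas mT_lin = T.mult_map_lin[OF T_algebra]
  and uT_lin = T.unit_map_lin[OF T_algebra]

lemma mT: "z \<in> TP (m + n) \<Longrightarrow> mT (sp [m, n] z) = sp [m + n] z"
  using sp_tpow[of z "[m, n]"] mu_sp[of z "[m, n]"]
  by (simp add: T.mult_map[OF T_algebra] numeral_2_eq_2 sp_one)

lemma uT: "z \<in> TP 0 \<Longrightarrow> uT (sp [] z) = sp [0] z"
  using sp_tpow[of z "[]"] mu_sp[of z "[]"]
  by (simp add: T.unit_map[OF T_algebra] sp_one)

lemma id_lin': "idm \<in> lin_hom K (tpow K T n) (tpow K T n)"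
  by (rule lin_homI) auto

lemma lins:
  shows cL_lin: "tens K T 2 cT 1 idm \<in> lin_hom K (tpow K T 3) (tpow K T 3)"
    and cR_lin: "tens K T 1 idm 2 cT \<in> lin_hom K (tpow K T 3) (tpow K T 3)"
    and mL_lin: "tens K T 2 mT 1 idm \<in> lin_hom K (tpow K T 3) (tpow K T 2)"
    and mR_lin: "tens K T 1 idm 2 mT \<in> lin_hom K (tpow K T 3) (tpow K T 2)"
    and uL_lin: "tens K T 0 uT 1 idm \<in> lin_hom K (tpow K T 1) (tpow K T 2)"
    and uR_lin: "tens K T 1 idm 0 uT \<in> lin_hom K (tpow K T 1) (tpow K T 2)"
    and DL_lin: "tens K T 1 DT 1 idm \<in> lin_hom K (tpow K T 2) (tpow K T 3)"
    and DR_lin: "tens K T 1 idm 1 DT \<in> lin_hom K (tpow K T 2) (tpow K T 3)"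
    and eL_lin: "tens K T 1 eT 1 idm \<in> lin_hom K (tpow K T 2) (tpow K T 1)"
    and eR_lin: "tens K T 1 idm 1 eT \<in> lin_hom K (tpow K T 2) (tpow K T 1)"
    and DD_lin: "tens K T 1 DT 1 DT \<in> lin_hom K (tpow K T 2) (tpow K T 4)"
    and mm_lin: "tens K T 2 mT 2 mT \<in> lin_hom K (tpow K T 4) (tpow K T 2)"
    and cM_lin: "tens K T 1 idm 3 (tens K T 2 cT 1 idm) \<in> lin_hom K (tpow K T 4) (tpow K T 4)"
    and ee_lin: "tens K T 1 eT 1 eT \<in> lin_hom K (tpow K T 2) (tpow K T 0)"
    and uu_lin: "tens K T 0 uT 0 uT \<in> lin_hom K (tpow K T 0) (tpow K T 2)"
proof -
  have n: "2 + 1 = (3::nat)" "1 + 2 = (3::nat)" "1 + 1 = (2::nat)" "2 + 2 = (4::nat)" "1 + 3 = (4::nat)"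
    "0 + 1 = (1::nat)" "1 + 0 = (1::nat)" "0 + 0 = (0::nat)" by simp_all
  note t = T.tens_tpow
  show c: "tens K T 2 cT 1 idm \<in> lin_hom K (tpow K T 3) (tpow K T 3)"
    using t[OF cT_lin id_lin'[of 1]] unfolding n .
  show "tens K T 1 idm 2 cT \<in> lin_hom K (tpow K T 3) (tpow K T 3)"
    using t[OF id_lin'[of 1] cT_lin] unfolding n .
  show "tens K T 2 mT 1 idm \<in> lin_hom K (tpow K T 3) (tpow K T 2)"
    using t[OF mT_lin id_lin'[of 1]] unfolding n .
  show "tens K T 1 idm 2 mT \<in> lin_hom K (tpow K T 3) (tpow K T 2)"
    using t[OF id_lin'[of 1] mT_lin] unfolding n .
  show "tens K T 0 uT 1 idm \<in> lin_hom K (tpow K T 1) (tpow K T 2)"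
    using t[OF uT_lin id_lin'[of 1]] unfolding n .
  show "tens K T 1 idm 0 uT \<in> lin_hom K (tpow K T 1) (tpow K T 2)"
    using t[OF id_lin'[of 1] uT_lin] unfolding n .
  show "tens K T 1 DT 1 idm \<in> lin_hom K (tpow K T 2) (tpow K T 3)"
    using t[OF DT_lin id_lin'[of 1]] unfolding n .
  show "tens K T 1 idm 1 DT \<in> lin_hom K (tpow K T 2) (tpow K T 3)"
    using t[OF id_lin'[of 1] DT_lin] unfolding n .
  show "tens K T 1 eT 1 idm \<in> lin_hom K (tpow K T 2) (tpow K T 1)"
    using t[OF eT_lin id_lin'[of 1]] unfolding n .
  show "tens K T 1 idm 1 eT \<in> lin_hom K (tpow K T 2) (tpow K T 1)"
    using t[OF id_lin'[of 1] eT_lin] unfolding n .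
  show "tens K T 1 DT 1 DT \<in> lin_hom K (tpow K T 2) (tpow K T 4)"
    using t[OF DT_lin DT_lin] unfolding n .
  show "tens K T 2 mT 2 mT \<in> lin_hom K (tpow K T 4) (tpow K T 2)"
    using t[OF mT_lin mT_lin] unfolding n .
  show "tens K T 1 idm 3 (tens K T 2 cT 1 idm) \<in> lin_hom K (tpow K T 4) (tpow K T 4)"
    using t[OF id_lin'[of 1] c] unfolding n .
  show "tens K T 1 eT 1 eT \<in> lin_hom K (tpow K T 2) (tpow K T 0)"
    using t[OF eT_lin eT_lin] unfolding n .
  show "tens K T 0 uT 0 uT \<in> lin_hom K (tpow K T 0) (tpow K T 2)"
    using t[OF uT_lin uT_lin] unfolding n .
qed

lemma cL: "z \<in> TP (l + (m + n)) \<Longrightarrow> tens K T 2 cT 1 idm (sp [l, m, n] z) = sp [m, l, n] (C 0 l m z)"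
  using tens_sp_left1[OF T.lin_hom_tpow_T[OF cT_lin], of "[l, m]" "[n]" 1 "[m, l]" "\<lambda>k. C k l m" z]
  by (simp add: cT(2) fam_C add.assoc)

lemma cR: "z \<in> TP (l + (m + n)) \<Longrightarrow> tens K T 1 idm 2 cT (sp [l, m, n] z) = sp [l, n, m] (C l m n z)"
  using tens_sp_right1[OF T.lin_hom_tpow_T[OF cT_lin], of "[l]" 1 "[m, n]" "[n, m]" "\<lambda>k. C k m n" z]
  by (simp add: cT(2) fam_C)

lemma cM: "z \<in> TP (k + (l + (m + n))) \<Longrightarrow>
  tens K T 1 idm 3 (tens K T 2 cT 1 idm) (sp [k, l, m, n] z) = sp [k, m, l, n] (C k l m z)"
  using tens_sp_right1[OF T.lin_hom_tpow_T[OF cL_lin], of "[k]" 1 "[l, m, n]" "[m, l, n]" "\<lambda>k. C k l m" z]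
  by (simp add: cL[unfolded One_nat_def] fam_C)

lemma mL: "z \<in> TP (l + (m + n)) \<Longrightarrow> tens K T 2 mT 1 idm (sp [l, m, n] z) = sp [l + m, n] z"
  using tens_sp_left1[OF T.lin_hom_tpow_T[OF mT_lin], of "[l, m]" "[n]" 1 "[l + m]" "\<lambda>k z. z" z]
  by (simp add: mT fam.id add.assoc)

lemma mR: "z \<in> TP (l + (m + n)) \<Longrightarrow> tens K T 1 idm 2 mT (sp [l, m, n] z) = sp [l, m + n] z"
  using tens_sp_right1[OF T.lin_hom_tpow_T[OF mT_lin], of "[l]" 1 "[m, n]" "[m + n]" "\<lambda>k z. z" z]
  by (simp add: mT fam.id)

lemma uL: "z \<in> TP n \<Longrightarrow> tens K T 0 uT 1 idm (sp [n] z) = sp [0, n] z"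
  using tens_sp_left1[OF T.lin_hom_tpow_T[OF uT_lin], of "[]" "[n]" 1 "[0]" "\<lambda>k z. z" z]
  by (simp add: uT fam.id)

lemma uR: "z \<in> TP n \<Longrightarrow> tens K T 1 idm 0 uT (sp [n] z) = sp [n, 0] z"
  using tens_sp_right1[OF T.lin_hom_tpow_T[OF uT_lin], of "[n]" 1 "[]" "[0]" "\<lambda>k z. z" z]
  by (simp add: uT fam.id)

lemma DL: "z \<in> TP (n + m) \<Longrightarrow>
  tens K T 1 DT 1 idm (sp [n, m] z) = (\<Oplus>\<^bsub>T.T\<^esub>a\<in>{..n}. sp [a, n - a, m] (sh 0 n a z))"
  using tens_sp_left[OF T.lin_hom_tpow_T[OF DT_lin], of "[n]" "[m]" 1 "{..n}" "\<lambda>a. [a, n - a]" "\<lambda>a k. sh k n a" z]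
  by (simp add: DT(2) fam_sh)

lemma DR: "z \<in> TP (m + n) \<Longrightarrow>
  tens K T 1 idm 1 DT (sp [m, n] z) = (\<Oplus>\<^bsub>T.T\<^esub>a\<in>{..n}. sp [m, a, n - a] (sh m n a z))"
  using tens_sp_right[OF T.lin_hom_tpow_T[OF DT_lin], of "[m]" 1 "[n]" "{..n}" "\<lambda>a. [a, n - a]" "\<lambda>a k. sh k n a" z]
  by (simp add: DT(2) fam_sh)

lemma DD: "z \<in> TP (m + n) \<Longrightarrow> tens K T 1 DT 1 DT (sp [m, n] z) =
  (\<Oplus>\<^bsub>T.T\<^esub>a\<in>{..m}. \<Oplus>\<^bsub>T.T\<^esub>b\<in>{..n}. sp [a, m - a, b, n - b] (sh 0 m a (sh m n b z)))"
  using tens_sp[OF T.lin_hom_tpow_T[OF DT_lin] T.lin_hom_tpow_T[OF DT_lin], of "[m]" "[n]" "{..m}" "{..n}"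
      "\<lambda>a. [a, m - a]" "\<lambda>a k. sh k m a" "\<lambda>a. [a, n - a]" "\<lambda>a k. sh k n a" z]
  by (simp add: DT(2) fam_sh)

lemma mm: "z \<in> TP (k + (l + (m + n))) \<Longrightarrow> tens K T 2 mT 2 mT (sp [k, l, m, n] z) = sp [k + l, m + n] z"
  using tens_sp[OF T.lin_hom_tpow_T[OF mT_lin] T.lin_hom_tpow_T[OF mT_lin], of "[k, l]" "[m, n]" "{()}" "{()}"
      "\<lambda>_. [k + l]" "\<lambda>_ k z. z" "\<lambda>_. [m + n]" "\<lambda>_ k z. z" z]
  by (simp add: mT fam.id tpow_T add.assoc)

lemma uu: "z \<in> TP 0 \<Longrightarrow> tens K T 0 uT 0 uT (sp [] z) = sp [0, 0] z"
  using tens_sp[OF T.lin_hom_tpow_T[OF uT_lin] T.lin_hom_tpow_T[OF uT_lin], of "[]" "[]" "{()}" "{()}"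
      "\<lambda>_. [0]" "\<lambda>_ k z. z" "\<lambda>_. [0]" "\<lambda>_ k z. z" z]
  by (simp add: uT fam.id tpow_T)

lemma eL: "z \<in> TP (n + m) \<Longrightarrow> tens K T 1 eT 1 idm (sp [n, m] z) = (if n = 0 then sp [m] z else \<zero>\<^bsub>T.T\<^esub>)"
proof (cases "n = 0")
  case True
  then show "z \<in> TP (n + m) \<Longrightarrow> ?thesis"
    using tens_sp_left1[OF T.lin_hom_tpow_T[OF eT_lin], of "[n]" "[m]" 1 "[]" "\<lambda>k z. z" z]
    by (simp add: eT(2) fam.id)
next
  case False
  then show "z \<in> TP (n + m) \<Longrightarrow> ?thesis"
    using tens_sp_left[OF T.lin_hom_tpow_T[OF eT_lin], of "[n]" "[m]" 1 "{}" "\<lambda>_. []" "\<lambda>_ k z. z" z]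
    by (simp add: eT(2))
qed

lemma eR: "z \<in> TP (m + n) \<Longrightarrow> tens K T 1 idm 1 eT (sp [m, n] z) = (if n = 0 then sp [m] z else \<zero>\<^bsub>T.T\<^esub>)"
proof (cases "n = 0")
  case True
  then show "z \<in> TP (m + n) \<Longrightarrow> ?thesis"
    using tens_sp_right1[OF T.lin_hom_tpow_T[OF eT_lin], of "[m]" 1 "[n]" "[]" "\<lambda>k z. z" z]
    by (simp add: eT(2) fam.id)
next
  case False
  then show "z \<in> TP (m + n) \<Longrightarrow> ?thesis"
    using tens_sp_right[OF T.lin_hom_tpow_T[OF eT_lin], of "[m]" 1 "[n]" "{}" "\<lambda>_. []" "\<lambda>_ k z. z" z]
    by (simp add: eT(2))
qed

lemma ee: "z \<in> TP (m + n) \<Longrightarrow> tens K T 1 eT 1 eT (sp [m, n] z) = (if m = 0 \<and> n = 0 then sp [] z else \<zero>\<^bsub>T.T\<^esub>)"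
proof -
  assume z: "z \<in> TP (m + n)"
  note t = tens_sp[OF T.lin_hom_tpow_T[OF eT_lin] T.lin_hom_tpow_T[OF eT_lin], of "[m]" "[n]" _ _
      "\<lambda>_. []" "\<lambda>_ k z. z" "\<lambda>_. []" "\<lambda>_ k z. z" z]
  consider "m = 0" "n = 0" | "m = 0" "n \<noteq> 0" | "m \<noteq> 0" "n = 0" | "m \<noteq> 0" "n \<noteq> 0" by blast
  then show ?thesis
  proof cases
    case 1 then show ?thesis using t[of "{()}" "{()}"] z by (simp add: eT(2) fam.id tpow_T)
  next
    case 2 then show ?thesis using t[of "{()}" "{}"] z by (simp add: eT(2) fam.id tpow_T)
  next
    case 3 then show ?thesis using t[of "{}" "{()}"] z by (simp add: eT(2) fam.id tpow_T)
  next
    case 4 then show ?thesis using t[of "{}" "{}"] z by (simp add: eT(2) fam.id tpow_T)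
  qed
qed

end


subsection \<open>The axioms of a braided bialgebra\<close>

context braided_vector_space
begin

interpretation T: assoc_algebra K T by (rule T_algebra)
interpretation TT: assoc_algebra K T.T by (rule T.T_algebra)

lemmas tp = C_tpow sh_tpow

text \<open>The crossing of two blocks is an operator on consecutive strands, hence slides through the crossing
  of these blocks with the third.\<close>

lemma cT_braid:
  assumes x: "x \<in> T.TP 3"
  shows "tens K T 2 cT 1 idm (tens K T 1 idm 2 cT (tens K T 2 cT 1 idm x)) =
    tens K T 1 idm 2 cT (tens K T 2 cT 1 idm (tens K T 1 idm 2 cT x))"
proof (rule TT_eqI3[OF lin_hom_comp[OF lin_hom_comp[OF cL_lin cR_lin] cL_lin] lin_hom_comp[OF lin_hom_comp[OF cR_lin cL_lin] cR_lin] _ x])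
  fix l m n z assume z: "z \<in> TP (l + (m + n))"
  have zz: "z \<in> TP (m + (l + n))" "z \<in> TP (m + (n + l))" "z \<in> TP (l + (n + m))" "z \<in> TP (n + (l + m))"
    using z by (simp_all add: ac_simps)
  have "C 0 m n (C m l n (C 0 l m z)) = C 0 m n (C 0 l (m + n) z)"
    using C_add_right[of 0 l m n z] by simp
  also have "\<dots> = C 0 l (m + n) (C l m n z)"
    using fam_C_left[OF fam_C[OF order_refl, of m n] tpow_T[OF z], of 0 l] by simp
  also have "\<dots> = C 0 l (n + m) (C l m n z)" by (simp add: add.commute)
  also have "\<dots> = C n l m (C 0 l n (C l m n z))"
    using C_add_right[of 0 l n m] by simp
  finally show "tens K T 2 cT 1 idm (tens K T 1 idm 2 cT (tens K T 2 cT 1 idm (sp [l, m, n] z))) =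
    tens K T 1 idm 2 cT (tens K T 2 cT 1 idm (tens K T 1 idm 2 cT (sp [l, m, n] z)))"
    using z zz by (simp only: cL cR tp)
qed

lemma T_braided: "braided_vector_space K T cT"
  by (unfold_locales) (rule cT_lin cT_braid; assumption?)+

lemma cT_mult_left:
  assumes x: "x \<in> T.TP 3"
  shows "cT (tens K T 2 mT 1 idm x) = tens K T 1 idm 2 mT (tens K T 2 cT 1 idm (tens K T 1 idm 2 cT x))"
proof (rule TT_eqI3[OF lin_hom_comp[OF mL_lin cT_lin] lin_hom_comp[OF lin_hom_comp[OF cR_lin cL_lin] mR_lin] _ x])
  fix l m n z assume z: "z \<in> TP (l + (m + n))"
  have zz: "z \<in> TP ((l + m) + n)" "z \<in> TP (l + (n + m))" "z \<in> TP (n + (l + m))"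
    using z by (simp_all add: ac_simps)
  have "C 0 (l + m) n z = C 0 l n (C l m n z)" using C_add_left[of 0 l m n z] by simp
  then show "cT (tens K T 2 mT 1 idm (sp [l, m, n] z)) =
    tens K T 1 idm 2 mT (tens K T 2 cT 1 idm (tens K T 1 idm 2 cT (sp [l, m, n] z)))"
    using z zz by (simp only: cL cR mL mR cT(2) tp)
qed

lemma cT_mult_right:
  assumes x: "x \<in> T.TP 3"
  shows "cT (tens K T 1 idm 2 mT x) = tens K T 2 mT 1 idm (tens K T 1 idm 2 cT (tens K T 2 cT 1 idm x))"
proof (rule TT_eqI3[OF lin_hom_comp[OF mR_lin cT_lin] lin_hom_comp[OF lin_hom_comp[OF cL_lin cR_lin] mL_lin] _ x])
  fix l m n z assume z: "z \<in> TP (l + (m + n))"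
  have zz: "z \<in> TP (m + (l + n))" "z \<in> TP (m + (n + l))"
    using z by (simp_all add: ac_simps)
  have "C 0 l (m + n) z = C m l n (C 0 l m z)" using C_add_right[of 0 l m n z] by simp
  then show "cT (tens K T 1 idm 2 mT (sp [l, m, n] z)) =
    tens K T 2 mT 1 idm (tens K T 1 idm 2 cT (tens K T 2 cT 1 idm (sp [l, m, n] z)))"
    using z zz by (simp only: cL cR mL mR cT(2) tp)
qed

lemma cT_unit_left:
  assumes x: "x \<in> T.TP 1"
  shows "cT (tens K T 0 uT 1 idm x) = tens K T 1 idm 0 uT x"
proof (rule TT_eqI1[OF lin_hom_comp[OF uL_lin cT_lin] uR_lin _ x])
  fix n z assume z: "z \<in> TP n"
  then have z': "z \<in> TP (0 + n)" by simp
  show "cT (tens K T 0 uT 1 idm (sp [n] z)) = tens K T 1 idm 0 uT (sp [n] z)"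
    unfolding uL[OF z] uR[OF z] cT(2)[OF z'] by simp
qed

lemma cT_unit_right:
  assumes x: "x \<in> T.TP 1"
  shows "cT (tens K T 1 idm 0 uT x) = tens K T 0 uT 1 idm x"
proof (rule TT_eqI1[OF lin_hom_comp[OF uR_lin cT_lin] uL_lin _ x])
  fix n z assume z: "z \<in> TP n"
  then have z': "z \<in> TP (n + 0)" by simp
  show "cT (tens K T 1 idm 0 uT (sp [n] z)) = tens K T 0 uT 1 idm (sp [n] z)"
    unfolding uL[OF z] uR[OF z] cT(2)[OF z'] by simp
qed

lemma T_braided_algebra: "braided_algebra K T cT"
  by (intro braided_algebra.intro T_algebra T_braided braided_algebra_axioms.intro)
    (rule cT_mult_left cT_mult_right cT_unit_left cT_unit_right; assumption)+

lemma sp_sh_tpow2: "z \<in> TP (n + m) \<Longrightarrow> a \<le> n \<Longrightarrow> sp [a, n - a, m] (sh k n a z) \<in> T.TP 3"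
  using sp_tpow[of "sh k n a z" "[a, n - a, m]"] sh_tpow[of z "n + m" k n a] by (simp add: numeral_3_eq_3)

lemma sp_sh_tpow3: "z \<in> TP (m + n) \<Longrightarrow> a \<le> n \<Longrightarrow> sp [m, a, n - a] (sh k n a z) \<in> T.TP 3"
  using sp_tpow[of "sh k n a z" "[m, a, n - a]"] sh_tpow[of z "m + n" k n a] by (simp add: numeral_3_eq_3)

lemma lin_sum_sp:
  assumes "h \<in> lin_hom K (tpow K T p) (tpow K T q)" "\<And>i. i \<in> A \<Longrightarrow> f i \<in> T.TP p"
  shows "h (finsum T.T f A) = (\<Oplus>\<^bsub>T.T\<^esub>i\<in>A. h (f i))"
  by (rule T.lin_tpow_finsum[OF T.T_module T.lin_hom_tpow_T[OF assms(1)] assms(2)])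

text \<open>In each tridegree this is \<open>sh_coassoc\<close>.\<close>

lemma DT_coassoc:
  assumes x: "x \<in> T.TP 1"
  shows "tens K T 1 DT 1 idm (DT x) = tens K T 1 idm 1 DT (DT x)"
proof (rule TT_eqI1[OF lin_hom_comp[OF DT_lin DL_lin] lin_hom_comp[OF DT_lin DR_lin] _ x])
  fix n z assume z: "z \<in> TP n"
  let ?H = "\<lambda>a s. sp [a, s - a, n - s] (sh 0 s a (sh 0 n s z))"
  have zT: "z \<in> carrier T" using z by (rule tpow_T)
  have "tens K T 1 DT 1 idm (DT (sp [n] z)) = (\<Oplus>\<^bsub>T.T\<^esub>s\<in>{..n}. tens K T 1 DT 1 idm (sp [s, n - s] (sh 0 n s z)))"
    unfolding DT(2)[OF z] by (rule lin_sum_sp[OF DL_lin]) (use sp_sh_tpow[OF z] in auto)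
  also have "\<dots> = (\<Oplus>\<^bsub>T.T\<^esub>s\<in>{..n}. \<Oplus>\<^bsub>T.T\<^esub>a\<in>{..s}. ?H a s)"
    using z zT by (intro TT.finsum_cong' refl DL funcsetI TT.finsum_closed sp_closed sh_closed sh_tpow) auto
  also have "\<dots> = (\<Oplus>\<^bsub>T.T\<^esub>a\<in>{..n}. \<Oplus>\<^bsub>T.T\<^esub>b\<in>{..n - a}. ?H a (b + a))"
    by (rule TT.finsum_triangle_swap) (use zT in simp)
  also have "\<dots> = (\<Oplus>\<^bsub>T.T\<^esub>a\<in>{..n}. \<Oplus>\<^bsub>T.T\<^esub>b\<in>{..n - a}. sp [a, b, n - a - b] (sh a (n - a) b (sh 0 n a z)))"
  proof (intro TT.finsum_cong' refl funcsetI TT.finsum_closed)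
    fix a b assume "a \<in> {..n}" "b \<in> {..n - a}"
    have "sh 0 (a + b) a (sh 0 n (a + b) z) = sh a (n - a) b (sh 0 n a z)"
      using sh_coassoc[OF zT, of 0 a b n] by simp
    then show "?H a (b + a) = sp [a, b, n - a - b] (sh a (n - a) b (sh 0 n a z))"
      by (simp add: add.commute)
  qed (use zT in simp_all)
  also have "\<dots> = (\<Oplus>\<^bsub>T.T\<^esub>a\<in>{..n}. tens K T 1 idm 1 DT (sp [a, n - a] (sh 0 n a z)))"
    using z by (intro TT.finsum_cong' refl DR[symmetric] funcsetI T.tpow_T[OF lin_hom_closed[OF DR_lin]] sp_sh_tpow)
      (auto intro: sh_tpow)
  also have "\<dots> = tens K T 1 idm 1 DT (DT (sp [n] z))"
    unfolding DT(2)[OF z] by (rule lin_sum_sp[OF DR_lin, symmetric]) (use sp_sh_tpow[OF z] in auto)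
  finally show "tens K T 1 DT 1 idm (DT (sp [n] z)) = tens K T 1 idm 1 DT (DT (sp [n] z))" .
qed

lemma DT_counit_left:
  assumes x: "x \<in> T.TP 1" shows "tens K T 1 eT 1 idm (DT x) = x"
proof (rule TT_eqI1[OF lin_hom_comp[OF DT_lin eL_lin] id_lin' _ x])
  fix n z assume z: "z \<in> TP n"
  have zT: "z \<in> carrier T" using z by (rule tpow_T)
  have "tens K T 1 eT 1 idm (DT (sp [n] z)) = (\<Oplus>\<^bsub>T.T\<^esub>s\<in>{..n}. tens K T 1 eT 1 idm (sp [s, n - s] (sh 0 n s z)))"
    unfolding DT(2)[OF z] by (rule lin_sum_sp[OF eL_lin]) (use sp_sh_tpow[OF z] in auto)
  also have "\<dots> = (\<Oplus>\<^bsub>T.T\<^esub>s\<in>{..n}. if s = 0 then sp [n - s] (sh 0 n s z) else \<zero>\<^bsub>T.T\<^esub>)"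
    using z zT by (intro TT.finsum_cong' refl eL funcsetI) (auto intro: sh_tpow)
  also have "\<dots> = sp [n] z"
    using zT by (subst TT.add.finprod_singleton_swap) auto
  finally show "tens K T 1 eT 1 idm (DT (sp [n] z)) = sp [n] z" .
qed

lemma DT_counit_right:
  assumes x: "x \<in> T.TP 1" shows "tens K T 1 idm 1 eT (DT x) = x"
proof (rule TT_eqI1[OF lin_hom_comp[OF DT_lin eR_lin] id_lin' _ x])
  fix n z assume z: "z \<in> TP n"
  have zT: "z \<in> carrier T" using z by (rule tpow_T)
  have "tens K T 1 idm 1 eT (DT (sp [n] z)) = (\<Oplus>\<^bsub>T.T\<^esub>s\<in>{..n}. tens K T 1 idm 1 eT (sp [s, n - s] (sh 0 n s z)))"
    unfolding DT(2)[OF z] by (rule lin_sum_sp[OF eR_lin]) (use sp_sh_tpow[OF z] in auto)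
  also have "\<dots> = (\<Oplus>\<^bsub>T.T\<^esub>s\<in>{..n}. if s = n then sp [s] (sh 0 n s z) else \<zero>\<^bsub>T.T\<^esub>)"
    using z zT by (intro TT.finsum_cong' refl trans[OF eR] funcsetI) (auto intro: sh_tpow)
  also have "\<dots> = sp [n] z"
    using zT by (subst TT.add.finprod_singleton_swap) auto
  finally show "tens K T 1 idm 1 eT (DT (sp [n] z)) = sp [n] z" .
qed

lemma T_coalgebra: "coalgebra K T DT eT"
  by unfold_locales (rule DT_lin eT_lin DT_coassoc DT_counit_left DT_counit_right; assumption?)+

text \<open>The shuffles of the second block slide through its crossing with the first, which then splits
  into the crossings with the two parts.\<close>

lemma cT_comult_left:
  assumes x: "x \<in> T.TP 2"
  shows "tens K T 1 DT 1 idm (cT x) =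
    tens K T 1 idm 2 cT (tens K T 2 cT 1 idm (tens K T 1 idm 1 DT x))"
proof (rule TT_eqI2[OF lin_hom_comp[OF cT_lin DL_lin] lin_hom_comp[OF lin_hom_comp[OF DR_lin cL_lin] cR_lin] _ x])
  fix l n z assume z: "z \<in> TP (l + n)"
  then have z': "z \<in> TP (n + l)" by (simp add: add.commute)
  have zT: "z \<in> carrier T" using z by (rule tpow_T)
  note cc = sp_closed[OF C_closed[OF sh_closed[OF zT]]] sp_closed[OF C_closed[OF C_closed[OF sh_closed[OF zT]]]]
  have "tens K T 1 DT 1 idm (cT (sp [l, n] z)) = (\<Oplus>\<^bsub>T.T\<^esub>a\<in>{..n}. sp [a, n - a, l] (sh 0 n a (C 0 l n z)))"
    by (simp only: cT(2)[OF z] DL[OF C_tpow[OF z']])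
  also have "\<dots> = (\<Oplus>\<^bsub>T.T\<^esub>a\<in>{..n}. tens K T 1 idm 2 cT (tens K T 2 cT 1 idm (sp [l, a, n - a] (sh l n a z))))"
  proof (intro TT.finsum_cong' refl funcsetI)
    fix a assume a: "a \<in> {..n}"
    have t: "sh l n a z \<in> TP (l + (a + (n - a)))" "sh l n a z \<in> TP (a + (l + (n - a)))"
      using sh_tpow[OF z, of l n a] a by (simp_all add: ac_simps)
    have e: "tens K T 1 idm 2 cT (tens K T 2 cT 1 idm (sp [l, a, n - a] (sh l n a z))) =
      sp [a, n - a, l] (C a l (n - a) (C 0 l a (sh l n a z)))"
      using t by (simp only: cL cR tp)
    show "tens K T 1 idm 2 cT (tens K T 2 cT 1 idm (sp [l, a, n - a] (sh l n a z))) \<in> carrier T.T"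
      unfolding e by (rule cc)
    have "C a l (n - a) (C 0 l a (sh l n a z)) = C 0 l n (sh l n a z)"
      using C_add_right[of 0 l a "n - a" "sh l n a z"] a by simp
    also have "\<dots> = sh 0 n a (C 0 l n z)"
      using fam_C_left[OF fam_sh[OF order_refl, of n a] zT, where i = 0 and l = l] by simp
    finally show "sp [a, n - a, l] (sh 0 n a (C 0 l n z)) =
      tens K T 1 idm 2 cT (tens K T 2 cT 1 idm (sp [l, a, n - a] (sh l n a z)))"
      unfolding e by simp
  qed
  also have "\<dots> = tens K T 1 idm 2 cT (tens K T 2 cT 1 idm (tens K T 1 idm 1 DT (sp [l, n] z)))"
    unfolding DR[OF z]
    by (rule lin_sum_sp[OF lin_hom_comp[OF cL_lin cR_lin], symmetric]) (use sp_sh_tpow3[OF z] in auto)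
  finally show "tens K T 1 DT 1 idm (cT (sp [l, n] z)) =
    tens K T 1 idm 2 cT (tens K T 2 cT 1 idm (tens K T 1 idm 1 DT (sp [l, n] z)))" .
qed

lemma cT_comult_right:
  assumes x: "x \<in> T.TP 2"
  shows "tens K T 1 idm 1 DT (cT x) =
    tens K T 2 cT 1 idm (tens K T 1 idm 2 cT (tens K T 1 DT 1 idm x))"
proof (rule TT_eqI2[OF lin_hom_comp[OF cT_lin DR_lin] lin_hom_comp[OF lin_hom_comp[OF DL_lin cR_lin] cL_lin] _ x])
  fix l n z assume z: "z \<in> TP (l + n)"
  then have z': "z \<in> TP (n + l)" by (simp add: add.commute)
  have zT: "z \<in> carrier T" using z by (rule tpow_T)
  note cc = sp_closed[OF C_closed[OF C_closed[OF sh_closed[OF zT]]]]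
  have "tens K T 1 idm 1 DT (cT (sp [l, n] z)) = (\<Oplus>\<^bsub>T.T\<^esub>a\<in>{..l}. sp [n, a, l - a] (sh n l a (C 0 l n z)))"
    by (simp only: cT(2)[OF z] DR[OF C_tpow[OF z']])
  also have "\<dots> = (\<Oplus>\<^bsub>T.T\<^esub>a\<in>{..l}. tens K T 2 cT 1 idm (tens K T 1 idm 2 cT (sp [a, l - a, n] (sh 0 l a z))))"
  proof (intro TT.finsum_cong' refl funcsetI)
    fix a assume a: "a \<in> {..l}"
    have t: "sh 0 l a z \<in> TP (a + (l - a + n))" "sh 0 l a z \<in> TP (a + (n + (l - a)))"
      using sh_tpow[OF z, of 0 l a] a by (simp_all add: ac_simps)
    have e: "tens K T 2 cT 1 idm (tens K T 1 idm 2 cT (sp [a, l - a, n] (sh 0 l a z))) =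
      sp [n, a, l - a] (C 0 a n (C a (l - a) n (sh 0 l a z)))"
      using t by (simp only: cL cR tp)
    show "tens K T 2 cT 1 idm (tens K T 1 idm 2 cT (sp [a, l - a, n] (sh 0 l a z))) \<in> carrier T.T"
      unfolding e by (rule cc)
    have "C 0 a n (C a (l - a) n (sh 0 l a z)) = C 0 l n (sh 0 l a z)"
      using C_add_left[of 0 a "l - a" n "sh 0 l a z"] a by simp
    also have "\<dots> = sh n l a (C 0 l n z)"
      using fam_C_right[OF fam_sh[OF order_refl, of l a] zT, where i = 0 and n = n] by simp
    finally show "sp [n, a, l - a] (sh n l a (C 0 l n z)) =
      tens K T 2 cT 1 idm (tens K T 1 idm 2 cT (sp [a, l - a, n] (sh 0 l a z)))"
      unfolding e by simp
  qed
  also have "\<dots> = tens K T 2 cT 1 idm (tens K T 1 idm 2 cT (tens K T 1 DT 1 idm (sp [l, n] z)))"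
    unfolding DL[OF z]
    by (rule lin_sum_sp[OF lin_hom_comp[OF cR_lin cL_lin], symmetric]) (use sp_sh_tpow2[OF z] in auto)
  finally show "tens K T 1 idm 1 DT (cT (sp [l, n] z)) =
    tens K T 2 cT 1 idm (tens K T 1 idm 2 cT (tens K T 1 DT 1 idm (sp [l, n] z)))" .
qed

lemma cT_counit_left:
  assumes x: "x \<in> T.TP 2" shows "tens K T 1 eT 1 idm (cT x) = tens K T 1 idm 1 eT x"
proof (rule TT_eqI2[OF lin_hom_comp[OF cT_lin eL_lin] eR_lin _ x])
  fix m n z assume z: "z \<in> TP (m + n)"
  then have z': "z \<in> TP (n + m)" by (simp add: add.commute)
  show "tens K T 1 eT 1 idm (cT (sp [m, n] z)) = tens K T 1 idm 1 eT (sp [m, n] z)"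
    unfolding cT(2)[OF z] eL[OF C_tpow[OF z']] eR[OF z] by simp
qed

lemma cT_counit_right:
  assumes x: "x \<in> T.TP 2" shows "tens K T 1 idm 1 eT (cT x) = tens K T 1 eT 1 idm x"
proof (rule TT_eqI2[OF lin_hom_comp[OF cT_lin eR_lin] eL_lin _ x])
  fix m n z assume z: "z \<in> TP (m + n)"
  then have z': "z \<in> TP (n + m)" by (simp add: add.commute)
  show "tens K T 1 idm 1 eT (cT (sp [m, n] z)) = tens K T 1 eT 1 idm (sp [m, n] z)"
    unfolding cT(2)[OF z] eR[OF C_tpow[OF z']] eL[OF z] by simp
qed

text \<open>In each bidegree this is \<open>sh_vandermonde\<close>, whose crossings are the braiding between the two middle
  factors of \<open>\<Delta> \<otimes> \<Delta>\<close>.\<close>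

lemma DT_mult:
  assumes x: "x \<in> T.TP 2"
  shows "DT (mT x) = tens K T 2 mT 2 mT (tens K T 1 idm 3 (tens K T 2 cT 1 idm) (tens K T 1 DT 1 DT x))"
proof (rule TT_eqI2[OF lin_hom_comp[OF mT_lin DT_lin] lin_hom_comp[OF lin_hom_comp[OF DD_lin cM_lin] mm_lin] _ x])
  fix m n z assume z: "z \<in> TP (m + n)"
  have zT: "z \<in> carrier T" using z by (rule tpow_T)
  let ?W = "\<lambda>i j. C i (m - i) j (sh 0 m i (sh m n j z))"
  let ?H = "\<lambda>i a. sp [a, m + n - a] (?W i (a - i))"
  have W: "?W i j \<in> TP (m + n)" for i j by (intro tp z)
  have WT: "?W i j \<in> carrier T" for i j using W by (rule tpow_T)
  have Hc: "?H i a \<in> carrier T.T" for i a using WT by (rule sp_closed)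
  have "DT (mT (sp [m, n] z)) = (\<Oplus>\<^bsub>T.T\<^esub>a\<in>{..m + n}. sp [a, m + n - a] (sh 0 (m + n) a z))"
    by (simp only: mT[OF z] DT(2)[OF z])
  also have "\<dots> = (\<Oplus>\<^bsub>T.T\<^esub>a\<in>{..m + n}. \<Oplus>\<^bsub>T.T\<^esub>i\<in>{..a}. ?H i a)"
  proof (intro TT.finsum_cong' refl funcsetI TT.finsum_closed)
    fix a
    have "sh 0 (m + n) a z = (\<Oplus>\<^bsub>T\<^esub>i\<in>{..a}. ?W i (a - i))"
      using sh_vandermonde[OF zT, of 0 m n a] by simp
    then show "sp [a, m + n - a] (sh 0 (m + n) a z) = (\<Oplus>\<^bsub>T.T\<^esub>i\<in>{..a}. ?H i a)"
      using lin_hom_finsum[OF sp_lin T_module T.T_module, of "\<lambda>i. ?W i (a - i)" "{..a}" "[a, m + n - a]"] WT by simp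
  qed (rule Hc)
  also have "\<dots> = (\<Oplus>\<^bsub>T.T\<^esub>i\<in>{..m + n}. \<Oplus>\<^bsub>T.T\<^esub>j\<in>{..m + n - i}. ?H i (j + i))"
    by (rule TT.finsum_triangle_swap) (rule Hc)
  \<comment> \<open>The terms with \<open>i > m\<close> or \<open>j > n\<close> vanish, as a block cannot send more strands to the left than it has.\<close>
  also have "\<dots> = (\<Oplus>\<^bsub>T.T\<^esub>i\<in>{..m}. \<Oplus>\<^bsub>T.T\<^esub>j\<in>{..n}. ?H i (j + i))"
  proof (rule TT.add.finprod_mono_neutral_cong_right)
    show "(\<Oplus>\<^bsub>T.T\<^esub>j\<in>{..m + n - i}. ?H i (j + i)) = \<zero>\<^bsub>T.T\<^esub>" if "i \<in> {..m + n} - {..m}" for i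
      using that by (intro TT.add.finprod_one_eqI) (simp add: sh_out C_zero)
    show "(\<Oplus>\<^bsub>T.T\<^esub>j\<in>{..m + n - i}. ?H i (j + i)) = (\<Oplus>\<^bsub>T.T\<^esub>j\<in>{..n}. ?H i (j + i))" if "i \<in> {..m}" for i
    proof (rule TT.add.finprod_mono_neutral_cong_right)
      show "?H i (j + i) = \<zero>\<^bsub>T.T\<^esub>" if "j \<in> {..m + n - i} - {..n}" for j
        using that by (simp add: sh_out C_zero)
    qed (use that WT in auto)
  qed (use WT in \<open>auto intro!: TT.finsum_closed\<close>)
  also have "\<dots> = (\<Oplus>\<^bsub>T.T\<^esub>i\<in>{..m}. \<Oplus>\<^bsub>T.T\<^esub>j\<in>{..n}. tens K T 2 mT 2 mT (tens K T 1 idm 3 (tens K T 2 cT 1 idm)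
      (sp [i, m - i, j, n - j] (sh 0 m i (sh m n j z)))))"
  proof -
    have e: "tens K T 2 mT 2 mT (tens K T 1 idm 3 (tens K T 2 cT 1 idm)
      (sp [i, m - i, j, n - j] (sh 0 m i (sh m n j z)))) = ?H i (j + i)" if "i \<in> {..m}" "j \<in> {..n}" for i j
    proof -
      have "i + (m - i + (j + (n - j))) = m + n" "i + (j + (m - i + (n - j))) = m + n" "m + n - (j + i) = m - i + (n - j)"
        using that by auto
      then have "sh 0 m i (sh m n j z) \<in> TP (i + (m - i + (j + (n - j))))"
        "?W i j \<in> TP (i + (j + (m - i + (n - j))))"
        using W sh_tpow[OF sh_tpow[OF z]] by simp_all
      then show ?thesis using \<open>m + n - (j + i) = m - i + (n - j)\<close>
        by (simp only: cM mm add_diff_cancel_right' add.commute[of i j])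
    qed
    show ?thesis
      by (intro TT.finsum_cong' refl funcsetI TT.finsum_closed e[symmetric]) (simp_all only: e Hc)
  qed
  also have "\<dots> = tens K T 2 mT 2 mT (tens K T 1 idm 3 (tens K T 2 cT 1 idm) (tens K T 1 DT 1 DT (sp [m, n] z)))"
  proof -
    note l = lin_hom_comp[OF cM_lin mm_lin]
    have t: "sp [i, m - i, j, n - j] (sh 0 m i (sh m n j z)) \<in> T.TP 4" if "i \<in> {..m}" "j \<in> {..n}" for i j
    proof -
      have "sum_list [i, m - i, j, n - j] = m + n" using that by simp
      then have "sh 0 m i (sh m n j z) \<in> TP (sum_list [i, m - i, j, n - j])"
        using sh_tpow[OF sh_tpow[OF z]] by simp
      from sp_tpow[OF this] show ?thesis by (simp add: numeral_eq_Suc)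
    qed
    show ?thesis unfolding DD[OF z]
      by (subst lin_sum_sp[OF l], rule T.tpow_finsum, rule t, assumption+)
        (intro TT.finsum_cong' refl funcsetI lin_sum_sp[OF l, symmetric] TT.finsum_closed t
          T.tpow_T[OF lin_hom_closed[OF l]] T.tpow_finsum)
  qed
  finally show "DT (mT (sp [m, n] z)) =
    tens K T 2 mT 2 mT (tens K T 1 idm 3 (tens K T 2 cT 1 idm) (tens K T 1 DT 1 DT (sp [m, n] z)))" .
qed

lemma TT_eqI0:
  assumes "f \<in> lin_hom K (tpow K T 0) N" and "g \<in> lin_hom K (tpow K T 0) N"
    and eq: "\<And>z. z \<in> TP 0 \<Longrightarrow> f (sp [] z) = g (sp [] z)"
    and Z: "Z \<in> T.TP 0"
  shows "f Z = g Z"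
  by (rule TT_eqI[OF assms(1,2) _ Z]) (simp add: eq)

lemma DT_unit:
  assumes x: "x \<in> T.TP 0" shows "DT (uT x) = tens K T 0 uT 0 uT x"
proof (rule TT_eqI0[OF lin_hom_comp[OF uT_lin DT_lin] uu_lin _ x])
  fix z assume z: "z \<in> TP 0"
  show "DT (uT (sp [] z)) = tens K T 0 uT 0 uT (sp [] z)"
    unfolding uT[OF z] uu[OF z] DT(2)[OF z] using tpow_T[OF z] by simp
qed

lemma eT_mult:
  assumes x: "x \<in> T.TP 2" shows "eT (mT x) = tens K T 1 eT 1 eT x"
proof (rule TT_eqI2[OF lin_hom_comp[OF mT_lin eT_lin] ee_lin _ x])
  fix m n z assume z: "z \<in> TP (m + n)"
  show "eT (mT (sp [m, n] z)) = tens K T 1 eT 1 eT (sp [m, n] z)"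
    unfolding mT[OF z] ee[OF z] eT(2)[OF z] by simp
qed

lemma eT_unit:
  assumes x: "x \<in> T.TP 0" shows "eT (uT x) = x"
proof (rule TT_eqI0[OF lin_hom_comp[OF uT_lin eT_lin] id_lin' _ x])
  fix z assume z: "z \<in> TP 0"
  show "eT (uT (sp [] z)) = sp [] z"
    unfolding uT[OF z] eT(2)[OF z] by simp
qed

lemma T_braided_bialgebra: "braided_bialgebra K T cT DT eT"
  by (intro braided_bialgebra.intro T_braided_algebra T_coalgebra braided_bialgebra_axioms.intro)
    (rule cT_comult_left cT_comult_right cT_counit_left cT_counit_right DT_mult DT_unit eT_mult eT_unit; assumption)+

lemma tensor_map2_incl: "x \<in> TP 2 \<Longrightarrow> tensor_map2 T inc inc x = sp [1, 1] x"
proof (rule tpow_eqI[OF lin_hom_T_tpow[OF tensor_map2(1)[OF T_module incl_lin incl_lin]] lin_hom_T_tpow[OF sp_lin]])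
  fix w assume "w \<in> L" "length w = 2"
  then obtain x y where w: "w = [x, y]" "x \<in> carrier V" "y \<in> carrier V"
    by (auto simp: numeral_2_eq_2 length_Suc_conv)
  then show "tensor_map2 T inc inc (P w) = sp [1, 1] (P w)"
    using sp_two[OF incl_tpow incl_tpow, of x y]
    by (simp only: tensor_map2(2)[OF T_module incl_lin incl_lin] pure_two[symmetric])
qed

lemma sub_tensor_map_incl:
  "x \<in> TP 2 \<Longrightarrow> sub_tensor_map K V T (carrier V) (carrier V) inc inc x = sp [1, 1] x"
  using sub_tensor_map[OF T_module incl_lin incl_lin subset_refl subset_refl refl refl, of x]
  by (simp add: sub_tensor_full tensor_map2_incl)

text \<open>The structure maps of \<open>T(V, c)\<close> are selected by a choice operator, so that exhibiting one structure
  is what makes any statement about them possible.\<close>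

theorem tensor_bialgebra_exists: "tensor_bialgebra K V c cT DT eT"
  unfolding tensor_bialgebra_def Let_def
proof (intro conjI ballI T_braided_bialgebra)
  fix x assume x: "x \<in> TP 2"
  then have x': "x \<in> TP (1 + 1)" by (simp add: numeral_2_eq_2)
  have "C 0 1 1 x = c x" using S0_c[OF x] by simp
  then show "cT (sub_tensor_map K V T (carrier V) (carrier V) inc inc x) =
    sub_tensor_map K V T (carrier V) (carrier V) inc inc (c x)"
    by (simp only: sub_tensor_map_incl[OF x] sub_tensor_map_incl[OF c_tpow[OF x]] cT(2)[OF x'])
next
  fix v assume v: "v \<in> carrier V"
  note t = incl_tpow[OF v]
  have "DT (T.inc (inc v)) = (\<Oplus>\<^bsub>T.T\<^esub>a\<in>{..1}. sp [a, 1 - a] (sh 0 1 a (inc v)))"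
    using DT(2)[OF t] by (simp only: sp_one[OF t])
  also have "\<dots> = sp [1, 0] (inc v) \<oplus>\<^bsub>T.T\<^esub> sp [0, 1] (inc v)"
    using v by (simp add: S_zero)
  also have "sp [1, 0] (inc v) = T.P [inc v, \<one>\<^bsub>T\<^esub>]"
    using sp_two[OF t one_tpow] v by simp
  also have "sp [0, 1] (inc v) = T.P [\<one>\<^bsub>T\<^esub>, inc v]"
    using sp_two[OF one_tpow t] v by simp
  finally show "DT (T.inc (inc v)) = T.P [inc v, \<one>\<^bsub>T\<^esub>] \<oplus>\<^bsub>T.T\<^esub> T.P [\<one>\<^bsub>T\<^esub>, inc v]" .
qed

end


section \<open>Uniqueness of the structure\<close>

lemma (in vec) tens_cong:
  assumes "\<And>x. x \<in> TP p \<Longrightarrow> f x = f' x" "\<And>y. y \<in> TP q \<Longrightarrow> g y = g' y"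
  shows "tens K V p f q g = tens K V p f' q g'"
  unfolding tens_def using assms by (simp cong: ball_cong)

context braided_vector_space
begin

interpretation T: assoc_algebra K T by (rule T_algebra)
interpretation TT: assoc_algebra K T.T by (rule T.T_algebra)

context
  fixes c' D' e'
  assumes bi: "tensor_bialgebra K V c c' D' e'"
begin

lemma c'_braided_algebra: "braided_algebra K T c'"
  using bi by (simp add: tensor_bialgebra_def Let_def braided_bialgebra_def)

lemma D'_coalgebra: "coalgebra K T D' e'"
  using bi by (simp add: tensor_bialgebra_def Let_def braided_bialgebra_def)

lemma c'_lin: "c' \<in> lin_hom K (tpow K T 2) (tpow K T 2)"
  using c'_braided_algebra by (simp add: braided_algebra_def braided_vector_space.c_linear)

lemma D'_lin: "D' \<in> lin_hom K (tpow K T 1) (tpow K T 2)"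
  by (rule coalgebra.comult_linear[OF D'_coalgebra])

lemma c'_left:
  assumes "\<And>x. x \<in> TP (l + m) \<Longrightarrow> c' (sp [l, m] x) = sp [m, l] (C 0 l m x)" "z \<in> TP (l + (m + n))"
  shows "tens K T 2 c' 1 idm (sp [l, m, n] z) = sp [m, l, n] (C 0 l m z)"
  using tens_sp_left1[OF T.lin_hom_tpow_T[OF c'_lin], of "[l, m]" "[n]" 1 "[m, l]" "\<lambda>k. C k l m" z] assms
  by (simp add: fam_C add.assoc)

lemma c'_right:
  assumes "\<And>x. x \<in> TP (m + n) \<Longrightarrow> c' (sp [m, n] x) = sp [n, m] (C 0 m n x)" "z \<in> TP (l + (m + n))"
  shows "tens K T 1 idm 2 c' (sp [l, m, n] z) = sp [l, n, m] (C l m n z)"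
  using tens_sp_right1[OF T.lin_hom_tpow_T[OF c'_lin], of "[l]" 1 "[m, n]" "[n, m]" "\<lambda>k. C k m n" z] assms
  by (simp add: fam_C)

lemma sp_tpow1: "z \<in> TP n \<Longrightarrow> sp [n] z \<in> T.TP 1"
  using sp_tpow[of z "[n]"] by simp

lemma sp_tpow2: "z \<in> TP (m + n) \<Longrightarrow> sp [m, n] z \<in> T.TP 2"
  using sp_tpow[of z "[m, n]"] by (simp add: numeral_2_eq_2)

lemma sp_tpow3: "z \<in> TP (l + (m + n)) \<Longrightarrow> sp [l, m, n] z \<in> T.TP 3"
  using sp_tpow[of z "[l, m, n]"] by (simp add: numeral_3_eq_3)

lemma c'_one_one: "z \<in> TP (1 + 1) \<Longrightarrow> c' (sp [1, 1] z) = sp [1, 1] (C 0 1 1 z)"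
proof -
  assume z: "z \<in> TP (1 + 1)"
  then have x: "z \<in> TP 2" by (simp add: numeral_2_eq_2)
  have "c' (sub_tensor_map K V T (carrier V) (carrier V) inc inc z) =
    sub_tensor_map K V T (carrier V) (carrier V) inc inc (c z)"
    using bi x by (simp add: tensor_bialgebra_def Let_def)
  moreover have "C 0 1 1 z = c z" using S0_c[OF x] by simp
  ultimately show ?thesis
    by (simp only: sub_tensor_map_incl[OF x] sub_tensor_map_incl[OF c_tpow[OF x]])
qed

lemma c'_one_left: "z \<in> TP (1 + n) \<Longrightarrow> c' (sp [1, n] z) = sp [n, 1] (C 0 1 n z)"
proof (induction n arbitrary: z)
  case 0
  then have z: "z \<in> TP 1" by simp
  show ?case
    using braided_algebra.c_unit_right[OF c'_braided_algebra sp_tpow1[OF z]]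
    unfolding uL[OF z] uR[OF z] by simp
next
  case (Suc n)
  have z: "z \<in> TP (1 + (1 + n))" "z \<in> TP (1 + (n + 1))" using Suc.prems by simp_all
  have "c' (tens K T 1 idm 2 mT (sp [1, 1, n] z)) =
    tens K T 2 mT 1 idm (tens K T 1 idm 2 c' (tens K T 2 c' 1 idm (sp [1, 1, n] z)))"
    by (rule braided_algebra.c_mult_right[OF c'_braided_algebra sp_tpow3[OF z(1)]])
  also have "\<dots> = sp [1 + n, 1] (C 1 1 n (C 0 1 1 z))"
    by (simp only: c'_left[OF c'_one_one z(1)] c'_right[OF Suc.IH C_tpow[OF z(1)]] mL[OF C_tpow[OF C_tpow[OF z(2)]]])
  also have "C 1 1 n (C 0 1 1 z) = C 0 1 (1 + n) z"
    using C_add_right[of 0 1 1 n z] by simp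
  finally show ?case by (simp only: mR[OF z(1)] Suc_eq_plus1_left)
qed

text \<open>The axioms relating braiding and multiplication determine \<open>c'\<close> on products from its values on the
  factors; peeling off one letter at a time, first on the right and then on the left, leads down to
  bidegree \<open>(1, 1)\<close>, where \<open>c'\<close> extends \<open>c\<close>.\<close>

lemma c'_sp: "z \<in> TP (m + n) \<Longrightarrow> c' (sp [m, n] z) = sp [n, m] (C 0 m n z)"
proof (induction m arbitrary: z)
  case 0
  then have z: "z \<in> TP n" by simp
  show ?case
    using braided_algebra.c_unit_left[OF c'_braided_algebra sp_tpow1[OF z]]
    unfolding uL[OF z] uR[OF z] by simp
next
  case (Suc m)
  have z: "z \<in> TP (1 + (m + n))" "z \<in> TP (1 + (n + m))" "z \<in> TP (n + (1 + m))"
    using Suc.prems by (simp_all add: ac_simps)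
  have "c' (tens K T 2 mT 1 idm (sp [1, m, n] z)) =
    tens K T 1 idm 2 mT (tens K T 2 c' 1 idm (tens K T 1 idm 2 c' (sp [1, m, n] z)))"
    by (rule braided_algebra.c_mult_left[OF c'_braided_algebra sp_tpow3[OF z(1)]])
  also have "\<dots> = sp [n, 1 + m] (C 0 1 n (C 1 m n z))"
    by (simp only: c'_right[OF Suc.IH z(1)] c'_left[OF c'_one_left C_tpow[OF z(2)]] mR[OF C_tpow[OF C_tpow[OF z(3)]]])
  also have "C 0 1 n (C 1 m n z) = C 0 (1 + m) n z"
    by simp
  finally show ?case by (simp only: mL[OF z(1)] Suc_eq_plus1_left)
qed

lemma c'_cT: "x \<in> T.TP 2 \<Longrightarrow> c' x = cT x"
  by (rule TT_eqI2[OF c'_lin cT_lin]) (simp_all add: c'_sp cT(2))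

lemma D'_one: "z \<in> TP 1 \<Longrightarrow> D' (sp [1] z) = DT (sp [1] z)"
proof -
  assume z: "z \<in> TP 1"
  then obtain v where v: "v \<in> carrier V" "z = inc v" by (rule tpow1_cases)
  have "D' (T.inc (inc v)) = DT (T.inc (inc v))"
    using bi tensor_bialgebra_exists v(1) by (simp add: tensor_bialgebra_def Let_def)
  then show ?thesis using z v by (simp only: sp_one)
qed

text \<open>Since \<open>D'\<close> is multiplicative for the product twisted by the braiding, which is already known, its
  values in degree \<open>n + 1\<close> follow from those in the degrees \<open>1\<close> and \<open>n\<close>.\<close>

lemma D'_sp: "z \<in> TP n \<Longrightarrow> D' (sp [n] z) = DT (sp [n] z)"
proof (induction n arbitrary: z)
  case 0
  have x: "sp [] z \<in> T.TP 0" using sp_tpow[of z "[]"] 0 by simp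
  have "D' (uT (sp [] z)) = tens K T 0 uT 0 uT (sp [] z)"
    using bi x braided_bialgebra.comult_unit by (fastforce simp: tensor_bialgebra_def Let_def)
  then show ?case using DT_unit[OF x] by (simp only: uT[OF 0])
next
  case (Suc n)
  have z: "z \<in> TP (1 + n)" using Suc.prems by simp
  have x: "sp [1, n] z \<in> T.TP 2" by (rule sp_tpow2[OF z])
  let ?cM = "\<lambda>c. tens K T 1 idm 3 (tens K T 2 c 1 idm)"
  have "tens K T 2 c' 1 idm = tens K T 2 cT 1 idm" by (rule T.tens_cong[OF c'_cT refl])
  then have cM: "?cM c' = ?cM cT" by simp
  have dd: "tens K T 1 D' 1 D' (sp [1, n] z) = tens K T 1 DT 1 DT (sp [1, n] z)"
    using tens_sp[OF T.lin_hom_tpow_T[OF D'_lin] T.lin_hom_tpow_T[OF D'_lin], of "[1]" "[n]" "{..1}" "{..n}"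
      "\<lambda>a. [a, 1 - a]" "\<lambda>a k. sh k 1 a" "\<lambda>a. [a, n - a]" "\<lambda>a k. sh k n a" z] z
    unfolding DD[OF z] by (simp add: D'_one[unfolded One_nat_def] Suc.IH DT(2) fam_sh)
  have "D' (mT (sp [1, n] z)) = tens K T 2 mT 2 mT (?cM c' (tens K T 1 D' 1 D' (sp [1, n] z)))"
    using bi x braided_bialgebra.comult_mult[of K T c' D' e'] by (simp add: tensor_bialgebra_def Let_def)
  also have "\<dots> = DT (mT (sp [1, n] z))"
    unfolding cM dd by (rule DT_mult[OF x, symmetric])
  finally show ?case by (simp only: mT[OF z] Suc_eq_plus1_left)
qed

lemma D'_DT: "x \<in> T.TP 1 \<Longrightarrow> D' x = DT x"
  by (rule TT_eqI1[OF D'_lin DT_lin]) (simp_all add: D'_sp)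

end

lemma tensor_structure: "tensor_bialgebra K V c (tensor_braiding K V c) (tensor_comult K V c) (snd (snd (tensor_structure K V c)))"
proof -
  have "case (cT, DT, eT) of (b, D, e) \<Rightarrow> tensor_bialgebra K V c b D e"
    using tensor_bialgebra_exists by simp
  then have "case tensor_structure K V c of (b, D, e) \<Rightarrow> tensor_bialgebra K V c b D e"
    unfolding tensor_structure_def by (rule someI)
  then show ?thesis by (simp add: tensor_braiding_def tensor_comult_def split: prod.splits)
qed

lemmas tensor_braiding_eq = c'_cT[OF tensor_structure]
  and tensor_comult_eq = D'_DT[OF tensor_structure]

section \<open>The primitive tensors\<close>

abbreviation "pj n \<equiv> tensor_proj K V n"
abbreviation "pp a b \<equiv> T.tensor_map2 T (pj a) (pj b)"

lemmas pp = T.tensor_map2[OF T_module tensor_proj_lin tensor_proj_lin]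

lemma pure_zero: "x \<in> carrier T \<Longrightarrow> T.P [\<zero>\<^bsub>T\<^esub>, x] = \<zero>\<^bsub>T.T\<^esub>" "x \<in> carrier T \<Longrightarrow> T.P [x, \<zero>\<^bsub>T\<^esub>] = \<zero>\<^bsub>T.T\<^esub>"
  by (simp_all add: T.pure_two lin_hom_zero[OF T.incl_lin T_module T.T_module])

lemma pp_sp:
  assumes "z \<in> TP (s + t)"
  shows "pp a b (sp [s, t] z) = (if s = a \<and> t = b then sp [s, t] z else \<zero>\<^bsub>T.T\<^esub>)"
proof (rule tpow_eqI_mult[OF _ _ _ assms, where g = "\<lambda>z. if s = a \<and> t = b then sp [s, t] z else \<zero>\<^bsub>T.T\<^esub>"])
  show "(\<lambda>z. pp a b (sp [s, t] z)) \<in> lin_hom K (tpow K V (s + t)) T.T"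
    by (rule lin_hom_T_tpow[OF lin_hom_comp[OF sp_lin pp(1)]])
  show "(\<lambda>z. if s = a \<and> t = b then sp [s, t] z else \<zero>\<^bsub>T.T\<^esub>) \<in> lin_hom K (tpow K V (s + t)) T.T"
    using lin_hom_T_tpow[OF sp_lin] lin_hom_zero_map[OF T.T_module] by (cases "s = a \<and> t = b") auto
  fix x y assume x: "x \<in> TP s" and y: "y \<in> TP t"
  have "pp a b (sp [s, t] (x \<otimes>\<^bsub>T\<^esub> y)) = T.P [pj a x, pj b y]"
    using x y by (simp add: sp_two pp(2) tpow_T)
  also have "\<dots> = (if s = a \<and> t = b then sp [s, t] (x \<otimes>\<^bsub>T\<^esub> y) else \<zero>\<^bsub>T.T\<^esub>)"
  proof (cases "s = a")
    case True
    then show ?thesis using x y tensor_proj_same[OF x] tensor_proj_same[OF y] tensor_proj_other[OF y, of b]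
      by (cases "t = b") (simp_all add: sp_two pure_zero tpow_T)
  next
    case False
    then show ?thesis using x y tensor_proj_other[OF x False] lin_hom_closed[OF tensor_proj_lin, of y b]
      by (simp add: pure_zero tpow_T)
  qed
  finally show "pp a b (sp [s, t] (x \<otimes>\<^bsub>T\<^esub> y)) = (if s = a \<and> t = b then sp [s, t] (x \<otimes>\<^bsub>T\<^esub> y) else \<zero>\<^bsub>T.T\<^esub>)" .
qed

text \<open>The projections to bidegree \<open>(a, b)\<close> single out one of the shuffles that make up the
  comultiplication.\<close>

lemma tensor_comult_comp:
  assumes z: "z \<in> TP (a + b)"
  shows "tensor_comult_comp K V c a b z = sp [a, b] (sh 0 (a + b) a z)"
proof -
  let ?n = "a + b"
  have zT: "z \<in> carrier T" using z by (rule tpow_T)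
  have x: "sp [?n] z \<in> T.TP 1" using sp_tpow[of z "[?n]"] z by simp
  have "tensor_comult K V c (T.inc z) = DT (sp [?n] z)"
    using tensor_comult_eq[OF x] by (simp only: sp_one[OF z])
  moreover have D2: "DT (sp [?n] z) \<in> T.TP 2" by (rule lin_hom_closed[OF DT_lin x])
  ultimately have "tensor_comult_comp K V c a b z = pp a b (DT (sp [?n] z))"
    unfolding tensor_comult_comp_def Let_def
    using T.sub_tensor_map[OF T_module tensor_proj_lin tensor_proj_lin subset_refl subset_refl refl refl, of "DT (sp [?n] z)" a b]
    by (simp add: T.sub_tensor_full)
  also have "\<dots> = (\<Oplus>\<^bsub>T.T\<^esub>s\<in>{..?n}. pp a b (sp [s, ?n - s] (sh 0 ?n s z)))"
    unfolding DT(2)[OF z] by (rule lin_hom_finsum[OF pp(1) T.T_module T.T_module]) (use zT in auto)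
  also have "\<dots> = (\<Oplus>\<^bsub>T.T\<^esub>s\<in>{..?n}. if s = a then sp [s, ?n - s] (sh 0 ?n s z) else \<zero>\<^bsub>T.T\<^esub>)"
  proof (intro TT.finsum_cong' refl funcsetI)
    fix s assume "s \<in> {..?n}"
    then have "sh 0 ?n s z \<in> TP (s + (?n - s))" using sh_tpow[OF z] by simp
    from pp_sp[OF this, of a b] show "pp a b (sp [s, ?n - s] (sh 0 ?n s z)) =
      (if s = a then sp [s, ?n - s] (sh 0 ?n s z) else \<zero>\<^bsub>T.T\<^esub>)" by auto
  qed (use zT in auto)
  also have "\<dots> = sp [a, b] (sh 0 ?n a z)"
    using zT by (subst TT.add.finprod_singleton_swap) auto
  finally show ?thesis .
qed

lemma sp_eq_zero: "z \<in> TP (sum_list ns) \<Longrightarrow> sp ns z = \<zero>\<^bsub>T.T\<^esub> \<Longrightarrow> z = \<zero>\<^bsub>T\<^esub>"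
  using mu_sp[of z ns] lin_hom_zero[OF T.mu_lin[OF T_algebra] T.T_module T_module] by simp

text \<open>Splitting is injective, so a component of the comultiplication vanishes on \<open>z\<close> exactly when the
  shuffle operator does.\<close>

lemma E_comp_iff:
  "z \<in> E_comp K V c n \<longleftrightarrow> z \<in> TP n \<and> (\<forall>a. 1 \<le> a \<and> a < n \<longrightarrow> sh 0 n a z = \<zero>\<^bsub>T\<^esub>)"
proof (cases "z \<in> TP n")
  case True
  have eq: "tensor_comult_comp K V c a b z = \<zero>\<^bsub>T.T\<^esub> \<longleftrightarrow> sh 0 n a z = \<zero>\<^bsub>T\<^esub>" if "a + b = n" for a b
  proof -
    have e: "tensor_comult_comp K V c a b z = sp [a, b] (sh 0 n a z)"
      using tensor_comult_comp[of z a b] True that by simp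
    have "sh 0 n a z \<in> TP (sum_list [a, b])" using sh_tpow[OF True] that by simp
    from sp_eq_zero[OF this] show ?thesis unfolding e by (metis sp_zero)
  qed
  show ?thesis
  proof
    assume z: "z \<in> E_comp K V c n"
    have "sh 0 n a z = \<zero>\<^bsub>T\<^esub>" if "1 \<le> a" "a < n" for a
    proof -
      have "tensor_comult_comp K V c a (n - a) z = \<zero>\<^bsub>T.T\<^esub>"
        using z that unfolding E_comp_def by simp
      then show ?thesis using eq[of a "n - a"] that by simp
    qed
    then show "z \<in> TP n \<and> (\<forall>a. 1 \<le> a \<and> a < n \<longrightarrow> sh 0 n a z = \<zero>\<^bsub>T\<^esub>)" using True by blast
  next
    assume z: "z \<in> TP n \<and> (\<forall>a. 1 \<le> a \<and> a < n \<longrightarrow> sh 0 n a z = \<zero>\<^bsub>T\<^esub>)"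
    have "tensor_comult_comp K V c a b z = \<zero>\<^bsub>T.T\<^esub>" if "1 \<le> a" "1 \<le> b" "a + b = n" for a b
      using z that eq[OF that(3)] by simp
    then show "z \<in> E_comp K V c n" using True unfolding E_comp_def by blast
  qed
qed (simp add: E_comp_def)

lemma E_comp_tpow: "z \<in> E_comp K V c n \<Longrightarrow> z \<in> TP n"
  by (simp add: E_comp_iff)

lemma E_comp_T: "z \<in> E_comp K V c n \<Longrightarrow> z \<in> carrier T"
  by (rule tpow_T[OF E_comp_tpow])

lemma E_comp_zero: "\<zero>\<^bsub>T\<^esub> \<in> E_comp K V c n"
  by (simp add: E_comp_iff tpow_zero)

lemma E_comp_add: "x \<in> E_comp K V c n \<Longrightarrow> y \<in> E_comp K V c n \<Longrightarrow> x \<oplus>\<^bsub>T\<^esub> y \<in> E_comp K V c n"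
  using tpow_T[of x n] tpow_T[of y n] by (simp add: E_comp_iff tpow_add sh_add)

lemma E_comp_smult: "a \<in> carrier K \<Longrightarrow> x \<in> E_comp K V c n \<Longrightarrow> a \<odot>\<^bsub>T\<^esub> x \<in> E_comp K V c n"
  using tpow_T[of x n] by (simp add: E_comp_iff tpow_smult lin_hom_smult[OF sh_lin])

abbreviation "EV \<equiv> carrier (E_space K V c)"

lemma E_carrier: "EV = {z. \<exists>N f. (\<forall>n\<in>{2..N}. f n \<in> E_comp K V c n) \<and> z = finsum T f {2..N}}"
  by (simp add: E_space_def)

lemma E_memI: "(\<And>n. n \<in> {2..N} \<Longrightarrow> f n \<in> E_comp K V c n) \<Longrightarrow> finsum T f {2..N} \<in> EV"
  unfolding E_carrier by blast

lemma E_ops [simp]: "add (E_space K V c) = add T" "smult (E_space K V c) = smult T" "zero (E_space K V c) = zero T"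
  by (simp_all add: E_space_def)

lemma E_sub: "EV \<subseteq> carrier T"
proof
  fix z assume "z \<in> EV"
  then obtain N f where f: "\<And>n. n \<in> {2..N} \<Longrightarrow> f n \<in> E_comp K V c n" "z = finsum T f {2..N}"
    unfolding E_carrier by blast
  show "z \<in> carrier T" unfolding f(2) by (intro T.finsum_closed funcsetI E_comp_T[OF f(1)])
qed

lemma E_zero: "\<zero>\<^bsub>T\<^esub> \<in> EV"
  using E_memI[of 0 "\<lambda>_. \<zero>\<^bsub>T\<^esub>"] by simp

text \<open>Elements of \<open>E(V, c)\<close> come as sums with different upper bounds; padding with zeros lets them be
  added degree by degree.\<close>

lemma finsum_pad:
  assumes "N \<le> M" "\<And>n::nat. n \<in> {2..N} \<Longrightarrow> f n \<in> carrier T"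
  shows "finsum T f {2..N} = finsum T (\<lambda>n. if n \<le> N then f n else \<zero>\<^bsub>T\<^esub>) {2..M}"
  by (rule T.add.finprod_mono_neutral_cong_left) (use assms in auto)

lemma E_add: "x \<in> EV \<Longrightarrow> y \<in> EV \<Longrightarrow> x \<oplus>\<^bsub>T\<^esub> y \<in> EV"
proof -
  assume "x \<in> EV" "y \<in> EV"
  then obtain N f M g where f: "\<And>n. n \<in> {2..N} \<Longrightarrow> f n \<in> E_comp K V c n" "x = finsum T f {2..N}"
    and g: "\<And>n. n \<in> {2..M} \<Longrightarrow> g n \<in> E_comp K V c n" "y = finsum T g {2..M}"
    unfolding E_carrier by blast
  let ?f = "\<lambda>n. if n \<le> N then f n else \<zero>\<^bsub>T\<^esub>" and ?g = "\<lambda>n. if n \<le> M then g n else \<zero>\<^bsub>T\<^esub>"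
  let ?M = "max N M"
  have c: "?f n \<in> E_comp K V c n" "?g n \<in> E_comp K V c n" if "n \<in> {2..?M}" for n
    using f(1)[of n] g(1)[of n] that E_comp_zero by simp_all
  have x: "x = finsum T ?f {2..?M}" unfolding f(2)
    by (rule finsum_pad) (simp, rule E_comp_T[OF f(1)])
  have y: "y = finsum T ?g {2..?M}" unfolding g(2)
    by (rule finsum_pad) (simp, rule E_comp_T[OF g(1)])
  have "x \<oplus>\<^bsub>T\<^esub> y = finsum T (\<lambda>n. ?f n \<oplus>\<^bsub>T\<^esub> ?g n) {2..?M}"
    unfolding x y by (rule T.finsum_addf[symmetric]; rule funcsetI) (rule E_comp_T, rule c, assumption)+
  also have "\<dots> \<in> EV" by (rule E_memI) (rule E_comp_add[OF c])
  finally show ?thesis .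
qed

lemma E_smult: "a \<in> carrier K \<Longrightarrow> x \<in> EV \<Longrightarrow> a \<odot>\<^bsub>T\<^esub> x \<in> EV"
proof -
  assume a: "a \<in> carrier K" and "x \<in> EV"
  then obtain N f where f: "\<And>n. n \<in> {2..N} \<Longrightarrow> f n \<in> E_comp K V c n" "x = finsum T f {2..N}"
    unfolding E_carrier by blast
  have "f \<in> {2..N} \<rightarrow> carrier T" by (intro funcsetI E_comp_T[OF f(1)])
  then have "a \<odot>\<^bsub>T\<^esub> x = finsum T (\<lambda>n. a \<odot>\<^bsub>T\<^esub> f n) {2..N}"
    unfolding f(2) using a by (intro T.finsum_smult_ldistr) auto
  also have "\<dots> \<in> EV" by (rule E_memI) (rule E_comp_smult[OF a f(1)])
  finally show ?thesis .
qed

lemma E_submodule: "submodule EV K T"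
  by (rule T.submoduleI') (use E_sub E_zero E_add E_smult in auto)

lemma E_module: "module K (E_space K V c)"
  using module_submodule[OF T_module E_submodule] by (simp add: E_space_def)

lemma E_comp_E: "2 \<le> n \<Longrightarrow> z \<in> E_comp K V c n \<Longrightarrow> z \<in> EV"
proof -
  assume n: "2 \<le> n" and z: "z \<in> E_comp K V c n"
  have "finsum T (\<lambda>k. if k = n then z else \<zero>\<^bsub>T\<^esub>) {2..n} \<in> EV"
    by (rule E_memI) (use z E_comp_zero in auto)
  also have "finsum T (\<lambda>k. if k = n then z else \<zero>\<^bsub>T\<^esub>) {2..n} = z"
    using n tpow_T[OF E_comp_tpow[OF z]] by (subst T.add.finprod_singleton_swap) auto
  finally show ?thesis .
qed

lemma E_induct [consumes 1, case_names comp add]: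
  assumes z: "z \<in> EV"
    and comp: "\<And>n x. 2 \<le> n \<Longrightarrow> x \<in> E_comp K V c n \<Longrightarrow> Q x"
    and add: "\<And>x y. x \<in> EV \<Longrightarrow> y \<in> EV \<Longrightarrow> Q x \<Longrightarrow> Q y \<Longrightarrow> Q (x \<oplus>\<^bsub>T\<^esub> y)"
  shows "Q z"
proof -
  obtain N f where f: "\<And>n. n \<in> {2..N} \<Longrightarrow> f n \<in> E_comp K V c n" "z = finsum T f {2..N}"
    using z unfolding E_carrier by blast
  have "Q (finsum T f {2..N})" using f(1)
  proof (induction N)
    case 0
    show ?case using comp[OF order_refl E_comp_zero] by simp
  next
    case (Suc N)
    show ?case
    proof (cases "2 \<le> Suc N")
      case True
      have t: "f k \<in> carrier T" if "k \<in> {2..Suc N}" for k by (rule E_comp_T[OF Suc.prems[OF that]])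
      have s: "{2..Suc N} = insert (Suc N) {2..N}" using True by auto
      have "finsum T f {2..Suc N} = f (Suc N) \<oplus>\<^bsub>T\<^esub> finsum T f {2..N}"
        unfolding s by (rule T.finsum_insert) (use t True in auto)
      moreover have "Q (f (Suc N))" using comp[OF True] Suc.prems True by simp
      moreover have "f (Suc N) \<in> EV" using E_comp_E[OF True] Suc.prems True by simp
      moreover have "finsum T f {2..N} \<in> EV" by (rule E_memI) (use Suc.prems in simp)
      moreover have "Q (finsum T f {2..N})" by (rule Suc.IH) (use Suc.prems in simp)
      ultimately show ?thesis using add by simp
    next
      case False
      then have "{2..Suc N} = {}" by simp
      then show ?thesis using comp[OF order_refl E_comp_zero] by simp
    qed
  qed
  then show ?thesis using f(2) by simp
qed

end


section \<open>Tensoring with a vector space is exact\<close>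

lemma submodule_zero: "submodule H K M \<Longrightarrow> \<zero>\<^bsub>M\<^esub> \<in> H"
  by (auto simp: submodule_def dest: subgroup.one_closed)

context vec
begin

interpretation T: assoc_algebra K T by (rule T_algebra)
interpretation TT: assoc_algebra K T.T by (rule T.T_algebra)

lemma maximal_complement:
  assumes H: "submodule H K V"
  obtains D where "submodule D K V" "D \<inter> H = {\<zero>\<^bsub>V\<^esub>}"
    "\<And>N. submodule N K V \<Longrightarrow> D \<subseteq> N \<Longrightarrow> N \<inter> H = {\<zero>\<^bsub>V\<^esub>} \<Longrightarrow> N = D"
proof -
  let ?A = "{D. submodule D K V \<and> D \<inter> H = {\<zero>\<^bsub>V\<^esub>}}"
  have "\<exists>D\<in>?A. \<forall>N\<in>?A. D \<subseteq> N \<longrightarrow> N = D"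
  proof (rule subset_Zorn_nonempty)
    have "submodule {\<zero>\<^bsub>V\<^esub>} K V" by (rule submoduleI') auto
    then show "?A \<noteq> {}" using submodule_zero[OF H] by blast
    fix Ch assume Ch: "Ch \<noteq> {}" "subset.chain ?A Ch"
    then have ChA: "Ch \<subseteq> ?A" and ch: "\<And>X Y. X \<in> Ch \<Longrightarrow> Y \<in> Ch \<Longrightarrow> X \<subseteq> Y \<or> Y \<subseteq> X"
      by (auto simp: subset_chain_def)
    have sm: "submodule X K V" if "X \<in> Ch" for X using ChA that by blast
    have "submodule (\<Union>Ch) K V"
    proof (rule submoduleI')
      show "\<Union>Ch \<subseteq> carrier V" using submoduleE(1)[OF sm] by blast
      show "\<zero>\<^bsub>V\<^esub> \<in> \<Union>Ch" using Ch(1) submodule_zero[OF sm] by blast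
      show "x \<oplus>\<^bsub>V\<^esub> y \<in> \<Union>Ch" if xy: "x \<in> \<Union>Ch" "y \<in> \<Union>Ch" for x y
      proof -
        obtain X Y where XY: "X \<in> Ch" "x \<in> X" "Y \<in> Ch" "y \<in> Y" using xy by blast
        then consider "x \<in> Y" | "y \<in> X" using ch by blast
        then show ?thesis
        proof cases
          case 1 then show ?thesis using submoduleE(5)[OF sm[OF XY(3)] 1 XY(4)] XY(3) by blast
        next
          case 2 then show ?thesis using submoduleE(5)[OF sm[OF XY(1)] XY(2) 2] XY(1) by blast
        qed
      qed
      show "a \<odot>\<^bsub>V\<^esub> x \<in> \<Union>Ch" if "a \<in> carrier K" "x \<in> \<Union>Ch" for a x
        using that submoduleE(4)[OF sm] by blast
    qed
    moreover have "\<Union>Ch \<inter> H = {\<zero>\<^bsub>V\<^esub>}" using Ch(1) ChA by blast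
    ultimately show "\<Union>Ch \<in> ?A" by simp
  qed
  then obtain D where D: "D \<in> ?A" "\<forall>N\<in>?A. D \<subseteq> N \<longrightarrow> N = D" by (rule bexE)
  show thesis
    by (rule that[of D]) (use D in simp_all)
qed

text \<open>A maximal subspace \<open>D\<close> that meets \<open>H\<close> trivially is a complement of \<open>H\<close>: adjoining to \<open>D\<close> an element
  \<open>x\<close> outside \<open>D\<close> produces a nonzero \<open>d + b x\<close> in \<open>H\<close>, and dividing by \<open>b\<close> shows that \<open>x\<close> lies in
  \<open>H + D\<close>. The map sought is the projection to \<open>H\<close> along \<open>D\<close>.\<close>

lemma projection_exists:
  assumes H: "submodule H K V"
  shows "\<exists>p\<in>lin_hom K V V. (\<forall>x\<in>carrier V. p x \<in> H) \<and> (\<forall>h\<in>H. p h = h)"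
proof -
  obtain D where D: "submodule D K V" "D \<inter> H = {\<zero>\<^bsub>V\<^esub>}"
    and max: "\<And>N. submodule N K V \<Longrightarrow> D \<subseteq> N \<Longrightarrow> N \<inter> H = {\<zero>\<^bsub>V\<^esub>} \<Longrightarrow> N = D"
    using maximal_complement[OF H] by blast
  note sD = submoduleE[OF D(1)] and sH = submoduleE[OF H]
  note D0 = submodule_zero[OF D(1)] and H0 = submodule_zero[OF H]
  have DV: "d \<in> D \<Longrightarrow> d \<in> carrier V" and HV: "h \<in> H \<Longrightarrow> h \<in> carrier V" for d h
    using sD(1) sH(1) by blast+
  have dec: "\<exists>h\<in>H. \<exists>d\<in>D. x = h \<oplus>\<^bsub>V\<^esub> d" if x: "x \<in> carrier V" for x
  proof (cases "x \<in> D")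
    case True
    have "x = \<zero>\<^bsub>V\<^esub> \<oplus>\<^bsub>V\<^esub> x" using x by simp
    then show ?thesis using True H0 by blast
  next
    case False
    let ?N = "{d \<oplus>\<^bsub>V\<^esub> b \<odot>\<^bsub>V\<^esub> x | d b. d \<in> D \<and> b \<in> carrier K}"
    have N: "submodule ?N K V"
    proof (rule submoduleI')
      show "?N \<subseteq> carrier V" using DV x by auto
      have "\<zero>\<^bsub>V\<^esub> = \<zero>\<^bsub>V\<^esub> \<oplus>\<^bsub>V\<^esub> \<zero> \<odot>\<^bsub>V\<^esub> x" using x by simp
      then show "\<zero>\<^bsub>V\<^esub> \<in> ?N" using D0 by blast
      show "y \<oplus>\<^bsub>V\<^esub> y' \<in> ?N" if yN: "y \<in> ?N" "y' \<in> ?N" for y y'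
      proof -
        obtain d b d' b' where db: "d \<in> D" "b \<in> carrier K" "y = d \<oplus>\<^bsub>V\<^esub> b \<odot>\<^bsub>V\<^esub> x"
          "d' \<in> D" "b' \<in> carrier K" "y' = d' \<oplus>\<^bsub>V\<^esub> b' \<odot>\<^bsub>V\<^esub> x" using yN by blast
        have "y \<oplus>\<^bsub>V\<^esub> y' = (d \<oplus>\<^bsub>V\<^esub> d') \<oplus>\<^bsub>V\<^esub> (b \<oplus> b') \<odot>\<^bsub>V\<^esub> x"
          using db x DV by (simp add: smult_l_distr M.a_ac)
        then show ?thesis using db sD(5) by blast
      qed
      show "a \<odot>\<^bsub>V\<^esub> y \<in> ?N" if ay: "a \<in> carrier K" "y \<in> ?N" for a y
      proof -
        obtain d b where db: "d \<in> D" "b \<in> carrier K" "y = d \<oplus>\<^bsub>V\<^esub> b \<odot>\<^bsub>V\<^esub> x" using ay by blast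
        have "a \<odot>\<^bsub>V\<^esub> y = a \<odot>\<^bsub>V\<^esub> d \<oplus>\<^bsub>V\<^esub> (a \<otimes> b) \<odot>\<^bsub>V\<^esub> x"
          using db x DV ay by (simp add: smult_r_distr smult_assoc1)
        then show ?thesis using db sD(4) ay by blast
      qed
    qed
    have DN: "D \<subseteq> ?N"
    proof
      fix d assume d: "d \<in> D"
      have "d = d \<oplus>\<^bsub>V\<^esub> \<zero> \<odot>\<^bsub>V\<^esub> x" using x DV[OF d] by simp
      then show "d \<in> ?N" using d by blast
    qed
    have "x = \<zero>\<^bsub>V\<^esub> \<oplus>\<^bsub>V\<^esub> \<one> \<odot>\<^bsub>V\<^esub> x" using x by simp
    then have "x \<in> ?N" using D0 by blast
    then have "?N \<inter> H \<noteq> {\<zero>\<^bsub>V\<^esub>}" using max[OF N DN] False by blast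
    then obtain h where h: "h \<in> ?N" "h \<in> H" "h \<noteq> \<zero>\<^bsub>V\<^esub>" using submodule_zero[OF N] H0 by blast
    then obtain d b where db: "d \<in> D" "b \<in> carrier K" "h = d \<oplus>\<^bsub>V\<^esub> b \<odot>\<^bsub>V\<^esub> x" by blast
    have "b \<noteq> \<zero>"
    proof
      assume "b = \<zero>"
      then have "h \<in> D" using db x DV by simp
      then show False using h D(2) by blast
    qed
    then have i: "inv b \<in> carrier K" "inv b \<otimes> b = \<one>" using field_Units db(2) by auto
    have "inv b \<odot>\<^bsub>V\<^esub> h = inv b \<odot>\<^bsub>V\<^esub> d \<oplus>\<^bsub>V\<^esub> x"
      using i db x DV by (simp add: smult_r_distr flip: smult_assoc1)
    moreover have id: "inv b \<odot>\<^bsub>V\<^esub> d \<in> D" and ih: "inv b \<odot>\<^bsub>V\<^esub> h \<in> H" using sD(4) sH(4) i db h by blast+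
    ultimately have "x = inv b \<odot>\<^bsub>V\<^esub> h \<oplus>\<^bsub>V\<^esub> (\<ominus>\<^bsub>V\<^esub> (inv b \<odot>\<^bsub>V\<^esub> d))"
      using x DV[OF id] by (simp add: M.a_assoc M.a_comm[of x] M.r_neg M.r_neg2)
    then show ?thesis using ih sD(3)[OF id] by blast
  qed
  have uniq: "h = h'" if *: "h \<in> H" "h' \<in> H" "d \<in> D" "d' \<in> D" "h \<oplus>\<^bsub>V\<^esub> d = h' \<oplus>\<^bsub>V\<^esub> d'" for h h' d d'
  proof -
    note m = HV[OF *(1)] HV[OF *(2)] DV[OF *(3)] DV[OF *(4)]
    have "h \<oplus>\<^bsub>V\<^esub> \<ominus>\<^bsub>V\<^esub> h' = d' \<oplus>\<^bsub>V\<^esub> \<ominus>\<^bsub>V\<^esub> d"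
    proof -
      have "h \<oplus>\<^bsub>V\<^esub> \<ominus>\<^bsub>V\<^esub> h' = (h \<oplus>\<^bsub>V\<^esub> d) \<oplus>\<^bsub>V\<^esub> (\<ominus>\<^bsub>V\<^esub> d \<oplus>\<^bsub>V\<^esub> \<ominus>\<^bsub>V\<^esub> h')" using m by (simp add: M.a_assoc M.r_neg2)
      also have "\<dots> = (d' \<oplus>\<^bsub>V\<^esub> h') \<oplus>\<^bsub>V\<^esub> (\<ominus>\<^bsub>V\<^esub> h' \<oplus>\<^bsub>V\<^esub> \<ominus>\<^bsub>V\<^esub> d)" unfolding *(5) using m by (simp add: M.a_comm)
      also have "\<dots> = d' \<oplus>\<^bsub>V\<^esub> \<ominus>\<^bsub>V\<^esub> d" using m by (simp add: M.a_assoc M.r_neg2)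
      finally show ?thesis .
    qed
    moreover have "h \<oplus>\<^bsub>V\<^esub> \<ominus>\<^bsub>V\<^esub> h' \<in> H" "d' \<oplus>\<^bsub>V\<^esub> \<ominus>\<^bsub>V\<^esub> d \<in> D" using * sH(3,5) sD(3,5) by blast+
    ultimately have "h \<oplus>\<^bsub>V\<^esub> \<ominus>\<^bsub>V\<^esub> h' = \<zero>\<^bsub>V\<^esub>" using D(2) by auto
    then show ?thesis using M.minus_zero_eq m by (simp add: M.minus_eq)
  qed
  define p where "p x = (THE h. h \<in> H \<and> (\<exists>d\<in>D. x = h \<oplus>\<^bsub>V\<^esub> d))" for x
  have p: "p (h \<oplus>\<^bsub>V\<^esub> d) = h" if "h \<in> H" "d \<in> D" for h d
    unfolding p_def by (rule the_equality) (use that uniq in blast)+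
  have "p \<in> lin_hom K V V"
  proof (rule lin_homI)
    fix x assume "x \<in> carrier V"
    then obtain h d where x: "h \<in> H" "d \<in> D" "x = h \<oplus>\<^bsub>V\<^esub> d" using dec by blast
    then show "p x \<in> carrier V" using p HV by simp
    fix y assume "y \<in> carrier V"
    then obtain h' d' where y: "h' \<in> H" "d' \<in> D" "y = h' \<oplus>\<^bsub>V\<^esub> d'" using dec by blast
    have "x \<oplus>\<^bsub>V\<^esub> y = (h \<oplus>\<^bsub>V\<^esub> h') \<oplus>\<^bsub>V\<^esub> (d \<oplus>\<^bsub>V\<^esub> d')" using x y HV DV by (simp add: M.a_ac)
    then show "p (x \<oplus>\<^bsub>V\<^esub> y) = p x \<oplus>\<^bsub>V\<^esub> p y" using x y p sH(5) sD(5) by simp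
  next
    fix a x assume a: "a \<in> carrier K" and "x \<in> carrier V"
    then obtain h d where x: "h \<in> H" "d \<in> D" "x = h \<oplus>\<^bsub>V\<^esub> d" using dec by blast
    have "a \<odot>\<^bsub>V\<^esub> x = a \<odot>\<^bsub>V\<^esub> h \<oplus>\<^bsub>V\<^esub> a \<odot>\<^bsub>V\<^esub> d" using x a HV DV by (simp add: smult_r_distr)
    then show "p (a \<odot>\<^bsub>V\<^esub> x) = a \<odot>\<^bsub>V\<^esub> p x" using x a p sH(4) sD(4) by simp
  qed
  moreover have "p x \<in> H" if x: "x \<in> carrier V" for x using dec[OF x] p by auto
  moreover have "p h = h" if "h \<in> H" for h using p[OF that D0] HV[OF that] by simp
  ultimately show ?thesis by blast
qed

text \<open>Let \<open>q\<close> be a projection onto the kernel of \<open>G\<close> and \<open>p\<close> one onto its image. Two preimages of \<open>p w\<close>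
  differ by an element of the kernel, which \<open>r = id - q\<close> sends to zero; hence \<open>r\<close> of a preimage does
  not depend on its choice, and is linear in \<open>w\<close>.\<close>

lemma generalized_inverse:
  assumes W: "module K W" and G: "G \<in> lin_hom K V W"
  shows "\<exists>s\<in>lin_hom K W V. \<forall>z\<in>carrier V. G (s (G z)) = G z"
proof -
  interpret W: vec K W using W field_axioms by (simp add: vec_def)
  note Ga = lin_hom_add[OF G] and Gs = lin_hom_smult[OF G] and Gc = lin_hom_closed[OF G]
    and G0 = lin_hom_zero[OF G module_axioms W]
  let ?k = "{z \<in> carrier V. G z = \<zero>\<^bsub>W\<^esub>}"
  have "submodule ?k K V" by (rule submoduleI') (auto simp: Ga Gs G0)
  then obtain q where q: "q \<in> lin_hom K V V" "\<And>z. z \<in> carrier V \<Longrightarrow> q z \<in> ?k" "\<And>z. z \<in> ?k \<Longrightarrow> q z = z"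
    using projection_exists by blast
  have "submodule (G ` carrier V) K W"
  proof (rule W.submoduleI')
    show "\<zero>\<^bsub>W\<^esub> \<in> G ` carrier V" using G0 by (metis image_eqI M.zero_closed)
  qed (auto simp: Gc simp flip: Ga Gs)
  then obtain p where p: "p \<in> lin_hom K W W" "\<And>w. w \<in> carrier W \<Longrightarrow> p w \<in> G ` carrier V"
    "\<And>w. w \<in> G ` carrier V \<Longrightarrow> p w = w"
    using W.projection_exists by blast
  define r where "r z = z \<oplus>\<^bsub>V\<^esub> (\<ominus> \<one>) \<odot>\<^bsub>V\<^esub> q z" for z
  have r: "r \<in> lin_hom K V V"
    unfolding r_def[abs_def]
    by (intro lin_hom_sum lin_hom_smult_map q module_axioms) (auto intro: lin_homI)
  note ra = lin_hom_add[OF r] and rs = lin_hom_smult[OF r] and rc = lin_hom_closed[OF r]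
  have rk: "r z = \<zero>\<^bsub>V\<^esub>" if "z \<in> ?k" for z
    using q(3)[OF that] that by (simp add: r_def smult_l_minus M.r_neg)
  have req: "r z = r z'" if "z \<in> carrier V" "z' \<in> carrier V" "G z = G z'" for z z'
  proof -
    have "z \<ominus>\<^bsub>V\<^esub> z' \<in> ?k" using that Gc by (simp add: lin_hom_minus[OF G module_axioms W] W.minus_eq W.r_neg)
    then have "r z \<ominus>\<^bsub>V\<^esub> r z' = \<zero>\<^bsub>V\<^esub>"
      using rk that by (simp flip: lin_hom_minus[OF r module_axioms module_axioms])
    then show ?thesis by (rule M.minus_zero_eq[OF _ rc[OF that(1)] rc[OF that(2)]])
  qed
  have Gr: "G (r z) = G z" if "z \<in> carrier V" for z
  proof -
    have "q z \<in> carrier V" "G (q z) = \<zero>\<^bsub>W\<^esub>" using q(2)[OF that] by simp_all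
    then show ?thesis using that Gc[OF that] by (simp add: r_def Ga Gs)
  qed
  define s0 where "s0 w = (SOME z. z \<in> carrier V \<and> G z = p w)" for w
  have s0: "s0 w \<in> carrier V" "G (s0 w) = p w" if w: "w \<in> carrier W" for w
  proof -
    have "\<exists>z. z \<in> carrier V \<and> G z = p w" using p(2)[OF w] by auto
    from someI_ex[OF this] show "s0 w \<in> carrier V" "G (s0 w) = p w" unfolding s0_def by blast+
  qed
  have "(\<lambda>w. r (s0 w)) \<in> lin_hom K W V"
  proof (rule lin_homI)
    show "r (s0 w) \<in> carrier V" if "w \<in> carrier W" for w using rc s0 that by simp
    show "r (s0 (w \<oplus>\<^bsub>W\<^esub> w')) = r (s0 w) \<oplus>\<^bsub>V\<^esub> r (s0 w')" if "w \<in> carrier W" "w' \<in> carrier W" for w w'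
      using that s0 req[of "s0 (w \<oplus>\<^bsub>W\<^esub> w')" "s0 w \<oplus>\<^bsub>V\<^esub> s0 w'"] by (simp add: Ga ra lin_hom_add[OF p(1)])
    show "r (s0 (a \<odot>\<^bsub>W\<^esub> w)) = a \<odot>\<^bsub>V\<^esub> r (s0 w)" if "a \<in> carrier K" "w \<in> carrier W" for a w
      using that s0 req[of "s0 (a \<odot>\<^bsub>W\<^esub> w)" "a \<odot>\<^bsub>V\<^esub> s0 w"] by (simp add: Gs rs lin_hom_smult[OF p(1)])
  qed
  moreover have "G (r (s0 (G z))) = G z" if "z \<in> carrier V" for z
    using that s0[OF Gc[OF that]] Gr p(3)[of "G z"] by simp
  ultimately show ?thesis by (intro bexI[of _ "\<lambda>w. r (s0 w)"]) auto
qed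

lemma pure_add:
  assumes "x \<in> carrier V" "y \<in> carrier V" "z \<in> carrier V"
  shows pure_add_left: "P [x \<oplus>\<^bsub>V\<^esub> y, z] = P [x, z] \<oplus>\<^bsub>T\<^esub> P [y, z]"
    and pure_add_right: "P [z, x \<oplus>\<^bsub>V\<^esub> y] = P [z, x] \<oplus>\<^bsub>T\<^esub> P [z, y]"
  using multilinearD(2)[OF pure_multilinear, of "[]" "[z]" x y]
    multilinearD(2)[OF pure_multilinear, of "[z]" "[]" x y] assms by simp_all

end

context vec
begin

interpretation T: assoc_algebra K T by (rule T_algebra)
interpretation TT: assoc_algebra K T.T by (rule T.T_algebra)

context
  fixes n q :: nat and G :: "('a, 'c) tensor \<Rightarrow> ('a, ('a, 'c) tensor) tensor"
    and Y :: "('a, ('a, 'c) tensor) tensor set"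
  assumes G: "G \<in> lin_hom K (tpow K V n) (tpow K T q)" and Y: "submodule Y K T.T"
begin

text \<open>Subtracting \<open>s (G z)\<close> from \<open>z\<close> leaves an element of the kernel of \<open>G\<close>.\<close>

lemma split_kernel:
  obtains s where "s \<in> lin_hom K (tpow K T q) T"
    "\<And>z. z \<in> TP n \<Longrightarrow> \<exists>z'\<in>TP n. G z' = \<zero>\<^bsub>T.T\<^esub> \<and> z = z' \<oplus>\<^bsub>T\<^esub> s (G z)"
proof -
  interpret TN: vec K "tpow K V n" using tpow_module field_axioms by (simp add: vec_def)
  obtain s where s: "s \<in> lin_hom K (tpow K T q) (tpow K V n)" "\<forall>z\<in>TP n. G (s (G z)) = G z"
    using TN.generalized_inverse[OF T.tpow_module G] by blast
  have "\<exists>z'\<in>TP n. G z' = \<zero>\<^bsub>T.T\<^esub> \<and> z = z' \<oplus>\<^bsub>T\<^esub> s (G z)" if z: "z \<in> TP n" for z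
  proof (intro bexI conjI)
    have sz: "s (G z) \<in> TP n" using lin_hom_closed[OF s(1) lin_hom_closed[OF G z]] .
    have m: "z \<ominus>\<^bsub>tpow K V n\<^esub> s (G z) \<in> TP n" using z sz by simp
    have "(z \<ominus>\<^bsub>tpow K V n\<^esub> s (G z)) \<oplus>\<^bsub>tpow K V n\<^esub> s (G z) = z" by (rule TN.minus_add_cancel[OF z sz])
    then show "z = (z \<ominus>\<^bsub>tpow K V n\<^esub> s (G z)) \<oplus>\<^bsub>T\<^esub> s (G z)" by simp
    show "z \<ominus>\<^bsub>tpow K V n\<^esub> s (G z) \<in> TP n" by (rule m)
    interpret TQ: vec K "tpow K T q" using T.tpow_module field_axioms by (simp add: vec_def)
    have "G (z \<ominus>\<^bsub>tpow K V n\<^esub> s (G z)) = G z \<ominus>\<^bsub>tpow K T q\<^esub> G z"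
      using lin_hom_minus[OF G tpow_module T.tpow_module z sz] s(2) z by simp
    then show "G (z \<ominus>\<^bsub>tpow K V n\<^esub> s (G z)) = \<zero>\<^bsub>T.T\<^esub>"
      using TQ.r_neg[OF lin_hom_closed[OF G z]] by (simp add: TQ.minus_eq)
  qed
  then show thesis using that lin_hom_tpow_T[OF s(1)] by blast
qed

text \<open>The kernel of \<open>V \<otimes> G\<close> is \<open>V \<otimes> ker G\<close>: the map \<open>V \<otimes> s\<close> recovers every tensor from its image up to
  a sum of pure tensors \<open>x \<otimes> z'\<close> with \<open>z'\<close> in the kernel of \<open>G\<close>. In the statement \<open>H\<close> is \<open>V \<otimes> G\<close>, and \<open>Y\<close>
  is any subspace that contains these pure tensors.\<close>

lemma tensor_kernel_left:
  assumes H: "H \<in> lin_hom K T T.T" "\<And>x z. x \<in> TP 1 \<Longrightarrow> z \<in> TP n \<Longrightarrow> H (x \<otimes>\<^bsub>T\<^esub> z) = T.inc x \<otimes>\<^bsub>T.T\<^esub> G z"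
    and base: "\<And>x z. x \<in> TP 1 \<Longrightarrow> z \<in> TP n \<Longrightarrow> G z = \<zero>\<^bsub>T.T\<^esub> \<Longrightarrow> T.P [x, z] \<in> Y"
    and y: "y \<in> TP (1 + n)" "H y = \<zero>\<^bsub>T.T\<^esub>"
  shows "sp [1, n] y \<in> Y"
proof -
  obtain s where s: "s \<in> lin_hom K (tpow K T q) T"
    "\<And>z. z \<in> TP n \<Longrightarrow> \<exists>z'\<in>TP n. G z' = \<zero>\<^bsub>T.T\<^esub> \<and> z = z' \<oplus>\<^bsub>T\<^esub> s (G z)" by (rule split_kernel) blast
  obtain k where k: "k \<in> lin_hom K T.T T.T"
    "\<forall>X\<in>T.TP 1. \<forall>Z\<in>T.TP q. k (X \<otimes>\<^bsub>T.T\<^esub> Z) = X \<otimes>\<^bsub>T.T\<^esub> T.inc (s Z)"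
    using T.product_lift[OF T.T_algebra T.id_lin[of 1] lin_hom_comp[OF s(1) T.incl_lin]] by blast
  note sY = TT.submoduleE[OF Y]
  have YT: "u \<in> Y \<Longrightarrow> u \<in> carrier T.T" for u using sY(1) by blast
  from y(1) have "\<exists>u\<in>Y. sp [1, n] y = u \<oplus>\<^bsub>T.T\<^esub> k (H y)"
  proof (induction y rule: tpow_induct_mult)
    case (mult x z)
    obtain z' where z': "z' \<in> TP n" "G z' = \<zero>\<^bsub>T.T\<^esub>" "z = z' \<oplus>\<^bsub>T\<^esub> s (G z)" using s(2)[OF mult(2)] by blast
    have Gz: "G z \<in> T.TP q" by (rule lin_hom_closed[OF G mult(2)])
    have sz: "s (G z) \<in> carrier T" by (rule lin_hom_closed[OF s(1) Gz])
    note xT = tpow_T[OF mult(1)]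
    have "sp [1, n] (x \<otimes>\<^bsub>T\<^esub> z) = T.P [x, z' \<oplus>\<^bsub>T\<^esub> s (G z)]"
      using sp_two[OF mult] z'(3) by simp
    also have "\<dots> = T.P [x, z'] \<oplus>\<^bsub>T.T\<^esub> T.P [x, s (G z)]"
      by (rule T.pure_add_right[OF tpow_T[OF z'(1)] sz xT])
    also have "T.P [x, s (G z)] = k (H (x \<otimes>\<^bsub>T\<^esub> z))"
      using k(2) T.incl_tpow[OF xT] Gz by (simp add: H(2)[OF mult] T.pure_two[OF xT sz])
    finally show ?case using base[OF mult(1) z'(1,2)] by blast
  next
    case (add x y)
    then obtain u v where uv: "u \<in> Y" "sp [1, n] x = u \<oplus>\<^bsub>T.T\<^esub> k (H x)" "v \<in> Y" "sp [1, n] y = v \<oplus>\<^bsub>T.T\<^esub> k (H y)" by blast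
    have "sp [1, n] (x \<oplus>\<^bsub>T\<^esub> y) = (u \<oplus>\<^bsub>T.T\<^esub> v) \<oplus>\<^bsub>T.T\<^esub> k (H (x \<oplus>\<^bsub>T\<^esub> y))"
      using uv add(1,2) YT lin_hom_closed[OF k(1)] lin_hom_closed[OF H(1)]
      by (simp add: sp_add tpow_T lin_hom_add[OF H(1)] lin_hom_add[OF k(1)] TT.a_ac)
    then show ?case using sY(5)[OF uv(1,3)] by blast
  next
    case (smult a x)
    then obtain u where u: "u \<in> Y" "sp [1, n] x = u \<oplus>\<^bsub>T.T\<^esub> k (H x)" by blast
    have "sp [1, n] (a \<odot>\<^bsub>T\<^esub> x) = (a \<odot>\<^bsub>T.T\<^esub> u) \<oplus>\<^bsub>T.T\<^esub> k (H (a \<odot>\<^bsub>T\<^esub> x))"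
      using u smult(1,2) YT lin_hom_closed[OF k(1)] lin_hom_closed[OF H(1)]
      by (simp add: sp_smult tpow_T lin_hom_smult[OF H(1)] lin_hom_smult[OF k(1)] TT.smult_r_distr)
    then show ?case using sY(4)[OF smult(1) u(1)] by blast
  qed
  then show ?thesis using y(2) lin_hom_zero[OF k(1) T.T_module T.T_module] YT by auto
qed

lemma tensor_kernel_right:
  assumes H: "H \<in> lin_hom K T T.T" "\<And>x z. x \<in> TP 1 \<Longrightarrow> z \<in> TP n \<Longrightarrow> H (z \<otimes>\<^bsub>T\<^esub> x) = G z \<otimes>\<^bsub>T.T\<^esub> T.inc x"
    and base: "\<And>x z. x \<in> TP 1 \<Longrightarrow> z \<in> TP n \<Longrightarrow> G z = \<zero>\<^bsub>T.T\<^esub> \<Longrightarrow> T.P [z, x] \<in> Y"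
    and y: "y \<in> TP (n + 1)" "H y = \<zero>\<^bsub>T.T\<^esub>"
  shows "sp [n, 1] y \<in> Y"
proof -
  obtain s where s: "s \<in> lin_hom K (tpow K T q) T"
    "\<And>z. z \<in> TP n \<Longrightarrow> \<exists>z'\<in>TP n. G z' = \<zero>\<^bsub>T.T\<^esub> \<and> z = z' \<oplus>\<^bsub>T\<^esub> s (G z)" by (rule split_kernel) blast
  obtain k where k: "k \<in> lin_hom K T.T T.T"
    "\<forall>Z\<in>T.TP q. \<forall>X\<in>T.TP 1. k (Z \<otimes>\<^bsub>T.T\<^esub> X) = T.inc (s Z) \<otimes>\<^bsub>T.T\<^esub> X"
    using T.product_lift[OF T.T_algebra lin_hom_comp[OF s(1) T.incl_lin] T.id_lin[of 1]] by blast
  note sY = TT.submoduleE[OF Y]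
  have YT: "u \<in> Y \<Longrightarrow> u \<in> carrier T.T" for u using sY(1) by blast
  from y(1) have "\<exists>u\<in>Y. sp [n, 1] y = u \<oplus>\<^bsub>T.T\<^esub> k (H y)"
  proof (induction y rule: tpow_induct_mult)
    case (mult z x)
    obtain z' where z': "z' \<in> TP n" "G z' = \<zero>\<^bsub>T.T\<^esub>" "z = z' \<oplus>\<^bsub>T\<^esub> s (G z)" using s(2)[OF mult(1)] by blast
    have Gz: "G z \<in> T.TP q" by (rule lin_hom_closed[OF G mult(1)])
    have sz: "s (G z) \<in> carrier T" by (rule lin_hom_closed[OF s(1) Gz])
    note xT = tpow_T[OF mult(2)]
    have "sp [n, 1] (z \<otimes>\<^bsub>T\<^esub> x) = T.P [z' \<oplus>\<^bsub>T\<^esub> s (G z), x]"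
      using sp_two[OF mult] z'(3) by simp
    also have "\<dots> = T.P [z', x] \<oplus>\<^bsub>T.T\<^esub> T.P [s (G z), x]"
      by (rule T.pure_add_left[OF tpow_T[OF z'(1)] sz xT])
    also have "T.P [s (G z), x] = k (H (z \<otimes>\<^bsub>T\<^esub> x))"
      using k(2) T.incl_tpow[OF xT] Gz by (simp add: H(2)[OF mult(2,1)] T.pure_two[OF sz xT])
    finally show ?case using base[OF mult(2) z'(1,2)] by blast
  next
    case (add x y)
    then obtain u v where uv: "u \<in> Y" "sp [n, 1] x = u \<oplus>\<^bsub>T.T\<^esub> k (H x)" "v \<in> Y" "sp [n, 1] y = v \<oplus>\<^bsub>T.T\<^esub> k (H y)" by blast
    have "sp [n, 1] (x \<oplus>\<^bsub>T\<^esub> y) = (u \<oplus>\<^bsub>T.T\<^esub> v) \<oplus>\<^bsub>T.T\<^esub> k (H (x \<oplus>\<^bsub>T\<^esub> y))"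
      using uv add(1,2) YT lin_hom_closed[OF k(1)] lin_hom_closed[OF H(1)]
      by (simp add: sp_add tpow_T lin_hom_add[OF H(1)] lin_hom_add[OF k(1)] TT.a_ac)
    then show ?case using sY(5)[OF uv(1,3)] by blast
  next
    case (smult a x)
    then obtain u where u: "u \<in> Y" "sp [n, 1] x = u \<oplus>\<^bsub>T.T\<^esub> k (H x)" by blast
    have "sp [n, 1] (a \<odot>\<^bsub>T\<^esub> x) = (a \<odot>\<^bsub>T.T\<^esub> u) \<oplus>\<^bsub>T.T\<^esub> k (H (a \<odot>\<^bsub>T\<^esub> x))"
      using u smult(1,2) YT lin_hom_closed[OF k(1)] lin_hom_closed[OF H(1)]
      by (simp add: sp_smult tpow_T lin_hom_smult[OF H(1)] lin_hom_smult[OF k(1)] TT.smult_r_distr)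
    then show ?case using sY(4)[OF smult(1) u(1)] by blast
  qed
  then show ?thesis using y(2) lin_hom_zero[OF k(1) T.T_module T.T_module] YT by auto
qed

end

end

context braided_vector_space
begin

interpretation T: assoc_algebra K T by (rule T_algebra)
interpretation TT: assoc_algebra K T.T by (rule T.T_algebra)

text \<open>The reduced comultiplication, without the two outer terms; in degree \<open>n\<close> its kernel is \<open>E\<^sub>n\<close>.\<close>

definition red :: "nat \<Rightarrow> ('a, 'c) tensor \<Rightarrow> ('a, ('a, 'c) tensor) tensor" where
  "red n z = (\<Oplus>\<^bsub>T.T\<^esub>a\<in>{1..<n}. sp [a, n - a] (sh 0 n a z))"

lemma red_lin: "red n \<in> lin_hom K (tpow K V n) (tpow K T 2)"
proof (rule T.lin_hom_into_tpow)
  show "red n \<in> lin_hom K (tpow K V n) T.T"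
    unfolding red_def[abs_def]
    by (intro lin_hom_T_tpow lin_hom_finsum_map T_module T.T_module lin_hom_comp[OF sh_lin sp_lin])
  show "red n z \<in> T.TP 2" if "z \<in> TP n" for z
    unfolding red_def using sp_sh_tpow[OF that] by (intro T.tpow_finsum) simp
qed

text \<open>Terms of different bidegree cannot cancel, because the projections separate them.\<close>

lemma red_zero_E:
  assumes z: "z \<in> TP n" "red n z = \<zero>\<^bsub>T.T\<^esub>" shows "z \<in> E_comp K V c n"
  unfolding E_comp_iff
proof (intro conjI allI impI z(1))
  fix a assume a: "1 \<le> a \<and> a < n"
  have zT: "z \<in> carrier T" by (rule tpow_T[OF z(1)])
  have t: "sh 0 n s z \<in> TP (s + (n - s))" if "s < n" for s using sh_tpow[OF z(1)] that by simp
  have "\<zero>\<^bsub>T.T\<^esub> = pp a (n - a) (red n z)"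
    using z(2) lin_hom_zero[OF pp(1) T.T_module T.T_module] by simp
  also have "\<dots> = (\<Oplus>\<^bsub>T.T\<^esub>s\<in>{1..<n}. pp a (n - a) (sp [s, n - s] (sh 0 n s z)))"
    unfolding red_def by (rule lin_hom_finsum[OF pp(1) T.T_module T.T_module]) (use zT in auto)
  also have "\<dots> = (\<Oplus>\<^bsub>T.T\<^esub>s\<in>{1..<n}. if s = a then sp [s, n - s] (sh 0 n s z) else \<zero>\<^bsub>T.T\<^esub>)"
  proof (intro TT.finsum_cong' refl funcsetI)
    fix s assume "s \<in> {1..<n}"
    then show "pp a (n - a) (sp [s, n - s] (sh 0 n s z)) =
      (if s = a then sp [s, n - s] (sh 0 n s z) else \<zero>\<^bsub>T.T\<^esub>)"
      using pp_sp[OF t, of s a "n - a"] by auto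
  qed (use zT in auto)
  also have "\<dots> = sp [a, n - a] (sh 0 n a z)"
    using a zT by (subst TT.add.finprod_singleton_swap) auto
  finally show "sh 0 n a z = \<zero>\<^bsub>T\<^esub>" using sp_eq_zero[of "sh 0 n a z" "[a, n - a]"] t[of a] a by simp
qed

text \<open>On \<open>V \<otimes> V\<^sup>\<otimes>\<^sup>n\<close> the shuffles of the last \<open>n\<close> letters are \<open>V \<otimes> sh\<close>, so their common kernel is that of
  \<open>V \<otimes> red\<close>, which by exactness is \<open>V \<otimes> E\<^sub>n\<close>.\<close>

lemma E_kernel_left:
  assumes Y: "submodule Y K T.T" "\<And>x z. x \<in> TP 1 \<Longrightarrow> z \<in> E_comp K V c n \<Longrightarrow> T.P [x, z] \<in> Y"
    and w: "w \<in> TP (1 + n)" "\<And>a. 1 \<le> a \<Longrightarrow> a < n \<Longrightarrow> sh 1 n a w = \<zero>\<^bsub>T\<^esub>"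
  shows "sp [1, n] w \<in> Y"
proof (rule tensor_kernel_left[OF red_lin Y(1) _ _ _ w(1), where H = "\<lambda>y. \<Oplus>\<^bsub>T.T\<^esub>a\<in>{1..<n}. sp [1, a, n - a] (sh 1 n a y)"])
  show "(\<lambda>y. \<Oplus>\<^bsub>T.T\<^esub>a\<in>{1..<n}. sp [1, a, n - a] (sh 1 n a y)) \<in> lin_hom K T T.T"
    by (intro lin_hom_finsum_map T_module T.T_module lin_hom_comp[OF sh_lin sp_lin])
  show "(\<Oplus>\<^bsub>T.T\<^esub>a\<in>{1..<n}. sp [1, a, n - a] (sh 1 n a w)) = \<zero>\<^bsub>T.T\<^esub>"
    using w(2) by (intro TT.add.finprod_one_eqI) simp
  show "T.P [x, z] \<in> Y" if "x \<in> TP 1" "z \<in> TP n" "red n z = \<zero>\<^bsub>T.T\<^esub>" for x z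
    by (intro Y(2) red_zero_E that)
  fix x z assume x: "x \<in> TP 1" and z: "z \<in> TP n"
  have "sp [1, a, n - a] (sh 1 n a (x \<otimes>\<^bsub>T\<^esub> z)) = T.inc x \<otimes>\<^bsub>T.T\<^esub> sp [a, n - a] (sh 0 n a z)" if "a \<in> {1..<n}" for a
  proof -
    have "sh 1 n a (x \<otimes>\<^bsub>T\<^esub> z) = x \<otimes>\<^bsub>T\<^esub> sh 0 n a z"
      using fam_left[OF fam_sh[OF order_refl, of n a] x tpow_T[OF z], of 0] by simp
    moreover have "sh 0 n a z \<in> TP (sum_list [a, n - a])" using sh_tpow[OF z] that by simp
    ultimately show ?thesis using sp_Cons[OF x] by simp
  qed
  then have "(\<Oplus>\<^bsub>T.T\<^esub>a\<in>{1..<n}. sp [1, a, n - a] (sh 1 n a (x \<otimes>\<^bsub>T\<^esub> z))) =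
    (\<Oplus>\<^bsub>T.T\<^esub>a\<in>{1..<n}. T.inc x \<otimes>\<^bsub>T.T\<^esub> sp [a, n - a] (sh 0 n a z))"
    using tpow_T[OF x] tpow_T[OF z] by (intro TT.finsum_cong') auto
  also have "\<dots> = T.inc x \<otimes>\<^bsub>T.T\<^esub> red n z"
    unfolding red_def using tpow_T[OF x] tpow_T[OF z] by (intro TT.finsum_rdistr[symmetric]) auto
  finally show "(\<Oplus>\<^bsub>T.T\<^esub>a\<in>{1..<n}. sp [1, a, n - a] (sh 1 n a (x \<otimes>\<^bsub>T\<^esub> z))) = T.inc x \<otimes>\<^bsub>T.T\<^esub> red n z" .
qed

lemma E_kernel_right:
  assumes Y: "submodule Y K T.T" "\<And>x z. x \<in> TP 1 \<Longrightarrow> z \<in> E_comp K V c n \<Longrightarrow> T.P [z, x] \<in> Y"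
    and w: "w \<in> TP (n + 1)" "\<And>a. 1 \<le> a \<Longrightarrow> a < n \<Longrightarrow> sh 0 n a w = \<zero>\<^bsub>T\<^esub>"
  shows "sp [n, 1] w \<in> Y"
proof (rule tensor_kernel_right[OF red_lin Y(1) _ _ _ w(1), where H = "\<lambda>y. \<Oplus>\<^bsub>T.T\<^esub>a\<in>{1..<n}. sp [a, n - a, 1] (sh 0 n a y)"])
  show "(\<lambda>y. \<Oplus>\<^bsub>T.T\<^esub>a\<in>{1..<n}. sp [a, n - a, 1] (sh 0 n a y)) \<in> lin_hom K T T.T"
    by (intro lin_hom_finsum_map T_module T.T_module lin_hom_comp[OF sh_lin sp_lin])
  show "(\<Oplus>\<^bsub>T.T\<^esub>a\<in>{1..<n}. sp [a, n - a, 1] (sh 0 n a w)) = \<zero>\<^bsub>T.T\<^esub>"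
    using w(2) by (intro TT.add.finprod_one_eqI) simp
  show "T.P [z, x] \<in> Y" if "x \<in> TP 1" "z \<in> TP n" "red n z = \<zero>\<^bsub>T.T\<^esub>" for x z
    by (intro Y(2) red_zero_E that)
  fix x z assume x: "x \<in> TP 1" and z: "z \<in> TP n"
  have "sp [a, n - a, 1] (sh 0 n a (z \<otimes>\<^bsub>T\<^esub> x)) = sp [a, n - a] (sh 0 n a z) \<otimes>\<^bsub>T.T\<^esub> T.inc x" if "a \<in> {1..<n}" for a
  proof -
    have "sh 0 n a (z \<otimes>\<^bsub>T\<^esub> x) = sh 0 n a z \<otimes>\<^bsub>T\<^esub> x"
      using fam_right[OF fam_sh[OF order_refl, of n a] z _ tpow_T[OF x], of 0] by simp
    moreover have "sh 0 n a z \<in> TP (sum_list [a, n - a])" using sh_tpow[OF z] that by simp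
    moreover have "x \<in> TP (sum_list [1])" using x by simp
    ultimately show ?thesis
      using sp_append[of "sh 0 n a z" "[a, n - a]" x "[1]"] sp_one[OF x] by (simp del: One_nat_def)
  qed
  then have "(\<Oplus>\<^bsub>T.T\<^esub>a\<in>{1..<n}. sp [a, n - a, 1] (sh 0 n a (z \<otimes>\<^bsub>T\<^esub> x))) =
    (\<Oplus>\<^bsub>T.T\<^esub>a\<in>{1..<n}. sp [a, n - a] (sh 0 n a z) \<otimes>\<^bsub>T.T\<^esub> T.inc x)"
    using tpow_T[OF x] tpow_T[OF z] by (intro TT.finsum_cong') auto
  also have "\<dots> = red n z \<otimes>\<^bsub>T.T\<^esub> T.inc x"
    unfolding red_def using tpow_T[OF x] tpow_T[OF z] by (intro TT.finsum_ldistr[symmetric]) auto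
  finally show "(\<Oplus>\<^bsub>T.T\<^esub>a\<in>{1..<n}. sp [a, n - a, 1] (sh 0 n a (z \<otimes>\<^bsub>T\<^esub> x))) = red n z \<otimes>\<^bsub>T.T\<^esub> T.inc x" .
qed

end


section \<open>The bracket of a braided algebra\<close>

context braided_algebra
begin

interpretation T: assoc_algebra K T by (rule T_algebra)
interpretation TT: assoc_algebra K T.T by (rule T.T_algebra)

lemmas alg = assoc_algebra_axioms
lemmas A_module = assoc_algebra_module[OF alg]
lemmas mu_l = mu_lin[OF alg]
lemmas mu_c [simp] = mu_closed[OF alg]
lemmas mu_i [simp] = mu_incl[OF alg]
lemmas mu_m = mu_mult[OF alg]

lemma incl_mu: "x \<in> TP 1 \<Longrightarrow> inc (mu x) = x"
  by (erule tpow1_cases) simp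

abbreviation "ml \<equiv> tens K A 2 (mult_map K A) 1 (\<lambda>x. x)"
abbreviation "mr \<equiv> tens K A 1 (\<lambda>x. x) 2 (mult_map K A)"

lemma ml: "t \<in> TP 2 \<Longrightarrow> b \<in> TP 1 \<Longrightarrow> ml (t \<otimes>\<^bsub>T\<^esub> b) = inc (mu t) \<otimes>\<^bsub>T\<^esub> b"
  by (simp only: tens_mult[OF lin_hom_tpow_T[OF mult_map_lin[OF alg]] id_lin] mult_map[OF alg])

lemma mr: "t \<in> TP 2 \<Longrightarrow> b \<in> TP 1 \<Longrightarrow> mr (b \<otimes>\<^bsub>T\<^esub> t) = b \<otimes>\<^bsub>T\<^esub> inc (mu t)"
  by (simp only: tens_mult[OF id_lin lin_hom_tpow_T[OF mult_map_lin[OF alg]]] mult_map[OF alg])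

lemma ml_lin: "ml \<in> lin_hom K (tpow K A 3) T"
  using tens_lin[OF lin_hom_tpow_T[OF mult_map_lin[OF alg]] id_lin[of 1]] by (simp add: numeral_3_eq_3)

lemma mr_lin: "mr \<in> lin_hom K (tpow K A 3) T"
  using tens_lin[OF id_lin[of 1] lin_hom_tpow_T[OF mult_map_lin[OF alg]]] by (simp add: numeral_3_eq_3)

text \<open>\<open>MM\<close> is \<open>mu \<otimes> mu: T(A) \<otimes> T(A) \<rightarrow> A \<otimes> A\<close>, and \<open>N m n\<close> is the same map on tensors of degree
  \<open>m + n\<close>, cut after \<open>m\<close> letters.\<close>

abbreviation "MM \<equiv> T.tensor_map2 A mu mu"
abbreviation "N m n z \<equiv> MM (sp [m, n] z)"

lemmas MM = T.tensor_map2[OF A_module mu_l mu_l]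

lemma N_mult: "x \<in> TP m \<Longrightarrow> y \<in> TP n \<Longrightarrow> N m n (x \<otimes>\<^bsub>T\<^esub> y) = inc (mu x) \<otimes>\<^bsub>T\<^esub> inc (mu y)"
  by (simp add: sp_two MM(2) tpow_T pure_two)

lemma N_lin: "(\<lambda>z. N m n z) \<in> lin_hom K T T"
  by (rule lin_hom_comp[OF sp_lin MM(1)])

lemma N_tpow: "z \<in> TP (m + n) \<Longrightarrow> N m n z \<in> TP 2"
proof (induction z rule: tpow_induct_mult)
  case (mult x y)
  then show ?case using tpow_mult[OF incl_tpow incl_tpow, of "mu x" "mu y"]
    by (simp add: N_mult tpow_T numeral_2_eq_2)
qed (simp_all add: lin_hom_add[OF N_lin] lin_hom_smult[OF N_lin] tpow_add tpow_smult tpow_T)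

lemma N_lin2: "d = m + n \<Longrightarrow> (\<lambda>z. N m n z) \<in> lin_hom K (tpow K A d) (tpow K A 2)"
  by (rule lin_hom_into_tpow[OF lin_hom_T_tpow[OF N_lin]]) (simp add: N_tpow)

text \<open>As \<open>mu\<close> is an algebra map, a product of several letters can be formed by multiplying one letter
  into the product of the others. This rule, and its analogue for left factors below, peels off the
  letter that is to be braided next.\<close>

lemma mr_N:
  assumes t: "t \<in> TP 2" and x: "x \<in> TP m"
  shows "mr (t \<otimes>\<^bsub>T\<^esub> inc (mu x)) = N 1 (1 + m) (t \<otimes>\<^bsub>T\<^esub> x)"
proof -
  have i: "inc (mu x) \<in> TP 1" by (intro incl_tpow mu_c tpow_T[OF x])
  have t': "t \<in> TP (1 + 1)" using t by (simp add: numeral_2_eq_2)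
  have l1: "(\<lambda>t. t \<otimes>\<^bsub>T\<^esub> inc (mu x)) \<in> lin_hom K (tpow K A (1 + 1)) (tpow K A 3)"
    by (rule lin_homI) (use tpow_mult[OF _ i, of _ 2] i in \<open>simp_all add: numeral_2_eq_2 numeral_3_eq_3 T.l_distr T.smult_mult_left tpow_T\<close>)
  have l2: "(\<lambda>t. t \<otimes>\<^bsub>T\<^esub> x) \<in> lin_hom K (tpow K A (1 + 1)) T"
    by (rule lin_homI) (use x in \<open>simp_all add: T.l_distr T.smult_mult_left tpow_T\<close>)
  show ?thesis
  proof (rule tpow_eqI_mult[OF lin_hom_comp[OF l1 mr_lin] lin_hom_comp[OF l2 N_lin] _ t'])
    fix p q assume p: "p \<in> TP 1" and q: "q \<in> TP 1"
    note m = tpow_T[OF p] tpow_T[OF q] tpow_T[OF x]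
    have qi: "q \<otimes>\<^bsub>T\<^esub> inc (mu x) \<in> TP 2" using tpow_mult[OF q i] by (simp add: numeral_2_eq_2)
    have "mr (p \<otimes>\<^bsub>T\<^esub> q \<otimes>\<^bsub>T\<^esub> inc (mu x)) = p \<otimes>\<^bsub>T\<^esub> inc (mu (q \<otimes>\<^bsub>T\<^esub> inc (mu x)))"
      using mr[OF qi p] m by (simp add: T.m_assoc)
    also have "mu (q \<otimes>\<^bsub>T\<^esub> inc (mu x)) = mu (q \<otimes>\<^bsub>T\<^esub> x)" using m by (simp add: mu_m)
    also have "p \<otimes>\<^bsub>T\<^esub> inc (mu (q \<otimes>\<^bsub>T\<^esub> x)) = N 1 (1 + m) (p \<otimes>\<^bsub>T\<^esub> (q \<otimes>\<^bsub>T\<^esub> x))"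
      using N_mult[OF p tpow_mult[OF q x]] incl_mu[OF p] by simp
    also have "p \<otimes>\<^bsub>T\<^esub> (q \<otimes>\<^bsub>T\<^esub> x) = p \<otimes>\<^bsub>T\<^esub> q \<otimes>\<^bsub>T\<^esub> x" using m by (simp add: T.m_assoc)
    finally show "mr (p \<otimes>\<^bsub>T\<^esub> q \<otimes>\<^bsub>T\<^esub> inc (mu x)) = N 1 (1 + m) (p \<otimes>\<^bsub>T\<^esub> q \<otimes>\<^bsub>T\<^esub> x)" .
  qed
qed

lemma left_mult_lin: "p \<in> TP k \<Longrightarrow> (\<lambda>w. p \<otimes>\<^bsub>T\<^esub> w) \<in> lin_hom K (tpow K A d) (tpow K A (k + d))"
  by (rule lin_homI) (simp_all add: tpow_mult T.r_distr T.smult_mult_right tpow_T)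

lemma tpow3: "TP (1 + 2) = TP 3" "TP (2 + 1) = TP 3"
  by (simp_all add: numeral_3_eq_3)

lemma ml_N:
  assumes p: "p \<in> TP 1" and w: "w \<in> TP (m + 1)"
  shows "ml (p \<otimes>\<^bsub>T\<^esub> N m 1 w) = N (1 + m) 1 (p \<otimes>\<^bsub>T\<^esub> w)"
proof -
  have e: "1 + 2 = (3::nat)" by simp
  have l1: "(\<lambda>w. ml (p \<otimes>\<^bsub>T\<^esub> N m 1 w)) \<in> lin_hom K (tpow K A (m + 1)) T"
    by (rule lin_hom_comp[OF lin_hom_comp[OF N_lin2[OF refl] left_mult_lin[OF p, of 2, unfolded e]] ml_lin])
  have l2: "(\<lambda>w. N (1 + m) 1 (p \<otimes>\<^bsub>T\<^esub> w)) \<in> lin_hom K (tpow K A (m + 1)) T"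
    by (rule lin_hom_comp[OF lin_hom_tpow_T[OF left_mult_lin[OF p]] N_lin])
  show ?thesis
  proof (rule tpow_eqI_mult[OF l1 l2 _ w])
    fix x b assume x: "x \<in> TP m" and b: "b \<in> TP 1"
    note m = tpow_T[OF p] tpow_T[OF x] tpow_T[OF b]
    have i: "inc (mu x) \<in> TP 1" by (intro incl_tpow mu_c m)
    have pi: "p \<otimes>\<^bsub>T\<^esub> inc (mu x) \<in> TP 2" using tpow_mult[OF p i] by (simp add: numeral_2_eq_2)
    have "p \<otimes>\<^bsub>T\<^esub> N m 1 (x \<otimes>\<^bsub>T\<^esub> b) = (p \<otimes>\<^bsub>T\<^esub> inc (mu x)) \<otimes>\<^bsub>T\<^esub> b"
      using m i by (simp add: N_mult[OF x b] incl_mu[OF b] T.m_assoc del: One_nat_def)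
    then have "ml (p \<otimes>\<^bsub>T\<^esub> N m 1 (x \<otimes>\<^bsub>T\<^esub> b)) = inc (mu (p \<otimes>\<^bsub>T\<^esub> inc (mu x))) \<otimes>\<^bsub>T\<^esub> b"
      by (simp only: ml[OF pi b])
    also have "mu (p \<otimes>\<^bsub>T\<^esub> inc (mu x)) = mu (p \<otimes>\<^bsub>T\<^esub> x)" using m by (simp add: mu_m)
    also have "inc (mu (p \<otimes>\<^bsub>T\<^esub> x)) \<otimes>\<^bsub>T\<^esub> b = N (1 + m) 1 (p \<otimes>\<^bsub>T\<^esub> x \<otimes>\<^bsub>T\<^esub> b)"
      using N_mult[OF tpow_mult[OF p x] b] incl_mu[OF b] by simp
    also have "p \<otimes>\<^bsub>T\<^esub> x \<otimes>\<^bsub>T\<^esub> b = p \<otimes>\<^bsub>T\<^esub> (x \<otimes>\<^bsub>T\<^esub> b)" using m by (simp add: T.m_assoc)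
    finally show "ml (p \<otimes>\<^bsub>T\<^esub> N m 1 (x \<otimes>\<^bsub>T\<^esub> b)) = N (1 + m) 1 (p \<otimes>\<^bsub>T\<^esub> (x \<otimes>\<^bsub>T\<^esub> b))" .
  qed
qed

lemma S0_mult: "t \<in> TP 2 \<Longrightarrow> y \<in> carrier T \<Longrightarrow> S 0 (t \<otimes>\<^bsub>T\<^esub> y) = c t \<otimes>\<^bsub>T\<^esub> y"
  using S_right[of t 2 0 y] by (simp add: S0_c)

lemma S1_mult: "p \<in> TP 1 \<Longrightarrow> t \<in> TP 2 \<Longrightarrow> S 1 (p \<otimes>\<^bsub>T\<^esub> t) = p \<otimes>\<^bsub>T\<^esub> c t"
  using S_left[of p 1 t 0] by (simp add: S0_c tpow_T)

lemma tens_S: "x \<in> TP 3 \<Longrightarrow> tens K A 2 c 1 (\<lambda>x. x) x = S 0 x" "x \<in> TP 3 \<Longrightarrow> tens K A 1 (\<lambda>x. x) 2 c x = S 1 x"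
  using S0_tens[of x 1] S1_tens[of x 1] by (simp_all add: numeral_3_eq_3)

lemma c_ml: "x \<in> TP 3 \<Longrightarrow> c (ml x) = mr (S 0 (S 1 x))"
  using c_mult_left[of x] S_tpow[of x 3 1] by (simp only: tens_S)

lemma c_mr: "x \<in> TP 3 \<Longrightarrow> c (mr x) = ml (S 1 (S 0 x))"
  using c_mult_right[of x] S_tpow[of x 3 0] by (simp only: tens_S)

lemmas unit_lin_T = lin_hom_tpow_T[OF unit_map_lin[OF alg]]

lemma c_unit:
  assumes b: "b \<in> TP 1"
  shows "c (inc (mu \<one>\<^bsub>T\<^esub>) \<otimes>\<^bsub>T\<^esub> b) = b \<otimes>\<^bsub>T\<^esub> inc (mu \<one>\<^bsub>T\<^esub>)" (is ?l)
    and "c (b \<otimes>\<^bsub>T\<^esub> inc (mu \<one>\<^bsub>T\<^esub>)) = inc (mu \<one>\<^bsub>T\<^esub>) \<otimes>\<^bsub>T\<^esub> b" (is ?r)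
proof -
  have l: "tens K A 0 (unit_map K A) 1 (\<lambda>x. x) b = inc (mu \<one>\<^bsub>T\<^esub>) \<otimes>\<^bsub>T\<^esub> b"
    using tens_mult[OF unit_lin_T id_lin one_tpow b] tpow_T[OF b] by (simp add: unit_map[OF alg] one_tpow)
  have r: "tens K A 1 (\<lambda>x. x) 0 (unit_map K A) b = b \<otimes>\<^bsub>T\<^esub> inc (mu \<one>\<^bsub>T\<^esub>)"
    using tens_mult[OF id_lin unit_lin_T b one_tpow] tpow_T[OF b] by (simp add: unit_map[OF alg] one_tpow)
  show ?l using c_unit_left[OF b] unfolding l r .
  show ?r using c_unit_right[OF b] unfolding l r .
qed

text \<open>The axiom that relates \<open>c\<close> and the multiplication moves the letters of a product across one at a
  time; the effect on all letters together is the crossing of strands.\<close>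

lemma c_N_right: "z \<in> TP (m + 1) \<Longrightarrow> c (N m 1 z) = N 1 m (C 0 m 1 z)"
proof (induction m arbitrary: z)
  case 0
  then have z: "z \<in> TP 1" by simp
  have "N 0 1 (\<one>\<^bsub>T\<^esub> \<otimes>\<^bsub>T\<^esub> z) = inc (mu \<one>\<^bsub>T\<^esub>) \<otimes>\<^bsub>T\<^esub> z"
    using N_mult[OF one_tpow z] incl_mu[OF z] by simp
  moreover have "N 1 0 (z \<otimes>\<^bsub>T\<^esub> \<one>\<^bsub>T\<^esub>) = z \<otimes>\<^bsub>T\<^esub> inc (mu \<one>\<^bsub>T\<^esub>)"
    using N_mult[OF z one_tpow] incl_mu[OF z] by simp
  ultimately show ?case using c_unit(1)[OF z] tpow_T[OF z] by simp
next
  case (Suc m)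
  have z: "z \<in> TP (1 + (m + 1))" using Suc.prems by simp
  have "c (N (1 + m) 1 z) = N 1 (1 + m) (C 0 (1 + m) 1 z)"
  proof (rule tpow_eqI_mult[OF lin_hom_comp[OF N_lin2 c_lin] lin_hom_T_tpow[OF lin_hom_comp[OF C_lin N_lin]] _ z])
    show "1 + (m + 1) = 1 + m + 1" by simp
    fix p w assume p: "p \<in> TP 1" and w: "w \<in> TP (m + 1)"
    note pT = tpow_T[OF p] and wT = tpow_T[OF w]
    have Nw: "N m 1 w \<in> TP 2" by (rule N_tpow[OF w])
    have pN: "p \<otimes>\<^bsub>T\<^esub> N m 1 w \<in> TP 3" using tpow_mult[OF p Nw] by (simp only: tpow3)
    let ?y = "C 0 m 1 w"
    have y: "?y \<in> TP (1 + m)" using C_tpow[OF w] by simp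
    \<comment> \<open>Braiding the first two letters and multiplying out the other ones commute.\<close>
    have key: "mr (S 0 (p \<otimes>\<^bsub>T\<^esub> N 1 m y)) = N 1 (1 + m) (S 0 (p \<otimes>\<^bsub>T\<^esub> y))" if y: "y \<in> TP (1 + m)" for y
    proof -
      have e: "1 + 2 = (3::nat)" by simp
      have s3: "S 0 \<in> lin_hom K (tpow K A 3) (tpow K A 3)"
        by (rule lin_hom_into_tpow[OF lin_hom_T_tpow[OF S_lin] S_tpow])
      have l1: "(\<lambda>y. mr (S 0 (p \<otimes>\<^bsub>T\<^esub> N 1 m y))) \<in> lin_hom K (tpow K A (1 + m)) T"
        by (rule lin_hom_comp[OF lin_hom_comp[OF lin_hom_comp[OF N_lin2[OF refl] left_mult_lin[OF p, of 2, unfolded e]] s3] mr_lin])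
      have l2: "(\<lambda>y. N 1 (1 + m) (S 0 (p \<otimes>\<^bsub>T\<^esub> y))) \<in> lin_hom K (tpow K A (1 + m)) T"
        by (rule lin_hom_comp[OF lin_hom_comp[OF lin_hom_tpow_T[OF left_mult_lin[OF p]] S_lin] N_lin])
      show ?thesis
      proof (rule tpow_eqI_mult[OF l1 l2 _ y])
        fix q x assume q: "q \<in> TP 1" and x: "x \<in> TP m"
        note m = pT tpow_T[OF q] tpow_T[OF x]
        have pq: "p \<otimes>\<^bsub>T\<^esub> q \<in> TP 2" using tpow_mult[OF p q] by (simp add: numeral_2_eq_2)
        have "S 0 (p \<otimes>\<^bsub>T\<^esub> N 1 m (q \<otimes>\<^bsub>T\<^esub> x)) = c (p \<otimes>\<^bsub>T\<^esub> q) \<otimes>\<^bsub>T\<^esub> inc (mu x)"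
          using S0_mult[OF pq, of "inc (mu x)"] m by (simp add: N_mult[OF q x] incl_mu[OF q] T.m_assoc del: One_nat_def)
        moreover have "S 0 (p \<otimes>\<^bsub>T\<^esub> (q \<otimes>\<^bsub>T\<^esub> x)) = c (p \<otimes>\<^bsub>T\<^esub> q) \<otimes>\<^bsub>T\<^esub> x"
          using S0_mult[OF pq, of x] m by (simp add: T.m_assoc)
        ultimately show "mr (S 0 (p \<otimes>\<^bsub>T\<^esub> N 1 m (q \<otimes>\<^bsub>T\<^esub> x))) = N 1 (1 + m) (S 0 (p \<otimes>\<^bsub>T\<^esub> (q \<otimes>\<^bsub>T\<^esub> x)))"
          using mr_N[OF c_tpow[OF pq] x] by (simp only:)
      qed
    qed
    have "c (N (1 + m) 1 (p \<otimes>\<^bsub>T\<^esub> w)) = c (ml (p \<otimes>\<^bsub>T\<^esub> N m 1 w))"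
      by (simp only: ml_N[OF p w])
    also have "\<dots> = mr (S 0 (S 1 (p \<otimes>\<^bsub>T\<^esub> N m 1 w)))" by (rule c_ml[OF pN])
    also have "S 1 (p \<otimes>\<^bsub>T\<^esub> N m 1 w) = p \<otimes>\<^bsub>T\<^esub> N 1 m ?y"
      by (simp only: S1_mult[OF p Nw] Suc.IH[OF w])
    also have "mr (S 0 (p \<otimes>\<^bsub>T\<^esub> N 1 m ?y)) = N 1 (1 + m) (S 0 (p \<otimes>\<^bsub>T\<^esub> ?y))" by (rule key[OF y])
    also have "p \<otimes>\<^bsub>T\<^esub> ?y = C 1 m 1 (p \<otimes>\<^bsub>T\<^esub> w)"
      using fam_left[OF fam_C[OF order_refl, of m 1] p wT, of 0] by simp
    also have "S 0 (C 1 m 1 (p \<otimes>\<^bsub>T\<^esub> w)) = C 0 (1 + m) 1 (p \<otimes>\<^bsub>T\<^esub> w)"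
      by simp
    finally show "c (N (1 + m) 1 (p \<otimes>\<^bsub>T\<^esub> w)) = N 1 (1 + m) (C 0 (1 + m) 1 (p \<otimes>\<^bsub>T\<^esub> w))" .
  qed
  then show ?case by (simp only: Suc_eq_plus1_left)
qed

lemma c_N_left: "z \<in> TP (1 + n) \<Longrightarrow> c (N 1 n z) = N n 1 (C 0 1 n z)"
proof (induction n arbitrary: z)
  case 0
  then have z: "z \<in> TP 1" by simp
  have "N 0 1 (\<one>\<^bsub>T\<^esub> \<otimes>\<^bsub>T\<^esub> z) = inc (mu \<one>\<^bsub>T\<^esub>) \<otimes>\<^bsub>T\<^esub> z"
    using N_mult[OF one_tpow z] incl_mu[OF z] by simp
  moreover have "N 1 0 (z \<otimes>\<^bsub>T\<^esub> \<one>\<^bsub>T\<^esub>) = z \<otimes>\<^bsub>T\<^esub> inc (mu \<one>\<^bsub>T\<^esub>)"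
    using N_mult[OF z one_tpow] incl_mu[OF z] by simp
  ultimately show ?case using c_unit(2)[OF z] tpow_T[OF z] by simp
next
  case (Suc n)
  have z: "z \<in> TP (2 + n)" using Suc.prems by (simp add: numeral_2_eq_2)
  have "c (N 1 (1 + n) z) = N (1 + n) 1 (C 0 1 (1 + n) z)"
  proof (rule tpow_eqI_mult[OF lin_hom_comp[OF N_lin2 c_lin] lin_hom_T_tpow[OF lin_hom_comp[OF C_lin N_lin]] _ z])
    show "2 + n = 1 + (1 + n)" by simp
    fix t y assume t: "t \<in> TP 2" and y: "y \<in> TP n"
    note tT = tpow_T[OF t] and yT = tpow_T[OF y]
    let ?i = "inc (mu y)"
    have i: "?i \<in> TP 1" by (intro incl_tpow mu_c yT)
    have ti: "t \<otimes>\<^bsub>T\<^esub> ?i \<in> TP 3" using tpow_mult[OF t i] by (simp only: tpow3)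
    \<comment> \<open>The induction hypothesis, applied to the second letter and the product of the ones after it.\<close>
    have key: "ml (S 1 (t \<otimes>\<^bsub>T\<^esub> ?i)) = N (1 + n) 1 (C 1 1 n (t \<otimes>\<^bsub>T\<^esub> y))" if t: "t \<in> TP 2" for t
    proof -
      have e: "1 + 1 + 1 = (3::nat)" by simp
      have t': "t \<in> TP (1 + 1)" using t by (simp add: numeral_2_eq_2)
      have r: "(\<lambda>t. t \<otimes>\<^bsub>T\<^esub> w) \<in> lin_hom K (tpow K A (1 + 1)) (tpow K A (1 + 1 + d))" if "w \<in> TP d" for w d
        by (rule lin_homI) (use that tpow_mult[OF _ that, of _ "1 + 1"] in \<open>auto simp: T.l_distr T.smult_mult_left tpow_T\<close>)
      have s3: "S 1 \<in> lin_hom K (tpow K A 3) (tpow K A 3)"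
        by (rule lin_hom_into_tpow[OF lin_hom_T_tpow[OF S_lin] S_tpow])
      have l1: "(\<lambda>t. ml (S 1 (t \<otimes>\<^bsub>T\<^esub> ?i))) \<in> lin_hom K (tpow K A (1 + 1)) T"
        by (rule lin_hom_comp[OF lin_hom_comp[OF r[OF i, unfolded e] s3] ml_lin])
      have l2: "(\<lambda>t. N (1 + n) 1 (C 1 1 n (t \<otimes>\<^bsub>T\<^esub> y))) \<in> lin_hom K (tpow K A (1 + 1)) T"
        by (rule lin_hom_comp[OF lin_hom_comp[OF lin_hom_tpow_T[OF r[OF y]] C_lin] N_lin])
      show ?thesis
      proof (rule tpow_eqI_mult[OF l1 l2 _ t'])
        fix p q assume p: "p \<in> TP 1" and q: "q \<in> TP 1"
        note m = tpow_T[OF p] tpow_T[OF q] yT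
        have qy: "q \<otimes>\<^bsub>T\<^esub> y \<in> TP (1 + n)" by (rule tpow_mult[OF q y])
        have qi: "q \<otimes>\<^bsub>T\<^esub> ?i = N 1 n (q \<otimes>\<^bsub>T\<^esub> y)" using N_mult[OF q y] incl_mu[OF q] by simp
        have w: "C 0 1 n (q \<otimes>\<^bsub>T\<^esub> y) \<in> TP (n + 1)"
          using C_tpow[OF qy, of 0 1 n] by (simp only: add.commute[of n 1])
        have "S 1 (p \<otimes>\<^bsub>T\<^esub> q \<otimes>\<^bsub>T\<^esub> ?i) = p \<otimes>\<^bsub>T\<^esub> c (q \<otimes>\<^bsub>T\<^esub> ?i)"
          using S1_mult[OF p, of "q \<otimes>\<^bsub>T\<^esub> ?i"] N_tpow[OF qy] m qi by (simp add: T.m_assoc)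
        also have "\<dots> = p \<otimes>\<^bsub>T\<^esub> N n 1 (C 0 1 n (q \<otimes>\<^bsub>T\<^esub> y))"
          by (simp only: qi Suc.IH[OF qy])
        finally have "ml (S 1 (p \<otimes>\<^bsub>T\<^esub> q \<otimes>\<^bsub>T\<^esub> ?i)) = N (1 + n) 1 (p \<otimes>\<^bsub>T\<^esub> C 0 1 n (q \<otimes>\<^bsub>T\<^esub> y))"
          by (simp only: ml_N[OF p w])
        also have "p \<otimes>\<^bsub>T\<^esub> C 0 1 n (q \<otimes>\<^bsub>T\<^esub> y) = C 1 1 n (p \<otimes>\<^bsub>T\<^esub> q \<otimes>\<^bsub>T\<^esub> y)"
          using fam_left[OF fam_C[OF order_refl, of 1 n] p tpow_T[OF qy], of 0] m by (simp add: T.m_assoc)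
        finally show "ml (S 1 (p \<otimes>\<^bsub>T\<^esub> q \<otimes>\<^bsub>T\<^esub> ?i)) = N (1 + n) 1 (C 1 1 n (p \<otimes>\<^bsub>T\<^esub> q \<otimes>\<^bsub>T\<^esub> y))" .
      qed
    qed
    have "c (N 1 (1 + n) (t \<otimes>\<^bsub>T\<^esub> y)) = c (mr (t \<otimes>\<^bsub>T\<^esub> ?i))" by (simp only: mr_N[OF t y])
    also have "\<dots> = ml (S 1 (S 0 (t \<otimes>\<^bsub>T\<^esub> ?i)))" by (rule c_mr[OF ti])
    also have "S 0 (t \<otimes>\<^bsub>T\<^esub> ?i) = c t \<otimes>\<^bsub>T\<^esub> ?i" using yT by (intro S0_mult[OF t]) simp
    also have "ml (S 1 (c t \<otimes>\<^bsub>T\<^esub> ?i)) = N (1 + n) 1 (C 1 1 n (c t \<otimes>\<^bsub>T\<^esub> y))" by (rule key[OF c_tpow[OF t]])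
    also have "C 1 1 n (c t \<otimes>\<^bsub>T\<^esub> y) = C 0 1 (1 + n) (t \<otimes>\<^bsub>T\<^esub> y)"
      using C_add_right[of 0 1 1 n "t \<otimes>\<^bsub>T\<^esub> y"] S0_mult[OF t yT] by simp
    finally show "c (N 1 (1 + n) (t \<otimes>\<^bsub>T\<^esub> y)) = N (1 + n) 1 (C 0 1 (1 + n) (t \<otimes>\<^bsub>T\<^esub> y))" .
  qed
  then show ?case by (simp only: Suc_eq_plus1_left)
qed

subsection \<open>The bracket is the restriction of the product\<close>

lemma iter_mult: "x \<in> TP (n + 1) \<Longrightarrow> iter_mult K A n x = inc (mu x)"
proof (induction n arbitrary: x)
  case 0
  then show ?case using incl_mu[of x] by simp
next
  case (Suc n)
  have x: "x \<in> TP (n + 1 + 1)" using Suc.prems by simp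
  have cong: "tens K A (n + 1) (iter_mult K A n) 1 (\<lambda>x. x) = tens K A (n + 1) (\<lambda>x. inc (mu x)) 1 (\<lambda>x. x)"
    by (rule tens_cong[OF Suc.IH refl])
  have id1: "(\<lambda>x. x) \<in> lin_hom K (tpow K A 1) (tpow K A 1)" by (rule lin_homI) auto
  have t: "tens K A (n + 1) (\<lambda>x. inc (mu x)) 1 (\<lambda>x. x) \<in> lin_hom K (tpow K A (n + 1 + 1)) (tpow K A 2)"
    using tens_tpow[OF incl_mu_lin[OF alg] id1, of "n + 1"] by (simp add: numeral_2_eq_2)
  have "mult_map K A (tens K A (n + 1) (\<lambda>x. inc (mu x)) 1 (\<lambda>x. x) x) = inc (mu x)"
  proof (rule tpow_eqI_mult[OF lin_hom_comp[OF t mult_map_lin[OF alg]] incl_mu_lin[OF alg] _ x])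
    fix a b assume a: "a \<in> TP (n + 1)" and b: "b \<in> TP 1"
    have "tens K A (n + 1) (\<lambda>x. inc (mu x)) 1 (\<lambda>x. x) (a \<otimes>\<^bsub>T\<^esub> b) = inc (mu a) \<otimes>\<^bsub>T\<^esub> b"
      by (rule tens_mult[OF lin_hom_tpow_T[OF incl_mu_lin[OF alg]] id_lin a b])
    moreover have "inc (mu a) \<otimes>\<^bsub>T\<^esub> b \<in> TP 2"
      using tpow_mult[OF incl_tpow b, of "mu a"] tpow_T[OF a] by (simp add: numeral_2_eq_2)
    ultimately show "mult_map K A (tens K A (n + 1) (\<lambda>x. inc (mu x)) 1 (\<lambda>x. x) (a \<otimes>\<^bsub>T\<^esub> b)) = inc (mu (a \<otimes>\<^bsub>T\<^esub> b))"
      using tpow_T[OF a] tpow_T[OF b] by (simp add: mult_map[OF alg] mu_m)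
  qed
  then show ?case by (simp only: iter_mult.simps cong)
qed

lemma unincl_incl: "v \<in> carrier A \<Longrightarrow> unincl K A (inc v) = v"
  by (simp add: unincl_def inv_into_f_f[OF incl_inj])

lemma unincl_mu: "x \<in> TP 1 \<Longrightarrow> unincl K A x = mu x"
  by (erule tpow1_cases) (simp add: unincl_incl)

abbreviation "bA \<equiv> algebra_bracket K A c"

text \<open>The homogeneous components span \<open>E(A, c)\<close>, so the prescribed values leave at most one linear map,
  and \<open>mu\<close> takes these values.\<close>

lemma bracket_restrict: "bA = restrict mu EV"
  unfolding algebra_bracket_def
proof (rule the_lin_hom[OF _ E_module])
  show mE: "mu \<in> lin_hom K (E_space K A c) A"
    using lin_hom_domain[OF mu_l E_sub] by (simp add: E_space_def)
  have it: "unincl K A (iter_mult K A (t - 1) z) = mu z" if "t \<ge> 2" "z \<in> E_comp K A c t" for t z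
  proof -
    have "z \<in> TP (t - 1 + 1)" using E_comp_tpow[OF that(2)] that(1) by simp
    then show ?thesis using E_comp_T[OF that(2)] by (simp only: iter_mult unincl_incl mu_c)
  qed
  show "\<forall>t\<ge>2. \<forall>z\<in>E_comp K A c t. restrict mu EV z = unincl K A (iter_mult K A (t - 1) z)"
    using it E_comp_E by simp
  fix h x assume h: "h \<in> lin_hom K (E_space K A c) A"
    "\<forall>t\<ge>2. \<forall>z\<in>E_comp K A c t. h z = unincl K A (iter_mult K A (t - 1) z)" and x: "x \<in> EV"
  from x show "h x = mu x"
  proof (induction x rule: E_induct)
    case (comp n x)
    then show ?case using h(2) it by simp
  next
    case (add x y)
    then show ?case using lin_hom_add[OF h(1), of x y] lin_hom_add[OF mE, of x y] by simp
  qed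
qed

lemma bracket: "z \<in> EV \<Longrightarrow> bA z = mu z"
  by (simp add: bracket_restrict)

lemma bracket_lin: "bA \<in> lin_hom K (E_space K A c) A"
proof -
  have "mu \<in> lin_hom K (E_space K A c) A"
    using lin_hom_domain[OF mu_l E_sub] by (simp add: E_space_def)
  then show ?thesis unfolding bracket_restrict by (rule lin_hom_restrict[OF _ E_module])
qed

abbreviation "V1 \<equiv> TP 1"
abbreviation "EV1 \<equiv> carrier (sub_tensor K T EV V1)"
abbreviation "V1E \<equiv> carrier (sub_tensor K T V1 EV)"

lemma V1_sub: "V1 \<subseteq> carrier T"
  using tpow_T by blast

lemmas st_EV = T.sub_tensor[OF E_sub V1_sub]
  and st_VE = T.sub_tensor[OF V1_sub E_sub]

lemma cT_l: "cT \<in> lin_hom K T.T T.T"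
  by (rule cT(1))

lemma sub_VE:
  assumes "w \<in> TP (1 + n)" "2 \<le> n" "\<And>a. 1 \<le> a \<Longrightarrow> a < n \<Longrightarrow> sh 1 n a w = \<zero>\<^bsub>T\<^esub>"
  shows "sp [1, n] w \<in> V1E"
  using assms(2,3) by (intro E_kernel_left[OF st_VE(1) _ assms(1)] st_VE(4) E_comp_E) simp_all

lemma sub_EV:
  assumes "w \<in> TP (n + 1)" "2 \<le> n" "\<And>a. 1 \<le> a \<Longrightarrow> a < n \<Longrightarrow> sh 0 n a w = \<zero>\<^bsub>T\<^esub>"
  shows "sp [n, 1] w \<in> EV1"
  using assms(2,3) by (intro E_kernel_right[OF st_EV(1) _ assms(1)] st_EV(4) E_comp_E) simp_all

text \<open>For \<open>x\<close> in \<open>E\<^sub>n\<close> the shuffles vanish on the first \<open>n\<close> letters of \<open>x \<otimes> y\<close>. They slide through the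
  crossing with \<open>y\<close>, so that they vanish on the last \<open>n\<close> letters of the result; hence the result lies
  in \<open>A \<otimes> E\<^sub>n\<close>. The second assertion is \<open>c_N_right\<close>.\<close>

lemma braid_EV_pure:
  assumes x: "x \<in> EV" and y: "y \<in> V1"
  shows "cT (T.P [x, y]) \<in> V1E \<and> c (MM (T.P [x, y])) = MM (cT (T.P [x, y]))"
  using x
proof (induction x rule: E_induct)
  case (comp n x)
  note xn = E_comp_tpow[OF comp(2)]
  have xy: "x \<otimes>\<^bsub>T\<^esub> y \<in> TP (n + 1)" by (rule tpow_mult[OF xn y])
  let ?w = "C 0 n 1 (x \<otimes>\<^bsub>T\<^esub> y)"
  have w: "?w \<in> TP (1 + n)" using C_tpow[OF xy, of 0 n 1] by (simp only: add.commute[of n 1])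
  have e: "T.P [x, y] = sp [n, 1] (x \<otimes>\<^bsub>T\<^esub> y)" using sp_two[OF xn y] by simp
  have "sh 1 n a ?w = \<zero>\<^bsub>T\<^esub>" if "1 \<le> a" "a < n" for a
  proof -
    have "sh 1 n a ?w = C 0 n 1 (sh 0 n a (x \<otimes>\<^bsub>T\<^esub> y))"
      using fam_C_right[OF fam_sh[OF order_refl, of n a] tpow_T[OF xy], where i = 0 and n = 1] by simp
    also have "sh 0 n a (x \<otimes>\<^bsub>T\<^esub> y) = sh 0 n a x \<otimes>\<^bsub>T\<^esub> y"
      by (rule fam_right[OF fam_sh[OF order_refl, of n a] xn]) (use tpow_T[OF y] in auto)
    also have "sh 0 n a x = \<zero>\<^bsub>T\<^esub>" using comp(2) that by (simp add: E_comp_iff)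
    finally show ?thesis using tpow_T[OF y] C_zero[of 0 n 1] by simp
  qed
  then have "sp [1, n] ?w \<in> V1E" by (rule sub_VE[OF w comp(1)])
  then show ?case unfolding e using cT(2)[OF xy] c_N_right[OF xy] by simp
next
  case (add x z)
  have m: "x \<in> carrier T" "z \<in> carrier T" "y \<in> carrier T" using add(1,2) y E_sub tpow_T by auto
  have t: "T.P [x, y] \<in> T.TP 2" "T.P [z, y] \<in> T.TP 2" using m by (auto intro!: T.pure_tpow)
  have MMt: "MM (T.P [x, y]) \<in> TP 2" "MM (T.P [z, y]) \<in> TP 2"
    using lin_hom_closed[OF T.tensor_map2_tpow[OF A_module mu_l mu_l]] t by blast+
  show ?case
    using add(3,4) TT.submoduleE(5)[OF st_VE(1)] MMt T.tpow_T[OF t(1)] T.tpow_T[OF t(2)] lin_hom_closed[OF cT_l]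
    by (simp add: T.pure_add_left m lin_hom_add[OF cT_l] lin_hom_add[OF MM(1)] c_add)
qed

lemma braid_VE_pure:
  assumes x: "x \<in> EV" and y: "y \<in> V1"
  shows "cT (T.P [y, x]) \<in> EV1 \<and> c (MM (T.P [y, x])) = MM (cT (T.P [y, x]))"
  using x
proof (induction x rule: E_induct)
  case (comp n x)
  note xn = E_comp_tpow[OF comp(2)]
  have xy: "y \<otimes>\<^bsub>T\<^esub> x \<in> TP (1 + n)" by (rule tpow_mult[OF y xn])
  let ?w = "C 0 1 n (y \<otimes>\<^bsub>T\<^esub> x)"
  have w: "?w \<in> TP (n + 1)" using C_tpow[OF xy, of 0 1 n] by (simp only: add.commute[of n 1])
  have e: "T.P [y, x] = sp [1, n] (y \<otimes>\<^bsub>T\<^esub> x)" using sp_two[OF y xn] by simp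
  have "sh 0 n a ?w = \<zero>\<^bsub>T\<^esub>" if "1 \<le> a" "a < n" for a
  proof -
    have "sh 0 n a ?w = C 0 1 n (sh 1 n a (y \<otimes>\<^bsub>T\<^esub> x))"
      using fam_C_left[OF fam_sh[OF order_refl, of n a] tpow_T[OF xy], where i = 0 and l = 1] by simp
    also have "sh 1 n a (y \<otimes>\<^bsub>T\<^esub> x) = y \<otimes>\<^bsub>T\<^esub> sh 0 n a x"
      using fam_left[OF fam_sh[OF order_refl, of n a] y tpow_T[OF xn], of 0] by simp
    also have "sh 0 n a x = \<zero>\<^bsub>T\<^esub>" using comp(2) that by (simp add: E_comp_iff)
    finally show ?thesis using tpow_T[OF y] C_zero[of 0 1 n] by simp
  qed
  then have "sp [n, 1] ?w \<in> EV1" by (rule sub_EV[OF w comp(1)])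
  then show ?case unfolding e using cT(2)[OF xy] c_N_left[OF xy] by simp
next
  case (add x z)
  have m: "x \<in> carrier T" "z \<in> carrier T" "y \<in> carrier T" using add(1,2) y E_sub tpow_T by auto
  have t: "T.P [y, x] \<in> T.TP 2" "T.P [y, z] \<in> T.TP 2" using m by (auto intro!: T.pure_tpow)
  have MMt: "MM (T.P [y, x]) \<in> TP 2" "MM (T.P [y, z]) \<in> TP 2"
    using lin_hom_closed[OF T.tensor_map2_tpow[OF A_module mu_l mu_l]] t by blast+
  show ?case
    using add(3,4) TT.submoduleE(5)[OF st_EV(1)] MMt T.tpow_T[OF t(1)] T.tpow_T[OF t(2)] lin_hom_closed[OF cT_l]
    by (simp add: T.pure_add_right m lin_hom_add[OF cT_l] lin_hom_add[OF MM(1)] c_add)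
qed

lemma MM_tpow: "x \<in> T.TP 2 \<Longrightarrow> MM x \<in> TP 2"
  using lin_hom_closed[OF T.tensor_map2_tpow[OF A_module mu_l mu_l]] .

lemma braid_span:
  assumes S: "S1 \<subseteq> carrier T" "S2 \<subseteq> carrier T" "submodule Y K T.T" and x: "x \<in> carrier (sub_tensor K T S1 S2)"
    and p: "\<And>x y. x \<in> S1 \<Longrightarrow> y \<in> S2 \<Longrightarrow> cT (T.P [x, y]) \<in> Y \<and> c (MM (T.P [x, y])) = MM (cT (T.P [x, y]))"
  shows "cT x \<in> Y \<and> c (MM x) = MM (cT x)"
  using x S(1,2)
proof (induction x rule: T.sub_tensor_induct)
  note sub = T.sub_tensor_tpow[OF S(1,2)]
  note Y = TT.submoduleE[OF S(3)]
  case (pure x y)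
  then show ?case by (rule p)
next
  note z = lin_hom_zero[OF cT_l T.T_module T.T_module] lin_hom_zero[OF MM(1) T.T_module T_module]
    lin_hom_zero[OF c_lin tpow_module T_module]
  case zero
  show ?case using z S(3) by (auto simp: submodule_def dest: subgroup.one_closed)
next
  note sub = T.sub_tensor_tpow[OF S(1,2)]
  note Y = TT.submoduleE[OF S(3)]
  case (add x y)
  have t: "x \<in> T.TP 2" "y \<in> T.TP 2" using add sub by auto
  show ?case
    using add Y(5) MM_tpow[OF t(1)] MM_tpow[OF t(2)] T.tpow_T[OF t(1)] T.tpow_T[OF t(2)] lin_hom_closed[OF cT_l]
    by (simp add: lin_hom_add[OF cT_l] lin_hom_add[OF MM(1)] c_add)
next
  note sub = T.sub_tensor_tpow[OF S(1,2)]
  note Y = TT.submoduleE[OF S(3)]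
  case (smult a x)
  have t: "x \<in> T.TP 2" using smult sub by auto
  show ?case
    using smult Y(4) MM_tpow[OF t] T.tpow_T[OF t] lin_hom_closed[OF cT_l]
    by (simp add: lin_hom_smult[OF cT_l] lin_hom_smult[OF MM(1)] c_smult)
qed

lemma bracket_braided: "braided_bracket K A c bA"
proof -
  have bV: "sub_tensor_map K T A EV V1 bA (unincl K A) x = MM x" if "x \<in> EV1" for x
    by (rule T.sub_tensor_map[OF A_module mu_l mu_l E_sub V1_sub bracket unincl_mu that])
  have Vb: "sub_tensor_map K T A V1 EV (unincl K A) bA x = MM x" if "x \<in> V1E" for x
    by (rule T.sub_tensor_map[OF A_module mu_l mu_l V1_sub E_sub unincl_mu bracket that])
  have l: "cT x \<in> V1E \<and> c (MM x) = MM (cT x)" if "x \<in> EV1" for x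
    by (rule braid_span[OF E_sub V1_sub st_VE(1) that braid_EV_pure])
  have r: "cT x \<in> EV1 \<and> c (MM x) = MM (cT x)" if "x \<in> V1E" for x
    by (rule braid_span[OF V1_sub E_sub st_EV(1) that braid_VE_pure])
  have bl: "tensor_braiding K A c x = cT x" if "x \<in> EV1" for x
    using tensor_braiding_eq st_EV(3) that by blast
  have br: "tensor_braiding K A c x = cT x" if "x \<in> V1E" for x
    using tensor_braiding_eq st_VE(3) that by blast
  show ?thesis
    unfolding braided_bracket_def Let_def
    using bracket_lin l r by (simp add: bl br bV Vb del: One_nat_def)
qed

subsection \<open>Injectivity\<close>

lemma mu_ring_hom: "ring_hom_ring T A mu"
  by (rule ring_hom_ringI[OF T_ring assoc_algebra_ring[OF alg]])
    (simp_all add: mu_m lin_hom_add[OF mu_l] mu_one[OF alg])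

text \<open>On \<open>E(A, c)\<close> the bracket is \<open>mu\<close>, and on \<open>A\<close> itself \<open>mu\<close> is the identity.\<close>

lemma env_gens: "{z \<ominus>\<^bsub>T\<^esub> inc (bA z) | z. z \<in> EV} \<subseteq> a_kernel T A mu"
proof -
  have "z \<ominus>\<^bsub>T\<^esub> inc (bA z) \<in> carrier T \<and> mu (z \<ominus>\<^bsub>T\<^esub> inc (bA z)) = \<zero>\<^bsub>A\<^esub>" if "z \<in> EV" for z
  proof -
    have z: "z \<in> carrier T" using that E_sub by blast
    have "mu (z \<ominus>\<^bsub>T\<^esub> inc (mu z)) = mu z \<ominus>\<^bsub>A\<^esub> mu z"
      using z by (simp add: lin_hom_minus[OF mu_l T_module A_module])
    also have "\<dots> = \<zero>\<^bsub>A\<^esub>"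
      using abelian_group.r_neg[OF ring.is_abelian_group[OF assoc_algebra_ring[OF alg]], of "mu z"] z by (simp add: a_minus_def)
    finally show ?thesis using z by (simp add: bracket[OF that])
  qed
  then show ?thesis by (auto simp: a_kernel_def')
qed

lemma env_ideal: "ideal (enveloping_ideal K A c bA) T"
  unfolding enveloping_ideal_def
  by (rule T.genideal_ideal) (use env_gens in \<open>auto simp: a_kernel_def'\<close>)

lemma env_ideal_kernel: "enveloping_ideal K A c bA \<subseteq> a_kernel T A mu"
  unfolding enveloping_ideal_def
  by (rule T.genideal_minimal[OF ring_hom_ring.kernel_is_ideal[OF mu_ring_hom] env_gens])

text \<open>As \<open>mu\<close> is constant on the cosets of the enveloping ideal, it recovers \<open>v\<close> from its image in the
  enveloping algebra.\<close>

lemma i_U_inj: "inj_on (i_U K A c bA) (carrier A)"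
proof (rule inj_onI)
  fix v w assume v: "v \<in> carrier A" and w: "w \<in> carrier A" and eq: "i_U K A c bA v = i_U K A c bA w"
  have "inc v \<ominus>\<^bsub>T\<^esub> inc w \<in> enveloping_ideal K A c bA"
    using T.quotient_eq_iff_same_a_r_cos[OF env_ideal, of "inc v" "inc w"] eq v w by (simp add: i_U_def)
  then have "mu (inc v \<ominus>\<^bsub>T\<^esub> inc w) = \<zero>\<^bsub>A\<^esub>"
    using env_ideal_kernel by (auto simp: a_kernel_def')
  then have "v \<ominus>\<^bsub>A\<^esub> w = \<zero>\<^bsub>A\<^esub>"
    using v w by (simp add: lin_hom_minus[OF mu_l T_module A_module])
  then show "v = w"
    using abelian_group.minus_zero_eq[OF ring.is_abelian_group[OF assoc_algebra_ring[OF alg]]] v w by blast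
qed

lemma i_U_closed: "i_U K A c bA \<in> carrier A \<rightarrow> carrier (enveloping_algebra K A c bA)"
proof
  fix v assume v: "v \<in> carrier A"
  show "i_U K A c bA v \<in> carrier (enveloping_algebra K A c bA)"
    unfolding i_U_def enveloping_algebra_def FactRing_def A_RCOSETS_def'
    by (simp, rule bexI[of _ "inc v"]) (simp_all add: v)
qed

theorem bracket_braided_lie: "braided_lie_algebra K A c bA"
  unfolding braided_lie_algebra_def
  by (intro conjI braided_vector_space_axioms bracket_braided i_U_closed i_U_inj)

end

theorem proposition5p8:
  fixes K :: "('k, 'm) ring_scheme" and A :: "('k, 'a, 'n) module_scheme"
    and c\<^sub>A :: "('k, 'a) tensor \<Rightarrow> ('k, 'a) tensor"
  assumes "braided_algebra K A c\<^sub>A"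
  shows "braided_lie_algebra K A c\<^sub>A (algebra_bracket K A c\<^sub>A)"
  by (rule braided_algebra.bracket_braided_lie[OF assms])

end
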